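(* Let $A(t)$ be a one-parameter subgroup of $\mathrm{GL}(n,\mathbb{R})$ with $A(1)\in\mathrm{SL}(n,\mathbb{Z})$ and such that $G=\mathbb{R}^n\rtimes_A\mathbb{R}$ is exponential. Let $\Gamma=\mathbb{Z}^n\rtimes_A\mathbb{Z}$ and let $\varepsilon:\Gamma\to\mathbb{Z}_2$ be a homomorphism. Then the right regular representation $\rho$ of $G$ in $L^2(G,\varepsilon)$ decomposes (unitarily, as Hilbert space direct sums) as $$\rho\;\cong\;\bigoplus_{\theta\in\mathbb{Z}\setminus\Sigma_{\varepsilon'}}\rho_\theta\;\cong\;\Big(\bigoplus_{\omega\in X^0_{\varepsilon'}}\bigoplus_{m\in\mathbb{Z}}\chi_{\dot\varepsilon,\omega,m}\Big)\oplus\Big(\bigoplus_{\omega\in X^\infty_{\varepsilon'}}m_{\varepsilon,\omega}\,\rho_\omega\Big),$$ where the multiplicities $m_{\varepsilon,\omega}=\#\,\mathbb{Z}\setminus(\omega\cap\Sigma_{\varepsilon'})$ (the number of $\mathbb{Z}$-orbits in $\omega\cap\Sigma_{\varepsilon'}$) are finite, the $$\chi_{\dot\varepsilon,\omega,m}(x,s)=e^{\pi i\langle\xi,x\rangle}\,e^{\pi i(2m+\dot\varepsilon(1))s}\qquad(\omega=\{\xi\})$$ are characters of $G$, and the $\rho_\omega$ are irreducible on $L^2(\mathbb{R})$. For every $\eta\in\omega$, $$\rho_\eta(x,s)\psi\,(t)=e^{\pi i\langle A(t)^\top\eta,x\rangle}\,\psi(t+s)$$ is a representative of the unitary equivalence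 class of $\rho_\omega$. Moreover, the representations $\{\chi_{\dot\varepsilon,\omega,m}:\omega\in X^0_{\varepsilon'},\,m\in\mathbb{Z}\}\cup\{\rho_\omega:\omega\in X^\infty_{\varepsilon'}\}$ are mutually inequivalent.
   Context: $G=\mathbb{R}^n\rtimes_A\mathbb{R}$ has group law $(x,s)(y,t)=(x+A(s)y,s+t)$; a Lie group is exponential if its exponential map is a diffeomorphism. $\mathbb{Z}_2=\{0,1\}$. Put $\varepsilon'(k)=\varepsilon(k,0)$ for $k\in\mathbb{Z}^n$ and $\dot\varepsilon(l)=\varepsilon(0,l)$ for $l\in\mathbb{Z}$. $\langle\cdot,\cdot\rangle$ is the standard inner product of $\mathbb{R}^n$ and $\top$ the transpose. $L^2(G,\varepsilon)$ is the completion of the space of continuous $\varphi:G\to\mathbb{C}$ with $\varphi(\gamma y)=e^{i\pi\varepsilon(\gamma)}\varphi(y)$ ($\gamma\in\Gamma,y\in G$) with respect to $|\varphi|_{L^2}^2=\int_{\Gamma\setminus G}|\varphi|^2d\mu=\int_0^1\int_{[0,1]^n}|\varphi(x,s)|^2dx\,ds$. The right regular representation is $\rho(x)\varphi(y)=\varphi(yx)$. Such $\varphi$ are $2\mathbb{Z}^n$-periodic in the first variable, and for $\xi\in\mathbb{Z}^n$ one sets $\widehat\varphi(\xi,t)=\int_{[0,1]^n}\varphi(2x,t)e^{-2\pi i\langle\xi,x\rangle}dx$. $\Sigma_{\varepsilon'}=\{\xi\in\mathbb{Z}^n:\xi_\nu\in2\mathbb{Z}+\varepsilon'(e_\nu)\text{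 for all }\nu\}$. The group $\mathbb{R}$ acts on $\mathbb{R}^n$ by $t\mapsto A(t)^\top$; the $\mathbb{Z}$-orbit and $\mathbb{R}$-orbit of $\xi$ are $\{A(l)^\top\xi:l\in\mathbb{Z}\}$ and $\{A(t)^\top\xi:t\in\mathbb{R}\}$. $\Sigma_{\varepsilon'}$ is invariant under $\mathbb{Z}$, and $\mathbb{Z}\setminus\Sigma_{\varepsilon'}$ denotes its set of $\mathbb{Z}$-orbits. For such an orbit $\theta$, $U_\theta=\{\varphi\in L^2(G,\varepsilon):\widehat\varphi(\xi,\cdot)=0\text{ for all }\xi\in\mathbb{Z}^n\setminus\theta\}$, a closed $\rho(G)$-invariant subspace, and $\rho_\theta=\rho|_{U_\theta}$. $X^\infty_{\varepsilon'}$ is the set of all $\mathbb{R}$-orbits which intersect $\Sigma_{\varepsilon'}$ and are not relatively compact; $X^0_{\varepsilon'}$ is the set of all orbits $\omega=\{\xi\}$ with $\xi\in\Sigma_{\varepsilon'}$ a fixed point. For $\omega\in X^\infty_{\varepsilon'}$, $\rho_\omega$ denotes the common unitary equivalence class of the representations $\rho_\theta$, $\theta$ a $\mathbb{Z}$-orbit contained in $\omega\cap\Sigma_{\varepsilon'}$. *)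

theory Defs
  imports "HOL-Analysis.Analysis" "HOL-Algebra.Elementary_Groups"
begin

section \<open>Hilbert spaces on carrier sets\<close>

record 'v hspace =
  hcarrier :: "'v set"
  hplus :: "'v \<Rightarrow> 'v \<Rightarrow> 'v"
  hzero :: 'v
  hscale :: "complex \<Rightarrow> 'v \<Rightarrow> 'v"
  hinner :: "'v \<Rightarrow> 'v \<Rightarrow> complex"

definition hminus :: "('v, 'b) hspace_scheme \<Rightarrow> 'v \<Rightarrow> 'v \<Rightarrow> 'v" where
  "hminus H u v = hplus H u (hscale H (-1) v)"

definition hnorm :: "('v, 'b) hspace_scheme \<Rightarrow> 'v \<Rightarrow> real" where
  "hnorm H v = sqrt (Re (hinner H v v))"

definition hconverges :: "('v, 'b) hspace_scheme \<Rightarrow> (nat \<Rightarrow> 'v) \<Rightarrow> 'v \<Rightarrow> bool" where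
  "hconverges H s l \<longleftrightarrow> (\<lambda>k. hnorm H (hminus H (s k) l)) \<longlonglongrightarrow> 0"

definition hcauchy :: "('v, 'b) hspace_scheme \<Rightarrow> (nat \<Rightarrow> 'v) \<Rightarrow> bool" where
  "hcauchy H s \<longleftrightarrow> (\<forall>e>0. \<exists>N. \<forall>j\<ge>N. \<forall>k\<ge>N. hnorm H (hminus H (s j) (s k)) < e)"

text \<open>The inner product is linear in the first and conjugate linear in the second argument.\<close>

locale hilbert_space =
  fixes H :: "('v, 'b) hspace_scheme"
  assumes zero_closed: "hzero H \<in> hcarrier H"
    and plus_closed: "\<lbrakk>u \<in> hcarrier H; v \<in> hcarrier H\<rbrakk> \<Longrightarrow> hplus H u v \<in> hcarrier H"
    and scale_closed: "u \<in> hcarrier H \<Longrightarrow> hscale H c u \<in> hcarrier H"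
    and plus_assoc: "\<lbrakk>u \<in> hcarrier H; v \<in> hcarrier H; w \<in> hcarrier H\<rbrakk>
      \<Longrightarrow> hplus H (hplus H u v) w = hplus H u (hplus H v w)"
    and plus_commute: "\<lbrakk>u \<in> hcarrier H; v \<in> hcarrier H\<rbrakk> \<Longrightarrow> hplus H u v = hplus H v u"
    and plus_zero: "u \<in> hcarrier H \<Longrightarrow> hplus H u (hzero H) = u"
    and minus_self: "u \<in> hcarrier H \<Longrightarrow> hminus H u u = hzero H"
    and scale_one: "u \<in> hcarrier H \<Longrightarrow> hscale H 1 u = u"
    and scale_scale: "u \<in> hcarrier H \<Longrightarrow> hscale H c (hscale H d u) = hscale H (c * d) u"
    and scale_plus: "\<lbrakk>u \<in> hcarrier H; v \<in> hcarrier H\<rbrakk>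
      \<Longrightarrow> hscale H c (hplus H u v) = hplus H (hscale H c u) (hscale H c v)"
    and plus_scale: "u \<in> hcarrier H
      \<Longrightarrow> hscale H (c + d) u = hplus H (hscale H c u) (hscale H d u)"
    and inner_commute: "\<lbrakk>u \<in> hcarrier H; v \<in> hcarrier H\<rbrakk> \<Longrightarrow> hinner H v u = cnj (hinner H u v)"
    and inner_plus: "\<lbrakk>u \<in> hcarrier H; v \<in> hcarrier H; w \<in> hcarrier H\<rbrakk>
      \<Longrightarrow> hinner H (hplus H u v) w = hinner H u w + hinner H v w"
    and inner_scale: "\<lbrakk>u \<in> hcarrier H; v \<in> hcarrier H\<rbrakk>
      \<Longrightarrow> hinner H (hscale H c u) v = c * hinner H u v"
    and inner_nonneg: "u \<in> hcarrier H \<Longrightarrow> 0 \<le> Re (hinner H u u)"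
    and inner_definite: "\<lbrakk>u \<in> hcarrier H; hinner H u u = 0\<rbrakk> \<Longrightarrow> u = hzero H"
    and complete: "\<lbrakk>range s \<subseteq> hcarrier H; hcauchy H s\<rbrakk> \<Longrightarrow> \<exists>l\<in>hcarrier H. hconverges H s l"

definition closed_subspace :: "('v, 'b) hspace_scheme \<Rightarrow> 'v set \<Rightarrow> bool" where
  "closed_subspace H W \<longleftrightarrow>
     W \<subseteq> hcarrier H \<and> hzero H \<in> W \<and>
     (\<forall>u\<in>W. \<forall>v\<in>W. hplus H u v \<in> W) \<and> (\<forall>c. \<forall>u\<in>W. hscale H c u \<in> W) \<and>
     (\<forall>s l. range s \<subseteq> W \<and> l \<in> hcarrier H \<and> hconverges H s l \<longrightarrow> l \<in> W)"

definition unitary_map ::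
  "('v, 'b) hspace_scheme \<Rightarrow> ('w, 'c) hspace_scheme \<Rightarrow> ('v \<Rightarrow> 'w) \<Rightarrow> bool" where
  "unitary_map H K T \<longleftrightarrow>
     bij_betw T (hcarrier H) (hcarrier K) \<and>
     (\<forall>u\<in>hcarrier H. \<forall>v\<in>hcarrier H. T (hplus H u v) = hplus K (T u) (T v)) \<and>
     (\<forall>c. \<forall>u\<in>hcarrier H. T (hscale H c u) = hscale K c (T u)) \<and>
     (\<forall>u\<in>hcarrier H. \<forall>v\<in>hcarrier H. hinner K (T u) (T v) = hinner H u v)"


section \<open>Unitary representations\<close>

record ('g, 'v) rep = "'v hspace" +
  act :: "'g \<Rightarrow> 'v \<Rightarrow> 'v"

definition unitary_rep :: "('g::topological_space) monoid \<Rightarrow> ('g, 'v) rep \<Rightarrow> bool" where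
  "unitary_rep G R \<longleftrightarrow>
     hilbert_space R \<and>
     (\<forall>g\<in>carrier G. unitary_map R R (act R g)) \<and>
     (\<forall>g\<in>carrier G. \<forall>h\<in>carrier G. \<forall>v\<in>hcarrier R.
        act R (g \<otimes>\<^bsub>G\<^esub> h) v = act R g (act R h v)) \<and>
     (\<forall>v\<in>hcarrier R. \<forall>g\<in>carrier G.
        ((\<lambda>h. hnorm R (hminus R (act R h v) (act R g v))) \<longlongrightarrow> 0) (at g within carrier G))"

definition unitarily_equivalent :: "'g monoid \<Rightarrow> ('g, 'v) rep \<Rightarrow> ('g, 'w) rep \<Rightarrow> bool" where
  "unitarily_equivalent G R S \<longleftrightarrow>
     (\<exists>T. unitary_map R S T \<and>
          (\<forall>g\<in>carrier G. \<forall>v\<in>hcarrier R. T (act R g v) = act S g (T v)))"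

definition invariant_subset :: "'g monoid \<Rightarrow> ('g, 'v) rep \<Rightarrow> 'v set \<Rightarrow> bool" where
  "invariant_subset G R W \<longleftrightarrow> (\<forall>g\<in>carrier G. \<forall>v\<in>W. act R g v \<in> W)"

definition irreducible_rep :: "('g::topological_space) monoid \<Rightarrow> ('g, 'v) rep \<Rightarrow> bool" where
  "irreducible_rep G R \<longleftrightarrow>
     unitary_rep G R \<and> hcarrier R \<noteq> {hzero R} \<and>
     (\<forall>W. closed_subspace R W \<and> invariant_subset G R W \<longrightarrow> W = {hzero R} \<or> W = hcarrier R)"

definition unitary_character :: "('g::topological_space) monoid \<Rightarrow> ('g \<Rightarrow> complex) \<Rightarrow> bool" where
  "unitary_character G f \<longleftrightarrow>
     continuous_on (carrier G) f \<and> (\<forall>g\<in>carrier G. cmod (f g) = 1) \<and>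
     (\<forall>g\<in>carrier G. \<forall>h\<in>carrier G. f (g \<otimes>\<^bsub>G\<^esub> h) = f g * f h)"

definition character_rep :: "('g \<Rightarrow> complex) \<Rightarrow> ('g, complex) rep" where
  "character_rep f =
     \<lparr>hcarrier = UNIV, hplus = (+), hzero = 0, hscale = (*), hinner = (\<lambda>z w. z * cnj w),
      act = (\<lambda>g z. f g * z)\<rparr>"

text \<open>Hilbert space direct sum: the square-summable families.\<close>

definition rep_sum :: "'i set \<Rightarrow> ('i \<Rightarrow> ('g, 'v) rep) \<Rightarrow> ('g, 'i \<Rightarrow> 'v) rep" where
  "rep_sum I R =
     \<lparr>hcarrier = {u \<in> (\<Pi>\<^sub>E i\<in>I. hcarrier (R i)). (\<lambda>i. (hnorm (R i) (u i))\<^sup>2) summable_on I},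
      hplus = (\<lambda>u v. \<lambda>i\<in>I. hplus (R i) (u i) (v i)),
      hzero = (\<lambda>i\<in>I. hzero (R i)),
      hscale = (\<lambda>c u. \<lambda>i\<in>I. hscale (R i) c (u i)),
      hinner = (\<lambda>u v. \<Sum>\<^sub>\<infinity>i\<in>I. hinner (R i) (u i) (v i)),
      act = (\<lambda>g u. \<lambda>i\<in>I. act (R i) g (u i))\<rparr>"

definition rep_sum2 :: "('g, 'v) rep \<Rightarrow> ('g, 'w) rep \<Rightarrow> ('g, 'v \<times> 'w) rep" where
  "rep_sum2 R S =
     \<lparr>hcarrier = hcarrier R \<times> hcarrier S,
      hplus = (\<lambda>u v. (hplus R (fst u) (fst v), hplus S (snd u) (snd v))),
      hzero = (hzero R, hzero S),
      hscale = (\<lambda>c u. (hscale R c (fst u), hscale S c (snd u))),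
      hinner = (\<lambda>u v. hinner R (fst u) (fst v) + hinner S (snd u) (snd v)),
      act = (\<lambda>g u. (act R g (fst u), act S g (snd u)))\<rparr>"

definition rep_multiple :: "nat \<Rightarrow> ('g, 'v) rep \<Rightarrow> ('g, nat \<Rightarrow> 'v) rep" where
  "rep_multiple m R = rep_sum {..<m} (\<lambda>_. R)"


section \<open>Spaces of square-integrable functions modulo null functions\<close>

text \<open>Given a linear space \<open>S\<close> of square-integrable functions, the elements are the classes in
  \<open>S\<close> modulo equality almost everywhere. The inner product does not depend on the chosen
  representatives.\<close>

definition L2_classes :: "'x measure \<Rightarrow> ('x \<Rightarrow> complex) set \<Rightarrow> ('x \<Rightarrow> complex) set hspace" where
  "L2_classes M S =
     \<lparr>hcarrier = S // {(f, g). f \<in> S \<and> g \<in> S \<and> (AE x in M. f x = g x)},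
      hplus = (\<lambda>C D. {h \<in> S. \<exists>f\<in>C. \<exists>g\<in>D. AE x in M. h x = f x + g x}),
      hzero = {h \<in> S. AE x in M. h x = 0},
      hscale = (\<lambda>c C. {h \<in> S. \<exists>f\<in>C. AE x in M. h x = c * f x}),
      hinner = (\<lambda>C D. LINT x|M. (SOME f. f \<in> C) x * cnj ((SOME g. g \<in> D) x))\<rparr>"

definition real_L2 :: "(real \<Rightarrow> complex) set hspace" where
  "real_L2 = L2_classes lborel
     {\<psi> \<in> borel_measurable borel. integrable lborel (\<lambda>t. (cmod (\<psi> t))\<^sup>2)}"


section \<open>Exponential Lie groups\<close>

text \<open>\<open>C_k k f\<close>: all iterated directional derivatives of \<open>f\<close> of order at most \<open>k\<close> exist and are
  continuous (the intended domains are finite-dimensional).\<close>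

primrec C_k :: "nat \<Rightarrow> ('a::real_normed_vector \<Rightarrow> 'b::real_normed_vector) \<Rightarrow> bool" where
  "C_k 0 f \<longleftrightarrow> continuous_on UNIV f"
| "C_k (Suc k) f \<longleftrightarrow>
     (\<forall>x. f differentiable (at x)) \<and> (\<forall>v. C_k k (\<lambda>x. frechet_derivative f (at x) v))"

definition diffeomorphism :: "('a::real_normed_vector \<Rightarrow> 'b::real_normed_vector) \<Rightarrow> bool" where
  "diffeomorphism f \<longleftrightarrow> bij f \<and> (\<forall>k. C_k k f) \<and> (\<forall>k. C_k k (the_inv f))"

text \<open>Exponential map of a Lie group whose underlying manifold is a vector space \<open>'a\<close>, in the
  global chart given by the identity: the Lie algebra, as the tangent space at the unit, is \<open>'a\<close>,
  and \<open>X\<close> is mapped to \<open>\<gamma> 1\<close>, where \<open>\<gamma>\<close> is the one-parameter subgroup with velocity \<open>X\<close> at 0.\<close>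

definition lie_exp :: "('a::real_normed_vector) monoid \<Rightarrow> 'a \<Rightarrow> 'a" where
  "lie_exp G X =
     (THE \<gamma> :: real \<Rightarrow> 'a. (\<forall>s t. \<gamma> (s + t) = \<gamma> s \<otimes>\<^bsub>G\<^esub> \<gamma> t) \<and>
        (\<gamma> has_vector_derivative X) (at 0)) 1"

definition exponential_lie_group :: "('a::real_normed_vector) monoid \<Rightarrow> bool" where
  "exponential_lie_group G \<longleftrightarrow> diffeomorphism (lie_exp G)"


section \<open>The groups \<open>G\<close> and \<open>\<Gamma>\<close>\<close>

definition one_parameter_subgroup :: "(real \<Rightarrow> real^'n^'n) \<Rightarrow> bool" where
  "one_parameter_subgroup A \<longleftrightarrow>
     continuous_on UNIV A \<and> (\<forall>t. invertible (A t)) \<and> (\<forall>s t. A (s + t) = A s ** A t)"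

definition integer_vectors :: "(real^'n) set" where
  "integer_vectors = {k. \<forall>\<nu>. k $ \<nu> \<in> \<int>}"

definition SL_int :: "(real^'n^'n) set" where
  "SL_int = {M. (\<forall>\<mu> \<nu>. M $ \<mu> $ \<nu> \<in> \<int>) \<and> det M = 1}"

definition semidirect :: "(real \<Rightarrow> real^'n^'n) \<Rightarrow> ((real^'n) \<times> real) monoid" where
  "semidirect A =
     \<lparr>carrier = UNIV,
      mult = (\<lambda>g h. (fst g + A (snd g) *v fst h, snd g + snd h)),
      one = (0, 0)\<rparr>"

definition lattice :: "((real^'n) \<times> real) set" where
  "lattice = integer_vectors \<times> \<int>"

text \<open>\<open>integer_mod_group 2\<close> has carrier \<open>{0, 1}\<close>; the values of \<open>\<epsilon>\<close> outside \<open>\<Gamma>\<close> play no role.\<close>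

definition parity_hom :: "(real \<Rightarrow> real^'n^'n) \<Rightarrow> ((real^'n) \<times> real \<Rightarrow> int) \<Rightarrow> bool" where
  "parity_hom A \<epsilon> \<longleftrightarrow> \<epsilon> \<in> hom (semidirect A\<lparr>carrier := lattice\<rparr>) (integer_mod_group 2)"


section \<open>The right regular representation in \<open>L\<^sup>2(G,\<epsilon>)\<close>\<close>

definition equivariant ::
  "(real \<Rightarrow> real^'n^'n) \<Rightarrow> ((real^'n) \<times> real \<Rightarrow> int) \<Rightarrow> ((real^'n) \<times> real \<Rightarrow> complex) \<Rightarrow> bool" where
  "equivariant A \<epsilon> \<phi> \<longleftrightarrow>
     (\<forall>\<gamma>\<in>lattice. \<forall>y. \<phi> (\<gamma> \<otimes>\<^bsub>semidirect A\<^esub> y) = cis (pi * of_int (\<epsilon> \<gamma>)) * \<phi> y)"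

text \<open>Lebesgue measure on the fundamental domain \<open>[0,1]\<^sup>n \<times> [0,1]\<close> of \<open>\<Gamma> \ G\<close>.\<close>

definition fundamental_measure :: "((real^'n) \<times> real) measure" where
  "fundamental_measure = restrict_space lborel (cbox 0 1 \<times> {0..1})"

text \<open>The completion of the space of continuous equivariant functions, realised inside the
  measurable equivariant functions: those which are \<open>L\<^sup>2\<close>-limits of continuous equivariant
  functions.\<close>

definition L2G_functions ::
  "(real \<Rightarrow> real^'n^'n) \<Rightarrow> ((real^'n) \<times> real \<Rightarrow> int) \<Rightarrow> ((real^'n) \<times> real \<Rightarrow> complex) set" where
  "L2G_functions A \<epsilon> =
     {\<phi> \<in> borel_measurable borel.
        equivariant A \<epsilon> \<phi> \<and>
        integrable fundamental_measure (\<lambda>y. (cmod (\<phi> y))\<^sup>2) \<and>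
        (\<forall>e>0. \<exists>\<psi>. continuous_on UNIV \<psi> \<and> equivariant A \<epsilon> \<psi> \<and>
           (LINT y|fundamental_measure. (cmod (\<phi> y - \<psi> y))\<^sup>2) < e)}"

definition L2G ::
  "(real \<Rightarrow> real^'n^'n) \<Rightarrow> ((real^'n) \<times> real \<Rightarrow> int) \<Rightarrow> ((real^'n) \<times> real \<Rightarrow> complex) set hspace" where
  "L2G A \<epsilon> = L2_classes fundamental_measure (L2G_functions A \<epsilon>)"

text \<open>A translation of functions maps classes onto classes, so it acts on a class by taking the
  image; likewise for \<open>\<rho>_eta\<close> below.\<close>

definition right_regular ::
  "(real \<Rightarrow> real^'n^'n) \<Rightarrow> ((real^'n) \<times> real \<Rightarrow> int) \<Rightarrow>
   ((real^'n) \<times> real, ((real^'n) \<times> real \<Rightarrow> complex) set) rep" where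
  "right_regular A \<epsilon> =
     hspace.extend (L2G A \<epsilon>)
       (rep.fields (\<lambda>g C. (\<lambda>\<phi> y. \<phi> (y \<otimes>\<^bsub>semidirect A\<^esub> g)) ` C))"

definition fourier_coeff :: "((real^'n) \<times> real \<Rightarrow> complex) \<Rightarrow> real^'n \<Rightarrow> real \<Rightarrow> complex" where
  "fourier_coeff \<phi> \<xi> t =
     (LINT x:cbox 0 1|lborel. \<phi> (2 *\<^sub>R x, t) * cis (- 2 * pi * (\<xi> \<bullet> x)))"


section \<open>Orbits and the representations in the decomposition\<close>

definition Sigma_eps :: "((real^'n) \<times> real \<Rightarrow> int) \<Rightarrow> (real^'n) set" where
  "Sigma_eps \<epsilon> = {\<xi>. \<forall>\<nu>. \<exists>k::int. \<xi> $ \<nu> = of_int (2 * k + \<epsilon> (axis \<nu> 1, 0))}"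

definition int_orbit :: "(real \<Rightarrow> real^'n^'n) \<Rightarrow> real^'n \<Rightarrow> (real^'n) set" where
  "int_orbit A \<xi> = (\<lambda>l::int. transpose (A (of_int l)) *v \<xi>) ` UNIV"

definition real_orbit :: "(real \<Rightarrow> real^'n^'n) \<Rightarrow> real^'n \<Rightarrow> (real^'n) set" where
  "real_orbit A \<xi> = (\<lambda>t. transpose (A t) *v \<xi>) ` UNIV"

text \<open>The orbit set \<open>\<int> \ S\<close> of a \<open>\<int>\<close>-invariant set \<open>S\<close>.\<close>

definition int_orbits :: "(real \<Rightarrow> real^'n^'n) \<Rightarrow> (real^'n) set \<Rightarrow> (real^'n) set set" where
  "int_orbits A S = int_orbit A ` S"

definition X_infty ::
  "(real \<Rightarrow> real^'n^'n) \<Rightarrow> ((real^'n) \<times> real \<Rightarrow> int) \<Rightarrow> (real^'n) set set" where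
  "X_infty A \<epsilon> =
     {\<omega> \<in> range (real_orbit A). \<omega> \<inter> Sigma_eps \<epsilon> \<noteq> {} \<and> \<not> compact (closure \<omega>)}"

definition X_zero ::
  "(real \<Rightarrow> real^'n^'n) \<Rightarrow> ((real^'n) \<times> real \<Rightarrow> int) \<Rightarrow> (real^'n) set set" where
  "X_zero A \<epsilon> = {{\<xi>} |\<xi>. \<xi> \<in> Sigma_eps \<epsilon> \<and> (\<forall>t. transpose (A t) *v \<xi> = \<xi>)}"

definition U_theta ::
  "(real \<Rightarrow> real^'n^'n) \<Rightarrow> ((real^'n) \<times> real \<Rightarrow> int) \<Rightarrow> (real^'n) set \<Rightarrow>
   ((real^'n) \<times> real \<Rightarrow> complex) set set" where
  "U_theta A \<epsilon> \<theta> =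
     {C \<in> hcarrier (L2G A \<epsilon>). \<forall>\<phi>\<in>C. \<forall>\<xi>\<in>integer_vectors - \<theta>.
        AE t in lborel. fourier_coeff \<phi> \<xi> t = 0}"

definition rho_theta ::
  "(real \<Rightarrow> real^'n^'n) \<Rightarrow> ((real^'n) \<times> real \<Rightarrow> int) \<Rightarrow> (real^'n) set \<Rightarrow>
   ((real^'n) \<times> real, ((real^'n) \<times> real \<Rightarrow> complex) set) rep" where
  "rho_theta A \<epsilon> \<theta> = right_regular A \<epsilon>\<lparr>hcarrier := U_theta A \<epsilon> \<theta>\<rparr>"

text \<open>The common unitary equivalence class \<open>\<rho>_\<omega>\<close> of the \<open>\<rho>_\<theta>\<close>, given by its members: the unitary
  representations, on a Hilbert space over any type \<open>'v\<close>, equivalent to every \<open>\<rho>_\<theta>\<close> with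
  \<open>\<theta> \<subseteq> \<omega> \<inter> \<Sigma>\<close>.\<close>

definition rho_omega ::
  "(real \<Rightarrow> real^'n^'n) \<Rightarrow> ((real^'n) \<times> real \<Rightarrow> int) \<Rightarrow> (real^'n) set \<Rightarrow>
   ((real^'n) \<times> real, 'v) rep set" where
  "rho_omega A \<epsilon> \<omega> =
     {R. unitary_rep (semidirect A) R \<and>
         (\<forall>\<theta>\<in>int_orbits A (\<omega> \<inter> Sigma_eps \<epsilon>).
            unitarily_equivalent (semidirect A) R (rho_theta A \<epsilon> \<theta>))}"

definition mult_omega ::
  "(real \<Rightarrow> real^'n^'n) \<Rightarrow> ((real^'n) \<times> real \<Rightarrow> int) \<Rightarrow> (real^'n) set \<Rightarrow> nat" where
  "mult_omega A \<epsilon> \<omega> = card (int_orbits A (\<omega> \<inter> Sigma_eps \<epsilon>))"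

definition rho_eta ::
  "(real \<Rightarrow> real^'n^'n) \<Rightarrow> real^'n \<Rightarrow> ((real^'n) \<times> real, (real \<Rightarrow> complex) set) rep" where
  "rho_eta A \<eta> =
     hspace.extend real_L2
       (rep.fields (\<lambda>(x, s) C.
          (\<lambda>\<psi> t. cis (pi * ((transpose (A t) *v \<eta>) \<bullet> x)) * \<psi> (t + s)) ` C))"

definition chi ::
  "((real^'n) \<times> real \<Rightarrow> int) \<Rightarrow> (real^'n) set \<Rightarrow> int \<Rightarrow> (real^'n) \<times> real \<Rightarrow> complex" where
  "chi \<epsilon> \<omega> m = (\<lambda>(x, s).
     cis (pi * (the_elem \<omega> \<bullet> x)) * cis (pi * of_int (2 * m + \<epsilon> (0, 1)) * s))"

end

theory Submission
  imports Defs
begin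

text \<open>For \<open>\<xi> \<in> \<Sigma>\<close> and a continuous, compactly supported \<open>\<psi>\<close> on the line, the Poincare series
  \<open>P\<^sub>\<xi> \<psi> (x, t) = \<Sum>\<^sub>l \<epsilon>(l) \<psi>(t + l) exp (\<pi> i \<langle>A(l)\<^sup>\<top>\<xi>, x\<rangle>)\<close> is equivariant, and unfolding shows that the
  inner product of \<open>\<phi>\<close> with it is the integral of the Fourier coefficient of \<open>\<phi>\<close> at \<open>\<xi>\<close> against the
  conjugate of \<open>\<psi>\<close>. So the series for \<open>\<xi> \<in> \<theta>\<close> are total in \<open>U\<^sub>\<theta>\<close>, and those for different orbits are
  orthogonal. If the orbit of \<open>\<xi>\<close> is free, then \<open>\<psi> \<mapsto> P\<^sub>\<xi> \<psi>\<close> preserves inner products and intertwines \<open>\<rho>\<^sub>\<xi>\<close>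
  with the right translation. All equivalences arise in this manner, from two total families
  with the same Gram matrix which are permuted in the same way by the group.

  Because \<open>G\<close> is exponential, a periodic point of the dual action is fixed: an orbit that meets \<open>\<Sigma>\<close>
  is therefore either a fixed point, where Fourier expansion in \<open>t\<close> yields the characters, or free.
  For a free orbit the matrix coefficients of \<open>\<rho>\<^sub>\<eta>\<close> are Fourier transforms of complex measures on that
  orbit. Uniqueness of the Fourier transform turns a vanishing matrix coefficient into
  \<open>f(t + s) g(t) = 0\<close> for almost every \<open>t\<close> and every \<open>s\<close>, which is impossible for nonzero \<open>f\<close> and \<open>g\<close>,
  and it separates disjoint orbits.\<close>

section \<open>Periodic functions\<close>

text \<open>Right translation does not preserve the box \<open>cbox 0 1 \<times> {0..1}\<close>, so
  invariance of the inner product has to come from periodicity: a surjective integral linear map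
  followed by a shift preserves the torus measure, in the fibre as well as in time. The same change
  of variables removes the doubling in \<open>fourier_coeff\<close>, links the coefficients along a
  \<int>-orbit and yields the orthogonality relations. The total families are made large, indexed by
  all test functions or all complex multiples, so that the group maps each family into itself;
  intertwining is then checked on indices, and no unitary operator has to be written as a formula.
  Continuous \<psi> of bounded support keep the Poincare sums locally finite and continuous, as
  \<open>L2G_functions\<close> demands of its approximants. Uniqueness on a curve in R^n is reached
  through tori, where Stone-Weierstrass applies to polynomials in cosines and sines. The
  multiplicities are finite because every \<int>-orbit inside an \<real>-orbit has a point on the
  compact arc \<open>0 \<le> t \<le> 1\<close>, which holds only finitely many integral
  vectors.\<close>

definition unit_lattice :: "'a::euclidean_space set" where
  "unit_lattice = {k. \<forall>b\<in>Basis. k \<bullet> b \<in> \<int>}"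

text \<open>Half-open, so that the lattice translates partition space; the closed cube of the
  fundamental domain differs from it by a null set.\<close>

definition unit_cell :: "'a::euclidean_space set" where
  "unit_cell = {x. \<forall>b\<in>Basis. 0 \<le> x \<bullet> b \<and> x \<bullet> b < 1}"

text \<open>Stated for any Euclidean space because it serves both the fibre R^n and the time
  interval; the closed cube matches \<open>fundamental_measure\<close>.\<close>

definition cube_measure :: "'a::euclidean_space measure" where
  "cube_measure = restrict_space lborel (cbox 0 One)"

lemma countable_unit_lattice: "countable (unit_lattice :: 'a::euclidean_space set)"
proof (rule countable_image_inj_on)
  let ?f = "\<lambda>k::'a. \<lambda>b\<in>Basis. \<lfloor>k \<bullet> b\<rfloor>"
  have "?f ` unit_lattice \<subseteq> PiE Basis (\<lambda>_. UNIV)" by auto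
  then show "countable (?f ` unit_lattice)"
    by (rule countable_subset) (intro countable_PiE, auto)
  show "inj_on ?f unit_lattice"
  proof (rule inj_onI, rule euclidean_eqI)
    fix x y b :: 'a assume *: "x \<in> unit_lattice" "y \<in> unit_lattice" "?f x = ?f y" "b \<in> Basis"
    then have "\<lfloor>x \<bullet> b\<rfloor> = \<lfloor>y \<bullet> b\<rfloor>" by (metis restrict_apply')
    then show "x \<bullet> b = y \<bullet> b" using * by (auto simp: unit_lattice_def elim!: Ints_cases)
  qed
qed

lemma unit_lattice_add: "x \<in> unit_lattice \<Longrightarrow> y \<in> unit_lattice \<Longrightarrow> x + y \<in> unit_lattice"
  by (simp add: unit_lattice_def inner_add_left)

lemma unit_lattice_minus: "x \<in> unit_lattice \<Longrightarrow> - x \<in> unit_lattice"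
  by (simp add: unit_lattice_def)

lemma unit_lattice_zero: "0 \<in> unit_lattice"
  by (simp add: unit_lattice_def)

lemma unit_lattice_Basis: "b \<in> Basis \<Longrightarrow> b \<in> unit_lattice"
  by (auto simp: unit_lattice_def inner_Basis)

lemma unit_cell_cover: "\<exists>k\<in>unit_lattice. x - k \<in> unit_cell"
proof
  let ?k = "\<Sum>b\<in>Basis. of_int \<lfloor>x \<bullet> b\<rfloor> *\<^sub>R b"
  have k: "?k \<bullet> b = of_int \<lfloor>x \<bullet> b\<rfloor>" if "b \<in> Basis" for b using that by simp
  then show "?k \<in> unit_lattice" by (simp add: unit_lattice_def)
  show "x - ?k \<in> unit_cell"
    unfolding unit_cell_def using k by (auto simp: inner_diff_left) linarith
qed

lemma unit_cell_unique:
  assumes "k \<in> unit_lattice" "l \<in> unit_lattice" "x - k \<in> unit_cell" "x - l \<in> unit_cell"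
  shows "k = l"
proof (rule euclidean_eqI)
  fix b :: 'a assume b: "b \<in> Basis"
  have "k \<bullet> b \<in> \<int>" "l \<bullet> b \<in> \<int>" using assms(1,2) b by (auto simp: unit_lattice_def)
  then obtain m n where mn: "k \<bullet> b = of_int m" "l \<bullet> b = of_int n"
    by (metis Ints_cases)
  have "0 \<le> x \<bullet> b - of_int m" "x \<bullet> b - of_int m < 1" "0 \<le> x \<bullet> b - of_int n" "x \<bullet> b - of_int n < 1"
    using assms(3,4) b mn by (auto simp: unit_cell_def inner_diff_left)
  then have "m = n" by linarith
  then show "k \<bullet> b = l \<bullet> b" using mn by simp
qed

lemma sets_unit_cell [measurable]: "unit_cell \<in> sets borel"
proof -
  have "unit_cell = (\<Inter>b\<in>Basis. {x::'a. 0 \<le> x \<bullet> b \<and> x \<bullet> b < 1})"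
    by (auto simp: unit_cell_def)
  also have "\<dots> \<in> sets borel"
    by (intro sets.finite_INT) (auto intro: measurable)
  finally show ?thesis .
qed

lemma AE_cube_unit_cell: "AE x in lborel. x \<in> cbox 0 One \<longleftrightarrow> x \<in> (unit_cell :: 'a::euclidean_space set)"
proof (rule AE_I')
  have "emeasure lborel (cbox 0 One - box 0 One :: 'a set) = emeasure lborel (cbox 0 One :: 'a set) - emeasure lborel (box 0 One :: 'a set)"
    by (intro emeasure_Diff) (auto simp: box_subset_cbox)
  also have "\<dots> = 0" by (simp add: emeasure_lborel_cbox emeasure_lborel_box)
  finally show "cbox 0 One - box 0 One \<in> null_sets (lborel :: 'a measure)" by auto
  show "{x \<in> space lborel. \<not> (x \<in> cbox 0 One \<longleftrightarrow> x \<in> (unit_cell :: 'a set))} \<subseteq> cbox 0 One - box 0 One"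
    by (fastforce simp: unit_cell_def mem_box)
qed

lemma AE_box_cube: "AE x in lborel. x \<in> cbox 0 One \<longleftrightarrow> x \<in> box 0 (One :: 'a::euclidean_space)"
proof (rule AE_I')
  have "emeasure lborel (cbox 0 One - box 0 One :: 'a set) = emeasure lborel (cbox 0 One :: 'a set) - emeasure lborel (box 0 One :: 'a set)"
    by (intro emeasure_Diff) (auto simp: box_subset_cbox)
  also have "\<dots> = 0" by (simp add: emeasure_lborel_cbox emeasure_lborel_box)
  finally show "cbox 0 One - box 0 One \<in> null_sets (lborel :: 'a measure)" by auto
  show "{x \<in> space lborel. \<not> (x \<in> cbox 0 One \<longleftrightarrow> x \<in> box 0 (One :: 'a))} \<subseteq> cbox 0 One - box 0 One"
    by (auto intro: subsetD[OF box_subset_cbox])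
qed

lemma emeasure_unit_cell: "emeasure lborel (unit_cell :: 'a::euclidean_space set) = 1"
proof -
  have "emeasure lborel (unit_cell :: 'a set) = emeasure lborel (cbox 0 One :: 'a set)"
    by (rule emeasure_eq_AE) (use AE_cube_unit_cell in auto)
  also have "\<dots> = 1" by (simp add: emeasure_lborel_cbox)
  finally show ?thesis .
qed

lemma emeasure_translate:
  fixes X :: "'a::euclidean_space set"
  assumes [measurable]: "X \<in> sets borel"
  shows "emeasure lborel {x. x + c \<in> X} = emeasure lborel X"
proof -
  have "emeasure lborel X = emeasure (distr lborel borel ((+) c)) X" by (simp add: lborel_distr_plus)
  also have "\<dots> = emeasure lborel ((+) c -` X \<inter> space lborel)" by (intro emeasure_distr) auto
  also have "(+) c -` X \<inter> space lborel = {x. x + c \<in> X}" by (auto simp: add.commute)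
  finally show ?thesis ..
qed

text \<open>Both sides are sums over the lattice of the measures of the same pieces, since a cell and its
  translate are fundamental domains.\<close>

lemma emeasure_cell_translate:
  fixes S :: "'a::euclidean_space set"
  assumes S[measurable]: "S \<in> sets borel"
    and inv: "\<And>k x. k \<in> unit_lattice \<Longrightarrow> x + k \<in> S \<longleftrightarrow> x \<in> S"
  shows "emeasure lborel {x \<in> unit_cell. x + b \<in> S} = emeasure lborel (unit_cell \<inter> S)"
proof -
  \<comment> \<open>\<open>A k\<close> is a piece of the translated cell
    \<open>b + unit_cell\<close>, sorted by the lattice cell containing it; \<open>B k\<close> is
    the same piece moved back by \<open>k\<close> into the standard cell.\<close>
  define A where "A k = {y \<in> S. y - b \<in> unit_cell \<and> y - k \<in> unit_cell}" for k
  define B where "B k = {z \<in> S. z - b + k \<in> unit_cell \<and> z \<in> unit_cell}" for k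
  have tr: "{x. x + c \<in> unit_cell} \<in> sets borel" for c :: 'a
    using measurable_sets[of "\<lambda>x. x + c" borel borel unit_cell] by (simp add: vimage_def)
  have "A k = S \<inter> ({x. x + - b \<in> unit_cell} \<inter> {x. x + - k \<in> unit_cell})" for k
    by (auto simp: A_def)
  then have A[measurable]: "A k \<in> sets borel" for k
    using S tr by simp
  have "B k = S \<inter> ({x. x + (k - b) \<in> unit_cell} \<inter> unit_cell)" for k
    by (auto simp: B_def algebra_simps)
  then have B[measurable]: "B k \<in> sets borel" for k
    using S tr by simp
  have "{x \<in> unit_cell. x + b \<in> S} = {x. x + b \<in> (\<Union>k\<in>unit_lattice. A k)}"
    using unit_cell_cover by (auto simp: A_def)
  moreover have "(\<Union>k\<in>unit_lattice. A k) \<in> sets borel"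
    using countable_unit_lattice A by (intro sets.countable_UN') auto
  ultimately have "emeasure lborel {x \<in> unit_cell. x + b \<in> S} = emeasure lborel (\<Union>k\<in>unit_lattice. A k)"
    by (simp only: emeasure_translate)
  also have "\<dots> = (\<integral>\<^sup>+k. emeasure lborel (A k) \<partial>count_space unit_lattice)"
    using countable_unit_lattice
    by (intro emeasure_UN_countable) (auto simp: disjoint_family_on_def A_def dest: unit_cell_unique)
  also have "\<dots> = (\<integral>\<^sup>+k. emeasure lborel (B k) \<partial>count_space unit_lattice)"
  proof (rule nn_integral_cong)
    fix k assume "k \<in> space (count_space unit_lattice :: 'a measure)"
    then have "x + k \<in> S \<longleftrightarrow> x \<in> S" for x using inv by simp
    then have "{x. x + k \<in> A k} = B k" by (auto simp: A_def B_def diff_add_eq)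
    then show "emeasure lborel (A k) = emeasure lborel (B k)" using emeasure_translate[OF A, of k k] by simp
  qed
  also have "\<dots> = emeasure lborel (\<Union>k\<in>unit_lattice. B k)"
  proof (rule emeasure_UN_countable[symmetric])
    show "disjoint_family_on B unit_lattice"
      unfolding disjoint_family_on_def
    proof (intro ballI impI)
      fix k l :: 'a assume kl: "k \<in> unit_lattice" "l \<in> unit_lattice" "k \<noteq> l"
      have False if "z \<in> B k" "z \<in> B l" for z
        using unit_cell_unique[of "-k" "-l" "z - b"] that kl by (auto simp: B_def unit_lattice_minus)
      then show "B k \<inter> B l = {}" by blast
    qed
  qed (use countable_unit_lattice in auto)
  also have "(\<Union>k\<in>unit_lattice. B k) = unit_cell \<inter> S"
  proof -
    have "\<exists>k\<in>unit_lattice. z - b + k \<in> unit_cell" for z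
      using unit_cell_cover[of "z - b"] unit_lattice_minus by (metis diff_minus_eq_add minus_minus)
    then show ?thesis by (auto simp: B_def)
  qed
  finally show ?thesis .
qed

text \<open>The left-hand side does not change when \<open>b\<close> is added inside \<open>S\<close>, because \<open>b = f c\<close> and
  \<open>S \<circ> f\<close> is periodic; averaging over \<open>b\<close> in the cell gives the claim.\<close>

lemma emeasure_cell_linear:
  fixes S :: "'a::euclidean_space set" and f :: "'a \<Rightarrow> 'a"
  assumes f: "linear f" "surj f" and fl: "\<And>k. k \<in> unit_lattice \<Longrightarrow> f k \<in> unit_lattice"
    and S[measurable]: "S \<in> sets borel"
    and inv: "\<And>k x. k \<in> unit_lattice \<Longrightarrow> x + k \<in> S \<longleftrightarrow> x \<in> S"
  shows "emeasure lborel {x \<in> unit_cell. f x \<in> S} = emeasure lborel (unit_cell \<inter> S)"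
proof -
  have fm[measurable]: "f \<in> borel_measurable borel"
    using f(1) by (intro borel_measurable_continuous_onI linear_continuous_on) (simp add: linear_conv_bounded_linear)
  define m where "m = emeasure lborel {x \<in> unit_cell. f x \<in> S}"
  have m: "emeasure lborel {x \<in> unit_cell. f x + b \<in> S} = m" for b
  proof -
    obtain c where c: "f c = b" using f(2) by (metis surjD)
    have "emeasure lborel {x \<in> unit_cell. x + c \<in> f -` S} = emeasure lborel (unit_cell \<inter> f -` S)"
    proof (rule emeasure_cell_translate)
      show "f -` S \<in> sets borel" using measurable_sets[OF fm S] by simp
      show "x + k \<in> f -` S \<longleftrightarrow> x \<in> f -` S" if "k \<in> unit_lattice" for k x
        using inv[OF fl[OF that]] by (simp add: linear_add[OF f(1)])
    qed
    moreover have "{x \<in> unit_cell. x + c \<in> f -` S} = {x \<in> unit_cell. f x + b \<in> S}"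
      using c by (auto simp: linear_add[OF f(1)])
    moreover have "unit_cell \<inter> f -` S = {x \<in> unit_cell. f x \<in> S}" by auto
    ultimately show ?thesis by (simp add: m_def)
  qed
  have "m = (\<integral>\<^sup>+b. indicator unit_cell b * m \<partial>(lborel :: 'a measure))"
    by (simp add: nn_integral_multc emeasure_unit_cell)
  also have "\<dots> = (\<integral>\<^sup>+b. \<integral>\<^sup>+x. indicator unit_cell b * (indicator unit_cell x * indicator S (f x + b)) \<partial>lborel \<partial>lborel)"
  proof (rule nn_integral_cong)
    fix b :: 'a
    have "m = (\<integral>\<^sup>+x. indicator {x \<in> unit_cell. f x + b \<in> S} x \<partial>lborel)"
      using m[of b] by simp
    also have "\<dots> = (\<integral>\<^sup>+x. indicator unit_cell x * indicator S (f x + b) \<partial>lborel)"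
      by (intro nn_integral_cong) (auto simp: indicator_def)
    finally show "indicator unit_cell b * m = (\<integral>\<^sup>+x. indicator unit_cell b * (indicator unit_cell x * indicator S (f x + b)) \<partial>lborel)"
      by (simp add: nn_integral_cmult)
  qed
  \<comment> \<open>Exchanging the integrals turns the average over \<open>b\<close> into a
    translation by \<open>f x\<close> for fixed \<open>x\<close>, and
    \<open>emeasure_cell_translate\<close> removes it.\<close>
  also have "\<dots> = (\<integral>\<^sup>+x. \<integral>\<^sup>+b. indicator unit_cell b * (indicator unit_cell x * indicator S (f x + b)) \<partial>lborel \<partial>lborel)"
    by (rule lborel_pair.Fubini') measurable
  also have "\<dots> = (\<integral>\<^sup>+x. indicator unit_cell x * emeasure lborel (unit_cell \<inter> S) \<partial>(lborel :: 'a measure))"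
  proof (rule nn_integral_cong)
    fix x :: 'a
    have "(\<integral>\<^sup>+b. indicator unit_cell b * (indicator unit_cell x * indicator S (f x + b)) \<partial>lborel)
      = (\<integral>\<^sup>+b. indicator unit_cell x * indicator {b \<in> unit_cell. b + f x \<in> S} b \<partial>lborel)"
      by (intro nn_integral_cong) (auto simp: indicator_def add.commute)
    also have "\<dots> = indicator unit_cell x * emeasure lborel {b \<in> unit_cell. b + f x \<in> S}"
      by (subst nn_integral_cmult) auto
    finally show "(\<integral>\<^sup>+b. indicator unit_cell b * (indicator unit_cell x * indicator S (f x + b)) \<partial>lborel)
      = indicator unit_cell x * emeasure lborel (unit_cell \<inter> S)"
      by (simp add: emeasure_cell_translate inv)
  qed
  also have "\<dots> = emeasure lborel (unit_cell \<inter> S)"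
    by (simp add: nn_integral_multc emeasure_unit_cell)
  finally show ?thesis by (simp add: m_def)
qed

section \<open>Affine changes of variables on the torus\<close>

lemma space_cube_measure: "space cube_measure = cbox 0 One"
  by (simp add: cube_measure_def)

lemma sets_cube_measure: "sets cube_measure = sets (restrict_space borel (cbox 0 One))"
  by (simp add: cube_measure_def sets_restrict_space)

lemma measurable_cube_measure: "f \<in> measurable borel N \<Longrightarrow> f \<in> measurable cube_measure N"
  by (simp add: cube_measure_def measurable_restrict_space1)

lemma emeasure_cube_measure:
  assumes [measurable]: "S \<in> sets borel"
  shows "emeasure cube_measure (S \<inter> cbox 0 One) = emeasure lborel (unit_cell \<inter> S)"
proof -
  have "emeasure cube_measure (S \<inter> cbox 0 One) = emeasure lborel (S \<inter> cbox 0 One)"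
    by (simp add: cube_measure_def emeasure_restrict_space)
  also have "\<dots> = emeasure lborel (unit_cell \<inter> S)"
    by (rule emeasure_eq_AE) (use AE_cube_unit_cell in auto)
  finally show ?thesis .
qed

lemma prob_space_cube: "emeasure cube_measure (space (cube_measure :: 'a::euclidean_space measure)) = 1"
  using emeasure_cube_measure[of "UNIV :: 'a set"] by (simp add: space_cube_measure emeasure_unit_cell)

lemma finite_cube_measure: "finite_measure cube_measure"
  by (rule finite_measureI) (simp add: prob_space_cube)

text \<open>A surjective endomorphism of the torus followed by a translation preserves Haar measure.
  Equality of image measures yields integrability, Bochner integrals and nonnegative integrals at
  once.\<close>

lemma distr_cube_affine:
  fixes h :: "'a::euclidean_space \<Rightarrow> 'b" and f :: "'a \<Rightarrow> 'a"
  assumes f: "linear f" "surj f" and fl: "\<And>k. k \<in> unit_lattice \<Longrightarrow> f k \<in> unit_lattice"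
    and h[measurable]: "h \<in> measurable borel N" and per: "\<And>k x. k \<in> unit_lattice \<Longrightarrow> h (x + k) = h x"
  shows "distr cube_measure N (\<lambda>x. h (f x + b)) = distr cube_measure N h"
proof (rule measure_eqI)
  fix X assume "X \<in> sets (distr cube_measure N (\<lambda>x. h (f x + b)))"
  then have X[measurable]: "X \<in> sets N" by simp
  have fm[measurable]: "f \<in> borel_measurable borel"
    using f(1) by (intro borel_measurable_continuous_onI linear_continuous_on) (simp add: linear_conv_bounded_linear)
  define S where "S = h -` X"
  have S[measurable]: "S \<in> sets borel" using measurable_sets[OF h X] by (simp add: S_def)
  have inv: "x + k \<in> S \<longleftrightarrow> x \<in> S" if "k \<in> unit_lattice" for k x using per[OF that] by (simp add: S_def)
  have S': "{y. y + b \<in> S} \<in> sets borel"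
    using measurable_sets[of "\<lambda>y. y + b" borel borel S] by (simp add: vimage_def)
  have S'': "{x. f x + b \<in> S} \<in> sets borel"
    using measurable_sets[of "\<lambda>y. f y + b" borel borel S] by (simp add: vimage_def)
  have "emeasure (distr cube_measure N (\<lambda>x. h (f x + b))) X
    = emeasure cube_measure ({x. f x + b \<in> S} \<inter> cbox 0 One)"
    by (subst emeasure_distr) (auto simp: S_def space_cube_measure intro!: measurable_cube_measure arg_cong2[where f = emeasure])
  also have "\<dots> = emeasure lborel {x \<in> unit_cell. f x \<in> {y. y + b \<in> S}}"
    by (subst emeasure_cube_measure[OF S'']) (auto intro!: arg_cong2[where f = emeasure])
  also have "\<dots> = emeasure lborel (unit_cell \<inter> {y. y + b \<in> S})"
  proof (rule emeasure_cell_linear[OF f fl S'])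
    show "x + k \<in> {y. y + b \<in> S} \<longleftrightarrow> x \<in> {y. y + b \<in> S}" if "k \<in> unit_lattice" for x k
      using inv[OF that, of "x + b"] by (simp add: algebra_simps)
  qed
  also have "unit_cell \<inter> {y. y + b \<in> S} = {x \<in> unit_cell. x + b \<in> S}" by auto
  also have "emeasure lborel \<dots> = emeasure lborel (unit_cell \<inter> S)"
    by (rule emeasure_cell_translate[OF S inv])
  also have "\<dots> = emeasure cube_measure (S \<inter> cbox 0 One)"
    by (rule emeasure_cube_measure[symmetric]) measurable
  also have "\<dots> = emeasure (distr cube_measure N h) X"
    by (subst emeasure_distr) (auto simp: S_def space_cube_measure intro!: measurable_cube_measure)
  finally show "emeasure (distr cube_measure N (\<lambda>x. h (f x + b))) X = emeasure (distr cube_measure N h) X" .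
qed simp

lemma
  fixes h :: "'a::euclidean_space \<Rightarrow> 'b::{banach, second_countable_topology}" and f :: "'a \<Rightarrow> 'a"
  assumes f: "linear f" "surj f" and fl: "\<And>k. k \<in> unit_lattice \<Longrightarrow> f k \<in> unit_lattice"
    and h[measurable]: "h \<in> borel_measurable borel" and per: "\<And>k x. k \<in> unit_lattice \<Longrightarrow> h (x + k) = h x"
  shows integral_cube_affine: "(LINT x|cube_measure. h (f x + b)) = (LINT x|cube_measure. h x)"
    and integrable_cube_affine: "integrable cube_measure (\<lambda>x. h (f x + b)) \<longleftrightarrow> integrable cube_measure h"
proof -
  have fm[measurable]: "f \<in> borel_measurable borel"
    using f(1) by (intro borel_measurable_continuous_onI linear_continuous_on) (simp add: linear_conv_bounded_linear)
  have m: "(\<lambda>x. h (f x + b)) \<in> borel_measurable cube_measure" "h \<in> borel_measurable cube_measure"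
    by (auto intro!: measurable_cube_measure)
  note eq = distr_cube_affine[OF f fl h per, of b]
  show "(LINT x|cube_measure. h (f x + b)) = (LINT x|cube_measure. h x)"
    using integral_distr[OF m(1), of "\<lambda>x. x"] integral_distr[OF m(2), of "\<lambda>x. x"] eq by simp
  show "integrable cube_measure (\<lambda>x. h (f x + b)) \<longleftrightarrow> integrable cube_measure h"
    using integrable_distr_eq[OF m(1), of "\<lambda>x. x"] integrable_distr_eq[OF m(2), of "\<lambda>x. x"] eq by simp
qed

lemma nn_integral_cube_affine:
  fixes h :: "'a::euclidean_space \<Rightarrow> ennreal" and f :: "'a \<Rightarrow> 'a"
  assumes f: "linear f" "surj f" and fl: "\<And>k. k \<in> unit_lattice \<Longrightarrow> f k \<in> unit_lattice"
    and h[measurable]: "h \<in> borel_measurable borel" and per: "\<And>k x. k \<in> unit_lattice \<Longrightarrow> h (x + k) = h x"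
  shows "(\<integral>\<^sup>+x. h (f x + b) \<partial>cube_measure) = (\<integral>\<^sup>+x. h x \<partial>cube_measure)"
proof -
  have fm[measurable]: "f \<in> borel_measurable borel"
    using f(1) by (intro borel_measurable_continuous_onI linear_continuous_on) (simp add: linear_conv_bounded_linear)
  have m: "(\<lambda>x. h (f x + b)) \<in> borel_measurable cube_measure" "h \<in> borel_measurable cube_measure"
    by (auto intro!: measurable_cube_measure)
  note eq = distr_cube_affine[OF f fl h per, of b]
  show ?thesis
    using nn_integral_distr[OF m(1), of "\<lambda>x. x"] nn_integral_distr[OF m(2), of "\<lambda>x. x"] eq by simp
qed

section \<open>Uniqueness of Fourier coefficients\<close>

text \<open>The torus as a subset of \<open>'a \<times> 'a\<close>, through the cosine and sine of
  each coordinate; polynomials on the image are then trigonometric polynomials.\<close>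

definition torus_map :: "'a::euclidean_space \<Rightarrow> 'a \<times> 'a" where
  "torus_map x = ((\<Sum>b\<in>Basis. cos (2 * pi * (x \<bullet> b)) *\<^sub>R b), (\<Sum>b\<in>Basis. sin (2 * pi * (x \<bullet> b)) *\<^sub>R b))"

lemma torus_map_continuous: "continuous_on S torus_map"
  unfolding torus_map_def by (intro continuous_intros)

lemma torus_map_measurable [measurable]: "torus_map \<in> borel_measurable borel"
  by (intro borel_measurable_continuous_onI torus_map_continuous)

lemma torus_map_eq_iff: "torus_map x = torus_map y \<longleftrightarrow> x - y \<in> unit_lattice"
proof -
  have "torus_map x = torus_map y \<longleftrightarrow>
    (\<forall>b\<in>Basis. cos (2 * pi * (x \<bullet> b)) = cos (2 * pi * (y \<bullet> b)) \<and> sin (2 * pi * (x \<bullet> b)) = sin (2 * pi * (y \<bullet> b)))"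
    unfolding torus_map_def prod.inject euclidean_eq_iff[where 'a = 'a] by auto
  also have "\<dots> \<longleftrightarrow> (\<forall>b\<in>Basis. (x - y) \<bullet> b \<in> \<int>)"
  proof (rule ball_cong[OF refl])
    fix b :: 'a
    have "cos (2 * pi * (x \<bullet> b)) = cos (2 * pi * (y \<bullet> b)) \<and> sin (2 * pi * (x \<bullet> b)) = sin (2 * pi * (y \<bullet> b))
      \<longleftrightarrow> (\<exists>n::int. 2 * pi * (x \<bullet> b) = 2 * pi * (y \<bullet> b) + 2 * pi * n)"
      using sin_cos_eq_iff[of "2 * pi * (x \<bullet> b)" "2 * pi * (y \<bullet> b)"] by blast
    also have "\<dots> \<longleftrightarrow> (\<exists>n::int. (x - y) \<bullet> b = n)"
    proof (rule ex_cong1)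
      fix n :: int
      have "2 * pi * (x \<bullet> b) = 2 * pi * (y \<bullet> b) + 2 * pi * n \<longleftrightarrow> 2 * pi * (x \<bullet> b) = 2 * pi * (y \<bullet> b + n)"
        by (simp add: distrib_left)
      also have "\<dots> \<longleftrightarrow> (x - y) \<bullet> b = n" by (auto simp: inner_diff_left)
      finally show "2 * pi * (x \<bullet> b) = 2 * pi * (y \<bullet> b) + 2 * pi * n \<longleftrightarrow> (x - y) \<bullet> b = n" .
    qed
    also have "\<dots> \<longleftrightarrow> (x - y) \<bullet> b \<in> \<int>" by (auto elim!: Ints_cases)
    finally show "cos (2 * pi * (x \<bullet> b)) = cos (2 * pi * (y \<bullet> b)) \<and> sin (2 * pi * (x \<bullet> b)) = sin (2 * pi * (y \<bullet> b))
      \<longleftrightarrow> (x - y) \<bullet> b \<in> \<int>" .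
  qed
  also have "\<dots> \<longleftrightarrow> x - y \<in> unit_lattice" by (simp add: unit_lattice_def)
  finally show ?thesis .
qed

lemma compact_range_torus_map: "compact (range (torus_map :: 'a::euclidean_space \<Rightarrow> _))"
proof -
  have "range (torus_map :: 'a \<Rightarrow> _) = torus_map ` cbox 0 One"
  proof -
    have "torus_map x \<in> torus_map ` cbox 0 One" for x :: 'a
    proof -
      obtain k where k: "k \<in> unit_lattice" "x - k \<in> unit_cell" using unit_cell_cover by blast
      then have "torus_map x = torus_map (x - k)" by (simp add: torus_map_eq_iff)
      moreover have "x - k \<in> cbox 0 One" using k by (auto simp: unit_cell_def mem_box less_imp_le)
      ultimately show ?thesis by blast
    qed
    then show ?thesis by blast
  qed
  then show ?thesis by (simp add: compact_continuous_image torus_map_continuous)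
qed

text \<open>\<open>char_eq M h F N k G\<close>: the images of the complex measures \<open>F M\<close> and \<open>G N\<close> under \<open>h\<close> and \<open>k\<close>
  have the same Fourier coefficients on the torus.\<close>

definition char_eq where
  "char_eq M h F N k G \<longleftrightarrow>
    (\<forall>l\<in>unit_lattice. (LINT t|M. cis (2 * pi * (l \<bullet> h t)) * F t) = (LINT t|N. cis (2 * pi * (l \<bullet> k t)) * G t))"

lemma integrable_bounded_mult:
  fixes F :: "'b \<Rightarrow> complex"
  assumes "integrable M F" "p \<in> borel_measurable M" "\<And>t. cmod (p t) \<le> B"
  shows "integrable M (\<lambda>t. p t * F t)"
proof (rule Bochner_Integration.integrable_bound)
  show "integrable M (\<lambda>t. B * cmod (F t))" using assms(1) by simp
  have "0 \<le> B" using assms(3)[of undefined] norm_ge_zero order_trans by blast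
  show "AE t in M. norm (p t * F t) \<le> norm (B * cmod (F t))"
    using assms(3) \<open>0 \<le> B\<close> by (auto simp: norm_mult intro!: mult_right_mono)
qed (use assms in measurable)

lemma cis_borel_measurable [measurable]: "cis \<in> borel_measurable borel"
  by (intro borel_measurable_continuous_onI continuous_intros)

text \<open>Multiplying by a polynomial in the cosines and sines replaces each Fourier coefficient
  by a finite linear combination of other coefficients, taken alike on both sides. \<open>F\<close>
  and \<open>G\<close> are generalized in the induction so that a product of polynomials is handled
  by applying the two hypotheses in succession.\<close>

lemma char_eq_polynomial:
  fixes h :: "'b \<Rightarrow> 'a::euclidean_space" and k :: "'c \<Rightarrow> 'a"
  assumes hm[measurable]: "h \<in> borel_measurable M" and km[measurable]: "k \<in> borel_measurable N"
    and p: "real_polynomial_function (p :: 'a \<times> 'a \<Rightarrow> real)"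
    and "integrable M F" "integrable N G" "char_eq M h F N k G"
  shows "integrable M (\<lambda>t. of_real (p (torus_map (h t))) * F t) \<and> integrable N (\<lambda>t. of_real (p (torus_map (k t))) * G t)
    \<and> char_eq M h (\<lambda>t. of_real (p (torus_map (h t))) * F t) N k (\<lambda>t. of_real (p (torus_map (k t))) * G t)"
  using p assms(4-6)
proof (induction p arbitrary: F G rule: real_polynomial_function.induct)
  case (linear f)
  let ?c = "\<lambda>b. f (b, 0)" and ?s = "\<lambda>b. f (0, b)"
  interpret f: bounded_linear f by fact
  have fE: "f (torus_map x) = (\<Sum>b\<in>Basis. ?c b * cos (2 * pi * (x \<bullet> b)) + ?s b * sin (2 * pi * (x \<bullet> b)))" for x
  proof -
    have "torus_map x = (\<Sum>b\<in>Basis. cos (2 * pi * (x \<bullet> b)) *\<^sub>R (b, 0) + sin (2 * pi * (x \<bullet> b)) *\<^sub>R (0, b))"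
      by (simp add: torus_map_def prod_eq_iff fst_sum snd_sum)
    then have "f (torus_map x) = (\<Sum>b\<in>Basis. f (cos (2 * pi * (x \<bullet> b)) *\<^sub>R (b, 0) + sin (2 * pi * (x \<bullet> b)) *\<^sub>R (0, b)))"
      by (simp only: f.sum)
    then show ?thesis by (simp only: f.add f.scaleR real_scaleR_def mult.commute)
  qed
  \<comment> \<open>Euler's formulas: \<open>c cos + s sin\<close> has coefficient
    \<open>(c - \<i> s) / 2\<close> at frequency \<open>b\<close> and
    \<open>(c + \<i> s) / 2\<close> at frequency \<open>-b\<close>.\<close>
  let ?w = "\<lambda>b. (of_real (?c b) - \<i> * of_real (?s b)) / 2" and ?v = "\<lambda>b. (of_real (?c b) + \<i> * of_real (?s b)) / 2"
  have e: "cis (2 * pi * (l \<bullet> x)) * of_real (f (torus_map x)) =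
      (\<Sum>b\<in>Basis. ?w b * cis (2 * pi * ((l + b) \<bullet> x)) + ?v b * cis (2 * pi * ((l - b) \<bullet> x)))" for l x
  proof -
    have "of_real (?c b * cos (2 * pi * (x \<bullet> b)) + ?s b * sin (2 * pi * (x \<bullet> b)))
      = ?w b * cis (2 * pi * (b \<bullet> x)) + ?v b * cis (- (2 * pi * (b \<bullet> x)))" for b
      by (simp add: complex_eq_iff inner_commute field_simps)
    moreover have "cis (2 * pi * ((l + b) \<bullet> x)) = cis (2 * pi * (l \<bullet> x)) * cis (2 * pi * (b \<bullet> x))"
      "cis (2 * pi * ((l - b) \<bullet> x)) = cis (2 * pi * (l \<bullet> x)) * cis (- (2 * pi * (b \<bullet> x)))" for b
      by (simp_all add: cis_mult inner_add_left inner_diff_left algebra_simps)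
    ultimately show ?thesis
      unfolding fE of_real_sum sum_distrib_left by (simp add: algebra_simps)
  qed
  have fb: "\<exists>B. \<forall>x::'a. \<bar>f (torus_map x)\<bar> \<le> B"
  proof -
    have "bounded (f ` range torus_map)"
      by (intro compact_imp_bounded compact_continuous_image compact_range_torus_map linear_continuous_on linear.hyps)
    then show ?thesis by (auto simp: bounded_iff)
  qed
  then obtain B where B: "\<And>x::'a. \<bar>f (torus_map x)\<bar> \<le> B" by blast
  have [measurable]: "f \<in> borel_measurable borel"
    by (intro borel_measurable_continuous_onI linear_continuous_on linear.hyps)
  have *: "(LINT t|M'. cis (2 * pi * (l \<bullet> h' t)) * (of_real (f (torus_map (h' t))) * F' t)) =
    (\<Sum>b\<in>Basis. ?w b * (LINT t|M'. cis (2 * pi * ((l + b) \<bullet> h' t)) * F' t) + ?v b * (LINT t|M'. cis (2 * pi * ((l - b) \<bullet> h' t)) * F' t))"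
    if [measurable]: "h' \<in> borel_measurable M'" and F': "integrable M' F'" for l and M' :: "'d measure" and h' F'
  proof -
    have i: "integrable M' (\<lambda>t. cis (2 * pi * (m \<bullet> h' t)) * F' t)" for m
      by (rule integrable_bounded_mult[OF F', where B = 1]) auto
    have "(LINT t|M'. cis (2 * pi * (l \<bullet> h' t)) * (of_real (f (torus_map (h' t))) * F' t))
      = (LINT t|M'. (\<Sum>b\<in>Basis. ?w b * (cis (2 * pi * ((l + b) \<bullet> h' t)) * F' t) + ?v b * (cis (2 * pi * ((l - b) \<bullet> h' t)) * F' t)))"
      by (simp only: mult.assoc[symmetric] e sum_distrib_right distrib_right)
    also have "\<dots> = (\<Sum>b\<in>Basis. ?w b * (LINT t|M'. cis (2 * pi * ((l + b) \<bullet> h' t)) * F' t) + ?v b * (LINT t|M'. cis (2 * pi * ((l - b) \<bullet> h' t)) * F' t))"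
      using i by (subst Bochner_Integration.integral_sum) (auto intro!: sum.cong)
    finally show ?thesis .
  qed
  show ?case
  proof (intro conjI)
    show "integrable M (\<lambda>t. of_real (f (torus_map (h t))) * F t)"
      by (rule integrable_bounded_mult[OF linear.prems(1), where B = B]) (use B in auto)
    show "integrable N (\<lambda>t. of_real (f (torus_map (k t))) * G t)"
      by (rule integrable_bounded_mult[OF linear.prems(2), where B = B]) (use B in auto)
    show "char_eq M h (\<lambda>t. of_real (f (torus_map (h t))) * F t) N k (\<lambda>t. of_real (f (torus_map (k t))) * G t)"
      unfolding char_eq_def
    proof
      fix l :: 'a assume l: "l \<in> unit_lattice"
      then have "l + b \<in> unit_lattice" "l - b \<in> unit_lattice" if "b \<in> Basis" for b
        using that unit_lattice_add[OF l unit_lattice_Basis] unit_lattice_add[OF l unit_lattice_minus[OF unit_lattice_Basis]] by auto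
      then show "(LINT t|M. cis (2 * pi * (l \<bullet> h t)) * (of_real (f (torus_map (h t))) * F t))
        = (LINT t|N. cis (2 * pi * (l \<bullet> k t)) * (of_real (f (torus_map (k t))) * G t))"
        unfolding *[OF hm linear.prems(1)] *[OF km linear.prems(2)]
        using linear.prems(3) by (intro sum.cong) (simp_all add: char_eq_def)
    qed
  qed
next
  case (const c)
  then show ?case by (auto simp: char_eq_def mult.left_commute[of _ "of_real c"])
next
  case (add f g)
  have i: "integrable M' (\<lambda>t. cis (2 * pi * (m \<bullet> h' t)) * F' t)"
    if [measurable]: "h' \<in> borel_measurable M'" and F': "integrable M' F'" for M' :: "'d measure" and h' F' and m :: 'a
    by (rule integrable_bounded_mult[OF F', where B = 1]) auto
  show ?case
    using add.IH(1)[OF add.prems] add.IH(2)[OF add.prems]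
    by (auto simp: char_eq_def i distrib_right distrib_left)
next
  case (mult f g)
  then show ?case
    using mult.IH(1)[of "\<lambda>t. of_real (g (torus_map (h t))) * F t" "\<lambda>t. of_real (g (torus_map (k t))) * G t"] mult.IH(2)[OF mult.prems]
    by (simp add: mult.assoc)
qed

text \<open>Stone-Weierstrass on the compact image of \<open>torus_map\<close>: a uniform error
  \<open>e\<close> in the test function costs at most \<open>e\<close> times the total mass
  \<open>C\<close> of both densities.\<close>

lemma char_eq_continuous:
  fixes h :: "'b \<Rightarrow> 'a::euclidean_space" and k :: "'c \<Rightarrow> 'a" and q :: "'a \<times> 'a \<Rightarrow> real"
  assumes hm[measurable]: "h \<in> borel_measurable M" and km[measurable]: "k \<in> borel_measurable N"
    and F: "integrable M F" and G: "integrable N G" and eq: "char_eq M h F N k G"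
    and q: "continuous_on UNIV q"
  shows "(LINT t|M. of_real (q (torus_map (h t))) * F t) = (LINT t|N. of_real (q (torus_map (k t))) * G t)"
proof -
  have [measurable]: "q \<in> borel_measurable borel" using q by (rule borel_measurable_continuous_onI)
  have "bounded (q ` range (torus_map :: 'a \<Rightarrow> _))"
    by (intro compact_imp_bounded compact_continuous_image compact_range_torus_map continuous_on_subset[OF q]) auto
  then obtain B where B: "\<And>x::'a. \<bar>q (torus_map x)\<bar> \<le> B" by (auto simp: bounded_iff)
  have qi: "integrable M (\<lambda>t. of_real (q (torus_map (h t))) * F t)" "integrable N (\<lambda>t. of_real (q (torus_map (k t))) * G t)"
    by (rule integrable_bounded_mult[where B = B], use F G B in auto)+
  define C where "C = (LINT t|M. cmod (F t)) + (LINT t|N. cmod (G t))"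
  define d where "d = cmod ((LINT t|M. of_real (q (torus_map (h t))) * F t) - (LINT t|N. of_real (q (torus_map (k t))) * G t))"
  have key: "d \<le> e * C"
    if e: "e > 0" for e
  proof -
    obtain p where p: "real_polynomial_function p" "\<And>x. x \<in> range torus_map \<Longrightarrow> \<bar>q x - p x\<bar> < e"
      using Stone_Weierstrass_real_polynomial_function[OF compact_range_torus_map continuous_on_subset[OF q] e] by blast
    from char_eq_polynomial[OF hm km p(1) F G eq]
    have pi: "integrable M (\<lambda>t. of_real (p (torus_map (h t))) * F t)" "integrable N (\<lambda>t. of_real (p (torus_map (k t))) * G t)"
      and "char_eq M h (\<lambda>t. of_real (p (torus_map (h t))) * F t) N k (\<lambda>t. of_real (p (torus_map (k t))) * G t)" by auto
    then have "(LINT t|M. of_real (p (torus_map (h t))) * F t) = (LINT t|N. of_real (p (torus_map (k t))) * G t)"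
      unfolding char_eq_def using unit_lattice_zero by force
    then have "(LINT t|M. of_real (q (torus_map (h t))) * F t) - (LINT t|N. of_real (q (torus_map (k t))) * G t)
      = (LINT t|M. of_real (q (torus_map (h t))) * F t - of_real (p (torus_map (h t))) * F t)
       - (LINT t|N. of_real (q (torus_map (k t))) * G t - of_real (p (torus_map (k t))) * G t)"
      using qi pi by simp
    also have "cmod \<dots> \<le> cmod (LINT t|M. of_real (q (torus_map (h t))) * F t - of_real (p (torus_map (h t))) * F t)
       + cmod (LINT t|N. of_real (q (torus_map (k t))) * G t - of_real (p (torus_map (k t))) * G t)"
      by (rule norm_triangle_ineq4)
    also have "\<dots> \<le> (LINT t|M. e * cmod (F t)) + (LINT t|N. e * cmod (G t))"
    proof (intro add_mono)
      show "cmod (LINT t|M. of_real (q (torus_map (h t))) * F t - of_real (p (torus_map (h t))) * F t) \<le> (LINT t|M. e * cmod (F t))"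
      proof (rule order_trans[OF integral_norm_bound integral_mono])
        show "norm (of_real (q (torus_map (h t))) * F t - of_real (p (torus_map (h t))) * F t) \<le> e * cmod (F t)" for t
          using p(2)[of "torus_map (h t)"]
          by (simp add: left_diff_distrib[symmetric] norm_mult mult_right_mono flip: of_real_diff)
      qed (use qi pi F in auto)
      show "cmod (LINT t|N. of_real (q (torus_map (k t))) * G t - of_real (p (torus_map (k t))) * G t) \<le> (LINT t|N. e * cmod (G t))"
      proof (rule order_trans[OF integral_norm_bound integral_mono])
        show "norm (of_real (q (torus_map (k t))) * G t - of_real (p (torus_map (k t))) * G t) \<le> e * cmod (G t)" for t
          using p(2)[of "torus_map (k t)"]
          by (simp add: left_diff_distrib[symmetric] norm_mult mult_right_mono flip: of_real_diff)
      qed (use qi pi G in auto)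
    qed
    also have "\<dots> = e * C" by (simp add: C_def distrib_left)
    finally show ?thesis by (simp add: d_def)
  qed
  have C0: "C \<ge> 0" by (simp add: C_def)
  have "d \<le> 0"
  proof (rule field_le_epsilon)
    fix e :: real assume e: "e > 0"
    \<comment> \<open>The \<open>+ 1\<close> keeps the quotient meaningful when both densities have
      mass zero.\<close>
    then have "d \<le> e / (C + 1) * C" using C0 key[of "e / (C + 1)"] by simp
    also have "\<dots> \<le> e" using e C0 by (simp add: field_simps)
    finally show "d \<le> 0 + e" by simp
  qed
  then show ?thesis by (simp add: d_def)
qed

text \<open>Tent functions of slope \<open>n\<close> over \<open>P\<close>; they are continuous and
  shrink to the indicator because points off a closed set have positive distance from it.\<close>

lemma indicator_limit:
  fixes P :: "'a::euclidean_space set"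
  assumes "closed P" "P \<noteq> {}"
  shows "(\<lambda>n. max 0 (1 - real n * infdist x P)) \<longlonglongrightarrow> indicator P x"
proof (cases "x \<in> P")
  case True then show ?thesis by simp
next
  case False
  then have d: "infdist x P > 0" using assms by (simp add: infdist_pos_not_in_closed)
  obtain m where m: "1 / infdist x P < real m" using reals_Archimedean2 by blast
  have "max 0 (1 - real n * infdist x P) = 0" if "n \<ge> m" for n
  proof -
    have "1 < real m * infdist x P" using m d by (simp add: field_simps)
    also have "\<dots> \<le> real n * infdist x P" using that d by (intro mult_right_mono) auto
    finally show ?thesis by simp
  qed
  then show ?thesis using False by (auto intro!: tendsto_eventually eventually_sequentiallyI[of m])
qed

text \<open>Dominated convergence with tent functions passes from continuous test functions to the
  indicator of a compact set.\<close>

lemma char_eq_compact: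
  fixes h :: "'b \<Rightarrow> 'a::euclidean_space" and k :: "'c \<Rightarrow> 'a" and P :: "('a \<times> 'a) set"
  assumes hm[measurable]: "h \<in> borel_measurable M" and km[measurable]: "k \<in> borel_measurable N"
    and F: "integrable M F" and G: "integrable N G" and eq: "char_eq M h F N k G"
    and P: "compact P"
  shows "(LINT t|M. indicator P (torus_map (h t)) * F t) = (LINT t|N. indicator P (torus_map (k t)) * G t)"
proof (cases "P = {}")
  case False
  define q where "q n x = max 0 (1 - real n * infdist x P)" for n x
  have qc: "continuous_on UNIV (q n)" for n
    unfolding q_def by (intro continuous_intros)
  have [measurable]: "q n \<in> borel_measurable borel" for n using qc by (rule borel_measurable_continuous_onI)
  have [measurable]: "P \<in> sets borel" using P by (simp add: compact_imp_closed)
  have ql: "(\<lambda>n. complex_of_real (q n x)) \<longlonglongrightarrow> indicator P x" for x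
  proof -
    have "(\<lambda>n. complex_of_real (q n x)) \<longlonglongrightarrow> of_real (indicator P x)"
      unfolding q_def using P False by (intro tendsto_of_real indicator_limit) (auto simp: compact_imp_closed)
    moreover have "complex_of_real (indicator P x) = indicator P x" by (simp add: indicator_def)
    ultimately show ?thesis by simp
  qed
  have qb: "\<bar>q n x\<bar> \<le> 1" for n x unfolding q_def using infdist_nonneg[of x P] by (auto simp: abs_le_iff max_def)
  have lim: "(\<lambda>n. LINT t|M'. of_real (q n (torus_map (h' t))) * F' t) \<longlonglongrightarrow> (LINT t|M'. indicator P (torus_map (h' t)) * F' t)"
    if [measurable]: "h' \<in> borel_measurable M'" and F': "integrable M' F'" for M' :: "'d measure" and h' and F' :: "'d \<Rightarrow> complex"
  proof (rule integral_dominated_convergence[where w = "\<lambda>t. cmod (F' t)"])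
    show "AE t in M'. (\<lambda>n. of_real (q n (torus_map (h' t))) * F' t) \<longlonglongrightarrow> indicator P (torus_map (h' t)) * F' t"
      by (intro AE_I2 tendsto_mult ql tendsto_const)
    show "AE t in M'. norm (of_real (q n (torus_map (h' t))) * F' t) \<le> cmod (F' t)" for n
      using qb by (intro AE_I2) (simp add: norm_mult mult_left_le_one_le)
    show "integrable M' (\<lambda>t. cmod (F' t))" using F' by simp
  qed (use F' in measurable)
  show ?thesis
    by (rule LIMSEQ_unique[OF lim[OF hm F]])
      (use lim[OF km G] char_eq_continuous[OF hm km F G eq qc] in simp)
qed simp

section \<open>Orbits of the dual action\<close>

definition dual_act :: "(real \<Rightarrow> real^'n^'n) \<Rightarrow> real \<Rightarrow> real^'n \<Rightarrow> real^'n" where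
  "dual_act A t \<xi> = transpose (A t) *v \<xi>"

lemma dual_act_inner: "dual_act A t \<xi> \<bullet> x = \<xi> \<bullet> (A t *v x)"
  by (simp add: dual_act_def dot_lmul_matrix)

locale one_parameter =
  fixes A :: "real \<Rightarrow> real^'n^'n"
  assumes A: "one_parameter_subgroup A"
begin

lemma A_add: "A (s + t) = A s ** A t"
  using A by (simp add: one_parameter_subgroup_def)

lemma A_zero: "A 0 = mat 1"
proof -
  have "A 0 ** A 0 = A 0" using A_add[of 0 0] by simp
  moreover obtain B where "B ** A 0 = mat 1"
    using A unfolding one_parameter_subgroup_def invertible_def by blast
  ultimately show ?thesis by (metis matrix_mul_assoc matrix_mul_lid)
qed

lemma A_vec_add: "A (s + t) *v x = A s *v (A t *v x)"
  by (simp add: A_add matrix_vector_mul_assoc)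

lemma A_vec_zero: "A 0 *v x = x"
  by (simp add: A_zero)

lemma A_cont: "continuous_on S A"
  using A continuous_on_subset unfolding one_parameter_subgroup_def by blast

lemma A_vec_cont:
  assumes "continuous_on S f" "continuous_on S g"
  shows "continuous_on S (\<lambda>t. A (f t) *v g t)"
proof -
  have "continuous_on S (\<lambda>t. A (f t))"
    using continuous_on_compose2[OF A_cont assms(1)] by blast
  then show ?thesis
    unfolding matrix_vector_mult_def using assms(2)
    by (intro continuous_intros)
qed

lemma dual_act_zero: "dual_act A 0 \<xi> = \<xi>"
  by (simp add: dual_act_def A_zero)

text \<open>Transposition reverses the order of products; the parameters commute, so the transposed
  matrices still act.\<close>

lemma dual_act_add: "dual_act A (s + t) \<xi> = dual_act A s (dual_act A t \<xi>)"
proof -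
  have "dual_act A (s + t) \<xi> = transpose (A t ** A s) *v \<xi>"
    by (simp add: dual_act_def A_add[symmetric] add.commute del: transpose_matrix_vector)
  then show ?thesis
    by (simp only: dual_act_def matrix_transpose_mul matrix_vector_mul_assoc)
qed

lemma dual_act_cont:
  assumes "continuous_on S f"
  shows "continuous_on S (\<lambda>t. dual_act A (f t) \<xi>)"
proof -
  have "continuous_on S (\<lambda>t. A (f t))"
    using continuous_on_compose2[OF A_cont assms(1)] by blast
  then show ?thesis
    unfolding dual_act_def matrix_vector_mult_def transpose_def
    by (simp, intro continuous_intros)
qed

lemma dual_act_period_int:
  assumes "dual_act A p \<xi> = \<xi>"
  shows "dual_act A (p * of_int k) \<xi> = \<xi>"
proof (induction k rule: int_induct[where k = 0])
  case base show ?case by (simp add: dual_act_zero)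
next
  case (step1 i)
  then show ?case using assms by (simp add: distrib_left dual_act_add)
next
  case (step2 i)
  have "p * of_int i = p * of_int (i - 1) + p" by (simp add: algebra_simps)
  then show ?case using step2 assms dual_act_add[of "p * of_int (i - 1)" p \<xi>] by simp
qed

text \<open>Needed on the whole line, since one-parameter subgroups are defined for negative times
  as well.\<close>

lemma primitive_exists:
  fixes g :: "real \<Rightarrow> real^'n"
  assumes "continuous_on UNIV g"
  obtains F where "F 0 = 0" "\<And>t. (F has_vector_derivative g t) (at t)" "F 1 = integral {0..1} g"
proof -
  \<comment> \<open>For each \<open>t\<close> at least one of the two integrals is over an empty or
    one-point interval; the difference is the oriented integral from 0 to \<open>t\<close>.\<close>
  define F where "F t = integral {0..t} g - integral {t..0} g" for t
  note gi = integrable_continuous_real[OF continuous_on_subset[OF assms subset_UNIV]]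
  have "(F has_vector_derivative g t) (at t)" for t
  proof -
    \<comment> \<open>A window around \<open>t\<close> and 0 on which \<open>F\<close> is, up to a
      constant, a single integral with fixed lower end \<open>-N\<close>.\<close>
    define N where "N = \<bar>t\<bar> + 1"
    have N0: "- N \<le> 0" by (simp add: N_def)
    have F: "F u = integral {-N..u} g - integral {-N..0} g" if "u \<in> {-N..N}" for u
    proof (cases "0 \<le> u")
      case True
      then have "integral {u..0} g = 0" by (cases "u = 0") auto
      then show ?thesis
        using Henstock_Kurzweil_Integration.integral_combine[where a = "-N" and c = 0 and b = u and f = g] gi True N0
        by (simp add: F_def eq_diff_eq add.commute)
    next
      case False
      then show ?thesis
        using Henstock_Kurzweil_Integration.integral_combine[where a = "-N" and c = u and b = 0 and f = g] gi that
        by (simp add: F_def) (simp add: algebra_simps)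
    qed
    have "((\<lambda>u. integral {-N..u} g - integral {-N..0} g) has_vector_derivative g t - 0) (at t within {-N..N})"
      by (intro has_vector_derivative_diff has_vector_derivative_const integral_has_vector_derivative
          continuous_on_subset[OF assms]) (auto simp: N_def)
    then have "((\<lambda>u. integral {-N..u} g - integral {-N..0} g) has_vector_derivative g t) (at t within {-N..N})"
      by simp
    then have "(F has_vector_derivative g t) (at t within {-N..N})"
      by (rule has_vector_derivative_transform[rotated 2]) (auto simp: F N_def)
    moreover have "at t within {-N..N} = at t"
      by (rule at_within_interior) (auto simp: N_def interior_atLeastAtMost_real abs_if)
    ultimately show ?thesis by (simp only:)
  qed
  then show ?thesis using that[of F] by (simp add: F_def)
qed

section \<open>The exponential map of the semidirect product\<close>

lemma zero_vector_derivative_const: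
  fixes f :: "real \<Rightarrow> 'b::real_normed_vector"
  assumes "\<And>t. (f has_vector_derivative 0) (at t)"
  shows "f s = f t"
  by (rule has_derivative_zero_unique[of UNIV])
    (use assms in \<open>auto simp: has_vector_derivative_def\<close>)

lemma A_vec_derivative:
  assumes "(f has_vector_derivative d) F"
  shows "((\<lambda>t. A s *v f t) has_vector_derivative A s *v d) F"
  by (rule bounded_linear.has_vector_derivative[OF matrix_vector_mul_bounded_linear assms])

text \<open>The one-parameter subgroup with velocity \<open>(x, p)\<close> is
  \<open>t \<mapsto> (\<integral>_0^t A(p u) x du, p t)\<close>. The homomorphism law transports the
  derivative at 0 to every time, which determines the subgroup completely.\<close>

lemma lie_exp_semidirect:
  "lie_exp (semidirect A) (x, p) = (integral {0..1} (\<lambda>u. A (p * u) *v x), p)"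
proof -
  let ?G = "semidirect A"
  let ?P = "\<lambda>\<gamma>. (\<forall>s t. \<gamma> (s + t) = \<gamma> s \<otimes>\<^bsub>?G\<^esub> \<gamma> t) \<and> (\<gamma> has_vector_derivative (x, p)) (at 0)"
  let ?g = "\<lambda>u. A (p * u) *v x"
  have cont: "continuous_on UNIV ?g" by (intro A_vec_cont continuous_intros)
  obtain F where F: "F 0 = 0" "\<And>t. (F has_vector_derivative ?g t) (at t)" "F 1 = integral {0..1} ?g"
    using primitive_exists[OF cont] by blast
  have shiftF: "((\<lambda>t. f (s + t)) has_vector_derivative d (s + t)) (at t)"
    if "\<And>t. (f has_vector_derivative d t) (at t)" for f :: "real \<Rightarrow> 'b::real_normed_vector" and d s t
  proof -
    have "((\<lambda>t. s + t) has_vector_derivative 1) (at t)" by (auto intro!: derivative_eq_intros)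
    from vector_diff_chain_at[OF this that] show ?thesis by (simp add: o_def)
  qed
  \<comment> \<open>Both sides have the same derivative in \<open>t\<close>, since
    \<open>A(p s) A(p t) = A(p (s + t))\<close>, and agree at \<open>t = 0\<close>.\<close>
  have Fadd: "F (s + t) = F s + A (p * s) *v F t" for s t
  proof -
    have "F (s + t) - A (p * s) *v F t = F (s + 0) - A (p * s) *v F 0"
    proof (rule zero_vector_derivative_const[where f = "\<lambda>t. F (s + t) - A (p * s) *v F t"])
      fix t
      have "((\<lambda>t. F (s + t) - A (p * s) *v F t) has_vector_derivative ?g (s + t) - A (p * s) *v ?g t) (at t)"
        by (intro has_vector_derivative_diff A_vec_derivative shiftF F(2))
      then show "((\<lambda>t. F (s + t) - A (p * s) *v F t) has_vector_derivative 0) (at t)"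
        by (simp add: distrib_left A_vec_add)
    qed
    then show ?thesis using F(1) by (simp add: algebra_simps)
  qed
  let ?\<gamma> = "\<lambda>t. (F t, p * t)"
  have P: "?P ?\<gamma>"
  proof (intro conjI allI)
    show "?\<gamma> (s + t) = ?\<gamma> s \<otimes>\<^bsub>?G\<^esub> ?\<gamma> t" for s t
      by (simp add: semidirect_def Fadd distrib_left)
    have "((\<lambda>t. p * t) has_vector_derivative p) (at 0)" by (auto intro!: derivative_eq_intros simp: has_real_derivative_iff_has_vector_derivative[symmetric])
    then show "(?\<gamma> has_vector_derivative (x, p)) (at 0)"
      using has_vector_derivative_Pair[OF F(2)[of 0], of "\<lambda>t. p * t" p] by (simp add: A_vec_zero)
  qed
  have uniq: "\<gamma> = ?\<gamma>" if \<gamma>: "?P \<gamma>" for \<gamma>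
  proof -
    have add: "fst (\<gamma> (s + t)) = fst (\<gamma> s) + A (snd (\<gamma> s)) *v fst (\<gamma> t)" "snd (\<gamma> (s + t)) = snd (\<gamma> s) + snd (\<gamma> t)" for s t
      using \<gamma> by (simp_all add: semidirect_def)
    have z2: "snd (\<gamma> 0) = 0" using add(2)[of 0 0] by simp
    have z1: "fst (\<gamma> 0) = 0" using add(1)[of 0 0] z2 by (simp add: A_vec_zero)
    have d0: "((\<lambda>t. fst (\<gamma> t)) has_vector_derivative x) (at 0)" "((\<lambda>t. snd (\<gamma> t)) has_vector_derivative p) (at 0)"
      using \<gamma> bounded_linear.has_vector_derivative[OF bounded_linear_fst, of \<gamma> "(x,p)" "at 0"]
        bounded_linear.has_vector_derivative[OF bounded_linear_snd, of \<gamma> "(x,p)" "at 0"] by auto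
    \<comment> \<open>Differentiability is given only at 0; translating the argument moves it to
      \<open>s\<close>, where the group law supplies the remaining factor.\<close>
    have tr: "((\<lambda>u. f (u - s)) has_vector_derivative d) (at s)"
      if "(f has_vector_derivative d) (at 0)" for f :: "real \<Rightarrow> 'b::real_normed_vector" and d s
    proof -
      have "((\<lambda>u. u - s) has_vector_derivative 1) (at s)" by (auto intro!: derivative_eq_intros)
      from vector_diff_chain_at[OF this] that show ?thesis by (simp add: o_def)
    qed
    have d2: "((\<lambda>t. snd (\<gamma> t)) has_vector_derivative p) (at s)" for s
    proof -
      have "((\<lambda>u. snd (\<gamma> s) + snd (\<gamma> (u - s))) has_vector_derivative 0 + p) (at s)"
        by (intro has_vector_derivative_add has_vector_derivative_const tr d0)
      moreover have "(\<lambda>t. snd (\<gamma> t)) = (\<lambda>u. snd (\<gamma> s) + snd (\<gamma> (u - s)))"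
      proof
        show "snd (\<gamma> u) = snd (\<gamma> s) + snd (\<gamma> (u - s))" for u using add(2)[of s "u - s"] by simp
      qed
      ultimately show ?thesis by (metis add_0)
    qed
    have s: "snd (\<gamma> t) = p * t" for t
    proof -
      have "snd (\<gamma> t) - p * t = snd (\<gamma> 0) - p * 0"
      proof (rule zero_vector_derivative_const[where f = "\<lambda>t. snd (\<gamma> t) - p * t"])
        fix t
        have "((\<lambda>t. p * t) has_vector_derivative p) (at t)" by (auto intro!: derivative_eq_intros simp: has_real_derivative_iff_has_vector_derivative[symmetric])
        from has_vector_derivative_diff[OF d2[of t] this]
        show "((\<lambda>t. snd (\<gamma> t) - p * t) has_vector_derivative 0) (at t)" by simp
      qed
      then show ?thesis using z2 by simp
    qed
    have d1: "((\<lambda>t. fst (\<gamma> t)) has_vector_derivative ?g s) (at s)" for s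
    proof -
      have "((\<lambda>u. fst (\<gamma> s) + A (p * s) *v fst (\<gamma> (u - s))) has_vector_derivative 0 + A (p * s) *v x) (at s)"
        by (intro has_vector_derivative_add has_vector_derivative_const A_vec_derivative tr d0)
      moreover have "(\<lambda>t. fst (\<gamma> t)) = (\<lambda>u. fst (\<gamma> s) + A (p * s) *v fst (\<gamma> (u - s)))"
      proof
        show "fst (\<gamma> u) = fst (\<gamma> s) + A (p * s) *v fst (\<gamma> (u - s))" for u
          using add(1)[of s "u - s"] by (simp add: s)
      qed
      ultimately show ?thesis by (metis add_0)
    qed
    have "fst (\<gamma> t) - F t = fst (\<gamma> 0) - F 0" for t
    proof (rule zero_vector_derivative_const[where f = "\<lambda>t. fst (\<gamma> t) - F t"])
      show "((\<lambda>t. fst (\<gamma> t) - F t) has_vector_derivative 0) (at t)" for t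
        using has_vector_derivative_diff[OF d1 F(2), of t] by simp
    qed
    then show ?thesis using z1 F(1) s by (auto simp: fun_eq_iff prod_eq_iff)
  qed
  have "(THE \<gamma>. ?P \<gamma>) = ?\<gamma>"
    using P uniq by (rule the_equality)
  then show ?thesis unfolding lie_exp_def using F(3) by simp
qed

text \<open>Surjectivity of the exponential map makes \<open>y = \<integral>\<^sub>0\<^sup>1 A(pu)x du\<close> solvable. If \<open>\<xi>\<close> is \<open>p\<close>-periodic,
  then \<open>u \<mapsto> \<langle>\<xi>, A(pu)x\<rangle>\<close> has period 1, so its integral over a period does not change under the
  time shift by \<open>t/p\<close>, that is \<open>\<langle>A(t)\<^sup>\<top>\<xi> - \<xi>, y\<rangle> = 0\<close> for every \<open>y\<close>.\<close>

lemma periodic_imp_fixed: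
  assumes ex: "exponential_lie_group (semidirect A)" and p: "p \<noteq> 0" and per: "dual_act A p \<xi> = \<xi>"
  shows "dual_act A t \<xi> = \<xi>"
proof -
  have "(dual_act A t \<xi> - \<xi>) \<bullet> y = 0" for y
  proof -
    have "surj (lie_exp (semidirect A))"
      using ex by (auto simp: exponential_lie_group_def diffeomorphism_def bij_def)
    then obtain X where "(y, p) = lie_exp (semidirect A) X" by blast
    then obtain x where x: "y = integral {0..1} (\<lambda>u. A (p * u) *v x)"
      using lie_exp_semidirect by (cases X) auto
    define h where "h u = dual_act A (p * u) \<xi> \<bullet> x" for u
    have hc: "continuous_on S h" for S
      unfolding h_def by (intro continuous_intros dual_act_cont)
    \<comment> \<open>Pairing with \<open>y\<close> merges the two parameters: the pairing of
      \<open>A(\<tau>)^T \<xi>\<close> with \<open>A(p u) x\<close> is \<open>h\<close> at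
      \<open>u + \<tau>/p\<close>, because \<open>\<tau> + p u = p (u + \<tau>/p)\<close>.\<close>
    have sh: "(dual_act A \<tau> \<xi>) \<bullet> y = (LINT u|cube_measure. h (u + \<tau> / p))" for \<tau>
    proof -
      have "(dual_act A \<tau> \<xi>) \<bullet> y = integral {0..1} (\<lambda>u. (dual_act A \<tau> \<xi>) \<bullet> (A (p * u) *v x))"
        unfolding x by (rule integral_linear[OF _ bounded_linear_inner_right, unfolded o_def, symmetric])
          (intro integrable_continuous_real A_vec_cont continuous_intros)
      also have "\<dots> = integral {0..1} (\<lambda>u. h (u + \<tau> / p))"
        using p by (intro integral_cong) (simp add: h_def dual_act_inner dual_act_add[symmetric] distrib_left flip: dual_act_inner)
      also have "\<dots> = (LINT u : {0..1}|lborel. h (u + \<tau> / p))"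
      proof (rule set_borel_integral_eq_integral(2)[symmetric])
        have "continuous_on {0..1} (\<lambda>u. h (u + \<tau> / p))"
          by (rule continuous_on_compose2[OF hc[of UNIV]]) (auto intro!: continuous_intros)
        then show "set_integrable lborel {0..1} (\<lambda>u. h (u + \<tau> / p))"
          unfolding set_integrable_def by (intro borel_integrable_compact) auto
      qed
      also have "\<dots> = (LINT u|cube_measure. h (u + \<tau> / p))"
        by (simp add: cube_measure_def integral_restrict_space set_lebesgue_integral_def)
      finally show ?thesis .
    qed
    have "(LINT u|cube_measure. h (u + t / p)) = (LINT u|cube_measure. h u)"
    proof (rule integral_cube_affine[where f = "\<lambda>u. u"])
      fix k u :: real assume "k \<in> unit_lattice"
      then obtain m where "k = of_int m" by (auto simp: unit_lattice_def elim!: Ints_cases)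
      then have "dual_act A (p * (u + k)) \<xi> = dual_act A (p * u) (dual_act A (p * of_int m) \<xi>)"
        by (simp add: distrib_left dual_act_add)
      then show "h (u + k) = h u" by (simp add: h_def dual_act_period_int[OF per])
    qed (auto intro: borel_measurable_continuous_onI hc simp: linear_id[unfolded id_def])
    then show ?thesis using sh[of t] sh[of 0] by (simp add: inner_diff_left dual_act_zero)
  qed
  then have "dual_act A t \<xi> - \<xi> = 0" by (metis inner_eq_zero_iff)
  then show ?thesis by simp
qed

lemma real_orbit_eq: "real_orbit A \<xi> = range (\<lambda>t. dual_act A t \<xi>)"
  by (simp add: real_orbit_def dual_act_def del: transpose_matrix_vector)

lemma int_orbit_eq: "int_orbit A \<xi> = range (\<lambda>l::int. dual_act A (of_int l) \<xi>)"
  by (simp add: int_orbit_def dual_act_def del: transpose_matrix_vector)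

text \<open>A coincidence gives a period \<open>p\<close>, and then the orbit is the continuous
  image of one period, hence compact.\<close>

lemma noncompact_orbit_inj:
  assumes "\<not> compact (closure (real_orbit A \<xi>))"
  shows "inj (\<lambda>t. dual_act A t \<xi>)"
proof (rule injI, rule ccontr)
  fix s t assume st: "dual_act A s \<xi> = dual_act A t \<xi>" "s \<noteq> t"
  define p where "p = t - s"
  have p: "dual_act A p \<xi> = \<xi>"
  proof -
    have "dual_act A (-s) (dual_act A s \<xi>) = dual_act A (-s) (dual_act A t \<xi>)" using st by simp
    then show ?thesis unfolding dual_act_add[symmetric] by (simp add: dual_act_zero p_def)
  qed
  have "real_orbit A \<xi> = (\<lambda>t. dual_act A (p * t) \<xi>) ` {0..1}"
  proof
    show "real_orbit A \<xi> \<subseteq> (\<lambda>t. dual_act A (p * t) \<xi>) ` {0..1}"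
      unfolding real_orbit_eq
    proof clarify
      fix r :: real
      \<comment> \<open>Fractional and integral part of \<open>r / p\<close>; the integral part acts
        trivially.\<close>
      have "r = p * (r / p - of_int \<lfloor>r / p\<rfloor>) + p * of_int \<lfloor>r / p\<rfloor>"
        using st by (simp add: p_def right_diff_distrib)
      then have "dual_act A r \<xi> = dual_act A (p * (r / p - of_int \<lfloor>r / p\<rfloor>)) (dual_act A (p * of_int \<lfloor>r / p\<rfloor>) \<xi>)"
        by (simp only: dual_act_add[symmetric])
      then have "dual_act A r \<xi> = dual_act A (p * (r / p - of_int \<lfloor>r / p\<rfloor>)) \<xi>"
        by (simp only: dual_act_period_int[OF p])
      moreover have "r / p - of_int \<lfloor>r / p\<rfloor> \<in> {0..1}" by (simp add: less_imp_le) linarith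
      ultimately show "dual_act A r \<xi> \<in> (\<lambda>t. dual_act A (p * t) \<xi>) ` {0..1}" by blast
    qed
  qed (auto simp: real_orbit_eq)
  moreover have "compact ((\<lambda>t. dual_act A (p * t) \<xi>) ` {0..1})"
    by (intro compact_continuous_image dual_act_cont continuous_intros compact_Icc)
  ultimately show False using assms by (simp add: closure_closed compact_imp_closed)
qed

section \<open>Integral points and bounded orbits\<close>

lemma finite_integer_vectors_bounded:
  assumes "bounded S" "S \<subseteq> integer_vectors"
  shows "finite (S :: (real^'n) set)"
proof -
  obtain B where B: "\<And>x. x \<in> S \<Longrightarrow> norm x \<le> B" using assms(1) by (auto simp: bounded_iff)
  let ?V = "{v :: real^'n. \<forall>i. v $ i \<in> real_of_int ` {- \<lceil>B\<rceil>..\<lceil>B\<rceil>}}"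
  have "S \<subseteq> ?V"
  proof clarify
    fix x i assume x: "x \<in> S"
    then have "\<bar>x $ i\<bar> \<le> B" using B component_le_norm_cart order_trans by blast
    moreover obtain m where m: "x $ i = of_int m"
      using assms(2) x by (auto simp: integer_vectors_def elim!: Ints_cases)
    ultimately have "m \<in> {- \<lceil>B\<rceil>..\<lceil>B\<rceil>}" by (simp, linarith)
    then show "x $ i \<in> real_of_int ` {- \<lceil>B\<rceil>..\<lceil>B\<rceil>}" using m by blast
  qed
  moreover have "finite ?V"
  proof (rule finite_imageD)
    show "finite (vec_nth ` ?V)"
    proof (rule finite_subset)
      show "vec_nth ` ?V \<subseteq> PiE UNIV (\<lambda>_. real_of_int ` {- \<lceil>B\<rceil>..\<lceil>B\<rceil>})" by auto
      show "finite (PiE (UNIV :: 'n set) (\<lambda>_. real_of_int ` {- \<lceil>B\<rceil>..\<lceil>B\<rceil>}))" by (intro finite_PiE) auto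
    qed
    show "inj_on vec_nth ?V" by (auto intro!: inj_onI simp: vec_nth_inject)
  qed
  ultimately show ?thesis by (rule finite_subset)
qed

text \<open>An integral point has an integral, hence finite, \<open>\<int>\<close>-orbit if its \<open>\<real>\<close>-orbit is bounded.\<close>

lemma compact_orbit_fixed:
  assumes ex: "exponential_lie_group (semidirect A)"
    and int: "\<And>l::int. dual_act A (of_int l) \<xi> \<in> integer_vectors"
    and c: "compact (closure (real_orbit A \<xi>))"
  shows "dual_act A t \<xi> = \<xi>"
proof -
  let ?f = "\<lambda>l::int. dual_act A (of_int l) \<xi>"
  have "range ?f \<subseteq> closure (real_orbit A \<xi>)"
    using closure_subset[of "real_orbit A \<xi>"] by (auto simp: real_orbit_eq)
  then have "bounded (range ?f)" using c compact_imp_bounded bounded_subset by blast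
  then have "finite (range ?f)" using int by (intro finite_integer_vectors_bounded) auto
  then have "\<not> inj ?f" using finite_imageD infinite_UNIV_int by blast
  then obtain k l where kl: "?f k = ?f l" "k \<noteq> l" by (auto simp: inj_on_def)
  have "dual_act A (of_int (k - l)) \<xi> = \<xi>"
  proof -
    have "dual_act A (- of_int l) (?f k) = dual_act A (- of_int l) (?f l)" using kl by simp
    then show ?thesis unfolding dual_act_add[symmetric] by (simp add: dual_act_zero)
  qed
  then show ?thesis using periodic_imp_fixed[OF ex, of "of_int (k - l)"] kl by simp
qed

end

section \<open>Vanishing criteria\<close>

text \<open>A closed set is the increasing union of its intersections with balls, so integrals over
  closed sets vanish; closed sets form an intersection-stable generator, and a Dynkin induction
  reaches all Borel sets.\<close>

lemma AE_zero_if_compact_integrals_zero: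
  fixes F :: "'a::euclidean_space \<Rightarrow> complex"
  assumes F: "integrable lborel F" and K: "\<And>K. compact K \<Longrightarrow> (LINT x|lborel. indicator K x * F x) = 0"
  shows "AE x in lborel. F x = 0"
proof (rule sigma_finite_measure.density_zero[OF sigma_finite_lborel F])
  have [measurable]: "F \<in> borel_measurable lborel" "\<And>r. cball 0 r \<in> sets (borel :: 'a measure)"
    using F by (auto intro: borel_closed)
  fix A :: "'a set" assume "A \<in> sets lborel"
  then have "A \<in> sigma_sets UNIV (Collect closed)"
    by (metis borel_eq_closed sets_lborel sets_measure_of subset_UNIV Pow_UNIV)
  have FA: "integrable lborel (\<lambda>x. indicator B x * F x)" if [measurable]: "B \<in> sets borel" for B
  proof -
    have "indicator B x *\<^sub>R F x = indicator B x * F x" for x by (auto simp: indicator_def)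
    then show ?thesis using integrable_mult_indicator[of B lborel F] F by simp
  qed
  have cl: "(LINT x|lborel. indicator C x * F x) = 0" if C: "closed C" for C
  proof -
    have [measurable]: "C \<in> sets borel" using C by simp
    have "(\<lambda>n. LINT x|lborel. indicator (C \<inter> cball 0 (real n)) x * F x) \<longlonglongrightarrow> (LINT x|lborel. indicator C x * F x)"
    proof (rule integral_dominated_convergence[where w = "\<lambda>x. cmod (F x)"])
      show "AE x in lborel. (\<lambda>n. indicator (C \<inter> cball 0 (real n)) x * F x) \<longlonglongrightarrow> indicator C x * F x"
      proof (rule AE_I2, rule tendsto_eventually, rule eventually_sequentiallyI)
        fix x :: 'a and n :: nat assume "nat \<lceil>norm x\<rceil> \<le> n"
        then have "norm x \<le> real n" by linarith
        then show "indicator (C \<inter> cball 0 (real n)) x * F x = indicator C x * F x" by (simp add: indicator_def)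
      qed
      show "AE x in lborel. norm (indicator (C \<inter> cball 0 (real n)) x * F x) \<le> cmod (F x)" for n
        by (auto simp: indicator_def)
      show "integrable lborel (\<lambda>x. cmod (F x))" using F by simp
    qed (use F in measurable)
    moreover have "(LINT x|lborel. indicator (C \<inter> cball 0 (real n)) x * F x) = 0" for n
      using C by (intro K closed_Int_compact) auto
    ultimately show ?thesis by (simp add: LIMSEQ_const_iff)
  qed
  have Int_closed: "Int_stable (Collect closed :: 'a set set)" and subset_Pow: "Collect closed \<subseteq> Pow (UNIV :: 'a set)"
    by (auto simp: Int_stable_def)
  have "(LINT x|lborel. indicator A x * F x) = 0"
    using Int_closed subset_Pow \<open>A \<in> sigma_sets UNIV (Collect closed)\<close>
  proof (induction A rule: sigma_sets_induct_disjoint)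
    case (compl A)
    then have [measurable]: "A \<in> sets borel" by (simp add: borel_eq_closed)
    have "(LINT x|lborel. indicator (UNIV - A) x * F x) = (LINT x|lborel. indicator UNIV x * F x - indicator A x * F x)"
      by (intro Bochner_Integration.integral_cong) (auto simp: indicator_def)
    also have "\<dots> = (LINT x|lborel. indicator UNIV x * F x) - (LINT x|lborel. indicator A x * F x)"
      by (intro Bochner_Integration.integral_diff FA) auto
    finally show ?case using cl[of UNIV] compl by simp
  next
    case (union B)
    then have B[measurable]: "B i \<in> sets borel" for i by (auto simp: borel_eq_closed)
    have "(\<lambda>n. LINT x|lborel. (\<Sum>i<n. indicator (B i) x * F x)) \<longlonglongrightarrow> (LINT x|lborel. indicator (\<Union>i. B i) x * F x)"
    proof (rule integral_dominated_convergence[where w = "\<lambda>x. cmod (F x)"])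
      have e: "(\<Sum>i<n. indicator (B i) x * F x) = indicator (\<Union>i<n. B i) x * F x" for n x
        using union(1) by (simp add: indicator_UN_disjoint disjoint_family_on_def sum_distrib_right)
      show "AE x in lborel. (\<lambda>n. \<Sum>i<n. indicator (B i) x * F x) \<longlonglongrightarrow> indicator (\<Union>i. B i) x * F x"
      proof (rule AE_I2)
        fix x
        show "(\<lambda>n. \<Sum>i<n. indicator (B i) x * F x) \<longlonglongrightarrow> indicator (\<Union>i. B i) x * F x"
        proof (cases "x \<in> (\<Union>i. B i)")
          case True
          then obtain m where m: "x \<in> B m" by blast
          have "indicator (\<Union>i<n. B i) x * F x = indicator (\<Union>i. B i) x * F x" if "Suc m \<le> n" for n
          proof -
            have "x \<in> (\<Union>i<n. B i)" using m that by (auto intro: bexI[of _ m])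
            then show ?thesis using True by simp
          qed
          then show ?thesis unfolding e by (intro tendsto_eventually eventually_sequentiallyI) blast
        next
          case False
          then have "indicator (\<Union>i<n. B i) x * F x = indicator (\<Union>i. B i) x * F x" for n by (auto simp: indicator_def)
          then show ?thesis unfolding e by (simp only: tendsto_const)
        qed
      qed
      show "AE x in lborel. norm (\<Sum>i<n. indicator (B i) x * F x) \<le> cmod (F x)" for n
        unfolding e by (auto simp: indicator_def)
      show "integrable lborel (\<lambda>x. cmod (F x))" using F by simp
    qed (use F in measurable)
    moreover have "(LINT x|lborel. (\<Sum>i<n. indicator (B i) x * F x)) = 0" for n
      using union(3) by (subst Bochner_Integration.integral_sum) (auto intro: FA)
    ultimately show ?case by (simp add: LIMSEQ_const_iff)
  qed (use cl in auto)
  moreover have "set_lebesgue_integral lborel A F = (LINT x|lborel. indicator A x * F x)"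
    unfolding set_lebesgue_integral_def by (intro Bochner_Integration.integral_cong) (auto simp: indicator_def)
  ultimately show "set_lebesgue_integral lborel A F = 0" by simp
qed

lemma integrable_cube_iff:
  fixes F :: "'a::euclidean_space \<Rightarrow> complex"
  shows "integrable cube_measure F \<longleftrightarrow> integrable lborel (\<lambda>x. indicator (cbox 0 One) x * F x)"
    and integral_cube_eq: "(LINT x|cube_measure. F x) = (LINT x|lborel. indicator (cbox 0 One) x * F x)"
proof -
  have e: "indicator (cbox 0 One) x *\<^sub>R F x = indicator (cbox 0 One) x * F x" for x
    by (auto simp: indicator_def)
  show "integrable cube_measure F \<longleftrightarrow> integrable lborel (\<lambda>x. indicator (cbox 0 One) x * F x)"
    by (simp add: cube_measure_def integrable_restrict_space e)
  show "(LINT x|cube_measure. F x) = (LINT x|lborel. indicator (cbox 0 One) x * F x)"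
    by (simp add: cube_measure_def integral_restrict_space e)
qed

lemma AE_cube_iff: "(AE x in cube_measure. P x) \<longleftrightarrow> (AE x in lborel. x \<in> cbox 0 One \<longrightarrow> P x)"
  unfolding cube_measure_def by (rule AE_restrict_space_iff) simp

text \<open>Opposite faces of the closed cube are glued by \<open>torus_map\<close>; with one point
  interior, the coordinate differences are integers below 1 in absolute value.\<close>

lemma torus_map_box:
  assumes x: "x \<in> box 0 One" and y: "y \<in> cbox 0 One" and eq: "torus_map x = torus_map y"
  shows "x = y"
proof (rule euclidean_eqI)
  fix b :: 'a assume b: "b \<in> Basis"
  have "x - y \<in> unit_lattice" using eq by (simp add: torus_map_eq_iff)
  then have "x \<bullet> b - y \<bullet> b \<in> \<int>" using b by (auto simp: unit_lattice_def inner_diff_left)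
  then obtain m where m: "x \<bullet> b - y \<bullet> b = of_int m" by (elim Ints_cases)
  moreover have "0 < x \<bullet> b" "x \<bullet> b < 1" "0 \<le> y \<bullet> b" "y \<bullet> b \<le> 1" using x y b by (auto simp: mem_box)
  ultimately have "\<bar>of_int m :: real\<bar> < 1" by linarith
  then have "m = 0" by linarith
  then show "x \<bullet> b = y \<bullet> b" using m by simp
qed

text \<open>\<open>F\<close> is compared with the zero density. A compact \<open>K\<close> is tested
  through the torus image of \<open>K \<inter> cbox 0 One\<close>, whose preimage in the cube agrees
  with \<open>K\<close> up to the boundary, a null set.\<close>

theorem fourier_unique_cube:
  fixes F :: "'a::euclidean_space \<Rightarrow> complex"
  assumes F: "integrable cube_measure F"
    and z: "\<And>l. l \<in> unit_lattice \<Longrightarrow> (LINT x|cube_measure. cis (2 * pi * (l \<bullet> x)) * F x) = 0"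
  shows "AE x in cube_measure. F x = 0"
proof -
  have "char_eq cube_measure (\<lambda>x. x) F (cube_measure :: 'a measure) (\<lambda>x. x) (\<lambda>_. 0)"
    using z by (simp add: char_eq_def)
  moreover have id: "(\<lambda>x. x) \<in> borel_measurable (cube_measure :: 'a measure)" by (rule measurable_cube_measure) simp
  ultimately have P: "(LINT x|cube_measure. indicator P (torus_map x) * F x) = 0" if "compact P" for P
    using char_eq_compact[OF id id F, of "\<lambda>_. 0" P] that by simp
  have "AE x in lborel. indicator (cbox 0 One) x * F x = 0"
  proof (rule AE_zero_if_compact_integrals_zero)
    show i: "integrable lborel (\<lambda>x. indicator (cbox 0 One) x * F x)" using F by (simp add: integrable_cube_iff)
    fix K :: "'a set" assume K: "compact K"
    let ?P = "torus_map ` (K \<inter> cbox 0 One)"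
    have cP: "compact ?P" by (intro compact_continuous_image torus_map_continuous compact_Int K compact_cbox)
    have [measurable]: "K \<in> sets borel" "?P \<in> sets borel" using K cP by (simp_all add: compact_imp_closed)
    have [measurable]: "(\<lambda>x. indicator (cbox 0 One) x * F x) \<in> borel_measurable lborel" using i by simp
    have "(LINT x|lborel. indicator K x * (indicator (cbox 0 One) x * F x))
      = (LINT x|lborel. indicator ?P (torus_map x) * (indicator (cbox 0 One) x * F x))"
    proof (rule integral_cong_AE)
      show "AE x in lborel. indicator K x * (indicator (cbox 0 One) x * F x) = indicator ?P (torus_map x) * (indicator (cbox 0 One) x * F x)"
        using AE_box_cube
      proof eventually_elim
        case (elim x)
        show ?case
        proof (cases "x \<in> cbox 0 One")
          case True
          then have "torus_map x \<in> ?P \<longleftrightarrow> x \<in> K" using torus_map_box elim by blast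
          then show ?thesis by (simp add: indicator_def)
        qed simp
      qed
    qed measurable
    also have "\<dots> = (LINT x|lborel. indicator (cbox 0 One) x * (indicator ?P (torus_map x) * F x))"
      by (simp add: mult.left_commute)
    also have "\<dots> = 0" using P[OF cP] by (simp add: integral_cube_eq)
    finally show "(LINT x|lborel. indicator K x * (indicator (cbox 0 One) x * F x)) = 0" .
  qed
  then show ?thesis unfolding AE_cube_iff by eventually_elim (auto simp: indicator_def)
qed

text \<open>The torus is blown up by the factor \<open>2n\<close>; in the limit the lattice translates of a compact
  set disappear to infinity.\<close>

theorem fourier_unique_curves:
  fixes c d :: "real \<Rightarrow> 'a::euclidean_space"
  assumes c: "continuous_on UNIV c" and d: "continuous_on UNIV d"
    and F: "integrable lborel F" and G: "integrable lborel G"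
    and eq: "\<And>x. (LINT t|lborel. cis (pi * (c t \<bullet> x)) * F t) = (LINT t|lborel. cis (pi * (d t \<bullet> x)) * G t)"
    and K: "compact K"
  shows "(LINT t|lborel. indicator K (c t) * F t) = (LINT t|lborel. indicator K (d t) * G t)"
proof -
  have [measurable]: "c \<in> borel_measurable borel" "d \<in> borel_measurable borel" "K \<in> sets borel"
    using c d K by (auto intro: borel_measurable_continuous_onI borel_closed compact_imp_closed)
  \<comment> \<open>The scale \<open>1 / (2 (n + 1))\<close> turns the torus character of
    \<open>l\<close> into \<open>cis (pi * (v \<bullet> x))\<close> with
    \<open>x = l / (n + 1)\<close>, an instance of \<open>eq\<close>.\<close>
  define P where "P n = (torus_map ` (\<lambda>x. (1 / (2 * real (Suc n))) *\<^sub>R x) ` K :: ('a \<times> 'a) set)" for n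
  have P: "compact (P n)" for n
    unfolding P_def by (intro compact_continuous_image torus_map_continuous continuous_intros K)
  have [measurable]: "P n \<in> sets borel" for n using P by (simp add: compact_imp_closed)
  have "(LINT t|lborel. indicator (P n) (torus_map ((1 / (2 * real (Suc n))) *\<^sub>R c t)) * F t)
    = (LINT t|lborel. indicator (P n) (torus_map ((1 / (2 * real (Suc n))) *\<^sub>R d t)) * G t)" for n
  proof (rule char_eq_compact[OF _ _ F G _ P])
    show "char_eq lborel (\<lambda>t. (1 / (2 * real (Suc n))) *\<^sub>R c t) F lborel (\<lambda>t. (1 / (2 * real (Suc n))) *\<^sub>R d t) G"
      unfolding char_eq_def
    proof
      fix l :: 'a
      have "2 * pi * (l \<bullet> (1 / (2 * real (Suc n))) *\<^sub>R v) = pi * (v \<bullet> ((1 / real (Suc n)) *\<^sub>R l))" for v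
        by (simp add: inner_commute field_simps)
      then show "(LINT t|lborel. cis (2 * pi * (l \<bullet> (1 / (2 * real (Suc n))) *\<^sub>R c t)) * F t)
        = (LINT t|lborel. cis (2 * pi * (l \<bullet> (1 / (2 * real (Suc n))) *\<^sub>R d t)) * G t)"
        using eq[of "(1 / real (Suc n)) *\<^sub>R l"] by simp
    qed
  qed measurable
  moreover have lim: "(\<lambda>n. LINT t|lborel. indicator (P n) (torus_map ((1 / (2 * real (Suc n))) *\<^sub>R e t)) * E t)
      \<longlonglongrightarrow> (LINT t|lborel. indicator K (e t) * E t)"
    if [measurable]: "e \<in> borel_measurable borel" and E: "integrable lborel E" for e :: "real \<Rightarrow> 'a" and E :: "real \<Rightarrow> complex"
  proof (rule integral_dominated_convergence[where w = "\<lambda>t. cmod (E t)"])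
    show "AE t in lborel. (\<lambda>n. indicator (P n) (torus_map ((1 / (2 * real (Suc n))) *\<^sub>R e t)) * E t) \<longlonglongrightarrow> indicator K (e t) * E t"
    proof (rule AE_I2, rule tendsto_eventually)
      fix t
      obtain B where B: "\<And>x. x \<in> K \<Longrightarrow> norm x \<le> B" using compact_imp_bounded[OF K] by (auto simp: bounded_iff)
      show "\<forall>\<^sub>F n in sequentially. indicator (P n) (torus_map ((1 / (2 * real (Suc n))) *\<^sub>R e t)) * E t = indicator K (e t) * E t"
      proof (rule eventually_sequentiallyI)
        \<comment> \<open>From here on the scaled difference of \<open>e t\<close> and a point of
          \<open>K\<close> has all coordinates below 1 in absolute value, so equality on the torus
          means equality.\<close>
        fix n assume "nat \<lceil>norm (e t) + B\<rceil> \<le> n"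
        then have "norm (e t) + B \<le> real n" by linarith
        then have n: "norm (e t) + B < 2 * real (Suc n)" by simp
        have "e t = x" if x: "x \<in> K" and tx: "torus_map ((1 / (2 * real (Suc n))) *\<^sub>R e t) = torus_map ((1 / (2 * real (Suc n))) *\<^sub>R x)" for x
        proof (rule euclidean_eqI)
          fix b :: 'a assume b: "b \<in> Basis"
          have "(1 / (2 * real (Suc n))) * ((e t - x) \<bullet> b) \<in> \<int>"
            using tx b unfolding torus_map_eq_iff unit_lattice_def by (simp add: inner_diff_left right_diff_distrib)
          then obtain m where m: "(1 / (2 * real (Suc n))) * ((e t - x) \<bullet> b) = of_int m" by (elim Ints_cases)
          have "\<bar>(e t - x) \<bullet> b\<bar> \<le> norm (e t - x)" using b by (rule Basis_le_norm)
          also have "\<dots> \<le> norm (e t) + B" using norm_triangle_ineq4[of "e t" x] B[OF x] by linarith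
          finally have "\<bar>(e t - x) \<bullet> b\<bar> < 2 * real (Suc n)" using n by linarith
          then have "\<bar>(1 / (2 * real (Suc n))) * ((e t - x) \<bullet> b)\<bar> < 1" by (simp add: abs_mult divide_less_eq)
          then have "m = 0" unfolding m by linarith
          then show "e t \<bullet> b = x \<bullet> b" using m by (simp add: inner_diff_left)
        qed
        then have "torus_map ((1 / (2 * real (Suc n))) *\<^sub>R e t) \<in> P n \<longleftrightarrow> e t \<in> K" unfolding P_def by blast
        then show "indicator (P n) (torus_map ((1 / (2 * real (Suc n))) *\<^sub>R e t)) * E t = indicator K (e t) * E t"
          by (simp add: indicator_def)
      qed
    qed
    show "AE t in lborel. norm (indicator (P n) (torus_map ((1 / (2 * real (Suc n))) *\<^sub>R e t)) * E t) \<le> cmod (E t)" for n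
      by (auto simp: indicator_def)
    show "integrable lborel (\<lambda>t. cmod (E t))" using E by simp
  qed (use E in measurable)
  ultimately show ?thesis
    using lim[of c F] lim[of d G] F G by (auto intro: LIMSEQ_unique)
qed

section \<open>Test functions on the line\<close>

text \<open>Continuity together with bounded support makes Poincare series finite sums near every
  point; the class is closed under the translations and modulations by which the group acts.\<close>

definition test_functions :: "(real \<Rightarrow> complex) set" where
  "test_functions = {\<psi>. continuous_on UNIV \<psi> \<and> (\<exists>B. \<forall>t. \<psi> t \<noteq> 0 \<longrightarrow> \<bar>t\<bar> \<le> B)}"

lemma test_function_measurable: "\<psi> \<in> test_functions \<Longrightarrow> \<psi> \<in> borel_measurable borel"
  by (auto simp: test_functions_def intro: borel_measurable_continuous_onI)

lemma test_function_bounded: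
  assumes "\<psi> \<in> test_functions"
  obtains B where "B \<ge> 0" "\<And>t. cmod (\<psi> t) \<le> B" "\<And>t. \<psi> t \<noteq> 0 \<Longrightarrow> \<bar>t\<bar> \<le> B"
proof -
  obtain B where B: "\<And>t. \<psi> t \<noteq> 0 \<Longrightarrow> \<bar>t\<bar> \<le> B" using assms by (auto simp: test_functions_def)
  have "compact (\<psi> ` {-B..B})"
    using assms by (intro compact_continuous_image) (auto simp: test_functions_def intro: continuous_on_subset)
  then obtain C where C: "\<And>t. t \<in> {-B..B} \<Longrightarrow> cmod (\<psi> t) \<le> C" by (metis compact_imp_bounded bounded_iff imageI)
  have "cmod (\<psi> t) \<le> max 0 C" for t
    using C[of t] B[of t] by (cases "\<psi> t = 0") (auto simp: abs_le_iff)
  then show ?thesis using that[of "max (max 0 C) B"] B by (force simp: le_max_iff_disj)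
qed

text \<open>Tent functions around a compact set are test functions, so \<open>F\<close> integrates
  to zero over every compact set. Fourier coefficients are integrable only over bounded intervals,
  hence the truncations and the countable union over \<open>N\<close>.\<close>

lemma test_functions_total:
  assumes F: "\<And>N::nat. integrable lborel (\<lambda>t. indicator {- real N..real N} t * F t)"
    and z: "\<And>\<psi>. \<psi> \<in> test_functions \<Longrightarrow> (LINT t|lborel. \<psi> t * F t) = 0"
  shows "AE t in lborel. F t = (0::complex)"
proof -
  have K0: "(LINT t|lborel. indicator K t * F t) = 0" if K: "compact K" for K
  proof (cases "K = {}")
    case False
    obtain B where B: "\<And>x. x \<in> K \<Longrightarrow> \<bar>x\<bar> \<le> B" using compact_imp_bounded[OF K] by (auto simp: bounded_iff)
    \<comment> \<open>Tents of slope at least 1 live within distance 1 of \<open>K\<close>;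
      \<open>Suc n\<close> in \<open>q\<close> ensures this slope also for
      \<open>n = 0\<close>.\<close>
    obtain N :: nat where N: "B + 1 \<le> real N" using real_arch_simple by blast
    define q where "q n x = complex_of_real (max 0 (1 - real (Suc n) * infdist x K))" for n x
    have sup: "\<bar>x\<bar> \<le> real N" if "q n x \<noteq> 0" for n x
    proof -
      have "real (Suc n) * infdist x K < 1" using that by (auto simp: q_def max_def split: if_splits)
      moreover have "infdist x K \<le> real (Suc n) * infdist x K" using infdist_nonneg[of x K] by (simp add: distrib_right)
      moreover obtain y where y: "y \<in> K" "infdist x K = dist x y" using infdist_attains_inf[of K x] K False compact_imp_closed by blast
      ultimately have "dist x y < 1" by linarith
      then show ?thesis using B[OF y(1)] N by (simp add: dist_real_def)
    qed
    have qt: "q n \<in> test_functions" for n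
      unfolding test_functions_def using sup[of n] by (auto simp: q_def[abs_def] intro!: continuous_intros exI[of _ "real N"])
    then have [measurable]: "q n \<in> borel_measurable borel" for n by (rule test_function_measurable)
    have q1: "cmod (q n x) \<le> 1" for n x using infdist_nonneg[of x K] by (auto simp: q_def max_def)
    let ?F = "\<lambda>t. indicator {- real N..real N} t * F t"
    have [measurable]: "?F \<in> borel_measurable lborel" using F[of N] by (rule borel_measurable_integrable)
    have [measurable]: "K \<in> sets borel" using K by (simp add: compact_imp_closed)
    have "(\<lambda>n. LINT t|lborel. q n t * ?F t) \<longlonglongrightarrow> (LINT t|lborel. indicator K t * ?F t)"
    proof (rule integral_dominated_convergence[where w = "\<lambda>t. cmod (?F t)"])
      show "AE t in lborel. (\<lambda>n. q n t * ?F t) \<longlonglongrightarrow> indicator K t * ?F t"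
      proof (intro AE_I2 tendsto_mult tendsto_const)
        fix x
        have "(\<lambda>n. max 0 (1 - real (Suc n) * infdist x K)) \<longlonglongrightarrow> indicator K x"
          using indicator_limit[OF compact_imp_closed[OF K] False, of x] by (rule LIMSEQ_Suc)
        then have "(\<lambda>n. q n x) \<longlonglongrightarrow> of_real (indicator K x)" unfolding q_def by (rule tendsto_of_real)
        moreover have "complex_of_real (indicator K x) = indicator K x" by (simp add: indicator_def)
        ultimately show "(\<lambda>n. q n x) \<longlonglongrightarrow> indicator K x" by simp
      qed
      show "AE t in lborel. norm (q n t * ?F t) \<le> cmod (?F t)" for n
        using q1 by (intro AE_I2) (simp add: norm_mult mult_left_le_one_le)
      show "integrable lborel (\<lambda>t. cmod (?F t))" using F[of N] by (rule integrable_norm)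
    qed measurable
    moreover have "(LINT t|lborel. q n t * ?F t) = 0" for n
    proof -
      have "q n t * ?F t = q n t * F t" for t
        using sup[of n t] by (cases "q n t = 0") (auto simp: indicator_def)
      then have "(LINT t|lborel. q n t * ?F t) = (LINT t|lborel. q n t * F t)" by (simp only:)
      then show ?thesis using z[OF qt] by simp
    qed
    ultimately have "(LINT t|lborel. indicator K t * ?F t) = 0" by (simp add: LIMSEQ_const_iff)
    moreover have "(LINT t|lborel. indicator K t * ?F t) = (LINT t|lborel. indicator K t * F t)"
      by (intro Bochner_Integration.integral_cong refl) (use B N in \<open>force simp: indicator_def abs_le_iff\<close>)
    ultimately show ?thesis by simp
  qed simp
  have "AE t in lborel. indicator {- real N..real N} t * F t = 0" for N :: nat
  proof (rule AE_zero_if_compact_integrals_zero[OF F])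
    fix K :: "real set" assume "compact K"
    then have "(LINT t|lborel. indicator (K \<inter> {- real N..real N}) t * F t) = 0" by (intro K0 compact_Int_closed) auto
    then show "(LINT t|lborel. indicator K t * (indicator {- real N..real N} t * F t)) = 0"
      by (simp add: indicator_inter_arith mult.assoc)
  qed
  then have "AE t in lborel. \<forall>N::nat. indicator {- real N..real N} t * F t = 0" unfolding AE_all_countable by blast
  then show ?thesis
  proof eventually_elim
    case (elim t)
    obtain N :: nat where "\<bar>t\<bar> \<le> real N" using real_arch_simple by blast
    then show ?case using elim[rule_format, of N] by (auto simp: indicator_def abs_le_iff split: if_splits)
  qed
qed

section \<open>Hilbert spaces\<close>

context hilbert_space
begin

lemma minus_closed: "\<lbrakk>u \<in> hcarrier H; v \<in> hcarrier H\<rbrakk> \<Longrightarrow> hminus H u v \<in> hcarrier H"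
  by (simp add: hminus_def plus_closed scale_closed)

lemmas closed = zero_closed plus_closed scale_closed minus_closed

lemma inner_zero_left: "v \<in> hcarrier H \<Longrightarrow> hinner H (hzero H) v = 0"
  using inner_plus[of "hzero H" "hzero H" v] plus_zero[of "hzero H"] zero_closed by simp

lemma inner_zero_right: "v \<in> hcarrier H \<Longrightarrow> hinner H v (hzero H) = 0"
  using inner_commute[of "hzero H" v] inner_zero_left zero_closed by simp

lemma inner_plus_right:
  "\<lbrakk>u \<in> hcarrier H; v \<in> hcarrier H; w \<in> hcarrier H\<rbrakk>
    \<Longrightarrow> hinner H w (hplus H u v) = hinner H w u + hinner H w v"
  using inner_commute[of "hplus H u v" w] inner_commute[of u w] inner_commute[of v w]
    inner_plus[of u v w] by (simp add: closed)

lemma inner_scale_right: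
  "\<lbrakk>u \<in> hcarrier H; w \<in> hcarrier H\<rbrakk> \<Longrightarrow> hinner H w (hscale H c u) = cnj c * hinner H w u"
  using inner_commute[of "hscale H c u" w] inner_commute[of u w]
    inner_scale[of u w c] by (simp add: closed)

lemma inner_minus:
  "\<lbrakk>u \<in> hcarrier H; v \<in> hcarrier H; w \<in> hcarrier H\<rbrakk>
    \<Longrightarrow> hinner H (hminus H u v) w = hinner H u w - hinner H v w"
  by (simp add: hminus_def inner_plus inner_scale closed)

lemma inner_minus_right:
  "\<lbrakk>u \<in> hcarrier H; v \<in> hcarrier H; w \<in> hcarrier H\<rbrakk>
    \<Longrightarrow> hinner H w (hminus H u v) = hinner H w u - hinner H w v"
  by (simp add: hminus_def inner_plus_right inner_scale_right closed)

lemmas inner_simps = inner_zero_left inner_zero_right inner_plus inner_plus_right inner_scale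
  inner_scale_right inner_minus inner_minus_right

lemma inner_self: "u \<in> hcarrier H \<Longrightarrow> hinner H u u = of_real ((hnorm H u)\<^sup>2)"
  using inner_nonneg[of u] inner_commute[of u u]
  by (auto simp: hnorm_def complex_eq_iff)

lemma norm_sq: "u \<in> hcarrier H \<Longrightarrow> (hnorm H u)\<^sup>2 = Re (hinner H u u)"
  by (simp add: inner_self)

lemma norm_nonneg: "u \<in> hcarrier H \<Longrightarrow> 0 \<le> hnorm H u"
  by (simp add: hnorm_def inner_nonneg)

lemma norm_eq_zero: "u \<in> hcarrier H \<Longrightarrow> hnorm H u = 0 \<longleftrightarrow> u = hzero H"
  using inner_self[of u] inner_definite[of u] inner_zero_left[of "hzero H"]
  by (auto simp: hnorm_def zero_closed)

lemma eq_if_minus_zero: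
  assumes "u \<in> hcarrier H" "v \<in> hcarrier H" "hminus H u v = hzero H"
  shows "u = v"
proof -
  let ?n = "hscale H (-1) v"
  have "hplus H ?n v = hzero H"
    using minus_self[OF assms(2)] plus_commute[of v ?n] assms by (simp add: hminus_def closed)
  then have "u = hplus H u (hplus H ?n v)" using assms plus_zero by simp
  also have "\<dots> = hplus H (hminus H u v) v"
    using assms(1,2) by (simp add: hminus_def plus_assoc closed)
  also have "\<dots> = v" using assms plus_commute[of "hzero H" v] plus_zero by (simp add: closed)
  finally show ?thesis .
qed

text \<open>Turns identities between vectors into identities between complex numbers, which spares
  rearrangements with the vector space axioms.\<close>

lemma eqI_inner:
  assumes "u \<in> hcarrier H" "v \<in> hcarrier H" "\<And>w. w \<in> hcarrier H \<Longrightarrow> hinner H u w = hinner H v w"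
  shows "u = v"
proof (rule eq_if_minus_zero)
  show "hminus H u v = hzero H"
    using assms by (intro inner_definite) (simp_all add: closed inner_simps)
qed (use assms in auto)

lemma cauchy_schwarz:
  assumes u: "u \<in> hcarrier H" and v: "v \<in> hcarrier H"
  shows "cmod (hinner H u v) \<le> hnorm H u * hnorm H v"
proof (cases "v = hzero H")
  case True
  then show ?thesis using u v by (simp add: inner_simps norm_nonneg)
next
  case False
  define n where "n = (hnorm H v)\<^sup>2"
  have n: "n > 0" using False v norm_eq_zero norm_nonneg unfolding n_def
    by (metis zero_less_power2)
  \<comment> \<open>The coefficient of the orthogonal projection of \<open>u\<close> onto
    \<open>v\<close>, which minimizes the norm of \<open>u - c v\<close>.\<close>
  define c where "c = hinner H u v / of_real n"
  have "0 \<le> Re (hinner H (hminus H u (hscale H c v)) (hminus H u (hscale H c v)))"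
    using u v by (simp add: inner_nonneg closed)
  also have "hinner H (hminus H u (hscale H c v)) (hminus H u (hscale H c v))
      = hinner H u u - cnj c * hinner H u v - c * (hinner H v u - cnj c * hinner H v v)"
    using u v by (simp add: inner_simps closed algebra_simps)
  also have "\<dots> = of_real ((hnorm H u)\<^sup>2 - (cmod (hinner H u v))\<^sup>2 / n)"
    using n by (simp add: inner_self u v inner_commute[OF u v] c_def flip: n_def)
      (simp add: field_simps complex_norm_square flip: of_real_power)
  finally have "(cmod (hinner H u v))\<^sup>2 \<le> (hnorm H u * hnorm H v)\<^sup>2"
    using n by (simp add: field_simps n_def power_mult_distrib)
  then show ?thesis
    by (rule power2_le_imp_le) (simp add: norm_nonneg u v)
qed

lemma norm_plus_sq:
  assumes "u \<in> hcarrier H" "v \<in> hcarrier H"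
  shows "(hnorm H (hplus H u v))\<^sup>2 = (hnorm H u)\<^sup>2 + 2 * Re (hinner H u v) + (hnorm H v)\<^sup>2"
  using assms inner_commute[OF assms] by (simp add: norm_sq inner_simps closed)

lemma norm_minus_sq:
  assumes "u \<in> hcarrier H" "v \<in> hcarrier H"
  shows "(hnorm H (hminus H u v))\<^sup>2 = (hnorm H u)\<^sup>2 - 2 * Re (hinner H u v) + (hnorm H v)\<^sup>2"
  using assms inner_commute[OF assms] by (simp add: norm_sq inner_simps closed)

lemma norm_triangle:
  assumes "u \<in> hcarrier H" "v \<in> hcarrier H"
  shows "hnorm H (hplus H u v) \<le> hnorm H u + hnorm H v"
proof (rule power2_le_imp_le)
  have "Re (hinner H u v) \<le> hnorm H u * hnorm H v"
    using cauchy_schwarz[OF assms] complex_Re_le_cmod order_trans by blast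
  then show "(hnorm H (hplus H u v))\<^sup>2 \<le> (hnorm H u + hnorm H v)\<^sup>2"
    by (simp add: norm_plus_sq assms power2_sum)
qed (simp add: norm_nonneg assms)

lemma norm_scale:
  assumes "u \<in> hcarrier H"
  shows "hnorm H (hscale H c u) = cmod c * hnorm H u"
proof (rule power2_eq_imp_eq)
  have "of_real ((hnorm H (hscale H c u))\<^sup>2) = hinner H (hscale H c u) (hscale H c u)"
    using assms by (simp only: inner_self closed)
  also have "\<dots> = c * cnj c * hinner H u u"
    using assms by (simp add: inner_simps closed)
  also have "\<dots> = of_real ((cmod c * hnorm H u)\<^sup>2)"
    using assms by (simp only: inner_self complex_norm_square[symmetric] of_real_mult[symmetric] power_mult_distrib)
  finally show "(hnorm H (hscale H c u))\<^sup>2 = (cmod c * hnorm H u)\<^sup>2"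
    using of_real_eq_iff by blast
qed (simp_all add: assms norm_nonneg closed)

lemma minus_triangle:
  assumes "u \<in> hcarrier H" "v \<in> hcarrier H" "w \<in> hcarrier H"
  shows "hnorm H (hminus H u w) \<le> hnorm H (hminus H u v) + hnorm H (hminus H v w)"
proof -
  have "hminus H u w = hplus H (hminus H u v) (hminus H v w)"
    by (rule eqI_inner) (simp_all add: assms closed inner_simps)
  then show ?thesis using norm_triangle assms by (simp add: closed)
qed

lemma norm_minus_commute:
  assumes "u \<in> hcarrier H" "v \<in> hcarrier H"
  shows "hnorm H (hminus H u v) = hnorm H (hminus H v u)"
  using inner_commute[OF assms]
  by (intro power2_eq_imp_eq[OF _ norm_nonneg norm_nonneg]) (simp_all add: norm_minus_sq assms closed)

lemma minus_zero: "u \<in> hcarrier H \<Longrightarrow> hminus H u (hzero H) = u"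
  by (rule eqI_inner) (simp_all add: closed inner_simps)

lemma norm_diff_le:
  assumes "u \<in> hcarrier H" "v \<in> hcarrier H"
  shows "\<bar>hnorm H u - hnorm H v\<bar> \<le> hnorm H (hminus H u v)"
  using minus_triangle[of u v "hzero H"] minus_triangle[of v u "hzero H"] norm_minus_commute[of u v] assms
  by (simp add: closed minus_zero abs_le_iff)

lemma converges_const: "u \<in> hcarrier H \<Longrightarrow> hconverges H (\<lambda>_. u) u"
  by (simp add: hconverges_def minus_self hnorm_def inner_zero_left zero_closed)

lemma converges_plus:
  assumes "hconverges H s l" "hconverges H t m" "\<And>k. s k \<in> hcarrier H" "\<And>k. t k \<in> hcarrier H"
    "l \<in> hcarrier H" "m \<in> hcarrier H"
  shows "hconverges H (\<lambda>k. hplus H (s k) (t k)) (hplus H l m)"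
  unfolding hconverges_def
proof (rule tendsto_sandwich[OF always_eventually always_eventually tendsto_const])
  show "(\<lambda>k. hnorm H (hminus H (s k) l) + hnorm H (hminus H (t k) m)) \<longlonglongrightarrow> 0"
    using tendsto_add assms(1,2) unfolding hconverges_def by force
  show "\<forall>k. hnorm H (hminus H (hplus H (s k) (t k)) (hplus H l m))
      \<le> hnorm H (hminus H (s k) l) + hnorm H (hminus H (t k) m)"
  proof
    fix k
    have "hminus H (hplus H (s k) (t k)) (hplus H l m) = hplus H (hminus H (s k) l) (hminus H (t k) m)"
      by (rule eqI_inner) (simp_all add: assms closed inner_simps)
    then show "hnorm H (hminus H (hplus H (s k) (t k)) (hplus H l m))
      \<le> hnorm H (hminus H (s k) l) + hnorm H (hminus H (t k) m)"
      using norm_triangle assms by (simp add: closed)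
  qed
qed (simp add: norm_nonneg closed assms)

lemma converges_scale:
  assumes "hconverges H s l" "\<And>k. s k \<in> hcarrier H" "l \<in> hcarrier H"
  shows "hconverges H (\<lambda>k. hscale H c (s k)) (hscale H c l)"
proof -
  have "hminus H (hscale H c (s k)) (hscale H c l) = hscale H c (hminus H (s k) l)" for k
    by (rule eqI_inner) (simp_all add: assms closed inner_simps algebra_simps)
  then show ?thesis
    using assms by (simp add: hconverges_def norm_scale closed tendsto_mult_right_zero)
qed

lemma converges_inner:
  assumes "hconverges H s l" "\<And>k. s k \<in> hcarrier H" "l \<in> hcarrier H" "w \<in> hcarrier H"
  shows "(\<lambda>k. hinner H (s k) w) \<longlonglongrightarrow> hinner H l w"
proof (rule Lim_null_comparison[THEN LIM_zero_cancel])
  show "(\<lambda>k. hnorm H (hminus H (s k) l) * hnorm H w) \<longlonglongrightarrow> 0"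
    using assms(1) unfolding hconverges_def by (rule tendsto_mult_left_zero)
  show "\<forall>\<^sub>F k in sequentially. norm (hinner H (s k) w - hinner H l w)
      \<le> hnorm H (hminus H (s k) l) * hnorm H w"
    by (intro always_eventually allI)
      (simp add: inner_minus[symmetric] cauchy_schwarz assms closed)
qed

lemma converges_norm:
  assumes "hconverges H s l" "\<And>k. s k \<in> hcarrier H" "l \<in> hcarrier H"
  shows "(\<lambda>k. hnorm H (s k)) \<longlonglongrightarrow> hnorm H l"
  by (rule Lim_null_comparison[THEN LIM_zero_cancel])
    (use norm_diff_le assms in \<open>auto simp: hconverges_def\<close>)

lemma converges_minus:
  assumes "hconverges H s l" "hconverges H t m" "\<And>k. s k \<in> hcarrier H" "\<And>k. t k \<in> hcarrier H"
    "l \<in> hcarrier H" "m \<in> hcarrier H"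
  shows "hconverges H (\<lambda>k. hminus H (s k) (t k)) (hminus H l m)"
  unfolding hminus_def using assms by (intro converges_plus converges_scale closed)

lemma converges_unique:
  assumes "hconverges H s l" "hconverges H s m" "\<And>k. s k \<in> hcarrier H" "l \<in> hcarrier H" "m \<in> hcarrier H"
  shows "l = m"
  by (rule eqI_inner) (use assms converges_inner LIMSEQ_unique in blast)+

lemma converges_cauchy:
  assumes "hconverges H s l" "\<And>k. s k \<in> hcarrier H" "l \<in> hcarrier H"
  shows "hcauchy H s"
  unfolding hcauchy_def
proof (intro allI impI)
  fix e :: real assume "e > 0"
  then obtain N where N: "\<And>k. k \<ge> N \<Longrightarrow> hnorm H (hminus H (s k) l) < e / 2"
    using assms(1) unfolding hconverges_def
    by (metis LIMSEQ_D half_gt_zero diff_zero real_norm_def abs_less_iff)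
  have "hnorm H (hminus H (s j) (s k)) < e" if "j \<ge> N" "k \<ge> N" for j k
    using minus_triangle[of "s j" l "s k"] norm_minus_commute[of "s k" l] N[of j] N[of k] that assms
    by simp
  then show "\<exists>N. \<forall>j\<ge>N. \<forall>k\<ge>N. hnorm H (hminus H (s j) (s k)) < e" by blast
qed

lemma closed_subspace_closed:
  assumes "closed_subspace H W"
  shows "w \<in> W \<Longrightarrow> w \<in> hcarrier H" "hzero H \<in> W"
    "u \<in> W \<Longrightarrow> v \<in> W \<Longrightarrow> hplus H u v \<in> W" "u \<in> W \<Longrightarrow> hscale H c u \<in> W"
    "u \<in> W \<Longrightarrow> v \<in> W \<Longrightarrow> hminus H u v \<in> W"
  using assms unfolding closed_subspace_def hminus_def by blast+

text \<open>The difference between a vector outside \<open>W\<close> and its nearest point in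
  \<open>W\<close>. A minimizing sequence is Cauchy by the parallelogram law, and completeness
  supplies the nearest point.\<close>

theorem orthogonal_vector_exists:
  assumes W: "closed_subspace H W" and "W \<noteq> hcarrier H"
  obtains g where "g \<in> hcarrier H" "g \<noteq> hzero H" "\<And>w. w \<in> W \<Longrightarrow> hinner H w g = 0"
proof -
  note Wc = closed_subspace_closed[OF W]
  obtain v where v: "v \<in> hcarrier H" "v \<notin> W" using assms Wc(1) by blast
  define N where "N w = (hnorm H (hminus H v w))\<^sup>2" for w
  define d where "d = Inf (N ` W)"
  have bdd: "bdd_below (N ` W)" by (rule bdd_belowI2[of _ 0]) (simp add: N_def)
  have d: "d \<le> N w" if "w \<in> W" for w unfolding d_def by (intro cInf_lower bdd imageI that)
  have "\<exists>w\<in>W. N w < d + 1 / Suc k" for k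
    using cInf_lessD[of "N ` W" "d + 1 / Suc k"] Wc(2) unfolding d_def by auto
  then obtain s where s: "\<And>k. s k \<in> W" "\<And>k. N (s k) < d + 1 / Suc k" by metis
  note sc = Wc(1)[OF s(1)]
  have par: "(hnorm H (hminus H (s j) (s k)))\<^sup>2 \<le> 2 * (1 / Suc j) + 2 * (1 / Suc k)" for j k
  proof -
    \<comment> \<open>The midpoint lies in \<open>W\<close>, so its squared distance to
      \<open>v\<close> is at least the infimum \<open>d\<close>; the parallelogram law then bounds
      the distance of \<open>s j\<close> and \<open>s k\<close>.\<close>
    define m where "m = hscale H (1/2) (hplus H (s j) (s k))"
    have m: "m \<in> W" unfolding m_def by (intro Wc s)
    have "(hnorm H (hminus H (s j) (s k)))\<^sup>2 = 2 * N (s j) + 2 * N (s k) - 4 * N m"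
      using inner_commute[OF sc[of j] v(1)] inner_commute[OF sc[of k] v(1)] inner_commute[OF sc[of j] sc[of k]]
      by (simp add: N_def norm_sq inner_simps closed sc v(1) m_def algebra_simps)
    then show ?thesis using d[OF m] s(2)[of j] s(2)[of k] by linarith
  qed
  have "hcauchy H s"
    unfolding hcauchy_def
  proof (intro allI impI)
    fix e :: real assume e: "e > 0"
    obtain n where n: "4 / e\<^sup>2 < real n" using reals_Archimedean2 by blast
    have "hnorm H (hminus H (s j) (s k)) < e" if "j \<ge> n" "k \<ge> n" for j k
    proof -
      have pos: "0 < real n" using n e by (smt (verit) divide_pos_pos zero_less_power)
      have "2 * (1 / Suc j) + 2 * (1 / Suc k) \<le> 2 * (1 / real n) + 2 * (1 / real n)"
        using that pos by (intro add_mono mult_left_mono divide_left_mono) auto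
      also have "\<dots> < e\<^sup>2" using n e pos by (simp add: field_simps)
      finally show ?thesis using par[of j k] e by (intro power2_less_imp_less[of _ e]) auto
    qed
    then show "\<exists>N. \<forall>j\<ge>N. \<forall>k\<ge>N. hnorm H (hminus H (s j) (s k)) < e" by blast
  qed
  then obtain p where p: "p \<in> hcarrier H" "hconverges H s p"
    using complete[of s] sc by blast
  have pW: "p \<in> W" using W s(1) p unfolding closed_subspace_def by blast
  have "(\<lambda>k. (hnorm H (hminus H v (s k)))\<^sup>2) \<longlonglongrightarrow> (hnorm H (hminus H v p))\<^sup>2"
    by (intro tendsto_power converges_norm converges_minus converges_const p sc v closed)
  moreover have "(\<lambda>k. d + 1 / Suc k) \<longlonglongrightarrow> d + 0"
    by (intro tendsto_intros LIMSEQ_Suc lim_1_over_n)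
  ultimately have Np: "N p \<le> d"
    using s(2) by (intro LIMSEQ_le[of "\<lambda>k. N (s k)" _ "\<lambda>k. d + 1 / Suc k"]) (auto simp: N_def intro: less_imp_le)
  define g where "g = hminus H v p"
  have g: "g \<in> hcarrier H" using v p by (simp add: g_def closed)
  show ?thesis
  proof
    show "g \<in> hcarrier H" by fact
    show "g \<noteq> hzero H" using eq_if_minus_zero[of v p] v p pW by (auto simp: g_def)
    fix w assume w: "w \<in> W"
    note wc = Wc(1)[OF w]
    show "hinner H w g = 0"
    proof (cases "w = hzero H")
      case True then show ?thesis using g by (simp add: inner_simps)
    next
      case False
      define n where "n = (hnorm H w)\<^sup>2"
      have n: "n > 0" using False wc norm_eq_zero norm_nonneg unfolding n_def by (metis zero_less_power2)
      \<comment> \<open>With this coefficient, adding \<open>c w\<close> to \<open>p\<close> would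
        lower the squared distance by \<open>|\<langle>g, w\<rangle>|^2 / n\<close>; minimality
        forces this amount to be zero.\<close>
      define c where "c = hinner H g w / of_real n"
      have "hminus H g (hscale H c w) = hminus H v (hplus H p (hscale H c w))"
        by (rule eqI_inner) (simp_all add: g_def closed wc v p inner_simps)
      then have N': "N (hplus H p (hscale H c w)) = (hnorm H (hminus H g (hscale H c w)))\<^sup>2"
        by (simp add: N_def)
      have "hplus H p (hscale H c w) \<in> W" by (intro Wc pW w)
      from d[OF this] Np have "N p \<le> N (hplus H p (hscale H c w))" by simp
      then have le: "(hnorm H g)\<^sup>2 \<le> (hnorm H (hminus H g (hscale H c w)))\<^sup>2"
        unfolding N' by (simp add: N_def g_def)
      have "of_real ((hnorm H (hminus H g (hscale H c w)))\<^sup>2)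
          = hinner H (hminus H g (hscale H c w)) (hminus H g (hscale H c w))"
        using g wc by (simp add: inner_self closed)
      also have "\<dots> = hinner H g g - cnj c * hinner H g w - c * (hinner H w g - cnj c * hinner H w w)"
        using g wc by (simp add: inner_simps closed algebra_simps)
      also have "\<dots> = of_real ((hnorm H g)\<^sup>2 - (cmod (hinner H g w))\<^sup>2 / n)"
        using n by (simp add: inner_self g wc inner_commute[OF g wc] c_def flip: n_def)
          (simp add: field_simps complex_norm_square flip: of_real_power)
      finally have "(hnorm H (hminus H g (hscale H c w)))\<^sup>2 = (hnorm H g)\<^sup>2 - (cmod (hinner H g w))\<^sup>2 / n"
        using of_real_eq_iff by metis
      with le have "(cmod (hinner H g w))\<^sup>2 / n \<le> 0" by simp
      then have "hinner H g w = 0" using n by (simp add: field_simps)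
      then show ?thesis using inner_commute[OF g wc] by simp
    qed
  qed
qed

end

text \<open>Totality as a trivial orthogonal complement, the form in which uniqueness of Fourier
  coefficients delivers it; by \<open>closed_subspace_total\<close> it acts like density of the
  span.\<close>

definition total_in :: "('v, 'b) hspace_scheme \<Rightarrow> 'v set \<Rightarrow> bool" where
  "total_in H X \<longleftrightarrow> X \<subseteq> hcarrier H \<and>
     (\<forall>v\<in>hcarrier H. (\<forall>x\<in>X. hinner H x v = 0) \<longrightarrow> v = hzero H)"

context hilbert_space
begin

text \<open>A proper closed subspace would leave a nonzero orthogonal vector. This is the density
  principle behind every extension from a total set.\<close>

lemma closed_subspace_total:
  assumes "closed_subspace H W" "total_in H X" "X \<subseteq> W"
  shows "W = hcarrier H"
proof (rule ccontr)
  assume "W \<noteq> hcarrier H"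
  then obtain g where "g \<in> hcarrier H" "g \<noteq> hzero H" "\<And>w. w \<in> W \<Longrightarrow> hinner H w g = 0"
    using orthogonal_vector_exists assms(1) by blast
  then show False using assms(2,3) unfolding total_in_def by blast
qed

text \<open>\<open>U_theta\<close> will be recognized as a set of this form, which settles its
  closedness.\<close>

lemma closed_subspace_orthogonal:
  assumes "X \<subseteq> hcarrier H"
  shows "closed_subspace H {v \<in> hcarrier H. \<forall>x\<in>X. hinner H v x = 0}"
  unfolding closed_subspace_def
proof (intro conjI allI impI ballI)
  fix s l assume *: "range s \<subseteq> {v \<in> hcarrier H. \<forall>x\<in>X. hinner H v x = 0} \<and> l \<in> hcarrier H \<and> hconverges H s l"
  have "hinner H l x = 0" if "x \<in> X" for x
  proof -
    have "(\<lambda>k. hinner H (s k) x) \<longlonglongrightarrow> hinner H l x"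
      using * assms that by (intro converges_inner) auto
    moreover have "(\<lambda>k. hinner H (s k) x) = (\<lambda>_. 0)" using * that by auto
    ultimately show ?thesis by (simp add: LIMSEQ_const_iff)
  qed
  then show "l \<in> {v \<in> hcarrier H. \<forall>x\<in>X. hinner H v x = 0}" using * by blast
qed (use assms in \<open>auto simp: inner_simps closed subset_iff\<close>)

end

section \<open>Isometries and the unitary map between matched families\<close>

definition isometry_map :: "('v, 'b) hspace_scheme \<Rightarrow> ('w, 'c) hspace_scheme \<Rightarrow> ('v \<Rightarrow> 'w) \<Rightarrow> bool" where
  "isometry_map H K T \<longleftrightarrow> T ` hcarrier H \<subseteq> hcarrier K \<and>
     (\<forall>u\<in>hcarrier H. \<forall>v\<in>hcarrier H. hinner K (T u) (T v) = hinner H u v)"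

locale hilbert_isometry = H: hilbert_space H + K: hilbert_space K
  for H :: "('v, 'b) hspace_scheme" and K :: "('w, 'c) hspace_scheme" +
  fixes T :: "'v \<Rightarrow> 'w"
  assumes isometry: "isometry_map H K T"
begin

lemma into: "u \<in> hcarrier H \<Longrightarrow> T u \<in> hcarrier K"
  using isometry by (auto simp: isometry_map_def)

lemma inner: "\<lbrakk>u \<in> hcarrier H; v \<in> hcarrier H\<rbrakk> \<Longrightarrow> hinner K (T u) (T v) = hinner H u v"
  using isometry by (auto simp: isometry_map_def)

lemma norm: "u \<in> hcarrier H \<Longrightarrow> hnorm K (T u) = hnorm H u"
  by (simp add: hnorm_def inner)

text \<open>Linearity is automatic: \<open>\<parallel>T (u + v) - T u - T v\<parallel>\<^sup>2\<close> expands into inner products.\<close>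

lemma plus:
  assumes "u \<in> hcarrier H" "v \<in> hcarrier H"
  shows "T (hplus H u v) = hplus K (T u) (T v)"
proof (rule K.eq_if_minus_zero)
  let ?d = "hminus K (T (hplus H u v)) (hplus K (T u) (T v))"
  have "hinner K ?d ?d = 0"
    using assms by (simp add: K.inner_simps K.closed H.closed into inner H.inner_simps)
  then show "?d = hzero K" by (intro K.inner_definite K.closed into H.closed assms)
qed (intro K.closed into H.closed assms)+

lemma scale:
  assumes "u \<in> hcarrier H"
  shows "T (hscale H c u) = hscale K c (T u)"
proof (rule K.eq_if_minus_zero)
  let ?d = "hminus K (T (hscale H c u)) (hscale K c (T u))"
  have "hinner K ?d ?d = 0"
    using assms by (simp add: K.inner_simps K.closed H.closed into inner H.inner_simps)
  then show "?d = hzero K" by (intro K.inner_definite K.closed into H.closed assms)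
qed (intro K.closed into H.closed assms)+

lemma minus: "\<lbrakk>u \<in> hcarrier H; v \<in> hcarrier H\<rbrakk> \<Longrightarrow> T (hminus H u v) = hminus K (T u) (T v)"
  by (simp add: hminus_def plus scale H.closed)

lemma zero: "T (hzero H) = hzero K"
  using inner[of "hzero H" "hzero H"] by (intro K.inner_definite into H.closed) (simp add: H.inner_simps H.closed)

lemma converges:
  assumes "hconverges H s l" "\<And>k. s k \<in> hcarrier H" "l \<in> hcarrier H"
  shows "hconverges K (\<lambda>k. T (s k)) (T l)"
  using assms by (simp add: hconverges_def norm H.closed flip: minus)

lemma inj: "inj_on T (hcarrier H)"
proof (rule inj_onI)
  fix u v assume *: "u \<in> hcarrier H" "v \<in> hcarrier H" "T u = T v"
  then show "u = v" by (intro H.eqI_inner) (metis inner)+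
qed

lemma unitary: "T ` hcarrier H = hcarrier K \<Longrightarrow> unitary_map H K T"
  by (auto simp: unitary_map_def bij_betw_def inj plus scale inner)

end

lemma unitary_isometry: "unitary_map H K T \<Longrightarrow> isometry_map H K T"
  by (auto simp: unitary_map_def isometry_map_def bij_betw_def)

text \<open>The graph of the unitary map that sends one total family to another total family with the
  same Gram matrix.\<close>

inductive graph_closure for H :: "('v, 'b) hspace_scheme" and K :: "('w, 'c) hspace_scheme" and I e f where
  gen: "i \<in> I \<Longrightarrow> graph_closure H K I e f (e i) (f i)"
| zero: "graph_closure H K I e f (hzero H) (hzero K)"
| plus: "graph_closure H K I e f u v \<Longrightarrow> graph_closure H K I e f u' v'
    \<Longrightarrow> graph_closure H K I e f (hplus H u u') (hplus K v v')"
| scale: "graph_closure H K I e f u v \<Longrightarrow> graph_closure H K I e f (hscale H c u) (hscale K c v)"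
| lim: "(\<And>k. graph_closure H K I e f (s k) (t k)) \<Longrightarrow> hconverges H s u \<Longrightarrow> hconverges K t v
    \<Longrightarrow> u \<in> hcarrier H \<Longrightarrow> v \<in> hcarrier K \<Longrightarrow> graph_closure H K I e f u v"

locale gram_families = H: hilbert_space H + K: hilbert_space K
  for H :: "('v, 'b) hspace_scheme" and K :: "('w, 'c) hspace_scheme" +
  fixes I :: "'i set" and e :: "'i \<Rightarrow> 'v" and f :: "'i \<Rightarrow> 'w"
  assumes e: "total_in H (e ` I)" and f: "total_in K (f ` I)"
    and gram: "\<lbrakk>i \<in> I; j \<in> I\<rbrakk> \<Longrightarrow> hinner H (e i) (e j) = hinner K (f i) (f j)"
begin

abbreviation "gc \<equiv> graph_closure H K I e f"

lemma ec: "i \<in> I \<Longrightarrow> e i \<in> hcarrier H" using e by (auto simp: total_in_def)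
lemma fc: "i \<in> I \<Longrightarrow> f i \<in> hcarrier K" using f by (auto simp: total_in_def)

lemma graph_carrier: "gc u v \<Longrightarrow> u \<in> hcarrier H \<and> v \<in> hcarrier K"
  by (induction rule: graph_closure.induct) (auto simp: ec fc H.closed K.closed)

text \<open>One argument at a time: the pair \<open>(w, z)\<close> is only required to match on the
  generators, so \<open>graph_inner\<close> can apply this twice, once with a generator pair and
  once with an arbitrary related pair.\<close>

lemma graph_inner_aux:
  assumes w: "w \<in> hcarrier H" "z \<in> hcarrier K"
    and g: "\<And>i. i \<in> I \<Longrightarrow> hinner H (e i) w = hinner K (f i) z"
  shows "gc u v \<Longrightarrow> hinner H u w = hinner K v z"
proof (induction rule: graph_closure.induct)
  case (plus u v u' v')
  then show ?case using graph_carrier w by (simp add: H.inner_simps K.inner_simps)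
next
  case (scale u v c)
  then show ?case using graph_carrier w by (simp add: H.inner_simps K.inner_simps)
next
  case (lim s t u v)
  have "(\<lambda>k. hinner H (s k) w) \<longlonglongrightarrow> hinner H u w"
    using lim graph_carrier w by (intro H.converges_inner) auto
  moreover have "(\<lambda>k. hinner K (t k) z) \<longlonglongrightarrow> hinner K v z"
    using lim graph_carrier w by (intro K.converges_inner) auto
  ultimately show ?case using lim.IH LIMSEQ_unique by auto
qed (use g w in \<open>auto simp: H.inner_simps K.inner_simps\<close>)

lemma graph_inner:
  assumes "gc u v" "gc u' v'"
  shows "hinner H u u' = hinner K v v'"
proof (rule graph_inner_aux[OF _ _ _ assms(1)])
  fix i assume i: "i \<in> I"
  have "hinner H u' (e i) = hinner K v' (f i)"
    by (rule graph_inner_aux[OF ec[OF i] fc[OF i] gram[OF _ i] assms(2)])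
  then show "hinner H (e i) u' = hinner K (f i) v'"
    using H.inner_commute[of u' "e i"] K.inner_commute[of v' "f i"] graph_carrier[OF assms(2)] ec fc i by simp
qed (use graph_carrier assms in auto)

lemma graph_minus: "gc u v \<Longrightarrow> gc u' v' \<Longrightarrow> gc (hminus H u u') (hminus K v v')"
  unfolding hminus_def by (intro graph_closure.plus graph_closure.scale)

lemma graph_norm: "gc u v \<Longrightarrow> hnorm H u = hnorm K v"
  using graph_inner[of u v u v] by (simp add: hnorm_def)

text \<open>Related sequences have equal distances, so a convergent sequence in the domain has a
  Cauchy partner; completeness of \<open>K\<close> and the constructor \<open>lim\<close> put the
  limit into the domain.\<close>

lemma graph_domain: "{u. \<exists>v. gc u v} = hcarrier H"
proof (rule H.closed_subspace_total[OF _ e])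
  show "closed_subspace H {u. \<exists>v. gc u v}"
    unfolding closed_subspace_def
  proof (intro conjI allI impI)
    fix s l assume *: "range s \<subseteq> {u. \<exists>v. gc u v} \<and> l \<in> hcarrier H \<and> hconverges H s l"
    then have "\<forall>k. \<exists>v. gc (s k) v" by blast
    then obtain t where t: "\<And>k. gc (s k) (t k)" by metis
    have "hcauchy H s" using * graph_carrier[OF t] by (intro H.converges_cauchy[of s l]) auto
    then have "hcauchy K t" unfolding hcauchy_def using graph_norm[OF graph_minus[OF t t]] by simp
    then obtain m where m: "m \<in> hcarrier K" "hconverges K t m"
      using K.complete[of t] graph_carrier[OF t] by blast
    have "gc l m" by (rule graph_closure.lim[OF t _ m(2)]) (use * m in auto)
    then show "l \<in> {u. \<exists>v. gc u v}" by blast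
  qed (auto dest: graph_carrier intro: graph_closure.zero graph_closure.plus graph_closure.scale)
qed (auto intro: graph_closure.gen)

lemma graph_range: "{v. \<exists>u. gc u v} = hcarrier K"
proof (rule K.closed_subspace_total[OF _ f])
  show "closed_subspace K {v. \<exists>u. gc u v}"
    unfolding closed_subspace_def
  proof (intro conjI allI impI)
    fix s l assume *: "range s \<subseteq> {v. \<exists>u. gc u v} \<and> l \<in> hcarrier K \<and> hconverges K s l"
    then have "\<forall>k. \<exists>u. gc u (s k)" by blast
    then obtain t where t: "\<And>k. gc (t k) (s k)" by metis
    have "hcauchy K s" using * graph_carrier[OF t] by (intro K.converges_cauchy[of s l]) auto
    then have "hcauchy H t" unfolding hcauchy_def using graph_norm[OF graph_minus[OF t t]] by simp
    then obtain m where m: "m \<in> hcarrier H" "hconverges H t m"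
      using H.complete[of t] graph_carrier[OF t] by blast
    have "gc m l" by (rule graph_closure.lim[OF t m(2)]) (use * m in auto)
    then show "l \<in> {v. \<exists>u. gc u v}" by blast
  qed (auto dest: graph_carrier intro: graph_closure.zero graph_closure.plus graph_closure.scale)
qed (auto intro: graph_closure.gen)

text \<open>The zero vector is related to \<open>v - v'\<close>, and related vectors have equal
  norms.\<close>

lemma graph_unique: "gc u v \<Longrightarrow> gc u v' \<Longrightarrow> v = v'"
  using graph_norm[OF graph_minus, of u v u v'] graph_carrier H.minus_self[of u]
  by (metis H.norm_eq_zero H.zero_closed K.eq_if_minus_zero K.minus_closed K.norm_eq_zero)

theorem unitary_exists:
  obtains T where "unitary_map H K T" "\<And>i. i \<in> I \<Longrightarrow> T (e i) = f i"
proof -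
  define T where "T u = (THE v. gc u v)" for u
  have T: "T u = v" if "gc u v" for u v
    unfolding T_def using that graph_unique by blast
  have gcT: "gc u (T u)" if "u \<in> hcarrier H" for u
    using graph_domain T that by blast
  interpret hilbert_isometry H K T
    using graph_carrier[OF gcT] graph_inner[OF gcT gcT]
    by unfold_locales (auto simp: isometry_map_def)
  have "hcarrier K \<subseteq> T ` hcarrier H"
  proof
    fix v assume "v \<in> hcarrier K"
    then obtain u where "gc u v" using graph_range by blast
    then show "v \<in> T ` hcarrier H" using T[of u v] graph_carrier[of u v] by blast
  qed
  then have "T ` hcarrier H = hcarrier K" using into by blast
  then have "unitary_map H K T" by (rule unitary)
  moreover have "T (e i) = f i" if "i \<in> I" for i
    using that by (intro T graph_closure.gen)
  ultimately show ?thesis by (rule that)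
qed

end

text \<open>The vectors on which both compositions agree form a closed subspace containing a total
  set.\<close>

lemma intertwiner_total:
  assumes "hilbert_isometry H K T" "hilbert_isometry H H a" "hilbert_isometry K K b"
    and e: "total_in H X" "\<And>x. x \<in> X \<Longrightarrow> T (a x) = b (T x)" and "v \<in> hcarrier H"
  shows "T (a v) = b (T v)"
proof -
  interpret T: hilbert_isometry H K T by fact
  interpret a: hilbert_isometry H H a by fact
  interpret b: hilbert_isometry K K b by fact
  let ?W = "{v \<in> hcarrier H. T (a v) = b (T v)}"
  have "?W = hcarrier H"
  proof (rule T.H.closed_subspace_total[OF _ e(1)])
    show "closed_subspace H ?W"
      unfolding closed_subspace_def
    proof (intro conjI allI impI)
      fix s l assume *: "range s \<subseteq> ?W \<and> l \<in> hcarrier H \<and> hconverges H s l"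
      then have sc: "\<And>k. s k \<in> hcarrier H" by blast
      have "hconverges K (\<lambda>k. T (a (s k))) (T (a l))" "hconverges K (\<lambda>k. b (T (s k))) (b (T l))"
        using * sc by (auto intro!: T.converges a.converges b.converges a.into T.into)
      moreover have "(\<lambda>k. T (a (s k))) = (\<lambda>k. b (T (s k)))" using * by (auto simp: subset_iff)
      ultimately have "T (a l) = b (T l)"
        using sc * by (intro T.K.converges_unique[of "\<lambda>k. T (a (s k))"]) (auto intro: T.into a.into b.into)
      then show "l \<in> ?W" using * by blast
    qed (auto simp: T.H.closed T.K.closed T.plus a.plus b.plus T.scale a.scale b.scale
          T.zero a.zero b.zero a.into T.into)
  qed (use e in \<open>auto simp: total_in_def\<close>)
  then show ?thesis using assms by blast
qed

section \<open>Representations and their direct sums\<close>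

lemma (in hilbert_space) total_carrier: "total_in H (hcarrier H)"
  unfolding total_in_def using inner_definite by blast

lemma total_in_subset: "total_in H X \<Longrightarrow> x \<in> X \<Longrightarrow> x \<in> hcarrier H"
  by (auto simp: total_in_def)

text \<open>Keeps the Hilbert space and the preservation of inner products by each operator: this is
  what the gluing of equivalences consumes, and it passes to direct sums componentwise.\<close>

definition isometric_rep :: "'g monoid \<Rightarrow> ('g, 'v) rep \<Rightarrow> bool" where
  "isometric_rep G R \<longleftrightarrow> hilbert_space R \<and> (\<forall>g\<in>carrier G. isometry_map R R (act R g))"

lemma isometric_rep_hilbert: "isometric_rep G R \<Longrightarrow> hilbert_space R"
  by (simp add: isometric_rep_def)

lemma isometric_rep_act:
  "isometric_rep G R \<Longrightarrow> g \<in> carrier G \<Longrightarrow> hilbert_isometry R R (act R g)"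
  by (simp add: isometric_rep_def hilbert_isometry_def hilbert_isometry_axioms_def)

lemma unitary_rep_isometric: "unitary_rep G R \<Longrightarrow> isometric_rep G R"
  by (simp add: unitary_rep_def isometric_rep_def unitary_isometry)

text \<open>\<open>unitary_exists\<close> matches the families; the index condition says that both
  actions move index \<open>i\<close> to a common index \<open>j\<close>, so the operator
  intertwines on a total set.\<close>

lemma equivalentI_gram:
  assumes R: "isometric_rep G R" and S: "isometric_rep G S"
    and e: "total_in R (e ` I)" and f: "total_in S (f ` I)"
    and gram: "\<And>i j. \<lbrakk>i \<in> I; j \<in> I\<rbrakk> \<Longrightarrow> hinner R (e i) (e j) = hinner S (f i) (f j)"
    and act: "\<And>g i. \<lbrakk>g \<in> carrier G; i \<in> I\<rbrakk> \<Longrightarrow> \<exists>j\<in>I. act R g (e i) = e j \<and> act S g (f i) = f j"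
  shows "unitarily_equivalent G R S"
proof -
  interpret gram_families R S I e f
    using R S e f gram by (simp add: gram_families_def gram_families_axioms_def isometric_rep_hilbert)
  obtain T where T: "unitary_map R S T" "\<And>i. i \<in> I \<Longrightarrow> T (e i) = f i"
    by (rule unitary_exists) blast
  have iso: "hilbert_isometry R S T"
    using T(1) R S by (simp add: hilbert_isometry_def hilbert_isometry_axioms_def unitary_isometry isometric_rep_hilbert)
  have "T (act R g v) = act S g (T v)" if g: "g \<in> carrier G" and v: "v \<in> hcarrier R" for g v
  proof (rule intertwiner_total[OF iso isometric_rep_act[OF R g] isometric_rep_act[OF S g] e _ v])
    fix x assume "x \<in> e ` I"
    then obtain i where i: "i \<in> I" "x = e i" by blast
    then obtain j where "j \<in> I" "act R g (e i) = e j" "act S g (f i) = f j" using act[OF g] by blast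
    then show "T (act R g x) = act S g (T x)" using i T(2) by simp
  qed
  then show ?thesis using T(1) unfolding unitarily_equivalent_def by blast
qed

lemma unitarily_equivalentE:
  assumes "unitarily_equivalent G R S" "isometric_rep G R" "isometric_rep G S"
  obtains T where "hilbert_isometry R S T" "T ` hcarrier R = hcarrier S"
    "\<And>g v. \<lbrakk>g \<in> carrier G; v \<in> hcarrier R\<rbrakk> \<Longrightarrow> T (act R g v) = act S g (T v)"
proof -
  obtain T where T: "unitary_map R S T"
    "\<And>g v. \<lbrakk>g \<in> carrier G; v \<in> hcarrier R\<rbrakk> \<Longrightarrow> T (act R g v) = act S g (T v)"
    using assms(1) unfolding unitarily_equivalent_def by blast
  have "hilbert_isometry R S T"
    using T(1) assms by (simp add: hilbert_isometry_def hilbert_isometry_axioms_def unitary_isometry isometric_rep_hilbert)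
  moreover have "T ` hcarrier R = hcarrier S" using T(1) by (auto simp: unitary_map_def bij_betw_def)
  ultimately show ?thesis using that T(2) by blast
qed

text \<open>The images under \<open>T\<close> of all vectors form a total family on one side, the
  vectors themselves one on the other; this replaces the construction of an inverse
  operator.\<close>

lemma unitarily_equivalent_sym:
  assumes "unitarily_equivalent G R S" and R: "isometric_rep G R" and S: "isometric_rep G S"
  shows "unitarily_equivalent G S R"
proof -
  from assms obtain T where T: "hilbert_isometry R S T" "T ` hcarrier R = hcarrier S"
    "\<And>g v. \<lbrakk>g \<in> carrier G; v \<in> hcarrier R\<rbrakk> \<Longrightarrow> T (act R g v) = act S g (T v)"
    by (rule unitarily_equivalentE) blast
  interpret T: hilbert_isometry R S T by fact
  show ?thesis
  proof (rule equivalentI_gram[OF S R, where e = T and f = "\<lambda>v. v" and I = "hcarrier R"])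
    fix g i assume "g \<in> carrier G" "i \<in> hcarrier R"
    then show "\<exists>j\<in>hcarrier R. act S g (T i) = T j \<and> act R g i = j"
      using hilbert_isometry.into[OF isometric_rep_act[OF R]] T(3) by metis
  qed (simp_all add: T(2) T.K.total_carrier T.H.total_carrier T.inner)
qed

text \<open>The composite of the two operators provides the second family, with all vectors of
  \<open>R\<close> as indices.\<close>

lemma unitarily_equivalent_trans:
  assumes "unitarily_equivalent G R S" "unitarily_equivalent G S Q"
    and R: "isometric_rep G R" and S: "isometric_rep G S" and Q: "isometric_rep G Q"
  shows "unitarily_equivalent G R Q"
proof -
  from assms(1) R S obtain T where T: "hilbert_isometry R S T" "T ` hcarrier R = hcarrier S"
    "\<And>g v. \<lbrakk>g \<in> carrier G; v \<in> hcarrier R\<rbrakk> \<Longrightarrow> T (act R g v) = act S g (T v)"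
    by (rule unitarily_equivalentE) blast
  from assms(2) S Q obtain T' where T': "hilbert_isometry S Q T'" "T' ` hcarrier S = hcarrier Q"
    "\<And>g v. \<lbrakk>g \<in> carrier G; v \<in> hcarrier S\<rbrakk> \<Longrightarrow> T' (act S g v) = act Q g (T' v)"
    by (rule unitarily_equivalentE) blast
  interpret T: hilbert_isometry R S T by fact
  interpret T': hilbert_isometry S Q T' by fact
  have im: "(\<lambda>v. T' (T v)) ` hcarrier R = hcarrier Q" using T(2) T'(2) by (metis image_image)
  show ?thesis
  proof (rule equivalentI_gram[OF R Q, where e = "\<lambda>v. v" and f = "\<lambda>v. T' (T v)" and I = "hcarrier R"])
    fix g i assume "g \<in> carrier G" "i \<in> hcarrier R"
    then show "\<exists>j\<in>hcarrier R. act R g i = j \<and> act Q g (T' (T i)) = T' (T j)"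
      using hilbert_isometry.into[OF isometric_rep_act[OF R]] T(3) T'(3) T.into by metis
  qed (simp_all add: im T.H.total_carrier T'.K.total_carrier T.inner T'.inner T.into)
qed

lemma closed_subspace_limit:
  assumes "closed_subspace H W" "\<And>k. s k \<in> W" "hconverges H s l" "l \<in> hcarrier H"
  shows "l \<in> W"
proof -
  have "range s \<subseteq> W" using assms(2) by blast
  then show ?thesis using assms(1,3,4) unfolding closed_subspace_def by metis
qed

text \<open>Invariant closed subspaces are pulled back along the intertwiner.\<close>

lemma irreducible_equivalent:
  assumes S: "irreducible_rep G S" and R: "unitary_rep G R" and eq: "unitarily_equivalent G S R"
  shows "irreducible_rep G R"
proof -
  have iR: "isometric_rep G R" and iS: "isometric_rep G S"
    using S R by (auto simp: unitary_rep_isometric irreducible_rep_def)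
  from eq iS iR obtain T where T: "hilbert_isometry S R T" "T ` hcarrier S = hcarrier R"
    "\<And>g v. \<lbrakk>g \<in> carrier G; v \<in> hcarrier S\<rbrakk> \<Longrightarrow> T (act S g v) = act R g (T v)"
    by (rule unitarily_equivalentE) blast
  interpret T: hilbert_isometry S R T by fact
  have "hcarrier R \<noteq> {hzero R}"
  proof
    assume "hcarrier R = {hzero R}"
    then have "T v = T (hzero S)" if "v \<in> hcarrier S" for v
      using T.into[OF that] T.zero by auto
    then have "v = hzero S" if "v \<in> hcarrier S" for v
      using inj_onD[OF T.inj _ that T.H.zero_closed] that by blast
    then have "hcarrier S = {hzero S}" using T.H.zero_closed by blast
    then show False using S by (simp add: irreducible_rep_def)
  qed
  moreover have "W = {hzero R} \<or> W = hcarrier R" if W: "closed_subspace R W" "invariant_subset G R W" for W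
  proof -
    define V where "V = {v \<in> hcarrier S. T v \<in> W}"
    note Wc = T.K.closed_subspace_closed[OF W(1)]
    have TV: "T ` V = W"
    proof
      show "W \<subseteq> T ` V"
      proof
        fix w assume w: "w \<in> W"
        then have "w \<in> T ` hcarrier S" using Wc(1) T(2) by simp
        then show "w \<in> T ` V" using w by (auto simp: V_def)
      qed
    qed (auto simp: V_def)
    have "closed_subspace S V"
      unfolding closed_subspace_def
    proof (intro conjI allI impI)
      fix s l assume *: "range s \<subseteq> V \<and> l \<in> hcarrier S \<and> hconverges S s l"
      have "T (s k) \<in> W" for k using * by (auto simp: V_def)
      moreover have "hconverges R (\<lambda>k. T (s k)) (T l)"
        using * by (intro T.converges) (auto simp: V_def)
      moreover have "T l \<in> hcarrier R" using * by (intro T.into) blast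
      ultimately have "T l \<in> W" by (rule closed_subspace_limit[OF W(1)])
      then show "l \<in> V" using * by (simp add: V_def)
    qed (auto simp: V_def T.H.closed T.zero T.plus T.scale Wc(2) intro: Wc(3,4))
    moreover have "invariant_subset G S V"
      using W(2) hilbert_isometry.into[OF isometric_rep_act[OF iS]] T(3)
      by (auto simp: invariant_subset_def V_def)
    ultimately have "V = {hzero S} \<or> V = hcarrier S" using S unfolding irreducible_rep_def by blast
    then show ?thesis using TV T.zero T(2) by auto
  qed
  ultimately show ?thesis using R unfolding irreducible_rep_def by blast
qed

text \<open>Surjectivity on \<open>W\<close> does not follow from surjectivity on the whole space;
  it comes from group inverses, as \<open>w = g (h w)\<close> with \<open>h w\<close> again in
  \<open>W\<close>.\<close>

lemma unitary_rep_subrep: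
  assumes R: "unitary_rep G R" and W: "closed_subspace R W" "invariant_subset G R W"
    and inv: "\<And>g. g \<in> carrier G \<Longrightarrow> \<exists>h\<in>carrier G. \<forall>v\<in>hcarrier R. act R g (act R h v) = v"
  shows "unitary_rep G (R\<lparr>hcarrier := W\<rparr>)"
proof -
  let ?R = "R\<lparr>hcarrier := W\<rparr>"
  interpret hilbert_space R using R by (simp add: unitary_rep_def)
  note Wc = closed_subspace_closed[OF W(1)]
  have eqs: "hminus ?R = hminus R" "hnorm ?R = hnorm R"
    by (auto simp: hminus_def hnorm_def fun_eq_iff)
  have hs: "hilbert_space ?R"
  proof
    fix s assume s: "range s \<subseteq> hcarrier ?R" "hcauchy ?R s"
    then have "hcauchy R s" "range s \<subseteq> hcarrier R" using Wc(1) by (auto simp: hcauchy_def eqs)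
    then obtain l where l: "l \<in> hcarrier R" "hconverges R s l" using complete by blast
    then have "l \<in> W" using s W(1) unfolding closed_subspace_def by auto
    then show "\<exists>l\<in>hcarrier ?R. hconverges ?R s l" using l by (auto simp: hconverges_def eqs)
  qed (auto simp: Wc eqs plus_assoc plus_zero minus_self scale_one scale_scale scale_plus
        plus_scale inner_plus inner_scale inner_nonneg inner_definite intro: inner_commute plus_commute)
  have un: "unitary_map ?R ?R (act ?R g)" if g: "g \<in> carrier G" for g
  proof -
    have "unitary_map R R (act R g)" using R g by (simp add: unitary_rep_def)
    then interpret a: hilbert_isometry R R "act R g"
      by unfold_locales (rule unitary_isometry)
    interpret b: hilbert_isometry ?R ?R "act ?R g"
      using hs W(2) g Wc a.inner
      by (simp add: hilbert_isometry_def hilbert_isometry_axioms_def isometry_map_def invariant_subset_def image_subset_iff)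
    show ?thesis
    proof (rule b.unitary)
      obtain h where h: "h \<in> carrier G" "\<forall>v\<in>hcarrier R. act R g (act R h v) = v" using inv[OF g] by blast
      have "w \<in> act R g ` W" if "w \<in> W" for w
      proof (rule image_eqI)
        show "w = act R g (act R h w)" using h that Wc(1) by simp
        show "act R h w \<in> W" using h that W(2) by (simp add: invariant_subset_def)
      qed
      then show "act ?R g ` hcarrier ?R = hcarrier ?R" using W(2) g by (auto simp: invariant_subset_def)
    qed
  qed
  show ?thesis
    unfolding unitary_rep_def
    using hs un R Wc(1) by (auto simp: unitary_rep_def eqs)
qed

text \<open>The vectors of continuity form a closed subspace: \<open>2 * hnorm R v\<close> bounds
  the displacement of \<open>v\<close> uniformly in the group element, which lets limits
  pass.\<close>

lemma strongly_continuous_total: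
  fixes G :: "('g::topological_space) monoid"
  assumes R: "isometric_rep G R" and X: "total_in R X" and g: "g \<in> carrier G"
    and cont: "\<And>x. x \<in> X \<Longrightarrow> ((\<lambda>h. hnorm R (hminus R (act R h x) (act R g x))) \<longlongrightarrow> 0) (at g within carrier G)"
    and v: "v \<in> hcarrier R"
  shows "((\<lambda>h. hnorm R (hminus R (act R h v) (act R g v))) \<longlongrightarrow> 0) (at g within carrier G)"
proof -
  interpret hilbert_space R using R by (rule isometric_rep_hilbert)
  define D where "D v h = hnorm R (hminus R (act R h v) (act R g v))" for v h
  let ?F = "at g within carrier G"
  have evF: "\<forall>\<^sub>F h in ?F. h \<in> carrier G" by (simp add: eventually_at_filter)
  note a = isometric_rep_act[OF R]
  note into = hilbert_isometry.into[OF a]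
  have D0: "0 \<le> D v h" if "v \<in> hcarrier R" "h \<in> carrier G" for v h
    unfolding D_def by (intro norm_nonneg closed into that g)
  have Dplus: "D (hplus R u v) h \<le> D u h + D v h" if "u \<in> hcarrier R" "v \<in> hcarrier R" "h \<in> carrier G" for u v h
  proof -
    have "hminus R (act R h (hplus R u v)) (act R g (hplus R u v))
      = hplus R (hminus R (act R h u) (act R g u)) (hminus R (act R h v) (act R g v))"
      by (rule eqI_inner)
        (simp_all add: hilbert_isometry.plus[OF a] into closed inner_simps that g)
    then show ?thesis unfolding D_def by (simp add: norm_triangle closed into that g)
  qed
  have Dscale: "D (hscale R c v) h = cmod c * D v h" if "v \<in> hcarrier R" "h \<in> carrier G" for c v h
  proof -
    have "hminus R (act R h (hscale R c v)) (act R g (hscale R c v))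
      = hscale R c (hminus R (act R h v) (act R g v))"
      by (rule eqI_inner)
        (simp_all add: hilbert_isometry.scale[OF a] into closed inner_simps that g algebra_simps)
    then show ?thesis unfolding D_def by (simp add: norm_scale closed into that g)
  qed
  have Dbound: "D v h \<le> 2 * hnorm R v" if "v \<in> hcarrier R" "h \<in> carrier G" for v h
    unfolding D_def
    using minus_triangle[of "act R h v" "hzero R" "act R g v"] norm_minus_commute[of "hzero R" "act R g v"]
    by (simp add: into that g closed minus_zero hilbert_isometry.norm[OF a])
  have "{v \<in> hcarrier R. (D v \<longlongrightarrow> 0) ?F} = hcarrier R"
  proof (rule closed_subspace_total[OF _ X])
    show "closed_subspace R {v \<in> hcarrier R. (D v \<longlongrightarrow> 0) ?F}"
      unfolding closed_subspace_def
    proof (intro conjI ballI allI impI)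
      have "D (hzero R) h = 0" if "h \<in> carrier G" for h
        using Dbound[of "hzero R" h] D0[of "hzero R" h] that
        by (simp add: closed hnorm_def inner_simps)
      then have "(D (hzero R) \<longlongrightarrow> 0) ?F"
        using evF by (auto intro!: tendsto_eventually elim!: eventually_mono)
      then show "hzero R \<in> {v \<in> hcarrier R. (D v \<longlongrightarrow> 0) ?F}" by (simp add: closed)
    next
      fix u v assume *: "u \<in> {v \<in> hcarrier R. (D v \<longlongrightarrow> 0) ?F}" "v \<in> {v \<in> hcarrier R. (D v \<longlongrightarrow> 0) ?F}"
      have "(D (hplus R u v) \<longlongrightarrow> 0) ?F"
      proof (rule tendsto_sandwich[where f = "\<lambda>_. 0" and h = "\<lambda>h. D u h + D v h"])
        show "((\<lambda>h. D u h + D v h) \<longlongrightarrow> 0) ?F" using * tendsto_add_zero by blast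
      qed (use * evF Dplus D0 closed in \<open>auto elim!: eventually_mono\<close>)
      then show "hplus R u v \<in> {v \<in> hcarrier R. (D v \<longlongrightarrow> 0) ?F}" using * by (simp add: closed)
    next
      fix c u assume *: "u \<in> {v \<in> hcarrier R. (D v \<longlongrightarrow> 0) ?F}"
      have "(D (hscale R c u) \<longlongrightarrow> 0) ?F"
      proof (rule Lim_transform_eventually)
        show "((\<lambda>h. cmod c * D u h) \<longlongrightarrow> 0) ?F" using * by (auto intro: tendsto_mult_right_zero)
        show "\<forall>\<^sub>F h in ?F. cmod c * D u h = D (hscale R c u) h"
          using evF * by (auto simp: Dscale elim!: eventually_mono)
      qed
      then show "hscale R c u \<in> {v \<in> hcarrier R. (D v \<longlongrightarrow> 0) ?F}" using * by (simp add: closed)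
    next
      fix s l assume *: "range s \<subseteq> {v \<in> hcarrier R. (D v \<longlongrightarrow> 0) ?F} \<and> l \<in> hcarrier R \<and> hconverges R s l"
      then have s: "\<And>k. s k \<in> hcarrier R" "\<And>k. (D (s k) \<longlongrightarrow> 0) ?F" by auto
      have "(D l \<longlongrightarrow> 0) ?F"
      proof (rule tendstoI)
        fix e :: real assume e: "e > 0"
        have "(\<lambda>k. hnorm R (hminus R (s k) l)) \<longlonglongrightarrow> 0" using * by (simp add: hconverges_def)
        then have "\<forall>\<^sub>F k in sequentially. hnorm R (hminus R (s k) l) < e / 4"
          using e by (intro order_tendstoD(2)) auto
        \<comment> \<open>The remainder contributes at most twice its norm, so less than
          \<open>e / 2\<close>, and the approximant less than \<open>e / 4\<close>.\<close>
        then obtain k where k: "hnorm R (hminus R (s k) l) < e / 4"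
          using eventually_happens sequentially_bot by blast
        have "\<forall>\<^sub>F h in ?F. dist (D (s k) h) 0 < e / 4" using s(2) e by (intro tendstoD) auto
        then show "\<forall>\<^sub>F h in ?F. dist (D l h) 0 < e"
          using evF
        proof eventually_elim
          case (elim h)
          have m: "hminus R l (s k) \<in> hcarrier R" using * s by (simp add: closed)
          have "l = hplus R (hminus R l (s k)) (s k)"
            by (rule eqI_inner) (use * s in \<open>simp_all add: closed inner_simps\<close>)
          then have "D l h \<le> D (hminus R l (s k)) h + D (s k) h"
            using Dplus[OF m s(1) elim(2), of k] by simp
          also have "D (hminus R l (s k)) h \<le> 2 * hnorm R (hminus R l (s k))"
            by (rule Dbound[OF m elim(2)])
          finally have "D l h < e"
            using k elim norm_minus_commute[of l "s k"] * s e D0[OF s(1)[of k] elim(2)] by (simp add: dist_real_def)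
          then show ?case using D0[of l h] * elim by (simp add: dist_real_def)
        qed
      qed
      then show "l \<in> {v \<in> hcarrier R. (D v \<longlongrightarrow> 0) ?F}" using * by simp
    qed auto
  qed (use X cont in \<open>auto simp: total_in_def D_def[abs_def]\<close>)
  then show ?thesis using v unfolding D_def[abs_def] by blast
qed

lemma character_rep_isometric:
  assumes "\<And>g. g \<in> carrier G \<Longrightarrow> cmod (f g) = 1"
  shows "isometric_rep G (character_rep f)"
  unfolding isometric_rep_def
proof (intro conjI ballI)
  have n: "hnorm (character_rep f) (hminus (character_rep f) u v) = cmod (u - v)" for u v
    unfolding hnorm_def hminus_def character_rep_def by (simp add: cmod_def power2_eq_square algebra_simps)
  show "hilbert_space (character_rep f)"
  proof
    fix s assume "hcauchy (character_rep f) s"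
    then have "Cauchy s" by (simp add: hcauchy_def n Cauchy_def dist_norm)
    then obtain l where "s \<longlonglongrightarrow> l" using Cauchy_convergent convergent_def by blast
    then have "hconverges (character_rep f) s l"
      unfolding hconverges_def n by (rule tendsto_norm_zero[OF LIM_zero])
    then show "\<exists>l\<in>hcarrier (character_rep f). hconverges (character_rep f) s l"
      by (auto simp: character_rep_def)
  qed (auto simp: character_rep_def hminus_def algebra_simps)
  show "isometry_map (character_rep f) (character_rep f) (act (character_rep f) g)" if "g \<in> carrier G" for g
  proof -
    have "f g * u * (cnj (f g) * cnj v) = u * cnj v" for u v
    proof -
      have "f g * u * (cnj (f g) * cnj v) = (f g * cnj (f g)) * (u * cnj v)" by (simp add: algebra_simps)
      also have "f g * cnj (f g) = 1" using assms[OF that] by (simp flip: complex_norm_square)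
      finally show ?thesis by simp
    qed
    then show ?thesis by (simp add: isometry_map_def character_rep_def)
  qed
qed

section \<open>Hilbert direct sums\<close>

lemma two_squares: "(a + b)\<^sup>2 \<le> 2 * a\<^sup>2 + 2 * (b::real)\<^sup>2"
  using sum_squares_bound[of a b] by (simp add: power2_sum)

locale hilbert_family =
  fixes I :: "'i set" and R :: "'i \<Rightarrow> ('g, 'v) rep"
  assumes hilbert: "i \<in> I \<Longrightarrow> hilbert_space (R i)"
begin

abbreviation S where "S \<equiv> rep_sum I R"

lemma carrier_iff: "u \<in> hcarrier S \<longleftrightarrow>
    u \<in> (\<Pi>\<^sub>E i\<in>I. hcarrier (R i)) \<and> (\<lambda>i. (hnorm (R i) (u i))\<^sup>2) summable_on I"
  by (simp add: rep_sum_def)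

lemma component: "u \<in> hcarrier S \<Longrightarrow> i \<in> I \<Longrightarrow> u i \<in> hcarrier (R i)"
  by (auto simp: carrier_iff)

lemma norm_summable: "u \<in> hcarrier S \<Longrightarrow> (\<lambda>i. (hnorm (R i) (u i))\<^sup>2) summable_on I"
  by (simp add: carrier_iff)

lemma ext: "u \<in> hcarrier S \<Longrightarrow> v \<in> hcarrier S \<Longrightarrow> (\<And>i. i \<in> I \<Longrightarrow> u i = v i) \<Longrightarrow> u = v"
  by (rule extensionalityI[of _ I]) (auto simp: carrier_iff PiE_def)

text \<open>The comparison test as a membership criterion; sums, multiples, embedded vectors and
  limits enter the direct sum through it.\<close>

lemma restrict_carrier:
  assumes "\<And>i. i \<in> I \<Longrightarrow> u i \<in> hcarrier (R i)"
    and "f summable_on I" "\<And>i. i \<in> I \<Longrightarrow> (hnorm (R i) (u i))\<^sup>2 \<le> f i"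
  shows "(\<lambda>i\<in>I. u i) \<in> hcarrier S"
proof -
  have "(\<lambda>i. (hnorm (R i) (u i))\<^sup>2) summable_on I"
    by (rule summable_on_comparison_test[OF assms(2)]) (simp_all add: assms(3))
  then have "(\<lambda>i. (hnorm (R i) ((\<lambda>i\<in>I. u i) i))\<^sup>2) summable_on I"
    by (simp cong: summable_on_cong)
  then show ?thesis using assms(1) by (simp add: carrier_iff)
qed

lemma inner_summable:
  assumes "u \<in> hcarrier S" "v \<in> hcarrier S"
  shows "(\<lambda>i. hinner (R i) (u i) (v i)) summable_on I"
proof (rule abs_summable_summable, rule summable_on_comparison_test)
  show "(\<lambda>i. (hnorm (R i) (u i))\<^sup>2 + (hnorm (R i) (v i))\<^sup>2) summable_on I"
    by (intro summable_on_add norm_summable assms)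
  fix i assume i: "i \<in> I"
  interpret hilbert_space "R i" by (rule hilbert[OF i])
  have "cmod (hinner (R i) (u i) (v i)) \<le> hnorm (R i) (u i) * hnorm (R i) (v i)"
    by (intro cauchy_schwarz component assms i)
  also have "\<dots> \<le> (hnorm (R i) (u i))\<^sup>2 + (hnorm (R i) (v i))\<^sup>2"
    using sum_squares_bound[of "hnorm (R i) (u i)" "hnorm (R i) (v i)"]
      mult_nonneg_nonneg[OF norm_nonneg norm_nonneg, OF component component, OF assms(1) i assms(2) i] by linarith
  finally show "norm (hinner (R i) (u i) (v i)) \<le> (hnorm (R i) (u i))\<^sup>2 + (hnorm (R i) (v i))\<^sup>2"
    by simp
qed simp

lemma inner_eq: "hinner S u v = (\<Sum>\<^sub>\<infinity>i\<in>I. hinner (R i) (u i) (v i))"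
  by (simp add: rep_sum_def)

lemma inner_self_eq:
  assumes "u \<in> hcarrier S"
  shows "hinner S u u = of_real (\<Sum>\<^sub>\<infinity>i\<in>I. (hnorm (R i) (u i))\<^sup>2)"
proof -
  have "hinner S u u = (\<Sum>\<^sub>\<infinity>i\<in>I. of_real ((hnorm (R i) (u i))\<^sup>2))"
    unfolding inner_eq
    by (rule infsum_cong) (simp add: hilbert_space.inner_self[OF hilbert] component assms)
  also have "\<dots> = of_real (\<Sum>\<^sub>\<infinity>i\<in>I. (hnorm (R i) (u i))\<^sup>2)"
    by (intro infsumI has_sum_of_real has_sum_infsum norm_summable assms)
  finally show ?thesis .
qed

lemma norm_eq: "u \<in> hcarrier S \<Longrightarrow> (hnorm S u)\<^sup>2 = (\<Sum>\<^sub>\<infinity>i\<in>I. (hnorm (R i) (u i))\<^sup>2)"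
  by (simp add: hnorm_def[of S] inner_self_eq infsum_nonneg)

lemma plus_in:
  assumes "u \<in> hcarrier S" "v \<in> hcarrier S"
  shows "hplus S u v \<in> hcarrier S"
proof -
  have "(\<lambda>i\<in>I. hplus (R i) (u i) (v i)) \<in> hcarrier S"
  proof (rule restrict_carrier)
  show "(\<lambda>i. 2 * (hnorm (R i) (u i))\<^sup>2 + 2 * (hnorm (R i) (v i))\<^sup>2) summable_on I"
    by (intro summable_on_add summable_on_cmult_right norm_summable assms)
  fix i assume i: "i \<in> I"
  interpret hilbert_space "R i" by (rule hilbert[OF i])
  show "hplus (R i) (u i) (v i) \<in> hcarrier (R i)" by (intro plus_closed component assms i)
  have "(hnorm (R i) (hplus (R i) (u i) (v i)))\<^sup>2 \<le> (hnorm (R i) (u i) + hnorm (R i) (v i))\<^sup>2"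
    by (intro power_mono norm_triangle norm_nonneg plus_closed component assms i)
  also note two_squares
  finally show "(hnorm (R i) (hplus (R i) (u i) (v i)))\<^sup>2 \<le> 2 * (hnorm (R i) (u i))\<^sup>2 + 2 * (hnorm (R i) (v i))\<^sup>2" .
  qed
  then show ?thesis by (simp add: rep_sum_def)
qed

lemma scale_in:
  assumes "u \<in> hcarrier S"
  shows "hscale S c u \<in> hcarrier S"
proof -
  have "(\<lambda>i\<in>I. hscale (R i) c (u i)) \<in> hcarrier S"
  proof (rule restrict_carrier)
  show "(\<lambda>i. (cmod c)\<^sup>2 * (hnorm (R i) (u i))\<^sup>2) summable_on I"
    by (intro summable_on_cmult_right norm_summable assms)
  fix i assume i: "i \<in> I"
  interpret hilbert_space "R i" by (rule hilbert[OF i])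
  show "hscale (R i) c (u i) \<in> hcarrier (R i)" by (intro scale_closed component assms i)
  show "(hnorm (R i) (hscale (R i) c (u i)))\<^sup>2 \<le> (cmod c)\<^sup>2 * (hnorm (R i) (u i))\<^sup>2"
    using component[OF assms i] by (simp add: norm_scale power_mult_distrib)
  qed
  then show ?thesis by (simp add: rep_sum_def)
qed

lemma zero_in: "hzero S \<in> hcarrier S"
proof -
  have "(\<lambda>i\<in>I. hzero (R i)) \<in> hcarrier S"
    by (rule restrict_carrier[where f = "\<lambda>_. 0"])
      (auto simp: hilbert_space.zero_closed[OF hilbert] hnorm_def hilbert_space.inner_zero_left[OF hilbert])
  then show ?thesis by (simp add: rep_sum_def)
qed

lemma sum_apply:
  assumes "i \<in> I"
  shows "hplus S u v i = hplus (R i) (u i) (v i)" "hscale S c u i = hscale (R i) c (u i)"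
    "hzero S i = hzero (R i)" "hminus S u v i = hminus (R i) (u i) (v i)" "act S g u i = act (R i) g (u i)"
  using assms by (simp_all add: rep_sum_def hminus_def)

lemma minus_in: "u \<in> hcarrier S \<Longrightarrow> v \<in> hcarrier S \<Longrightarrow> hminus S u v \<in> hcarrier S"
  unfolding hminus_def by (intro plus_in scale_in)

lemma component_norm_le:
  assumes "u \<in> hcarrier S" "i \<in> I"
  shows "hnorm (R i) (u i) \<le> hnorm S u"
proof (rule power2_le_imp_le)
  have "(\<Sum>i\<in>{i}. (hnorm (R i) (u i))\<^sup>2) \<le> (hnorm S u)\<^sup>2"
    unfolding norm_eq[OF assms(1)] using assms by (intro finite_sum_le_infsum norm_summable) auto
  then show "(hnorm (R i) (u i))\<^sup>2 \<le> (hnorm S u)\<^sup>2" by simp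
  show "0 \<le> hnorm S u" by (simp add: hnorm_def inner_self_eq assms infsum_nonneg)
qed

text \<open>Componentwise limits exist. The Cauchy bound is passed to the limit over finite index
  sets, where it does not depend on the set, and therefore holds for the full sum.\<close>

lemma complete_sum:
  assumes s: "range s \<subseteq> hcarrier S" and c: "hcauchy S s"
  shows "\<exists>l\<in>hcarrier S. hconverges S s l"
proof -
  have sc: "s k \<in> hcarrier S" for k using s by auto
  have "\<exists>l\<in>hcarrier (R i). hconverges (R i) (\<lambda>k. s k i) l" if i: "i \<in> I" for i
  proof (rule hilbert_space.complete[OF hilbert[OF i]])
    show "range (\<lambda>k. s k i) \<subseteq> hcarrier (R i)" using component[OF sc i] by auto
    have "hnorm (R i) (hminus (R i) (s j i) (s k i)) \<le> hnorm S (hminus S (s j) (s k))" for j k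
      using component_norm_le[OF minus_in[OF sc sc] i, of j k] by (simp add: sum_apply i)
    then show "hcauchy (R i) (\<lambda>k. s k i)"
      using c unfolding hcauchy_def by (meson order_le_less_trans)
  qed
  then obtain l where l: "\<And>i. i \<in> I \<Longrightarrow> l i \<in> hcarrier (R i)"
    "\<And>i. i \<in> I \<Longrightarrow> hconverges (R i) (\<lambda>k. s k i) (l i)" by metis
  define L where "L = (\<lambda>i\<in>I. l i)"
  define d where "d j i = (hnorm (R i) (hminus (R i) (s j i) (l i)))\<^sup>2" for j i
  have bound: "sum (d j) F \<le> e\<^sup>2"
    if F: "finite F" "F \<subseteq> I" and e: "e > 0" and N: "\<And>k. k \<ge> N \<Longrightarrow> hnorm S (hminus S (s j) (s k)) < e" for F e j N
  proof (rule LIMSEQ_le_const2)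
    show "(\<lambda>k. \<Sum>i\<in>F. (hnorm (R i) (hminus (R i) (s j i) (s k i)))\<^sup>2) \<longlonglongrightarrow> sum (d j) F"
      unfolding d_def
    proof (intro tendsto_sum tendsto_power)
      fix i assume "i \<in> F"
      then have i: "i \<in> I" using F by blast
      interpret hilbert_space "R i" by (rule hilbert[OF i])
      show "(\<lambda>k. hnorm (R i) (hminus (R i) (s j i) (s k i))) \<longlonglongrightarrow> hnorm (R i) (hminus (R i) (s j i) (l i))"
        by (intro converges_norm converges_minus converges_const l closed component sc i)
    qed
    have "(\<Sum>i\<in>F. (hnorm (R i) (hminus (R i) (s j i) (s k i)))\<^sup>2) \<le> e\<^sup>2" if "k \<ge> N" for k
    proof -
      have "(\<Sum>i\<in>F. (hnorm (R i) (hminus (R i) (s j i) (s k i)))\<^sup>2) = (\<Sum>i\<in>F. (hnorm (R i) (hminus S (s j) (s k) i))\<^sup>2)"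
        using F by (intro sum.cong) (auto simp: sum_apply subset_iff)
      also have "\<dots> \<le> (hnorm S (hminus S (s j) (s k)))\<^sup>2"
        unfolding norm_eq[OF minus_in[OF sc sc]] using F by (intro finite_sum_le_infsum norm_summable minus_in sc) auto
      also have "\<dots> \<le> e\<^sup>2"
        using N[OF that] by (intro power_mono) (auto simp: hnorm_def inner_self_eq minus_in sc infsum_nonneg)
      finally show ?thesis .
    qed
    then show "\<exists>N. \<forall>k\<ge>N. (\<Sum>i\<in>F. (hnorm (R i) (hminus (R i) (s j i) (s k i)))\<^sup>2) \<le> e\<^sup>2" by blast
  qed
  have dsum: "d j summable_on I" "infsum (d j) I \<le> e\<^sup>2"
    if e: "e > 0" and N: "\<And>k. k \<ge> N \<Longrightarrow> hnorm S (hminus S (s j) (s k)) < e" for e j N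
  proof -
    show *: "d j summable_on I"
      by (rule nonneg_bdd_above_summable_on)
        (use bound[OF _ _ that] in \<open>auto simp: d_def bdd_above_def image_iff\<close>)
    show "infsum (d j) I \<le> e\<^sup>2" by (rule infsum_le_finite_sums[OF *]) (rule bound[OF _ _ that])
  qed
  \<comment> \<open>Square-summability of the limit: it differs from \<open>s N1\<close> by a
    square-summable family.\<close>
  obtain N1 where N1: "\<And>j k. j \<ge> N1 \<Longrightarrow> k \<ge> N1 \<Longrightarrow> hnorm S (hminus S (s j) (s k)) < 1"
    using c unfolding hcauchy_def by (metis zero_less_one)
  have L: "L \<in> hcarrier S"
    unfolding L_def
  proof (rule restrict_carrier)
    show "(\<lambda>i. 2 * (hnorm (R i) (s N1 i))\<^sup>2 + 2 * d N1 i) summable_on I"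
      using dsum(1)[of 1 N1 N1] N1 by (intro summable_on_add summable_on_cmult_right norm_summable sc) auto
    fix i assume i: "i \<in> I"
    interpret hilbert_space "R i" by (rule hilbert[OF i])
    have "hnorm (R i) (l i) \<le> hnorm (R i) (s N1 i) + hnorm (R i) (hminus (R i) (s N1 i) (l i))"
      using norm_diff_le[of "l i" "s N1 i"] norm_minus_commute[of "l i" "s N1 i"] l(1)[OF i] component[OF sc i]
      by (smt (verit, best))
    then have "(hnorm (R i) (l i))\<^sup>2 \<le> (hnorm (R i) (s N1 i) + hnorm (R i) (hminus (R i) (s N1 i) (l i)))\<^sup>2"
      by (intro power_mono norm_nonneg l i)
    then show "(hnorm (R i) (l i))\<^sup>2 \<le> 2 * (hnorm (R i) (s N1 i))\<^sup>2 + 2 * d N1 i"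
      using two_squares order_trans unfolding d_def by blast
  qed (rule l)
  have "hconverges S s L"
    unfolding hconverges_def
  proof (rule LIMSEQ_I)
    fix e :: real assume e: "e > 0"
    then obtain N where N: "\<And>j k. j \<ge> N \<Longrightarrow> k \<ge> N \<Longrightarrow> hnorm S (hminus S (s j) (s k)) < e / 2"
      using c unfolding hcauchy_def by (metis half_gt_zero)
    have "norm (hnorm S (hminus S (s j) L) - 0) < e" if j: "j \<ge> N" for j
    proof -
      have "(hnorm S (hminus S (s j) L))\<^sup>2 = infsum (d j) I"
        unfolding norm_eq[OF minus_in[OF sc L]] by (rule infsum_cong) (simp add: sum_apply L_def d_def)
      also have "\<dots> \<le> (e / 2)\<^sup>2" using e N[OF j] by (intro dsum(2)) auto
      finally have "hnorm S (hminus S (s j) L) \<le> e / 2" by (rule power2_le_imp_le) (use e in simp)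
      moreover have "0 \<le> hnorm S (hminus S (s j) L)"
        by (simp add: hnorm_def inner_self_eq minus_in sc L infsum_nonneg)
      ultimately show ?thesis using e by simp
    qed
    then show "\<exists>N. \<forall>j\<ge>N. norm (hnorm S (hminus S (s j) L) - 0) < e" by blast
  qed
  then show ?thesis using L by blast
qed

lemma hilbert_rep_sum: "hilbert_space S"
proof
  fix u v w c d
  assume u: "u \<in> hcarrier S"
  note cu = component[OF u]
  show "hscale S c u \<in> hcarrier S" by (rule scale_in[OF u])
  show "hplus S u (hzero S) = u"
    by (rule ext) (simp_all add: u plus_in zero_in sum_apply hilbert_space.plus_zero[OF hilbert] cu)
  show "hminus S u u = hzero S"
    by (rule ext) (simp_all add: u minus_in zero_in sum_apply hilbert_space.minus_self[OF hilbert] cu)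
  show "hscale S 1 u = u"
    by (rule ext) (simp_all add: u scale_in zero_in sum_apply hilbert_space.scale_one[OF hilbert] cu)
  show "hscale S c (hscale S d u) = hscale S (c * d) u"
    by (rule ext) (simp_all add: u scale_in zero_in sum_apply hilbert_space.scale_scale[OF hilbert] cu)
  show "hscale S (c + d) u = hplus S (hscale S c u) (hscale S d u)"
    by (rule ext) (simp_all add: u scale_in plus_in sum_apply hilbert_space.plus_scale[OF hilbert] cu)
  show "0 \<le> Re (hinner S u u)" by (simp add: inner_self_eq u infsum_nonneg)
  show "u = hzero S" if "hinner S u u = 0"
  proof (rule ext[OF u zero_in])
    fix i assume i: "i \<in> I"
    have "(\<Sum>\<^sub>\<infinity>i\<in>I. (hnorm (R i) (u i))\<^sup>2) \<le> 0" using that inner_self_eq[OF u] by simp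
    then have "(hnorm (R i) (u i))\<^sup>2 = 0" by (rule nonneg_infsum_le_0D) (use u i norm_summable in auto)
    then show "u i = hzero S i"
      using hilbert_space.norm_eq_zero[OF hilbert[OF i] cu[OF i]] i by (simp add: sum_apply)
  qed
  assume v: "v \<in> hcarrier S"
  note cv = component[OF v]
  show "hplus S u v \<in> hcarrier S" by (rule plus_in[OF u v])
  show "hplus S u v = hplus S v u"
    by (rule ext) (auto simp: u v plus_in sum_apply intro: hilbert_space.plus_commute[OF hilbert] cu cv)
  show "hscale S c (hplus S u v) = hplus S (hscale S c u) (hscale S c v)"
    by (rule ext) (simp_all add: u v scale_in plus_in sum_apply hilbert_space.scale_plus[OF hilbert] cu cv)
  show "hinner S v u = cnj (hinner S u v)"
    unfolding inner_eq infsum_cnj[symmetric]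
    by (rule infsum_cong) (rule hilbert_space.inner_commute[OF hilbert cu cv])
  show "hinner S (hscale S c u) v = c * hinner S u v"
    unfolding inner_eq
    by (subst infsum_cmult_right[symmetric])
      (auto simp: inner_summable u v sum_apply hilbert_space.inner_scale[OF hilbert] cu cv intro!: infsum_cong)
  assume w: "w \<in> hcarrier S"
  note cw = component[OF w]
  show "hplus S (hplus S u v) w = hplus S u (hplus S v w)"
    by (rule ext) (simp_all add: u v w plus_in sum_apply hilbert_space.plus_assoc[OF hilbert] cu cv cw)
  show "hinner S (hplus S u v) w = hinner S u w + hinner S v w"
    unfolding inner_eq
    by (subst infsum_add[symmetric])
      (auto simp: inner_summable u v w sum_apply hilbert_space.inner_plus[OF hilbert] cu cv cw intro!: infsum_cong)
qed (use zero_in complete_sum in auto)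

definition embed :: "'i \<Rightarrow> 'v \<Rightarrow> 'i \<Rightarrow> 'v" where
  "embed i u = (\<lambda>j\<in>I. if j = i then u else hzero (R j))"

lemma embed_in:
  assumes i: "i \<in> I" and u: "u \<in> hcarrier (R i)"
  shows "embed i u \<in> hcarrier S"
  unfolding embed_def
proof (rule restrict_carrier)
  show "(\<lambda>j. if j = i then (hnorm (R i) u)\<^sup>2 else 0) summable_on I"
    by (subst summable_on_cong_neutral[where T = "{i}" and g = "\<lambda>_. (hnorm (R i) u)\<^sup>2"]) (use i in auto)
qed (use i u in \<open>auto simp: hilbert_space.zero_closed[OF hilbert] hnorm_def hilbert_space.inner_zero_left[OF hilbert]\<close>)

lemma inner_embed:
  assumes i: "i \<in> I" and u: "u \<in> hcarrier (R i)" and v: "v \<in> hcarrier S"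
  shows "hinner S (embed i u) v = hinner (R i) u (v i)"
proof -
  have "hinner S (embed i u) v = infsum (\<lambda>j. hinner (R i) u (v i)) {i}"
    unfolding inner_eq
    by (rule infsum_cong_neutral)
      (use i u in \<open>auto simp: embed_def hilbert_space.inner_zero_left[OF hilbert] component v\<close>)
  then show ?thesis by simp
qed

text \<open>By \<open>inner_embed\<close>, a vector orthogonal to the embedded family has each
  component orthogonal to \<open>X i\<close>.\<close>

lemma total_embed:
  assumes "\<And>i. i \<in> I \<Longrightarrow> total_in (R i) (X i)"
  shows "total_in S {embed i x |i x. i \<in> I \<and> x \<in> X i}"
  unfolding total_in_def
proof (intro conjI ballI impI)
  show "{embed i x |i x. i \<in> I \<and> x \<in> X i} \<subseteq> hcarrier S"
    using assms by (auto intro!: embed_in dest: total_in_subset)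
  fix v assume v: "v \<in> hcarrier S" and o: "\<forall>x\<in>{embed i x |i x. i \<in> I \<and> x \<in> X i}. hinner S x v = 0"
  show "v = hzero S"
  proof (rule ext[OF v zero_in])
    fix i assume i: "i \<in> I"
    have "hinner (R i) x (v i) = 0" if x: "x \<in> X i" for x
    proof -
      have "embed i x \<in> {embed i x |i x. i \<in> I \<and> x \<in> X i}" using i x by blast
      then have "hinner S (embed i x) v = 0" by (rule bspec[OF o])
      then show ?thesis using inner_embed[OF i total_in_subset[OF assms[OF i] x] v] by simp
    qed
    then have "v i = hzero (R i)"
      using assms[OF i] component[OF v i] by (auto simp: total_in_def)
    then show "v i = hzero S i" using i by (simp add: sum_apply)
  qed
qed

end

lemma rep_sum_isometric:
  assumes "\<And>i. i \<in> I \<Longrightarrow> isometric_rep G (R i)"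
  shows "isometric_rep G (rep_sum I R)"
proof -
  interpret hilbert_family I R by (rule hilbert_family.intro) (use assms isometric_rep_hilbert in blast)
  note a = isometric_rep_act[OF assms]
  have "isometry_map S S (act S g)" if g: "g \<in> carrier G" for g
    unfolding isometry_map_def
  proof (intro conjI ballI)
    show "act S g ` hcarrier S \<subseteq> hcarrier S"
    proof clarify
      fix u assume u: "u \<in> hcarrier S"
      have "(\<lambda>i\<in>I. act (R i) g (u i)) \<in> hcarrier S"
        by (rule restrict_carrier[OF _ norm_summable[OF u]])
          (simp_all add: hilbert_isometry.into[OF a] hilbert_isometry.norm[OF a] g component u)
      then show "act S g u \<in> hcarrier S" by (simp add: rep_sum_def)
    qed
    show "hinner S (act S g u) (act S g v) = hinner S u v" if "u \<in> hcarrier S" "v \<in> hcarrier S" for u v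
      unfolding inner_eq
      by (rule infsum_cong) (simp add: sum_apply hilbert_isometry.inner[OF a] g component that)
  qed
  then show ?thesis using hilbert_rep_sum by (simp add: isometric_rep_def)
qed

lemma rep_sum_act_embed:
  assumes "\<And>i. i \<in> I \<Longrightarrow> isometric_rep G (R i)" "g \<in> carrier G"
  shows "act (rep_sum I R) g (hilbert_family.embed I R i u) = hilbert_family.embed I R i (act (R i) g u)"
proof -
  interpret hilbert_family I R by (rule hilbert_family.intro) (use assms isometric_rep_hilbert in blast)
  show ?thesis
    unfolding embed_def
    by (auto simp: rep_sum_def fun_eq_iff hilbert_isometry.zero[OF isometric_rep_act[OF assms]])
qed

lemma rep_sum2_isometric:
  fixes R :: "('a, 'b) rep" and S :: "('a, 'c) rep"
  assumes R: "isometric_rep G R" and S: "isometric_rep G S"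
  shows "isometric_rep G (rep_sum2 R S)"
proof -
  let ?P = "rep_sum2 R S"
  interpret R: hilbert_space R using R by (rule isometric_rep_hilbert)
  interpret S: hilbert_space S using S by (rule isometric_rep_hilbert)
  have minus: "hminus ?P u v = (hminus R (fst u) (fst v), hminus S (snd u) (snd v))" for u v
    by (simp add: hminus_def rep_sum2_def)
  have norm: "(hnorm ?P u)\<^sup>2 = (hnorm R (fst u))\<^sup>2 + (hnorm S (snd u))\<^sup>2" if "u \<in> hcarrier ?P" for u
    using that by (auto simp: hnorm_def rep_sum2_def R.inner_nonneg S.inner_nonneg)
  have nle: "hnorm ?P u \<le> hnorm R (fst u) + hnorm S (snd u)" if "u \<in> hcarrier ?P" for u
  proof (rule power2_le_imp_le)
    show "(hnorm ?P u)\<^sup>2 \<le> (hnorm R (fst u) + hnorm S (snd u))\<^sup>2"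
      using that mult_nonneg_nonneg[OF R.norm_nonneg[of "fst u"] S.norm_nonneg[of "snd u"]]
      by (simp add: norm power2_sum) (auto simp: rep_sum2_def)
  qed (use that in \<open>auto simp: rep_sum2_def R.norm_nonneg S.norm_nonneg\<close>)
  have n0: "0 \<le> hnorm ?P u" if "u \<in> hcarrier ?P" for u
    using that by (auto simp: rep_sum2_def hnorm_def R.inner_nonneg S.inner_nonneg)
  have nge: "hnorm R (fst u) \<le> hnorm ?P u" "hnorm S (snd u) \<le> hnorm ?P u" if "u \<in> hcarrier ?P" for u
  proof -
    show "hnorm R (fst u) \<le> hnorm ?P u" "hnorm S (snd u) \<le> hnorm ?P u"
      by (rule_tac [!] power2_le_imp_le) (simp_all add: norm[OF that] n0[OF that])
  qed
  have hs: "hilbert_space ?P"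
  proof
    show "u = hzero ?P" if "u \<in> hcarrier ?P" "hinner ?P u u = 0" for u
    proof -
      have u: "fst u \<in> hcarrier R" "snd u \<in> hcarrier S" using that by (auto simp: rep_sum2_def)
      have "complex_of_real ((hnorm R (fst u))\<^sup>2 + (hnorm S (snd u))\<^sup>2) = 0"
        using that u by (simp add: rep_sum2_def R.inner_self S.inner_self)
      then have "(hnorm R (fst u))\<^sup>2 + (hnorm S (snd u))\<^sup>2 = 0" by (simp only: of_real_eq_0_iff)
      then show ?thesis using u by (auto simp: rep_sum2_def R.norm_eq_zero S.norm_eq_zero prod_eq_iff)
    qed
    fix s assume s: "range s \<subseteq> hcarrier ?P" "hcauchy ?P s"
    then have "s k \<in> hcarrier ?P" for k by blast
    then have sc: "s k \<in> hcarrier ?P" "fst (s k) \<in> hcarrier R" "snd (s k) \<in> hcarrier S" for k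
      by (auto simp: rep_sum2_def mem_Times_iff)
    have mc: "hminus ?P (s j) (s k) \<in> hcarrier ?P" for j k
      unfolding minus using sc by (auto simp: rep_sum2_def intro!: R.minus_closed S.minus_closed)
    have "hcauchy R (\<lambda>k. fst (s k))" "hcauchy S (\<lambda>k. snd (s k))"
      using s(2) nge[OF mc] unfolding hcauchy_def minus fst_conv snd_conv by (meson order_le_less_trans)+
    then obtain l m where l: "l \<in> hcarrier R" "hconverges R (\<lambda>k. fst (s k)) l"
      and m: "m \<in> hcarrier S" "hconverges S (\<lambda>k. snd (s k)) m"
      using R.complete[of "\<lambda>k. fst (s k)"] S.complete[of "\<lambda>k. snd (s k)"] sc by blast
    have "hconverges ?P s (l, m)"
      unfolding hconverges_def
    proof (rule tendsto_sandwich[OF always_eventually always_eventually tendsto_const])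
      show "(\<lambda>k. hnorm R (hminus R (fst (s k)) l) + hnorm S (hminus S (snd (s k)) m)) \<longlonglongrightarrow> 0"
        using l m unfolding hconverges_def by (intro tendsto_add_zero)
      have c: "hminus ?P (s k) (l, m) \<in> hcarrier ?P" for k
        unfolding minus using sc l m by (auto simp: rep_sum2_def intro!: R.minus_closed S.minus_closed)
      show "\<forall>k. hnorm ?P (hminus ?P (s k) (l, m)) \<le> hnorm R (hminus R (fst (s k)) l) + hnorm S (hminus S (snd (s k)) m)"
        using nle[OF c] by (simp add: minus)
      show "\<forall>k. 0 \<le> hnorm ?P (hminus ?P (s k) (l, m))"
        using n0[OF c] by blast
    qed
    then show "\<exists>l\<in>hcarrier ?P. hconverges ?P s l" using l m by (auto simp: rep_sum2_def)
  next
    fix u v w :: "'b \<times> 'c" and c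
    assume u: "u \<in> hcarrier ?P" and v: "v \<in> hcarrier ?P"
    show "hinner ?P v u = cnj (hinner ?P u v)"
      using u v R.inner_commute[of "fst u" "fst v"] S.inner_commute[of "snd u" "snd v"] by (auto simp: rep_sum2_def)
    show "hplus ?P u v = hplus ?P v u"
      using u v R.plus_commute[of "fst u" "fst v"] S.plus_commute[of "snd u" "snd v"] by (auto simp: rep_sum2_def)
    show "hinner ?P (hscale ?P c u) v = c * hinner ?P u v"
      using u v by (auto simp: rep_sum2_def R.inner_scale S.inner_scale distrib_left)
    show "hinner ?P (hplus ?P u v) w = hinner ?P u w + hinner ?P v w" if "w \<in> hcarrier ?P"
      using u v that by (auto simp: rep_sum2_def R.inner_plus S.inner_plus)
  qed (auto simp: rep_sum2_def minus[unfolded rep_sum2_def] R.closed S.closed R.plus_assoc S.plus_assoc R.plus_zero S.plus_zero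
        R.minus_self S.minus_self R.scale_one S.scale_one R.scale_scale S.scale_scale R.scale_plus S.scale_plus
        R.plus_scale S.plus_scale R.inner_nonneg S.inner_nonneg)
  have "isometry_map ?P ?P (act ?P g)" if g: "g \<in> carrier G" for g
    using hilbert_isometry.into[OF isometric_rep_act[OF R g]] hilbert_isometry.into[OF isometric_rep_act[OF S g]]
      hilbert_isometry.inner[OF isometric_rep_act[OF R g]] hilbert_isometry.inner[OF isometric_rep_act[OF S g]]
    by (auto simp: isometry_map_def rep_sum2_def)
  then show ?thesis using hs by (simp add: isometric_rep_def)
qed

lemma rep_sum2_total:
  assumes R: "isometric_rep G R" and S: "isometric_rep G S" and X: "total_in R X" and Y: "total_in S Y"
  shows "total_in (rep_sum2 R S) ((\<lambda>x. (x, hzero S)) ` X \<union> (\<lambda>y. (hzero R, y)) ` Y)"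
proof -
  interpret R: hilbert_space R using R by (rule isometric_rep_hilbert)
  interpret S: hilbert_space S using S by (rule isometric_rep_hilbert)
  show ?thesis
    unfolding total_in_def
  proof (intro conjI ballI impI)
    fix v assume v: "v \<in> hcarrier (rep_sum2 R S)"
      and o: "\<forall>x\<in>(\<lambda>x. (x, hzero S)) ` X \<union> (\<lambda>y. (hzero R, y)) ` Y. hinner (rep_sum2 R S) x v = 0"
    have c: "fst v \<in> hcarrier R" "snd v \<in> hcarrier S" using v by (auto simp: rep_sum2_def)
    have "hinner R x (fst v) = 0" if "x \<in> X" for x
      using o that c by (force simp: rep_sum2_def S.inner_simps)
    moreover have "hinner S y (snd v) = 0" if "y \<in> Y" for y
      using o that c by (force simp: rep_sum2_def R.inner_simps)
    ultimately have "fst v = hzero R" "snd v = hzero S" using X Y c by (auto simp: total_in_def)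
    then show "v = hzero (rep_sum2 R S)" by (simp add: rep_sum2_def prod_eq_iff)
  qed (use X Y R.zero_closed S.zero_closed in \<open>auto simp: rep_sum2_def total_in_def\<close>)
qed

section \<open>Square-integrable functions\<close>

lemma cmod_diff_sq_le: "(cmod (a - b))\<^sup>2 \<le> 2 * (cmod a)\<^sup>2 + 2 * (cmod b)\<^sup>2"
proof -
  have "(cmod (a - b))\<^sup>2 \<le> (cmod a + cmod b)\<^sup>2" by (intro power_mono norm_triangle_ineq4) simp
  also note two_squares
  finally show ?thesis .
qed

lemma integrable_sq_diff:
  fixes f g :: "'x \<Rightarrow> complex"
  assumes [measurable]: "f \<in> borel_measurable M" "g \<in> borel_measurable M"
    and i: "integrable M (\<lambda>x. (cmod (f x))\<^sup>2)" "integrable M (\<lambda>x. (cmod (g x))\<^sup>2)"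
  shows "integrable M (\<lambda>x. (cmod (f x - g x))\<^sup>2)"
proof (rule Bochner_Integration.integrable_bound)
  show "integrable M (\<lambda>x. 2 * (cmod (f x))\<^sup>2 + 2 * (cmod (g x))\<^sup>2)" using i by simp
  show "AE x in M. norm ((cmod (f x - g x))\<^sup>2) \<le> norm (2 * (cmod (f x))\<^sup>2 + 2 * (cmod (g x))\<^sup>2)"
    using cmod_diff_sq_le by simp
qed measurable

lemma cnj_borel_measurable [measurable]: "cnj \<in> borel_measurable borel"
  by (intro borel_measurable_continuous_onI continuous_intros)

lemma integrable_inner_product:
  fixes f g :: "'x \<Rightarrow> complex"
  assumes [measurable]: "f \<in> borel_measurable M" "g \<in> borel_measurable M"
    and i: "integrable M (\<lambda>x. (cmod (f x))\<^sup>2)" "integrable M (\<lambda>x. (cmod (g x))\<^sup>2)"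
  shows "integrable M (\<lambda>x. f x * cnj (g x))"
proof (rule Bochner_Integration.integrable_bound)
  show "integrable M (\<lambda>x. (cmod (f x))\<^sup>2 + (cmod (g x))\<^sup>2)" using i by simp
  have "cmod a * cmod b \<le> (cmod a)\<^sup>2 + (cmod b)\<^sup>2" for a b :: complex
    using sum_squares_bound[of "cmod a" "cmod b"] mult_nonneg_nonneg[OF norm_ge_zero norm_ge_zero, of a b] by linarith
  then show "AE x in M. norm (f x * cnj (g x)) \<le> norm ((cmod (f x))\<^sup>2 + (cmod (g x))\<^sup>2)"
    by (simp add: norm_mult)
qed measurable

text \<open>Defined at every point, so that limits of equivariant functions can be equivariant
  everywhere and not just almost everywhere; the default value 0 is compatible with multiplication
  by signs.\<close>

definition sequence_limit :: "(nat \<Rightarrow> 'x \<Rightarrow> complex) \<Rightarrow> 'x \<Rightarrow> complex" where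
  "sequence_limit s x = (if Cauchy (\<lambda>k. s k x) then lim (\<lambda>k. s k x) else 0)"

lemma sequence_limit_measurable [measurable (raw)]:
  assumes [measurable]: "\<And>k. s k \<in> borel_measurable M"
  shows "sequence_limit s \<in> borel_measurable M"
  unfolding sequence_limit_def[abs_def] by measurable

text \<open>The limit is taken pointwise along a subsequence, so that it inherits pointwise identities
  such as equivariance.\<close>

theorem riesz_fischer:
  fixes s :: "nat \<Rightarrow> 'x \<Rightarrow> complex"
  assumes m[measurable]: "\<And>k. s k \<in> borel_measurable M"
    and sq: "\<And>k. integrable M (\<lambda>x. (cmod (s k x))\<^sup>2)"
    and cauchy: "\<And>e. e > 0 \<Longrightarrow> \<exists>N. \<forall>j\<ge>N. \<forall>k\<ge>N. (LINT x|M. (cmod (s j x - s k x))\<^sup>2) < e"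
  obtains r where "strict_mono r" "integrable M (\<lambda>x. (cmod (sequence_limit (\<lambda>k. s (r k)) x))\<^sup>2)"
    "(\<lambda>k. LINT x|M. (cmod (s k x - sequence_limit (\<lambda>k. s (r k)) x))\<^sup>2) \<longlonglongrightarrow> 0"
proof -
  let ?I = "\<lambda>j k. LINT x|M. (cmod (s j x - s k x))\<^sup>2"
  note sqd = integrable_sq_diff[OF m m sq sq]
  \<comment> \<open>Squared distances below \<open>8^-n\<close>, weighted by \<open>4^n\<close> in
    \<open>d\<close>, still sum geometrically; where the weighted sum is finite, the increments are
    bounded by a multiple of \<open>2^-n\<close>.\<close>
  have "\<exists>r. \<forall>n. (\<forall>i\<ge>r n. \<forall>j\<ge>r n. ?I i j < (1 / 8) ^ n) \<and> r n < r (Suc n)"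
  proof (rule dependent_nat_choice)
    show "\<exists>x. \<forall>i\<ge>x. \<forall>j\<ge>x. ?I i j < (1 / 8) ^ 0" using cauchy[of 1] by simp
    fix x n
    obtain N where N: "\<forall>j\<ge>N. \<forall>k\<ge>N. ?I j k < (1 / 8) ^ Suc n" using cauchy[of "(1 / 8) ^ Suc n"] by auto
    then show "\<exists>y. (\<forall>i\<ge>y. \<forall>j\<ge>y. ?I i j < (1 / 8) ^ Suc n) \<and> x < y"
      by (intro exI[of _ "max N (Suc x)"]) auto
  qed
  then obtain r where r: "\<And>n i j. i \<ge> r n \<Longrightarrow> j \<ge> r n \<Longrightarrow> ?I i j < (1 / 8) ^ n" "\<And>n. r n < r (Suc n)"
    by metis
  have mono: "strict_mono r" using r(2) by (simp add: strict_mono_Suc_iff)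
  define f where "f = sequence_limit (\<lambda>k. s (r k))"
  have [measurable]: "f \<in> borel_measurable M" unfolding f_def by measurable
  define d where "d n x = 4 ^ n * (cmod (s (r (Suc n)) x - s (r n) x))\<^sup>2" for n x
  have [measurable]: "d n \<in> borel_measurable M" for n unfolding d_def by measurable
  have dn: "(\<integral>\<^sup>+x. ennreal (d n x) \<partial>M) \<le> ennreal ((1 / 2) ^ n)" for n
  proof -
    have "(\<integral>\<^sup>+x. ennreal (d n x) \<partial>M) = ennreal (LINT x|M. d n x)"
      by (rule nn_integral_eq_integral) (auto simp: d_def sqd)
    also have "(LINT x|M. d n x) = 4 ^ n * ?I (r (Suc n)) (r n)" by (simp add: d_def)
    also have "\<dots> \<le> 4 ^ n * (1 / 8) ^ n"
      using r(1)[of n "r (Suc n)" "r n"] less_imp_le[OF r(2)[of n]] by (intro mult_left_mono) (auto intro: less_imp_le)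
    also have "\<dots> = (1 / 2) ^ n" by (simp flip: power_mult_distrib)
    finally show ?thesis by (simp add: ennreal_leI)
  qed
  have "(\<integral>\<^sup>+x. (\<Sum>n. ennreal (d n x)) \<partial>M) = (\<Sum>n. \<integral>\<^sup>+x. ennreal (d n x) \<partial>M)"
    by (rule nn_integral_suminf) measurable
  also have "\<dots> \<le> (\<Sum>n. ennreal ((1 / 2) ^ n))" by (intro suminf_le dn) auto
  also have "\<dots> = ennreal (\<Sum>n. (1 / 2) ^ n)" by (intro suminf_ennreal2) (auto simp: summable_geometric)
  also have "\<dots> < \<infinity>" by simp
  finally have "AE x in M. (\<Sum>n. ennreal (d n x)) \<noteq> \<infinity>" by (intro nn_integral_PInf_AE) auto
  then have conv: "AE x in M. (\<lambda>k. s (r k) x) \<longlonglongrightarrow> f x"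
  proof eventually_elim
    case (elim x)
    obtain c where c: "c \<ge> 0" "(\<Sum>n. ennreal (d n x)) = ennreal c"
      using elim by (cases "\<Sum>n. ennreal (d n x)") auto
    have C: "d n x \<le> c" for n
    proof -
      have "ennreal (d n x) \<le> ennreal c"
        using sum_le_suminf[of "\<lambda>n. ennreal (d n x)" "{n}"] c by simp
      then show ?thesis using c(1) by (simp add: ennreal_le_iff)
    qed
    have "norm (s (r (Suc n)) x - s (r n) x) \<le> sqrt c * (1 / 2) ^ n" for n
    proof (rule power2_le_imp_le)
      have p: "(4::real) ^ n * (1 / 4) ^ n = 1" by (simp flip: power_mult_distrib)
      have "(cmod (s (r (Suc n)) x - s (r n) x))\<^sup>2 = ((4::real) ^ n * (1 / 4) ^ n) * (cmod (s (r (Suc n)) x - s (r n) x))\<^sup>2"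
        unfolding p by simp
      also have "\<dots> = d n x * (1 / 4) ^ n" by (simp only: d_def ac_simps)
      also have "\<dots> \<le> c * (1 / 4) ^ n" using C by (intro mult_right_mono) auto
      also have "(1 / 4 :: real) ^ n = ((1 / 2) ^ n)\<^sup>2"
        by (simp add: power2_eq_square flip: power_mult_distrib)
      finally show "(norm (s (r (Suc n)) x - s (r n) x))\<^sup>2 \<le> (sqrt c * (1 / 2) ^ n)\<^sup>2"
        using c(1) by (simp add: power_mult_distrib)
    qed (use c in simp)
    then have "summable (\<lambda>n. s (r (Suc n)) x - s (r n) x)"
      by (intro summable_comparison_test'[OF summable_mult[OF summable_geometric[of "1 / 2 :: real"]], of 0 _ "sqrt c"]) auto
    then have "(\<lambda>m. \<Sum>n<m. s (r (Suc n)) x - s (r n) x) \<longlonglongrightarrow> (\<Sum>n. s (r (Suc n)) x - s (r n) x)"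
      by (rule summable_LIMSEQ)
    then have "(\<lambda>m. s (r m) x - s (r 0) x) \<longlonglongrightarrow> (\<Sum>n. s (r (Suc n)) x - s (r n) x)"
      by (simp add: sum_lessThan_telescope[of "\<lambda>n. s (r n) x"])
    then have "(\<lambda>m. (s (r m) x - s (r 0) x) + s (r 0) x) \<longlonglongrightarrow> (\<Sum>n. s (r (Suc n)) x - s (r n) x) + s (r 0) x"
      by (intro tendsto_add tendsto_const)
    then have "convergent (\<lambda>m. s (r m) x)" by (auto simp: convergent_def)
    then show "(\<lambda>k. s (r k) x) \<longlonglongrightarrow> f x"
      by (simp add: f_def sequence_limit_def Cauchy_convergent_iff convergent_LIMSEQ_iff)
  qed
  \<comment> \<open>Fatou's lemma along the subsequence replaces the second index by the limit
    \<open>f\<close>.\<close>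
  have fatou: "(\<integral>\<^sup>+x. ennreal ((cmod (s j x - f x))\<^sup>2) \<partial>M) \<le> ennreal e"
    if N: "\<And>k. k \<ge> N \<Longrightarrow> ?I j k < e" for j N e
  proof -
    have "(\<integral>\<^sup>+x. ennreal ((cmod (s j x - f x))\<^sup>2) \<partial>M)
      = (\<integral>\<^sup>+x. liminf (\<lambda>k. ennreal ((cmod (s j x - s (r k) x))\<^sup>2)) \<partial>M)"
    proof (rule nn_integral_cong_AE)
      show "AE x in M. ennreal ((cmod (s j x - f x))\<^sup>2) = liminf (\<lambda>k. ennreal ((cmod (s j x - s (r k) x))\<^sup>2))"
        using conv
      proof eventually_elim
        case (elim x)
        have "(\<lambda>k. ennreal ((cmod (s j x - s (r k) x))\<^sup>2)) \<longlonglongrightarrow> ennreal ((cmod (s j x - f x))\<^sup>2)"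
          by (intro tendsto_ennrealI tendsto_power tendsto_norm tendsto_diff tendsto_const elim)
        then show ?case by (rule lim_imp_Liminf[OF sequentially_bot, symmetric])
      qed
    qed
    also have "\<dots> \<le> liminf (\<lambda>k. \<integral>\<^sup>+x. ennreal ((cmod (s j x - s (r k) x))\<^sup>2) \<partial>M)"
      by (rule nn_integral_liminf) measurable
    also have "\<dots> \<le> limsup (\<lambda>k. \<integral>\<^sup>+x. ennreal ((cmod (s j x - s (r k) x))\<^sup>2) \<partial>M)"
      by (rule Liminf_le_Limsup) simp
    also have "\<dots> \<le> ennreal e"
    proof (rule Limsup_bounded, rule eventually_sequentiallyI[of N])
      fix k assume "N \<le> k"
      then have "N \<le> r k" using strict_mono_imp_increasing[OF mono, of k] by simp
      have "(\<integral>\<^sup>+x. ennreal ((cmod (s j x - s (r k) x))\<^sup>2) \<partial>M) = ennreal (?I j (r k))"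
        by (rule nn_integral_eq_integral) (auto simp: sqd)
      also have "\<dots> \<le> ennreal e" using N[OF \<open>N \<le> r k\<close>] by (intro ennreal_leI) simp
      finally show "(\<integral>\<^sup>+x. ennreal ((cmod (s j x - s (r k) x))\<^sup>2) \<partial>M) \<le> ennreal e" .
    qed
    finally show ?thesis .
  qed
  have ifd: "integrable M (\<lambda>x. (cmod (s j x - f x))\<^sup>2)" if N: "\<And>k. k \<ge> N \<Longrightarrow> ?I j k < e" for j N e
  proof (rule integrableI_nonneg)
    have "(\<integral>\<^sup>+x. ennreal ((cmod (s j x - f x))\<^sup>2) \<partial>M) \<le> ennreal e" by (rule fatou[OF N])
    then show "(\<integral>\<^sup>+x. ennreal ((cmod (s j x - f x))\<^sup>2) \<partial>M) < \<infinity>"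
      using ennreal_less_top order_le_less_trans by (metis infinity_ennreal_def)
  qed auto
  obtain N1 where N1: "\<forall>j\<ge>N1. \<forall>k\<ge>N1. ?I j k < 1" using cauchy[of 1] by auto
  have i1: "integrable M (\<lambda>x. (cmod (s N1 x - f x))\<^sup>2)" using ifd[of N1 N1 1] N1 by auto
  have "integrable M (\<lambda>x. (cmod (s N1 x - (s N1 x - f x)))\<^sup>2)"
    by (rule integrable_sq_diff) (use i1 sq in auto)
  then have fi: "integrable M (\<lambda>x. (cmod (f x))\<^sup>2)" by simp
  have "(\<lambda>k. LINT x|M. (cmod (s k x - f x))\<^sup>2) \<longlonglongrightarrow> 0"
  proof (rule LIMSEQ_I)
    fix e :: real assume e: "e > 0"
    then obtain N where N: "\<forall>j\<ge>N. \<forall>k\<ge>N. ?I j k < e / 2" using cauchy[of "e / 2"] by auto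
    have "norm ((LINT x|M. (cmod (s k x - f x))\<^sup>2) - 0) < e" if "k \<ge> N" for k
    proof -
      have "ennreal (LINT x|M. (cmod (s k x - f x))\<^sup>2) = (\<integral>\<^sup>+x. ennreal ((cmod (s k x - f x))\<^sup>2) \<partial>M)"
        by (rule nn_integral_eq_integral[symmetric]) (use integrable_sq_diff[OF m _ sq fi] in auto)
      also have "\<dots> \<le> ennreal (e / 2)" using N that by (intro fatou[of N]) auto
      finally have "(LINT x|M. (cmod (s k x - f x))\<^sup>2) \<le> e / 2" using e by (simp add: ennreal_le_iff)
      moreover have "0 \<le> (LINT x|M. (cmod (s k x - f x))\<^sup>2)" by simp
      ultimately show ?thesis using e by simp
    qed
    then show "\<exists>no. \<forall>k\<ge>no. norm ((LINT x|M. (cmod (s k x - f x))\<^sup>2) - 0) < e" by blast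
  qed
  then show ?thesis using that[OF mono] fi by (simp add: f_def)
qed

text \<open>Completeness is a requirement on \<open>S\<close>, since \<open>S\<close> may be cut out
  by pointwise conditions; it is met by \<open>riesz_fischer\<close> both for the equivariant
  functions and on the line.\<close>

locale L2_space =
  fixes M :: "'x measure" and S :: "('x \<Rightarrow> complex) set"
  assumes meas: "f \<in> S \<Longrightarrow> f \<in> borel_measurable M"
    and sq: "f \<in> S \<Longrightarrow> integrable M (\<lambda>x. (cmod (f x))\<^sup>2)"
    and zero_S: "(\<lambda>x. 0) \<in> S"
    and add_S: "\<lbrakk>f \<in> S; g \<in> S\<rbrakk> \<Longrightarrow> (\<lambda>x. f x + g x) \<in> S"
    and scale_S: "f \<in> S \<Longrightarrow> (\<lambda>x. c * f x) \<in> S"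
    and complete_S: "\<lbrakk>\<And>k. s k \<in> S; \<And>e. e > 0 \<Longrightarrow> \<exists>N. \<forall>j\<ge>N. \<forall>k\<ge>N. (LINT x|M. (cmod (s j x - s k x))\<^sup>2) < e\<rbrakk>
      \<Longrightarrow> \<exists>f\<in>S. (\<lambda>k. LINT x|M. (cmod (s k x - f x))\<^sup>2) \<longlonglongrightarrow> 0"
begin

abbreviation "H \<equiv> L2_classes M S"

definition cls :: "('x \<Rightarrow> complex) \<Rightarrow> ('x \<Rightarrow> complex) set" where
  "cls f = {g \<in> S. AE x in M. f x = g x}"

lemma cls_self: "f \<in> S \<Longrightarrow> f \<in> cls f"
  by (simp add: cls_def)

lemma cls_eqI:
  assumes "AE x in M. f x = g x"
  shows "cls f = cls g"
proof -
  have "(AE x in M. f x = h x) \<longleftrightarrow> (AE x in M. g x = h x)" for h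
  proof
    show "AE x in M. g x = h x" if "AE x in M. f x = h x" using that assms by eventually_elim simp
    show "AE x in M. f x = h x" if "AE x in M. g x = h x" using that assms by eventually_elim simp
  qed
  then show ?thesis by (simp add: cls_def)
qed

lemma cls_eq_iff: "f \<in> S \<Longrightarrow> g \<in> S \<Longrightarrow> cls f = cls g \<longleftrightarrow> (AE x in M. f x = g x)"
  using cls_eqI cls_self[of g] by (auto simp: cls_def)

lemma cls_memD: "g \<in> cls f \<Longrightarrow> g \<in> S \<and> (AE x in M. f x = g x) \<and> cls g = cls f"
  using cls_eqI[of f g] by (auto simp: cls_def)

lemma carrier_eq: "hcarrier H = cls ` S"
  by (auto simp: L2_classes_def quotient_def cls_def Image_def)

lemma carrierE:
  assumes "C \<in> hcarrier H"
  obtains f where "f \<in> S" "C = cls f"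
  using assms by (auto simp: carrier_eq)

lemma zero_eq: "hzero H = cls (\<lambda>x. 0)"
  by (simp add: L2_classes_def cls_def eq_commute[of "0 :: complex"])

lemma plus_eq:
  assumes "f \<in> S" "g \<in> S"
  shows "hplus H (cls f) (cls g) = cls (\<lambda>x. f x + g x)"
proof -
  have "(\<exists>f'\<in>cls f. \<exists>g'\<in>cls g. AE x in M. h x = f' x + g' x) \<longleftrightarrow> (AE x in M. f x + g x = h x)" (is "?L \<longleftrightarrow> ?R") for h
  proof
    assume ?L
    then obtain f' g' where "AE x in M. f x = f' x" "AE x in M. g x = g' x" "AE x in M. h x = f' x + g' x"
      by (auto simp: cls_def)
    then show ?R by eventually_elim simp
  next
    assume ?R
    then have "AE x in M. h x = f x + g x" by eventually_elim simp
    then show ?L using cls_self assms by blast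
  qed
  then show ?thesis by (auto simp: L2_classes_def cls_def)
qed

lemma scale_eq:
  assumes "f \<in> S"
  shows "hscale H c (cls f) = cls (\<lambda>x. c * f x)"
proof -
  have "(\<exists>f'\<in>cls f. AE x in M. h x = c * f' x) \<longleftrightarrow> (AE x in M. c * f x = h x)" (is "?L \<longleftrightarrow> ?R") for h
  proof
    assume ?L
    then obtain f' where "AE x in M. f x = f' x" "AE x in M. h x = c * f' x"
      by (auto simp: cls_def)
    then show ?R by eventually_elim simp
  next
    assume ?R
    then have "AE x in M. h x = c * f x" by eventually_elim simp
    then show ?L using cls_self assms by blast
  qed
  then show ?thesis by (auto simp: L2_classes_def cls_def)
qed

lemma diff_S: "f \<in> S \<Longrightarrow> g \<in> S \<Longrightarrow> (\<lambda>x. f x - g x) \<in> S"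
  using add_S[of f "\<lambda>x. (-1) * g x"] scale_S[of g "-1"] by simp

lemma minus_eq: "f \<in> S \<Longrightarrow> g \<in> S \<Longrightarrow> hminus H (cls f) (cls g) = cls (\<lambda>x. f x - g x)"
  using plus_eq[of f "\<lambda>x. (-1) * g x"] scale_S[of g "-1"] by (simp add: hminus_def scale_eq)

lemma inner_integrable: "f \<in> S \<Longrightarrow> g \<in> S \<Longrightarrow> integrable M (\<lambda>x. f x * cnj (g x))"
  by (intro integrable_inner_product meas sq)

lemma inner_eq:
  assumes "f \<in> S" "g \<in> S"
  shows "hinner H (cls f) (cls g) = (LINT x|M. f x * cnj (g x))"
proof -
  define f' where "f' = (SOME u. u \<in> cls f)"
  define g' where "g' = (SOME u. u \<in> cls g)"
  have f': "f' \<in> S" "AE x in M. f x = f' x" and g': "g' \<in> S" "AE x in M. g x = g' x"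
    using someI[of "\<lambda>u. u \<in> cls f", OF cls_self[OF assms(1)]] someI[of "\<lambda>u. u \<in> cls g", OF cls_self[OF assms(2)]]
    by (auto simp: f'_def g'_def cls_def)
  have "(LINT x|M. f' x * cnj (g' x)) = (LINT x|M. f x * cnj (g x))"
  proof (rule integral_cong_AE)
    show "AE x in M. f' x * cnj (g' x) = f x * cnj (g x)" using f'(2) g'(2) by eventually_elim simp
    show "(\<lambda>x. f' x * cnj (g' x)) \<in> borel_measurable M" "(\<lambda>x. f x * cnj (g x)) \<in> borel_measurable M"
      using inner_integrable[OF f'(1) g'(1)] inner_integrable[OF assms] by auto
  qed
  then show ?thesis by (simp add: L2_classes_def f'_def g'_def)
qed

lemma inner_self_eq: "f \<in> S \<Longrightarrow> hinner H (cls f) (cls f) = of_real (LINT x|M. (cmod (f x))\<^sup>2)"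
  by (simp only: inner_eq complex_norm_square[symmetric] integral_complex_of_real)

lemma norm_eq: "f \<in> S \<Longrightarrow> hnorm H (cls f) = sqrt (LINT x|M. (cmod (f x))\<^sup>2)"
  by (simp add: hnorm_def inner_self_eq)

lemma complete_H:
  assumes "range s \<subseteq> hcarrier H" "hcauchy H s"
  shows "\<exists>l\<in>hcarrier H. hconverges H s l"
proof -
  have "\<forall>k. \<exists>f. f \<in> S \<and> s k = cls f" using assms(1) by (auto simp: carrier_eq)
  then obtain f where f: "\<And>k. f k \<in> S" "\<And>k. s k = cls (f k)" by metis
  have n: "hnorm H (hminus H (s j) (s k)) = sqrt (LINT x|M. (cmod (f j x - f k x))\<^sup>2)" for j k
    by (simp add: f minus_eq norm_eq diff_S)
  have "\<exists>g\<in>S. (\<lambda>k. LINT x|M. (cmod (f k x - g x))\<^sup>2) \<longlonglongrightarrow> 0"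
  proof (rule complete_S[OF f(1)])
    fix e :: real assume "e > 0"
    then have "sqrt e > 0" by simp
    then obtain N where "\<forall>j\<ge>N. \<forall>k\<ge>N. hnorm H (hminus H (s j) (s k)) < sqrt e"
      using assms(2) unfolding hcauchy_def by blast
    then show "\<exists>N. \<forall>j\<ge>N. \<forall>k\<ge>N. (LINT x|M. (cmod (f j x - f k x))\<^sup>2) < e" by (auto simp: n)
  qed
  then obtain g where g: "g \<in> S" "(\<lambda>k. LINT x|M. (cmod (f k x - g x))\<^sup>2) \<longlonglongrightarrow> 0" by blast
  have "(\<lambda>k. sqrt (LINT x|M. (cmod (f k x - g x))\<^sup>2)) \<longlonglongrightarrow> sqrt 0" by (intro tendsto_real_sqrt g)
  then have "hconverges H s (cls g)"
    by (simp add: hconverges_def f minus_eq norm_eq diff_S g)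
  then show ?thesis using g by (auto simp: carrier_eq)
qed

lemma hilbert: "hilbert_space H"
proof
  fix u v w c d assume u: "u \<in> hcarrier H"
  obtain f where f: "f \<in> S" "u = cls f" using u by (rule carrierE)
  have id: "integrable M (\<lambda>x. (cmod (f x))\<^sup>2)" by (rule sq[OF f(1)])
  show "hscale H c u \<in> hcarrier H" "hplus H u (hzero H) = u" "hminus H u u = hzero H" "hscale H 1 u = u"
    "hscale H c (hscale H d u) = hscale H (c * d) u" "hscale H (c + d) u = hplus H (hscale H c u) (hscale H d u)"
    "0 \<le> Re (hinner H u u)"
    by (simp_all add: f scale_eq plus_eq zero_eq minus_eq scale_S zero_S carrier_eq inner_self_eq mult.assoc distrib_right)
  show "u = hzero H" if "hinner H u u = 0"
  proof -
    have "(LINT x|M. (cmod (f x))\<^sup>2) = 0" using that f by (simp add: inner_self_eq)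
    then have "AE x in M. (cmod (f x))\<^sup>2 = 0" using integral_nonneg_eq_0_iff_AE[OF id] by simp
    then show ?thesis unfolding f zero_eq by (intro cls_eqI) auto
  qed
  assume v: "v \<in> hcarrier H"
  obtain g where g: "g \<in> S" "v = cls g" using v by (rule carrierE)
  show "hplus H u v \<in> hcarrier H" "hplus H u v = hplus H v u"
    "hscale H c (hplus H u v) = hplus H (hscale H c u) (hscale H c v)"
    "hinner H (hscale H c u) v = c * hinner H u v"
    by (simp_all add: f g scale_eq plus_eq scale_S add_S carrier_eq inner_eq add.commute distrib_left mult.assoc)
  show "hinner H v u = cnj (hinner H u v)"
  proof -
    have "cnj (LINT x|M. f x * cnj (g x)) = (LINT x|M. cnj (f x * cnj (g x)))" by (rule integral_bounded_linear[OF bounded_linear_cnj, symmetric]) (intro inner_integrable f g)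
    also have "\<dots> = (LINT x|M. g x * cnj (f x))" by (rule Bochner_Integration.integral_cong) auto
    finally show ?thesis by (simp add: f g inner_eq)
  qed
  assume w: "w \<in> hcarrier H"
  obtain h where h: "h \<in> S" "w = cls h" using w by (rule carrierE)
  show "hplus H (hplus H u v) w = hplus H u (hplus H v w)"
    by (simp add: f g h plus_eq add_S add.assoc)
  show "hinner H (hplus H u v) w = hinner H u w + hinner H v w"
    by (simp add: f g h plus_eq add_S inner_eq distrib_right inner_integrable)
qed (use zero_S complete_H in \<open>auto simp: zero_eq carrier_eq\<close>)

end

section \<open>Representations on spaces of classes\<close>

lemma hilbert_space_extend:
  assumes "hilbert_space H"
  shows "hilbert_space (hspace.extend H m)"
proof -
  let ?R = "hspace.extend H m"
  have eqs: "hcarrier ?R = hcarrier H" "hplus ?R = hplus H" "hzero ?R = hzero H" "hscale ?R = hscale H"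
    "hinner ?R = hinner H" "hminus ?R = hminus H" "hnorm ?R = hnorm H"
    by (auto simp: hspace.defs hminus_def hnorm_def fun_eq_iff)
  show ?thesis
    using assms unfolding hilbert_space_def hcauchy_def hconverges_def eqs .
qed

text \<open>\<open>r\<close> acts on functions; its effect on classes is derived. \<open>D\<close>
  collects functions regular enough for strong continuity to be checked by dominated convergence,
  and numerous enough to be total.\<close>

locale L2_rep = L2_space M S
  for M :: "'x measure" and S :: "('x \<Rightarrow> complex) set" +
  fixes G :: "('g::topological_space) monoid" and r :: "'g \<Rightarrow> ('x \<Rightarrow> complex) \<Rightarrow> 'x \<Rightarrow> complex"
    and D :: "('x \<Rightarrow> complex) set"
  assumes r_closed: "\<lbrakk>g \<in> carrier G; f \<in> S\<rbrakk> \<Longrightarrow> r g f \<in> S"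
    and r_inner: "\<lbrakk>g \<in> carrier G; f \<in> S; f' \<in> S\<rbrakk>
      \<Longrightarrow> (LINT x|M. r g f x * cnj (r g f' x)) = (LINT x|M. f x * cnj (f' x))"
    and r_mult: "\<lbrakk>g \<in> carrier G; h \<in> carrier G; f \<in> S\<rbrakk> \<Longrightarrow> r (g \<otimes>\<^bsub>G\<^esub> h) f = r g (r h f)"
    and r_inv: "g \<in> carrier G \<Longrightarrow> \<exists>h\<in>carrier G. \<forall>f\<in>S. r g (r h f) = f"
    and D_total: "D \<subseteq> S" "\<lbrakk>f \<in> S; \<And>d. d \<in> D \<Longrightarrow> (LINT x|M. d x * cnj (f x)) = 0\<rbrakk> \<Longrightarrow> AE x in M. f x = 0"
    and D_cont: "\<lbrakk>d \<in> D; g \<in> carrier G\<rbrakk>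
      \<Longrightarrow> ((\<lambda>h. LINT x|M. (cmod (r h d x - r g d x))\<^sup>2) \<longlongrightarrow> 0) (at g within carrier G)"
begin

definition R :: "('g, ('x \<Rightarrow> complex) set) rep" where
  "R = hspace.extend (L2_classes M S) (rep.fields (\<lambda>g C. r g ` C))"

lemma R_simps: "hcarrier R = hcarrier H" "hplus R = hplus H" "hzero R = hzero H" "hscale R = hscale H"
  "hinner R = hinner H" "hminus R = hminus H" "hnorm R = hnorm H" "act R g C = r g ` C"
  by (auto simp: R_def hspace.defs rep.defs hminus_def hnorm_def fun_eq_iff)

lemma hilbert_R: "hilbert_space R"
  unfolding R_def by (intro hilbert_space_extend hilbert)

text \<open>Expanding the squared distance into inner products shows that \<open>r g\<close>
  preserves it, so distance zero is both preserved and reflected.\<close>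

lemma r_diff:
  assumes "g \<in> carrier G" "f \<in> S" "f' \<in> S"
  shows "(AE x in M. r g f x = r g f' x) \<longleftrightarrow> (AE x in M. f x = f' x)"
proof -
  interpret hilbert_space H by (rule hilbert)
  have c: "cls h \<in> hcarrier H" if "h \<in> S" for h using that by (simp add: carrier_eq)
  have "(hnorm H (hminus H (cls (r g f)) (cls (r g f'))))\<^sup>2 = (hnorm H (hminus H (cls f) (cls f')))\<^sup>2"
    using assms by (simp add: norm_minus_sq c r_closed norm_sq inner_eq r_inner)
  then have "hnorm H (hminus H (cls (r g f)) (cls (r g f'))) = 0 \<longleftrightarrow> hnorm H (hminus H (cls f) (cls f')) = 0"
    by (metis power_zero_numeral zero_eq_power2)
  then have "cls (r g f) = cls (r g f') \<longleftrightarrow> cls f = cls f'"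
    using eq_if_minus_zero minus_self by (metis assms c minus_closed norm_eq_zero r_closed)
  then show ?thesis using assms by (simp add: cls_eq_iff r_closed)
qed

text \<open>The image of a class has to be the full class of the image: a function \<open>u\<close>
  equivalent to \<open>r g f\<close> is reached from \<open>r h u\<close> with \<open>h\<close>
  inverse to \<open>g\<close>.\<close>

lemma act_cls:
  assumes g: "g \<in> carrier G" and f: "f \<in> S"
  shows "act R g (cls f) = cls (r g f)"
proof -
  obtain h where h: "h \<in> carrier G" "\<forall>f\<in>S. r g (r h f) = f" using r_inv[OF g] by blast
  have "r g ` cls f = cls (r g f)"
  proof
    show "r g ` cls f \<subseteq> cls (r g f)"
    proof clarify
      fix u assume "u \<in> cls f"
      then have u: "u \<in> S" "AE x in M. f x = u x" by (auto simp: cls_def)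
      then have "AE x in M. r g f x = r g u x" using r_diff[OF g f u(1)] by simp
      then show "r g u \<in> cls (r g f)" using r_closed[OF g u(1)] by (simp add: cls_def)
    qed
    show "cls (r g f) \<subseteq> r g ` cls f"
    proof
      fix u assume "u \<in> cls (r g f)"
      then have u: "u \<in> S" "AE x in M. r g f x = u x" by (auto simp: cls_def)
      have "r h u \<in> cls f"
        using r_diff[OF g f r_closed[OF h(1) u(1)]] u h by (simp add: cls_def r_closed)
      moreover have "u = r g (r h u)" using h u by simp
      ultimately show "u \<in> r g ` cls f" by blast
    qed
  qed
  then show ?thesis by (simp add: R_simps)
qed

lemma total_D: "total_in R (cls ` D)"
  unfolding total_in_def
proof (intro conjI ballI impI)
  show "cls ` D \<subseteq> hcarrier R" using D_total(1) by (auto simp: R_simps carrier_eq)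
  fix v assume v: "v \<in> hcarrier R" and o: "\<forall>x\<in>cls ` D. hinner R x v = 0"
  obtain f where f: "f \<in> S" "v = cls f" using v by (auto simp: R_simps elim: carrierE)
  have "AE x in M. f x = 0"
    using o D_total(1) f by (intro D_total(2)) (auto simp: R_simps inner_eq subset_iff)
  then show "v = hzero R" unfolding f R_simps zero_eq by (rule cls_eqI)
qed

lemma isometric: "isometric_rep G R"
  unfolding isometric_rep_def isometry_map_def
proof (intro conjI ballI hilbert_R)
  fix g assume g: "g \<in> carrier G"
  show "act R g ` hcarrier R \<subseteq> hcarrier R"
    using act_cls[OF g] r_closed[OF g] by (auto simp: R_simps(1) carrier_eq)
  fix u v assume "u \<in> hcarrier R" "v \<in> hcarrier R"
  then show "hinner R (act R g u) (act R g v) = hinner R u v"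
    using act_cls[OF g] r_closed[OF g] r_inner[OF g] by (auto simp: R_simps(1,5) carrier_eq inner_eq)
qed

lemma act_inverse:
  assumes "g \<in> carrier G"
  shows "\<exists>h\<in>carrier G. \<forall>v\<in>hcarrier R. act R g (act R h v) = v"
proof -
  obtain h where h: "h \<in> carrier G" "\<forall>f\<in>S. r g (r h f) = f" using r_inv[OF assms] by blast
  then show ?thesis
    using act_cls assms r_closed by (intro bexI[of _ h]) (auto simp: R_simps(1) carrier_eq)
qed

text \<open>Strong continuity is read off from \<open>D_cont\<close> on the classes of
  \<open>D\<close> and extended by \<open>strongly_continuous_total\<close>.\<close>

theorem unitary: "unitary_rep G R"
  unfolding unitary_rep_def
proof (intro conjI ballI hilbert_R)
  fix g assume g: "g \<in> carrier G"
  interpret a: hilbert_isometry R R "act R g" by (rule isometric_rep_act[OF isometric g])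
  show "unitary_map R R (act R g)"
  proof (rule a.unitary)
    obtain h where "h \<in> carrier G" "\<forall>v\<in>hcarrier R. act R g (act R h v) = v" using act_inverse[OF g] by blast
    then have "v \<in> act R g ` hcarrier R" if "v \<in> hcarrier R" for v
      using that hilbert_isometry.into[OF isometric_rep_act[OF isometric]] by (metis image_eqI)
    then show "act R g ` hcarrier R = hcarrier R" using a.into by blast
  qed
  show "act R (g \<otimes>\<^bsub>G\<^esub> h) v = act R g (act R h v)" if h: "h \<in> carrier G" and v: "v \<in> hcarrier R" for h v
  proof -
    obtain f where f: "f \<in> S" "v = cls f" using v carrierE unfolding R_simps(1) by blast
    have "r (g \<otimes>\<^bsub>G\<^esub> h) ` cls f = r g ` r h ` cls f"
      unfolding image_image using r_mult[OF g h] by (intro image_cong) (auto simp: cls_def)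
    then show ?thesis using f by (simp add: R_simps)
  qed
next
  fix v g assume v: "v \<in> hcarrier R" and g: "g \<in> carrier G"
  show "((\<lambda>h. hnorm R (hminus R (act R h v) (act R g v))) \<longlongrightarrow> 0) (at g within carrier G)"
  proof (rule strongly_continuous_total[OF isometric total_D g _ v])
    fix x assume "x \<in> cls ` D"
    then obtain d where d: "d \<in> D" "x = cls d" by blast
    have dS: "d \<in> S" using d D_total(1) by blast
    have "((\<lambda>h. sqrt (LINT x|M. (cmod (r h d x - r g d x))\<^sup>2)) \<longlongrightarrow> sqrt 0) (at g within carrier G)"
      by (intro tendsto_real_sqrt D_cont d g)
    moreover have "\<forall>\<^sub>F h in at g within carrier G. sqrt (LINT x|M. (cmod (r h d x - r g d x))\<^sup>2) = hnorm R (hminus R (act R h x) (act R g x))"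
      unfolding eventually_at_filter using dS g
      by (auto intro!: always_eventually simp: d act_cls R_simps(6,7) minus_eq norm_eq r_closed diff_S)
    ultimately show "((\<lambda>h. hnorm R (hminus R (act R h x) (act R g x))) \<longlongrightarrow> 0) (at g within carrier G)"
      by (simp add: tendsto_cong)
  qed
qed

end

section \<open>The lattice and the sign character\<close>

lemma One_vec: "(One :: real^'n) = 1"
proof (rule euclidean_eqI)
  fix b :: "real^'n" assume b: "b \<in> Basis"
  then obtain i where "b = axis i 1" by (auto simp: Basis_vec_def)
  then have "1 \<bullet> b = 1" by (simp add: inner_axis)
  then show "One \<bullet> b = 1 \<bullet> b" using b by simp
qed

lemma integer_vectors_eq: "integer_vectors = (unit_lattice :: (real^'n) set)"
  by (auto simp: integer_vectors_def unit_lattice_def Basis_vec_def inner_axis)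

lemma unit_lattice_real: "(unit_lattice :: real set) = \<int>"
  by (auto simp: unit_lattice_def)

lemma det_int: "(\<And>i j. B $ i $ j \<in> \<int>) \<Longrightarrow> det (B :: real^'n^'n) \<in> \<int>"
  unfolding det_def by (auto intro!: Ints_sum Ints_mult Ints_prod)

text \<open>Cramer's rule with determinant 1 expresses the preimage through determinants of integral
  matrices.\<close>

lemma SL_int_vec:
  assumes M: "M \<in> SL_int" shows "k \<in> integer_vectors \<longleftrightarrow> M *v k \<in> integer_vectors"
proof
  assume "k \<in> integer_vectors"
  then show "M *v k \<in> integer_vectors"
    using M by (auto simp: integer_vectors_def SL_int_def matrix_vector_mult_def intro!: Ints_sum Ints_mult)
next
  assume b: "M *v k \<in> integer_vectors"
  have "det M \<noteq> 0" using M by (simp add: SL_int_def)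
  from cramer[OF this, of k "M *v k"]
  have k: "k = (\<chi> i. det (\<chi> \<mu> \<nu>. if \<nu> = i then (M *v k) $ \<mu> else M $ \<mu> $ \<nu>) / det M)" by blast
  have "k $ i \<in> \<int>" for i
  proof -
    have "k $ i = det (\<chi> \<mu> \<nu>. if \<nu> = i then (M *v k) $ \<mu> else M $ \<mu> $ \<nu>)"
      using arg_cong[OF k, of "\<lambda>x. x $ i"] M by (simp add: SL_int_def)
    also have "\<dots> \<in> \<int>" by (rule det_int) (use b M in \<open>auto simp: integer_vectors_def SL_int_def\<close>)
    finally show ?thesis .
  qed
  then show "k \<in> integer_vectors" by (simp add: integer_vectors_def)
qed

lemma cis_eq_iff: "cis a = cis b \<longleftrightarrow> (\<exists>n::int. a = b + 2 * pi * n)"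
  by (auto simp: complex_eq_iff sin_cos_eq_iff[symmetric])

lemma cis_int_2pi: "cis (2 * pi * of_int m) = 1"
  by (simp add: cis_multiple_2pi)

locale solvmanifold = one_parameter A for A :: "real \<Rightarrow> real^'n^'n" +
  fixes \<epsilon> :: "(real^'n) \<times> real \<Rightarrow> int"
  assumes SL: "A 1 \<in> SL_int" and exponential: "exponential_lie_group (semidirect A)"
    and parity: "parity_hom A \<epsilon>"
begin

abbreviation G :: "((real^'n) \<times> real) monoid" where "G \<equiv> semidirect A"

text \<open>The character \<open>e^(i \<pi> \<epsilon>)\<close> of \<Gamma> with values 1 and -1;
  parity arguments become multiplicativity of this function.\<close>

definition \<sigma> :: "(real^'n) \<times> real \<Rightarrow> complex" where "\<sigma> \<gamma> = cis (pi * of_int (\<epsilon> \<gamma>))"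

lemma G_mult: "(x, s) \<otimes>\<^bsub>G\<^esub> (y, t) = (x + A s *v y, s + t)"
  by (simp add: semidirect_def)

lemma G_mult': "g \<otimes>\<^bsub>G\<^esub> h = (fst g + A (snd g) *v fst h, snd g + snd h)"
  by (simp add: semidirect_def)

lemma G_carrier: "carrier G = UNIV"
  by (simp add: semidirect_def)

lemma G_assoc: "(g \<otimes>\<^bsub>G\<^esub> h) \<otimes>\<^bsub>G\<^esub> k = g \<otimes>\<^bsub>G\<^esub> (h \<otimes>\<^bsub>G\<^esub> k)"
  by (simp add: G_mult' A_vec_add matrix_vector_right_distrib add.assoc)

lemma G_inverse: "\<exists>h. \<forall>y. (y \<otimes>\<^bsub>G\<^esub> g) \<otimes>\<^bsub>G\<^esub> h = y"
proof (intro exI allI)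
  fix y
  show "(y \<otimes>\<^bsub>G\<^esub> g) \<otimes>\<^bsub>G\<^esub> (- (A (- snd g) *v fst g), - snd g) = y"
    unfolding G_assoc
    by (simp add: G_mult' linear_neg[OF matrix_vector_mul_linear] A_vec_add[symmetric] A_vec_zero)
qed

lemma G_mult_cont: "continuous_on S (\<lambda>p. fst p \<otimes>\<^bsub>G\<^esub> snd p)"
  unfolding G_mult' by (intro continuous_intros A_vec_cont)

lemma G_right_cont: "continuous_on S (\<lambda>y. y \<otimes>\<^bsub>G\<^esub> g)"
  unfolding G_mult' by (intro continuous_intros A_vec_cont)

text \<open>Induction in both directions; the equivalence in \<open>SL_int_vec\<close> supplies
  integrality of the inverse of \<open>A 1\<close>.\<close>

lemma A_int_vec: "A (of_int l) *v k \<in> integer_vectors \<longleftrightarrow> k \<in> integer_vectors"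
proof (induction l arbitrary: k rule: int_induct[where k = 0])
  case base show ?case by (simp add: A_vec_zero)
next
  case (step1 i)
  have "A (of_int (i + 1)) *v k = A (of_int i) *v (A 1 *v k)" by (simp add: A_vec_add)
  then show ?case using step1 SL_int_vec[OF SL] by simp
next
  case (step2 i)
  have "A (of_int i) *v k = A (of_int (i - 1)) *v (A 1 *v k)" for k using A_vec_add[of "of_int (i - 1)" 1 k] by simp
  then have "A (of_int (i - 1)) *v k = A (of_int i) *v (A (- 1) *v k)"
    using A_vec_add[of "1" "-1" k] by (simp add: A_vec_zero)
  moreover have "A (-1) *v k \<in> integer_vectors \<longleftrightarrow> k \<in> integer_vectors"
    using SL_int_vec[OF SL, of "A (-1) *v k"] A_vec_add[of 1 "-1" k] by (simp add: A_vec_zero)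
  ultimately show ?case using step2(2)[of "A (-1) *v k"] by simp
qed

lemma A_Ints_vec: "l \<in> \<int> \<Longrightarrow> k \<in> integer_vectors \<Longrightarrow> A l *v k \<in> integer_vectors"
  using A_int_vec by (auto elim!: Ints_cases)

lemma lattice_iff: "(k, l) \<in> lattice \<longleftrightarrow> k \<in> integer_vectors \<and> l \<in> \<int>"
  by (simp add: lattice_def)

lemma zero_integer: "0 \<in> integer_vectors"
  by (simp add: integer_vectors_def)

lemma \<epsilon>_values: "\<gamma> \<in> lattice \<Longrightarrow> \<epsilon> \<gamma> = 0 \<or> \<epsilon> \<gamma> = 1"
proof -
  assume "\<gamma> \<in> lattice"
  then have "\<epsilon> \<gamma> \<in> {0..<2}" using parity by (auto simp: parity_hom_def hom_def integer_mod_group_def semidirect_def)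
  then show ?thesis by auto
qed

lemma \<sigma>_values: "\<gamma> \<in> lattice \<Longrightarrow> \<sigma> \<gamma> = 1 \<or> \<sigma> \<gamma> = -1"
  using \<epsilon>_values[of \<gamma>] by (auto simp: \<sigma>_def cis_pi)

lemma \<sigma>_cnj: "\<gamma> \<in> lattice \<Longrightarrow> cnj (\<sigma> \<gamma>) = \<sigma> \<gamma>"
  using \<sigma>_values by fastforce

lemma \<sigma>_square: "\<gamma> \<in> lattice \<Longrightarrow> \<sigma> \<gamma> * \<sigma> \<gamma> = 1"
  using \<sigma>_values by fastforce

lemma \<sigma>_norm: "cmod (\<sigma> \<gamma>) = 1"
  by (simp add: \<sigma>_def)

lemma \<sigma>_mult:
  assumes "\<gamma> \<in> lattice" "\<gamma>' \<in> lattice"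
  shows "\<sigma> (\<gamma> \<otimes>\<^bsub>G\<^esub> \<gamma>') = \<sigma> \<gamma> * \<sigma> \<gamma>'"
proof -
  have "\<epsilon> (\<gamma> \<otimes>\<^bsub>G\<^esub> \<gamma>') = (\<epsilon> \<gamma> + \<epsilon> \<gamma>') mod 2"
    using parity assms by (simp add: parity_hom_def hom_def integer_mod_group_def semidirect_def)
  then show ?thesis
    using \<epsilon>_values[OF assms(1)] \<epsilon>_values[OF assms(2)] by (auto simp: \<sigma>_def cis_pi)
qed

lemma \<sigma>_add: "k \<in> integer_vectors \<Longrightarrow> k' \<in> integer_vectors \<Longrightarrow> \<sigma> (k + k', 0) = \<sigma> (k, 0) * \<sigma> (k', 0)"
  using \<sigma>_mult[of "(k, 0)" "(k', 0)"] by (simp add: lattice_iff G_mult A_vec_zero)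

lemma \<sigma>_time_add: "l \<in> \<int> \<Longrightarrow> l' \<in> \<int> \<Longrightarrow> \<sigma> (0, l + l') = \<sigma> (0, l) * \<sigma> (0, l')"
  using \<sigma>_mult[of "(0, l)" "(0, l')"] by (simp add: lattice_iff G_mult zero_integer)

lemma \<sigma>_split: "k \<in> integer_vectors \<Longrightarrow> l \<in> \<int> \<Longrightarrow> \<sigma> (k, l) = \<sigma> (k, 0) * \<sigma> (0, l)"
  using \<sigma>_mult[of "(k, 0)" "(0, l)"] by (simp add: lattice_iff G_mult zero_integer)

lemma \<sigma>_zero: "\<sigma> (0, 0) = 1"
  using \<sigma>_time_add[of 0 0] \<sigma>_norm[of "(0, 0)"] by auto

lemma \<sigma>_nonzero: "\<sigma> \<gamma> \<noteq> 0"
  by (simp add: \<sigma>_def)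

text \<open>\<open>(0, l)\<close> conjugates \<open>(k, 0)\<close> into \<open>(A l k, 0)\<close>,
  and a character is blind to conjugation. This is what makes \<Sigma> invariant under the dual
  \<int>-action.\<close>

lemma \<sigma>_A:
  assumes "k \<in> integer_vectors" "l \<in> \<int>"
  shows "\<sigma> (A l *v k, 0) = \<sigma> (k, 0)"
proof -
  have "\<sigma> (0, l) * \<sigma> (k, 0) = \<sigma> (A l *v k, l)"
    using \<sigma>_mult[of "(0, l)" "(k, 0)"] assms by (simp add: lattice_iff G_mult zero_integer)
  also have "\<dots> = \<sigma> (A l *v k, 0) * \<sigma> (0, l)"
    using assms by (intro \<sigma>_split A_Ints_vec)
  finally show ?thesis using \<sigma>_nonzero[of "(0, l)"] by simp
qed

lemma \<sigma>_time_int: "\<sigma> (0, of_int l) = cis (pi * of_int (\<epsilon> (0, 1)) * of_int l)"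
proof (induction l rule: int_induct[where k = 0])
  case base show ?case by (simp add: \<sigma>_zero)
next
  case (step1 i)
  have "\<sigma> (0, of_int (i + 1)) = \<sigma> (0, of_int i) * \<sigma> (0, 1)" by (simp add: \<sigma>_time_add)
  also have "\<dots> = cis (pi * of_int (\<epsilon> (0, 1)) * of_int (i + 1))"
    unfolding step1 by (simp add: \<sigma>_def cis_mult algebra_simps)
  finally show ?case .
next
  case (step2 i)
  have "\<sigma> (0, of_int (i - 1)) * \<sigma> (0, 1) = \<sigma> (0, of_int i)" using \<sigma>_time_add[of "of_int (i - 1)" 1] by simp
  also have "\<dots> = cis (pi * of_int (\<epsilon> (0, 1)) * of_int (i - 1)) * \<sigma> (0, 1)"
    unfolding step2 by (simp add: \<sigma>_def cis_mult algebra_simps)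
  finally show ?case using \<sigma>_nonzero by simp
qed

section \<open>The frequency set and equivariance on generators\<close>

abbreviation \<Sigma> :: "(real^'n) set" where "\<Sigma> \<equiv> Sigma_eps \<epsilon>"

lemma Sigma_axis: "\<xi> \<in> \<Sigma> \<longleftrightarrow> (\<forall>\<nu>. cis (pi * (\<xi> $ \<nu>)) = \<sigma> (axis \<nu> 1, 0))"
proof -
  have "(\<exists>k::int. \<xi> $ \<nu> = of_int (2 * k + \<epsilon> (axis \<nu> 1, 0))) \<longleftrightarrow> cis (pi * (\<xi> $ \<nu>)) = \<sigma> (axis \<nu> 1, 0)" for \<nu>
  proof -
    have "cis (pi * (\<xi> $ \<nu>)) = \<sigma> (axis \<nu> 1, 0) \<longleftrightarrow> (\<exists>n::int. pi * (\<xi> $ \<nu>) = pi * of_int (\<epsilon> (axis \<nu> 1, 0)) + 2 * pi * n)"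
      by (simp add: \<sigma>_def cis_eq_iff)
    also have "\<dots> \<longleftrightarrow> (\<exists>n::int. pi * (\<xi> $ \<nu>) = pi * of_int (2 * n + \<epsilon> (axis \<nu> 1, 0)))"
      by (simp add: algebra_simps)
    finally show ?thesis by simp
  qed
  then show ?thesis by (simp add: Sigma_eps_def)
qed

lemma axis_integer: "axis \<nu> 1 \<in> integer_vectors"
  by (simp add: integer_vectors_def axis_def)

text \<open>Both sides are multiplicative in \<open>k\<close>, so the axis vectors in the definition
  of \<Sigma> suffice. In this form membership is visibly stable under the dual action and combines
  with equivariance.\<close>

lemma Sigma_iff: "\<xi> \<in> \<Sigma> \<longleftrightarrow> (\<forall>k\<in>integer_vectors. cis (pi * (\<xi> \<bullet> k)) = \<sigma> (k, 0))"
proof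
  assume R: "\<forall>k\<in>integer_vectors. cis (pi * (\<xi> \<bullet> k)) = \<sigma> (k, 0)"
  show "\<xi> \<in> \<Sigma>"
    unfolding Sigma_axis using R axis_integer by (auto simp: inner_axis dest!: bspec[of _ _ "axis _ 1"])
next
  assume \<xi>: "\<xi> \<in> \<Sigma>"
  let ?P = "\<lambda>k. k \<in> integer_vectors \<and> cis (pi * (\<xi> \<bullet> k)) = \<sigma> (k, 0)"
  have add: "?P (k + k')" if "?P k" "?P k'" for k k'
    using that by (auto simp: \<sigma>_add inner_add_right distrib_left simp flip: cis_mult) (auto simp: integer_vectors_def)
  have P0: "?P 0" by (simp add: zero_integer \<sigma>_zero)
  have ax: "?P (of_int m *\<^sub>R axis \<nu> 1)" for m \<nu>
  proof (induction m rule: int_induct[where k = 0])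
    case base show ?case using P0 by simp
  next
    have a: "?P (axis \<nu> 1)" using \<xi> axis_integer by (simp add: Sigma_axis inner_axis)
    case (step1 i)
    then show ?case using add[OF _ a] by (simp add: scaleR_left_distrib)
  next
    have a: "?P (- axis \<nu> 1)"
    proof
      show i: "- axis \<nu> 1 \<in> integer_vectors" using axis_integer by (simp add: integer_vectors_def)
      have "\<sigma> (axis \<nu> 1, 0) * \<sigma> (- axis \<nu> 1, 0) = 1" using \<sigma>_add[OF axis_integer[of \<nu>] i] \<sigma>_zero by simp
      moreover have "cis (pi * (\<xi> \<bullet> axis \<nu> 1)) * cis (pi * (\<xi> \<bullet> - axis \<nu> 1)) = 1" by (simp add: cis_mult)
      moreover have "cis (pi * (\<xi> \<bullet> axis \<nu> 1)) = \<sigma> (axis \<nu> 1, 0)" using \<xi> by (simp add: Sigma_axis inner_axis)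
      ultimately show "cis (pi * (\<xi> \<bullet> - axis \<nu> 1)) = \<sigma> (- axis \<nu> 1, 0)" using \<sigma>_nonzero by (metis mult_left_cancel)
    qed
    case (step2 i)
    have "of_int (i - 1) *\<^sub>R axis \<nu> 1 = of_int i *\<^sub>R axis \<nu> 1 + - (axis \<nu> 1 :: real^'n)"
      by (simp add: scaleR_left_diff_distrib)
    then show ?case using add[OF _ a] step2 by metis
  qed
  show "\<forall>k\<in>integer_vectors. cis (pi * (\<xi> \<bullet> k)) = \<sigma> (k, 0)"
  proof
    fix k :: "real^'n" assume k: "k \<in> integer_vectors"
    have "?P (\<Sum>\<nu>\<in>S. (k $ \<nu>) *\<^sub>R axis \<nu> 1)" if "finite S" for S
      using that
    proof (induction S)
      case (insert \<nu> S)
      obtain m where "k $ \<nu> = of_int m" using k by (auto simp: integer_vectors_def elim!: Ints_cases)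
      then show ?case using add[OF ax insert.IH] insert by simp
    qed (use P0 in simp)
    from this[OF finite_class.finite_UNIV] have "?P (\<Sum>\<nu>\<in>UNIV. (k $ \<nu>) *\<^sub>R axis \<nu> 1)" .
    moreover have "(\<Sum>\<nu>\<in>UNIV. (k $ \<nu>) *\<^sub>R axis \<nu> 1) = k"
      using basis_expansion[of k] by (simp add: scalar_mult_eq_scaleR)
    ultimately show "cis (pi * (\<xi> \<bullet> k)) = \<sigma> (k, 0)" by simp
  qed
qed

lemma Sigma_integer: "\<Sigma> \<subseteq> integer_vectors"
proof
  fix \<xi> assume \<xi>: "\<xi> \<in> \<Sigma>"
  have "\<xi> $ \<nu> \<in> \<int>" for \<nu>
  proof -
    obtain k :: int where "\<xi> $ \<nu> = of_int (2 * k + \<epsilon> (axis \<nu> 1, 0))" using \<xi> unfolding Sigma_eps_def by blast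
    then show ?thesis by (simp only: Ints_of_int)
  qed
  then show "\<xi> \<in> integer_vectors" by (simp add: integer_vectors_def)
qed

lemma Sigma_dual_act:
  assumes "l \<in> \<int>" "\<xi> \<in> \<Sigma>"
  shows "dual_act A l \<xi> \<in> \<Sigma>"
  using assms by (auto simp: Sigma_iff dual_act_inner A_Ints_vec \<sigma>_A)

text \<open>\<Gamma> is generated by its space and time parts, as
  \<open>(k, l) = (k, 0) (0, l)\<close>.\<close>

lemma equivariant_iff:
  "equivariant A \<epsilon> \<phi> \<longleftrightarrow> (\<forall>k\<in>integer_vectors. \<forall>x t. \<phi> (x + k, t) = \<sigma> (k, 0) * \<phi> (x, t)) \<and>
    (\<forall>l\<in>\<int>. \<forall>x t. \<phi> (A l *v x, t + l) = \<sigma> (0, l) * \<phi> (x, t))"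
proof
  assume e: "equivariant A \<epsilon> \<phi>"
  have e': "\<phi> ((k, l) \<otimes>\<^bsub>G\<^esub> (x, t)) = \<sigma> (k, l) * \<phi> (x, t)" if "k \<in> integer_vectors" "l \<in> \<int>" for k l x t
    using e that by (simp add: equivariant_def \<sigma>_def lattice_iff)
  have "\<phi> (x + k, t) = \<sigma> (k, 0) * \<phi> (x, t)" if "k \<in> integer_vectors" for k x t
    using e'[OF that, of 0 x t] by (simp add: G_mult A_vec_zero add.commute)
  moreover have "\<phi> (A l *v x, t + l) = \<sigma> (0, l) * \<phi> (x, t)" if "l \<in> \<int>" for l x t
    using e'[OF zero_integer that, of x t] by (simp add: G_mult add.commute)
  ultimately show "(\<forall>k\<in>integer_vectors. \<forall>x t. \<phi> (x + k, t) = \<sigma> (k, 0) * \<phi> (x, t)) \<and>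
    (\<forall>l\<in>\<int>. \<forall>x t. \<phi> (A l *v x, t + l) = \<sigma> (0, l) * \<phi> (x, t))" by blast
next
  assume R: "(\<forall>k\<in>integer_vectors. \<forall>x t. \<phi> (x + k, t) = \<sigma> (k, 0) * \<phi> (x, t)) \<and>
    (\<forall>l\<in>\<int>. \<forall>x t. \<phi> (A l *v x, t + l) = \<sigma> (0, l) * \<phi> (x, t))"
  have "\<phi> ((k, l) \<otimes>\<^bsub>G\<^esub> (x, t)) = \<sigma> (k, l) * \<phi> (x, t)" if "k \<in> integer_vectors" "l \<in> \<int>" for k l x t
  proof -
    have "\<phi> ((k, l) \<otimes>\<^bsub>G\<^esub> (x, t)) = \<phi> (A l *v x + k, t + l)" by (simp add: G_mult add.commute)
    also have "\<dots> = \<sigma> (k, 0) * \<phi> (A l *v x, t + l)" using R that(1) by blast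
    also have "\<phi> (A l *v x, t + l) = \<sigma> (0, l) * \<phi> (x, t)" using R that(2) by blast
    also have "\<sigma> (k, 0) * (\<sigma> (0, l) * \<phi> (x, t)) = \<sigma> (k, l) * \<phi> (x, t)"
      using \<sigma>_split[OF that] by simp
    finally show ?thesis .
  qed
  then show "equivariant A \<epsilon> \<phi>" by (auto simp: equivariant_def \<sigma>_def lattice_def)
qed

lemma equivariant_space: "equivariant A \<epsilon> \<phi> \<Longrightarrow> k \<in> integer_vectors \<Longrightarrow> \<phi> (x + k, t) = \<sigma> (k, 0) * \<phi> (x, t)"
  by (simp add: equivariant_iff)

lemma equivariant_time: "equivariant A \<epsilon> \<phi> \<Longrightarrow> l \<in> \<int> \<Longrightarrow> \<phi> (A l *v x, t + l) = \<sigma> (0, l) * \<phi> (x, t)"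
  by (simp add: equivariant_iff)

section \<open>The measure on the fundamental domain\<close>

abbreviation Q :: "(real^'n) measure" where "Q \<equiv> cube_measure"
abbreviation I :: "real measure" where "I \<equiv> cube_measure"
abbreviation F :: "((real^'n) \<times> real) measure" where "F \<equiv> fundamental_measure"

lemma pair_QI: "pair_sigma_finite Q I"
  unfolding pair_sigma_finite_def by (intro conjI finite_measure.axioms(1) finite_cube_measure)

text \<open>Opens the fundamental domain to Fubini, with both factors instances of
  \<open>cube_measure\<close>.\<close>

lemma F_eq: "F = Q \<Otimes>\<^sub>M I"
proof (rule pair_measure_eqI[symmetric])
  let ?C = "cbox 0 1 :: (real^'n) set"
  have Qs: "sets Q = {?C \<inter> X |X. X \<in> sets borel}" and Is: "sets I = {{0..1} \<inter> X |X. X \<in> sets borel}"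
    by (auto simp: sets_cube_measure sets_restrict_space One_vec)
  have Fs: "sets F = {(?C \<times> {0..1}) \<inter> X |X. X \<in> sets borel}"
    by (auto simp: fundamental_measure_def sets_restrict_space)
  show "sigma_finite_measure Q" "sigma_finite_measure I"
    by (intro finite_measure.axioms(1) finite_cube_measure)+
  show "sets (Q \<Otimes>\<^sub>M I) = sets F"
  proof
    have spF: "space F = space Q \<times> space I"
      by (simp add: fundamental_measure_def space_restrict_space space_cube_measure One_vec)
    show "sets (Q \<Otimes>\<^sub>M I) \<subseteq> sets F"
      unfolding sets_pair_measure spF[symmetric]
    proof (rule sets.sigma_sets_subset, clarify)
      fix a b assume "a \<in> sets Q" "b \<in> sets I"
      then obtain X Y where XY: "X \<in> sets borel" "a = ?C \<inter> X" "Y \<in> sets borel" "b = {0..1} \<inter> Y" by (auto simp: Qs Is)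
      then have "a \<times> b = (?C \<times> {0..1}) \<inter> (X \<times> Y)" "X \<times> Y \<in> sets borel" by (auto simp: borel_prod[symmetric])
      then show "a \<times> b \<in> sets F" unfolding Fs by blast
    qed
    show "sets F \<subseteq> sets (Q \<Otimes>\<^sub>M I)"
    proof
      fix Z assume "Z \<in> sets F"
      then obtain X where X: "X \<in> sets borel" "Z = (?C \<times> {0..1}) \<inter> X" by (auto simp: Fs)
      have m: "(\<lambda>p. (fst p, snd p)) \<in> Q \<Otimes>\<^sub>M I \<rightarrow>\<^sub>M (borel \<Otimes>\<^sub>M borel)"
        by (intro measurable_Pair measurable_compose[OF measurable_fst] measurable_compose[OF measurable_snd] measurable_cube_measure) auto
      have "(\<lambda>p. (fst p, snd p)) -` X \<inter> space (Q \<Otimes>\<^sub>M I) \<in> sets (Q \<Otimes>\<^sub>M I)"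
        using X(1) by (intro measurable_sets[OF m]) (simp only: borel_prod)
      also have "(\<lambda>p. (fst p, snd p)) -` X \<inter> space (Q \<Otimes>\<^sub>M I) = Z"
        using X by (auto simp: space_pair_measure space_cube_measure One_vec)
      finally show "Z \<in> sets (Q \<Otimes>\<^sub>M I)" .
    qed
  qed
  fix a b assume "a \<in> sets Q" "b \<in> sets I"
  then obtain X Y where XY: "X \<in> sets borel" "a = ?C \<inter> X" "Y \<in> sets borel" "b = {0..1} \<inter> Y" by (auto simp: Qs Is)
  then have ab: "a \<in> sets borel" "b \<in> sets borel" "a \<subseteq> ?C" "b \<subseteq> {0..1}" by auto
  have "emeasure Q a = emeasure lborel a" "emeasure I b = emeasure lborel b"
    using ab by (auto simp: cube_measure_def emeasure_restrict_space One_vec)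
  moreover have "emeasure F (a \<times> b) = emeasure lborel (a \<times> b)"
    unfolding fundamental_measure_def
  proof (rule emeasure_restrict_space)
    show "cbox 0 1 \<times> {0..1} \<inter> space lborel \<in> sets (lborel :: ((real^'n) \<times> real) measure)"
      using borel_closed[OF closed_Times[OF closed_cbox[of "0 :: real^'n" 1] closed_atLeastAtMost[of "0 :: real" 1]]] by simp
  qed (use ab in auto)
  moreover have "emeasure lborel (a \<times> b) = emeasure lborel a * emeasure lborel b"
    using ab by (simp add: lborel_prod[symmetric] lborel.emeasure_pair_measure_Times)
  ultimately show "emeasure Q a * emeasure I b = emeasure F (a \<times> b)" by simp
qed

lemma measurable_F: "f \<in> measurable borel N \<Longrightarrow> f \<in> measurable F N"
  by (simp add: fundamental_measure_def measurable_restrict_space1)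

lemma finite_F: "finite_measure F"
proof -
  interpret Q: finite_measure Q by (rule finite_cube_measure)
  interpret I: finite_measure I by (rule finite_cube_measure)
  show ?thesis unfolding F_eq by (rule finite_measure_pair_measure) (rule finite_cube_measure)+
qed

lemma measurable_slice: "\<phi> \<in> measurable borel N \<Longrightarrow> (\<lambda>x. \<phi> (x, t)) \<in> measurable borel N"
  by (rule measurable_compose[of "\<lambda>x. (x, t)" borel borel \<phi> N]) (auto intro!: borel_measurable_continuous_onI continuous_intros)

lemma nn_integral_F:
  fixes f :: "(real^'n) \<times> real \<Rightarrow> ennreal"
  assumes "f \<in> borel_measurable borel"
  shows "(\<integral>\<^sup>+y. f y \<partial>F) = (\<integral>\<^sup>+t. \<integral>\<^sup>+x. f (x, t) \<partial>Q \<partial>I)"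
proof -
  interpret QI: pair_sigma_finite Q I by (rule pair_QI)
  show ?thesis
    using QI.nn_integral_snd[of f] measurable_F[OF assms] by (simp add: F_eq)
qed

lemma measurable_slice_integral:
  fixes f :: "(real^'n) \<times> real \<Rightarrow> ennreal"
  assumes "f \<in> borel_measurable borel"
  shows "(\<lambda>t. \<integral>\<^sup>+x. f (x, t) \<partial>Q) \<in> borel_measurable borel"
proof -
  interpret Q: finite_measure Q by (rule finite_cube_measure)
  have m: "(\<lambda>p. (snd p, fst p)) \<in> borel \<Otimes>\<^sub>M Q \<rightarrow>\<^sub>M (borel \<Otimes>\<^sub>M borel)"
    by (intro measurable_Pair measurable_compose[OF measurable_snd] measurable_cube_measure) auto
  have "(\<lambda>p. f (snd p, fst p)) \<in> borel_measurable (borel \<Otimes>\<^sub>M Q)"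
    using measurable_compose[OF m, of f borel] assms by (simp add: borel_prod)
  then show ?thesis using Q.borel_measurable_nn_integral[of "\<lambda>t x. f (x, t)" borel] by (simp add: case_prod_unfold)
qed

text \<open>Left invariance under \<Gamma>, written out on the two kinds of generators as in
  \<open>equivariant_iff\<close>.\<close>

definition invariant :: "((real^'n) \<times> real \<Rightarrow> 'b) \<Rightarrow> bool" where
  "invariant h \<longleftrightarrow> (\<forall>k\<in>integer_vectors. \<forall>x t. h (x + k, t) = h (x, t)) \<and> (\<forall>l\<in>\<int>. \<forall>x t. h (A l *v x, t + l) = h (x, t))"

lemma A_surj: "surj (\<lambda>x. A t *v x)"
  by (rule surjI[of _ "\<lambda>x. A (-t) *v x"]) (simp add: A_vec_add[symmetric] A_vec_zero)

text \<open>Right translation by \<open>(x0, s0)\<close> shifts the slice at time \<open>t\<close>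
  by \<open>A t x0\<close> and the time by \<open>s0\<close>. The fibre shift is absorbed by
  periodicity in \<open>x\<close>, the time shift by 1-periodicity of the slice integral
  \<open>H\<close>, which holds because \<open>A l\<close> is an automorphism of the torus.\<close>

lemma nn_integral_right_invariant:
  fixes h :: "(real^'n) \<times> real \<Rightarrow> ennreal"
  assumes h[measurable]: "h \<in> borel_measurable borel" and inv: "invariant h"
  shows "(\<integral>\<^sup>+y. h (y \<otimes>\<^bsub>G\<^esub> g) \<partial>F) = (\<integral>\<^sup>+y. h y \<partial>F)"
proof -
  obtain x0 s0 where g: "g = (x0, s0)" by (cases g)
  define H where "H t = (\<integral>\<^sup>+x. h (x, t) \<partial>Q)" for t
  have Hm: "H \<in> borel_measurable borel" unfolding H_def[abs_def] by (rule measurable_slice_integral[OF h])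
  have hm: "(\<lambda>y. h (y \<otimes>\<^bsub>G\<^esub> g)) \<in> borel_measurable borel"
    by (rule measurable_compose[OF borel_measurable_continuous_onI[OF G_right_cont] h])
  have per: "h (x + k, t) = h (x, t)" if "k \<in> unit_lattice" for k x t
    using inv that by (simp add: invariant_def integer_vectors_eq)
  have Hper: "H (t + l) = H t" if "l \<in> unit_lattice" for t l
  proof -
    have l: "l \<in> \<int>" using that by (simp add: unit_lattice_real)
    have "H (t + l) = (\<integral>\<^sup>+x. h (A l *v x + 0, t + l) \<partial>Q)"
      unfolding H_def
      by (rule nn_integral_cube_affine[symmetric, where f = "\<lambda>x. A l *v x" and h = "\<lambda>x. h (x, t + l)"])
        (use l in \<open>auto simp: A_surj per measurable_slice[OF h] integer_vectors_eq[symmetric] A_Ints_vec matrix_vector_mul_linear\<close>)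
    also have "\<dots> = H t" unfolding H_def using inv l by (intro nn_integral_cong) (simp add: invariant_def)
    finally show ?thesis .
  qed
  have "(\<integral>\<^sup>+y. h (y \<otimes>\<^bsub>G\<^esub> g) \<partial>F) = (\<integral>\<^sup>+t. \<integral>\<^sup>+x. h (x + A t *v x0, t + s0) \<partial>Q \<partial>I)"
    unfolding nn_integral_F[OF hm] by (simp add: g G_mult)
  also have "\<dots> = (\<integral>\<^sup>+t. H (t + s0) \<partial>I)"
    unfolding H_def
    by (intro nn_integral_cong nn_integral_cube_affine[where f = "\<lambda>x. x"])
      (auto simp: per measurable_slice[OF h] linear_id[unfolded id_def])
  also have "\<dots> = (\<integral>\<^sup>+t. H t \<partial>I)"
    by (rule nn_integral_cube_affine[where f = "\<lambda>x. x"]) (auto simp: Hper Hm linear_id[unfolded id_def])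
  also have "\<dots> = (\<integral>\<^sup>+y. h y \<partial>F)" unfolding H_def nn_integral_F[OF h] ..
  finally show ?thesis .
qed

text \<open>The nonnegative case applied to indicators; through image measures it covers
  vector-valued integrals and integrability.\<close>

lemma distr_right_invariant:
  assumes h[measurable]: "h \<in> measurable borel N" and inv: "invariant h"
  shows "distr F N (\<lambda>y. h (y \<otimes>\<^bsub>G\<^esub> g)) = distr F N h"
proof (rule measure_eqI)
  have hm: "(\<lambda>y. h (y \<otimes>\<^bsub>G\<^esub> g)) \<in> measurable borel N"
    by (rule measurable_compose[OF borel_measurable_continuous_onI[OF G_right_cont] h])
  fix X assume "X \<in> sets (distr F N (\<lambda>y. h (y \<otimes>\<^bsub>G\<^esub> g)))"
  then have X[measurable]: "X \<in> sets N" by simp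
  have e: "emeasure (distr F N f) X = (\<integral>\<^sup>+y. indicator X (f y) \<partial>F)" if "f \<in> measurable borel N" for f
    using nn_integral_distr[of f F N "indicator X"] measurable_F[OF that] by simp
  have "(\<integral>\<^sup>+y. indicator X (h (y \<otimes>\<^bsub>G\<^esub> g)) \<partial>F) = (\<integral>\<^sup>+y. indicator X (h y) \<partial>F)"
    by (rule nn_integral_right_invariant[where h = "\<lambda>y. indicator X (h y)"])
      (use inv in \<open>auto simp: invariant_def\<close>)
  then show "emeasure (distr F N (\<lambda>y. h (y \<otimes>\<^bsub>G\<^esub> g))) X = emeasure (distr F N h) X"
    by (simp add: e[OF hm] e[OF h])
qed simp

lemma
  fixes h :: "(real^'n) \<times> real \<Rightarrow> 'b::{banach, second_countable_topology}"
  assumes h[measurable]: "h \<in> borel_measurable borel" and inv: "invariant h"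
  shows integral_right_invariant: "(LINT y|F. h (y \<otimes>\<^bsub>G\<^esub> g)) = (LINT y|F. h y)"
    and integrable_right_invariant: "integrable F (\<lambda>y. h (y \<otimes>\<^bsub>G\<^esub> g)) \<longleftrightarrow> integrable F h"
proof -
  have hm: "(\<lambda>y. h (y \<otimes>\<^bsub>G\<^esub> g)) \<in> borel_measurable borel"
    by (rule measurable_compose[OF borel_measurable_continuous_onI[OF G_right_cont] h])
  note m = measurable_F[OF hm] measurable_F[OF h]
  note eq = distr_right_invariant[OF h inv, of g]
  show "(LINT y|F. h (y \<otimes>\<^bsub>G\<^esub> g)) = (LINT y|F. h y)"
    using integral_distr[OF m(1), of "\<lambda>x. x"] integral_distr[OF m(2), of "\<lambda>x. x"] eq by simp
  show "integrable F (\<lambda>y. h (y \<otimes>\<^bsub>G\<^esub> g)) \<longleftrightarrow> integrable F h"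
    using integrable_distr_eq[OF m(1), of "\<lambda>x. x"] integrable_distr_eq[OF m(2), of "\<lambda>x. x"] eq by simp
qed

end

context solvmanifold
begin

section \<open>The space \<open>L\<^sup>2(G,\<epsilon>)\<close>\<close>

abbreviation S where "S \<equiv> L2G_functions A \<epsilon>"

lemma S_iff: "\<phi> \<in> S \<longleftrightarrow> \<phi> \<in> borel_measurable borel \<and> equivariant A \<epsilon> \<phi> \<and> integrable F (\<lambda>y. (cmod (\<phi> y))\<^sup>2) \<and>
   (\<forall>e>0. \<exists>\<psi>. continuous_on UNIV \<psi> \<and> equivariant A \<epsilon> \<psi> \<and> (LINT y|F. (cmod (\<phi> y - \<psi> y))\<^sup>2) < e)"
  by (simp add: L2G_functions_def)

lemma space_F: "space F = cbox 0 1 \<times> {0..1}"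
  by (simp add: fundamental_measure_def space_restrict_space)

lemma integrable_F_bounded:
  fixes f :: "(real^'n) \<times> real \<Rightarrow> 'b::{banach, second_countable_topology}"
  assumes "f \<in> borel_measurable borel" "\<And>y. y \<in> space F \<Longrightarrow> norm (f y) \<le> B"
  shows "integrable F f"
  by (rule finite_measure.integrable_const_bound[OF finite_F, of _ B])
    (use assms measurable_F in auto)

lemma compact_space_F: "compact (space F)"
  unfolding space_F by (intro compact_Times compact_cbox compact_Icc)

lemma integrable_F_continuous:
  fixes f :: "(real^'n) \<times> real \<Rightarrow> 'b::{banach, second_countable_topology}"
  assumes "continuous_on UNIV f"
  shows "integrable F f"
proof -
  have "bounded (f ` space F)"
    by (intro compact_imp_bounded compact_continuous_image compact_space_F continuous_on_subset[OF assms]) auto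
  then obtain B where "\<And>y. y \<in> space F \<Longrightarrow> norm (f y) \<le> B" by (auto simp: bounded_iff)
  then show ?thesis using assms by (intro integrable_F_bounded) (auto intro: borel_measurable_continuous_onI)
qed

lemma continuous_in_S:
  assumes c: "continuous_on UNIV \<phi>" and e: "equivariant A \<epsilon> \<phi>"
  shows "\<phi> \<in> S"
  unfolding S_iff
proof (intro conjI allI impI)
  show "integrable F (\<lambda>y. (cmod (\<phi> y))\<^sup>2)" by (intro integrable_F_continuous continuous_intros c)
  show "\<exists>\<psi>. continuous_on UNIV \<psi> \<and> equivariant A \<epsilon> \<psi> \<and> (LINT y|F. (cmod (\<phi> y - \<psi> y))\<^sup>2) < r" if "r > 0" for r
    using that c e by (intro exI[of _ \<phi>]) simp
qed (use c e in \<open>auto intro: borel_measurable_continuous_onI\<close>)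

lemma S_measurable: "\<phi> \<in> S \<Longrightarrow> \<phi> \<in> borel_measurable borel"
  and S_equivariant: "\<phi> \<in> S \<Longrightarrow> equivariant A \<epsilon> \<phi>"
  and S_square: "\<phi> \<in> S \<Longrightarrow> integrable F (\<lambda>y. (cmod (\<phi> y))\<^sup>2)"
  by (simp_all add: S_iff)

lemma integrable_S_diff:
  assumes "\<phi> \<in> borel_measurable borel" "\<psi> \<in> borel_measurable borel"
    "integrable F (\<lambda>y. (cmod (\<phi> y))\<^sup>2)" "integrable F (\<lambda>y. (cmod (\<psi> y))\<^sup>2)"
  shows "integrable F (\<lambda>y. (cmod (\<phi> y - \<psi> y))\<^sup>2)"
  using assms by (intro integrable_sq_diff measurable_F)

text \<open>Limits of limits of continuous equivariant functions are again such limits. Sums,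
  multiples, translates and sequence limits enter \<open>S\<close> through this test.\<close>

lemma S_closed:
  assumes m: "\<phi> \<in> borel_measurable borel" and e: "equivariant A \<epsilon> \<phi>" and i: "integrable F (\<lambda>y. (cmod (\<phi> y))\<^sup>2)"
    and approx: "\<And>e. e > 0 \<Longrightarrow> \<exists>\<psi>\<in>S. (LINT y|F. (cmod (\<phi> y - \<psi> y))\<^sup>2) < e"
  shows "\<phi> \<in> S"
  unfolding S_iff
proof (intro conjI m e i allI impI)
  fix r :: real assume "r > 0"
  \<comment> \<open>\<open>r / 4\<close> for each of two approximations, since
    \<open>(a + b)^2 \<le> 2 a^2 + 2 b^2\<close>.\<close>
  then obtain \<psi> where \<psi>: "\<psi> \<in> S" "(LINT y|F. (cmod (\<phi> y - \<psi> y))\<^sup>2) < r / 4" using approx[of "r / 4"] by auto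
  have "r / 4 > 0" using \<open>r > 0\<close> by simp
  then obtain \<kappa> where \<kappa>: "continuous_on UNIV \<kappa>" "equivariant A \<epsilon> \<kappa>" "(LINT y|F. (cmod (\<psi> y - \<kappa> y))\<^sup>2) < r / 4"
    using \<psi>(1) unfolding S_iff by blast
  have \<kappa>S: "\<kappa> \<in> S" by (rule continuous_in_S[OF \<kappa>(1,2)])
  note i1 = integrable_S_diff[OF m S_measurable[OF \<psi>(1)] i S_square[OF \<psi>(1)]]
  note i2 = integrable_S_diff[OF S_measurable[OF \<psi>(1)] S_measurable[OF \<kappa>S] S_square[OF \<psi>(1)] S_square[OF \<kappa>S]]
  have "(LINT y|F. (cmod (\<phi> y - \<kappa> y))\<^sup>2) \<le> (LINT y|F. 2 * (cmod (\<phi> y - \<psi> y))\<^sup>2 + 2 * (cmod (\<psi> y - \<kappa> y))\<^sup>2)"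
  proof (rule integral_mono)
    show "integrable F (\<lambda>y. (cmod (\<phi> y - \<kappa> y))\<^sup>2)" by (rule integrable_S_diff[OF m S_measurable[OF \<kappa>S] i S_square[OF \<kappa>S]])
    show "integrable F (\<lambda>y. 2 * (cmod (\<phi> y - \<psi> y))\<^sup>2 + 2 * (cmod (\<psi> y - \<kappa> y))\<^sup>2)" using i1 i2 by simp
    show "(cmod (\<phi> y - \<kappa> y))\<^sup>2 \<le> 2 * (cmod (\<phi> y - \<psi> y))\<^sup>2 + 2 * (cmod (\<psi> y - \<kappa> y))\<^sup>2" for y
      using cmod_diff_sq_le[of "\<phi> y - \<psi> y" "\<kappa> y - \<psi> y"] by (simp add: norm_minus_commute)
  qed
  also have "\<dots> = 2 * (LINT y|F. (cmod (\<phi> y - \<psi> y))\<^sup>2) + 2 * (LINT y|F. (cmod (\<psi> y - \<kappa> y))\<^sup>2)"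
    using i1 i2 by simp
  also have "\<dots> < r" using \<psi>(2) \<kappa>(3) by linarith
  finally show "\<exists>\<psi>. continuous_on UNIV \<psi> \<and> equivariant A \<epsilon> \<psi> \<and> (LINT y|F. (cmod (\<phi> y - \<psi> y))\<^sup>2) < r"
    using \<kappa> by blast
qed

lemma equivariant_add: "equivariant A \<epsilon> \<phi> \<Longrightarrow> equivariant A \<epsilon> \<psi> \<Longrightarrow> equivariant A \<epsilon> (\<lambda>y. \<phi> y + \<psi> y)"
  by (simp add: equivariant_def distrib_left)

lemma equivariant_scale: "equivariant A \<epsilon> \<phi> \<Longrightarrow> equivariant A \<epsilon> (\<lambda>y. c * \<phi> y)"
  by (simp add: equivariant_def)

text \<open>Multiplication by a nonzero constant preserves and reflects convergence, so the set of
  convergence is \<Gamma>-invariant.\<close>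

lemma equivariant_sequence_limit:
  assumes "\<And>k. equivariant A \<epsilon> (s k)"
  shows "equivariant A \<epsilon> (sequence_limit s)"
  unfolding equivariant_def
proof (intro ballI allI)
  fix \<gamma> y :: "(real^'n) \<times> real" assume \<gamma>: "\<gamma> \<in> lattice"
  let ?c = "cis (pi * of_int (\<epsilon> \<gamma>))"
  have s: "s k (\<gamma> \<otimes>\<^bsub>G\<^esub> y) = ?c * s k y" for k using assms \<gamma> unfolding equivariant_def by blast
  have conv: "convergent (\<lambda>k. ?c * s k y) \<longleftrightarrow> convergent (\<lambda>k. s k y)"
    by (rule convergent_mult_const_iff) simp
  show "sequence_limit s (\<gamma> \<otimes>\<^bsub>G\<^esub> y) = ?c * sequence_limit s y"
  proof (cases "convergent (\<lambda>k. s k y)")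
    case True
    then have "(\<lambda>k. ?c * s k y) \<longlonglongrightarrow> ?c * lim (\<lambda>k. s k y)" by (intro tendsto_mult tendsto_const) (simp add: convergent_LIMSEQ_iff)
    then have "lim (\<lambda>k. ?c * s k y) = ?c * lim (\<lambda>k. s k y)" by (rule limI)
    then show ?thesis using True conv by (simp add: sequence_limit_def s Cauchy_convergent_iff)
  next
    case False
    then show ?thesis using conv by (simp add: sequence_limit_def s Cauchy_convergent_iff)
  qed
qed

lemma S_L2_space: "L2_space F S"
proof
  show "f \<in> borel_measurable F" if "f \<in> S" for f by (rule measurable_F[OF S_measurable[OF that]])
  show "integrable F (\<lambda>x. (cmod (f x))\<^sup>2)" if "f \<in> S" for f by (rule S_square[OF that])
  show "(\<lambda>x. 0) \<in> S" by (rule continuous_in_S) (auto simp: equivariant_def)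
  show "(\<lambda>x. f x + g x) \<in> S" if f: "f \<in> S" and g: "g \<in> S" for f g
  proof (rule S_closed)
    show m: "(\<lambda>x. f x + g x) \<in> borel_measurable borel" using f g S_measurable by (intro borel_measurable_add)
    show "equivariant A \<epsilon> (\<lambda>y. f y + g y)" by (intro equivariant_add S_equivariant f g)
    show i: "integrable F (\<lambda>y. (cmod (f y + g y))\<^sup>2)"
      using integrable_S_diff[of f "\<lambda>y. - g y"] f g S_measurable S_square by simp
    fix r :: real assume "r > 0"
    then have r: "r / 4 > 0" by simp
    obtain \<kappa> where \<kappa>: "continuous_on UNIV \<kappa>" "equivariant A \<epsilon> \<kappa>" "(LINT y|F. (cmod (f y - \<kappa> y))\<^sup>2) < r / 4"
      using f r unfolding S_iff by blast
    obtain \<eta> where \<eta>: "continuous_on UNIV \<eta>" "equivariant A \<epsilon> \<eta>" "(LINT y|F. (cmod (g y - \<eta> y))\<^sup>2) < r / 4"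
      using g r unfolding S_iff by blast
    have S1: "(\<lambda>y. \<kappa> y + \<eta> y) \<in> S" using \<kappa> \<eta> by (intro continuous_in_S continuous_intros equivariant_add)
    have S2: "\<kappa> \<in> S" "\<eta> \<in> S" using \<kappa> \<eta> continuous_in_S by auto
    note i1 = integrable_S_diff[OF S_measurable[OF f] S_measurable[OF S2(1)] S_square[OF f] S_square[OF S2(1)]]
    note i2 = integrable_S_diff[OF S_measurable[OF g] S_measurable[OF S2(2)] S_square[OF g] S_square[OF S2(2)]]
    have "(LINT y|F. (cmod ((f y + g y) - (\<kappa> y + \<eta> y)))\<^sup>2) \<le> (LINT y|F. 2 * (cmod (f y - \<kappa> y))\<^sup>2 + 2 * (cmod (g y - \<eta> y))\<^sup>2)"
    proof (rule integral_mono)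
      show "integrable F (\<lambda>y. (cmod ((f y + g y) - (\<kappa> y + \<eta> y)))\<^sup>2)"
        by (rule integrable_S_diff[OF m S_measurable[OF S1] i S_square[OF S1]])
      show "integrable F (\<lambda>y. 2 * (cmod (f y - \<kappa> y))\<^sup>2 + 2 * (cmod (g y - \<eta> y))\<^sup>2)" using i1 i2 by simp
      show "(cmod ((f y + g y) - (\<kappa> y + \<eta> y)))\<^sup>2 \<le> 2 * (cmod (f y - \<kappa> y))\<^sup>2 + 2 * (cmod (g y - \<eta> y))\<^sup>2" for y
        using cmod_diff_sq_le[of "f y - \<kappa> y" "\<eta> y - g y"] by (simp add: norm_minus_commute algebra_simps)
    qed
    also have "\<dots> = 2 * (LINT y|F. (cmod (f y - \<kappa> y))\<^sup>2) + 2 * (LINT y|F. (cmod (g y - \<eta> y))\<^sup>2)"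
      using i1 i2 by simp
    also have "\<dots> < r" using \<kappa>(3) \<eta>(3) by linarith
    finally show "\<exists>\<psi>\<in>S. (LINT y|F. (cmod (f y + g y - \<psi> y))\<^sup>2) < r" by (rule bexI[OF _ S1])
  qed
  show "(\<lambda>x. c * f x) \<in> S" if f: "f \<in> S" for c f
  proof (rule S_closed)
    show "(\<lambda>x. c * f x) \<in> borel_measurable borel" using S_measurable[OF f] by measurable
    show "equivariant A \<epsilon> (\<lambda>x. c * f x)" by (intro equivariant_scale S_equivariant f)
    show "integrable F (\<lambda>y. (cmod (c * f y))\<^sup>2)" using S_square[OF f] by (simp add: norm_mult power_mult_distrib)
    fix r :: real assume r: "r > 0"
    \<comment> \<open>The \<open>+ 1\<close> covers \<open>c = 0\<close>.\<close>
    define d where "d = r / ((cmod c)\<^sup>2 + 1)"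
    have c1: "(cmod c)\<^sup>2 + 1 > 0" by (smt (verit) zero_le_power2)
    have "d > 0" using r c1 by (simp add: d_def)
    then obtain \<kappa> where \<kappa>: "continuous_on UNIV \<kappa>" "equivariant A \<epsilon> \<kappa>" "(LINT y|F. (cmod (f y - \<kappa> y))\<^sup>2) < d"
      using f unfolding S_iff by blast
    have cS: "(\<lambda>y. c * \<kappa> y) \<in> S" using \<kappa> by (intro continuous_in_S continuous_intros equivariant_scale)
    have "(LINT y|F. (cmod (c * f y - c * \<kappa> y))\<^sup>2) = (cmod c)\<^sup>2 * (LINT y|F. (cmod (f y - \<kappa> y))\<^sup>2)"
      by (simp add: norm_mult power_mult_distrib flip: right_diff_distrib)
    moreover have "(cmod c)\<^sup>2 * (LINT y|F. (cmod (f y - \<kappa> y))\<^sup>2) \<le> (cmod c)\<^sup>2 * d" using \<kappa>(3) by (intro mult_left_mono) auto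
    moreover have "(cmod c)\<^sup>2 * d < r"
    proof -
      have "(cmod c)\<^sup>2 * d < ((cmod c)\<^sup>2 + 1) * d" using \<open>d > 0\<close> by (simp add: distrib_right)
      also have "\<dots> = r" using c1 by (simp add: d_def)
      finally show ?thesis .
    qed
    ultimately have "(LINT y|F. (cmod (c * f y - c * \<kappa> y))\<^sup>2) < r" by linarith
    then show "\<exists>\<psi>\<in>S. (LINT y|F. (cmod (c * f y - \<psi> y))\<^sup>2) < r" by (intro bexI[OF _ cS])
  qed
  fix s :: "nat \<Rightarrow> (real^'n) \<times> real \<Rightarrow> complex"
  assume s: "\<And>k. s k \<in> S" and c: "\<And>e. e > 0 \<Longrightarrow> \<exists>N. \<forall>j\<ge>N. \<forall>k\<ge>N. (LINT x|F. (cmod (s j x - s k x))\<^sup>2) < e"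
  obtain r where r: "strict_mono r" "integrable F (\<lambda>x. (cmod (sequence_limit (\<lambda>k. s (r k)) x))\<^sup>2)"
    "(\<lambda>k. LINT x|F. (cmod (s k x - sequence_limit (\<lambda>k. s (r k)) x))\<^sup>2) \<longlonglongrightarrow> 0"
    using riesz_fischer[OF measurable_F[OF S_measurable[OF s]] S_square[OF s] c] by blast
  have "sequence_limit (\<lambda>k. s (r k)) \<in> S"
  proof (rule S_closed[OF _ _ r(2)])
    show "sequence_limit (\<lambda>k. s (r k)) \<in> borel_measurable borel"
      by (rule sequence_limit_measurable) (rule S_measurable[OF s])
    show "equivariant A \<epsilon> (sequence_limit (\<lambda>k. s (r k)))"
      by (rule equivariant_sequence_limit) (rule S_equivariant[OF s])
    fix e :: real assume "e > 0"
    then have "\<forall>\<^sub>F k in sequentially. (LINT x|F. (cmod (s k x - sequence_limit (\<lambda>k. s (r k)) x))\<^sup>2) < e"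
      using order_tendstoD(2)[OF r(3)] by blast
    then obtain k where "(LINT x|F. (cmod (s k x - sequence_limit (\<lambda>k. s (r k)) x))\<^sup>2) < e"
      using eventually_happens sequentially_bot by blast
    then show "\<exists>\<psi>\<in>S. (LINT y|F. (cmod (sequence_limit (\<lambda>k. s (r k)) y - \<psi> y))\<^sup>2) < e"
      using s by (auto simp: norm_minus_commute)
  qed
  then show "\<exists>f\<in>S. (\<lambda>k. LINT x|F. (cmod (s k x - f x))\<^sup>2) \<longlonglongrightarrow> 0" using r(3) by blast
qed

sublocale L2_space F S
  by (rule S_L2_space)

section \<open>Right translation on functions\<close>

definition translate :: "(real^'n) \<times> real \<Rightarrow> ((real^'n) \<times> real \<Rightarrow> complex) \<Rightarrow> (real^'n) \<times> real \<Rightarrow> complex" where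
  "translate g \<phi> y = \<phi> (y \<otimes>\<^bsub>G\<^esub> g)"

lemma translate_equivariant: "equivariant A \<epsilon> \<phi> \<Longrightarrow> equivariant A \<epsilon> (translate g \<phi>)"
  unfolding equivariant_def translate_def G_assoc by blast

lemma translate_measurable: "\<phi> \<in> borel_measurable borel \<Longrightarrow> translate g \<phi> \<in> borel_measurable borel"
  unfolding translate_def[abs_def] by (rule measurable_compose[OF borel_measurable_continuous_onI[OF G_right_cont]])

lemma translate_continuous: "continuous_on UNIV \<phi> \<Longrightarrow> continuous_on UNIV (translate g \<phi>)"
  unfolding translate_def[abs_def] by (rule continuous_on_compose2[OF _ G_right_cont]) auto

lemma equivariant_product_invariant:
  assumes "equivariant A \<epsilon> \<phi>" "equivariant A \<epsilon> \<psi>"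
  shows "invariant (\<lambda>y. \<phi> y * cnj (\<psi> y))"
proof -
  have "(\<sigma> \<gamma> * a) * cnj (\<sigma> \<gamma> * b) = a * cnj b" for \<gamma> a b
  proof -
    have "(\<sigma> \<gamma> * a) * cnj (\<sigma> \<gamma> * b) = (\<sigma> \<gamma> * cnj (\<sigma> \<gamma>)) * (a * cnj b)" by (simp add: algebra_simps)
    also have "\<sigma> \<gamma> * cnj (\<sigma> \<gamma>) = 1" using \<sigma>_norm[of \<gamma>] by (simp flip: complex_norm_square)
    finally show ?thesis by simp
  qed
  then show ?thesis using assms unfolding invariant_def equivariant_iff by metis
qed

lemma equivariant_square_invariant:
  assumes "equivariant A \<epsilon> \<phi>" shows "invariant (\<lambda>y. (cmod (\<phi> y))\<^sup>2)"
  using assms by (simp add: invariant_def equivariant_iff norm_mult \<sigma>_norm)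

lemma equivariant_diff: "equivariant A \<epsilon> \<phi> \<Longrightarrow> equivariant A \<epsilon> \<psi> \<Longrightarrow> equivariant A \<epsilon> (\<lambda>y. \<phi> y - \<psi> y)"
  by (simp add: equivariant_def right_diff_distrib)

text \<open>The continuous approximants are translated along; right invariance leaves their distance
  unchanged.\<close>

lemma translate_S:
  assumes \<phi>: "\<phi> \<in> S" shows "translate g \<phi> \<in> S"
proof (rule S_closed)
  show "translate g \<phi> \<in> borel_measurable borel" by (rule translate_measurable[OF S_measurable[OF \<phi>]])
  show "equivariant A \<epsilon> (translate g \<phi>)" by (rule translate_equivariant[OF S_equivariant[OF \<phi>]])
  have [measurable]: "\<phi> \<in> borel_measurable borel" by (rule S_measurable[OF \<phi>])
  show "integrable F (\<lambda>y. (cmod (translate g \<phi> y))\<^sup>2)"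
    using integrable_right_invariant[of "\<lambda>y. (cmod (\<phi> y))\<^sup>2" g] equivariant_square_invariant[OF S_equivariant[OF \<phi>]] S_square[OF \<phi>]
    by (simp add: translate_def)
  fix e :: real assume "e > 0"
  then obtain \<psi> where \<psi>: "continuous_on UNIV \<psi>" "equivariant A \<epsilon> \<psi>" "(LINT y|F. (cmod (\<phi> y - \<psi> y))\<^sup>2) < e"
    using \<phi> unfolding S_iff by blast
  have [measurable]: "\<psi> \<in> borel_measurable borel" by (rule borel_measurable_continuous_onI[OF \<psi>(1)])
  have "(LINT y|F. (cmod (translate g \<phi> y - translate g \<psi> y))\<^sup>2) = (LINT y|F. (cmod (\<phi> y - \<psi> y))\<^sup>2)"
    unfolding translate_def
    by (rule integral_right_invariant[where h = "\<lambda>y. (cmod (\<phi> y - \<psi> y))\<^sup>2"])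
      (simp_all add: equivariant_square_invariant[OF equivariant_diff[OF S_equivariant[OF \<phi>] \<psi>(2)]])
  then have "(LINT y|F. (cmod (translate g \<phi> y - translate g \<psi> y))\<^sup>2) < e" using \<psi>(3) by simp
  moreover have "translate g \<psi> \<in> S" by (intro continuous_in_S translate_continuous translate_equivariant \<psi>)
  ultimately show "\<exists>\<kappa>\<in>S. (LINT y|F. (cmod (translate g \<phi> y - \<kappa> y))\<^sup>2) < e" by (rule bexI)
qed

lemma translate_inner:
  assumes \<phi>: "\<phi> \<in> S" and \<psi>: "\<psi> \<in> S"
  shows "(LINT y|F. translate g \<phi> y * cnj (translate g \<psi> y)) = (LINT y|F. \<phi> y * cnj (\<psi> y))"
proof -
  have [measurable]: "\<phi> \<in> borel_measurable borel" "\<psi> \<in> borel_measurable borel" using \<phi> \<psi> S_measurable by auto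
  show ?thesis
    unfolding translate_def
    by (rule integral_right_invariant[where h = "\<lambda>y. \<phi> y * cnj (\<psi> y)"])
      (auto intro!: equivariant_product_invariant S_equivariant \<phi> \<psi>)
qed

text \<open>Sequences suffice. A convergent sequence with its limit is compact, so all products
  involved stay in one compact set, where \<open>d\<close> is bounded.\<close>

lemma translate_strongly_continuous:
  assumes d: "continuous_on UNIV d"
  shows "((\<lambda>h. LINT y|F. (cmod (translate h d y - translate g d y))\<^sup>2) \<longlongrightarrow> 0) (at g within carrier G)"
  unfolding tendsto_at_iff_sequentially
proof (intro allI impI)
  fix X :: "nat \<Rightarrow> (real^'n) \<times> real" assume X: "X \<longlonglongrightarrow> g"
  let ?K = "(\<lambda>p. fst p \<otimes>\<^bsub>G\<^esub> snd p) ` (space F \<times> insert g (range X))"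
  have "compact ?K"
    by (intro compact_continuous_image compact_Times compact_space_F compact_sequence_with_limit X G_mult_cont)
  then have "bounded (d ` ?K)"
    using compact_imp_bounded[OF compact_continuous_image[OF continuous_on_subset[OF d]]] by blast
  then obtain B where B: "\<And>z. z \<in> ?K \<Longrightarrow> cmod (d z) \<le> B" unfolding bounded_iff by blast
  have [measurable]: "translate h d \<in> borel_measurable F" for h
    by (intro measurable_F translate_measurable borel_measurable_continuous_onI d)
  have "(\<lambda>k. LINT y|F. (cmod (translate (X k) d y - translate g d y))\<^sup>2) \<longlonglongrightarrow> (LINT y|F. 0)"
  proof (rule integral_dominated_convergence[where w = "\<lambda>_. 4 * B\<^sup>2"])
    show "integrable F (\<lambda>_. 4 * B\<^sup>2)" using finite_measure.integrable_const[OF finite_F] by blast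
    show "AE y in F. (\<lambda>k. (cmod (translate (X k) d y - translate g d y))\<^sup>2) \<longlonglongrightarrow> 0"
    proof (rule AE_I2)
      fix y
      have "continuous_on UNIV (\<lambda>h. d (y \<otimes>\<^bsub>G\<^esub> h))"
        by (rule continuous_on_compose2[OF d]) (auto simp: G_mult' intro!: continuous_intros A_vec_cont)
      then have "isCont (\<lambda>h. d (y \<otimes>\<^bsub>G\<^esub> h)) g" using continuous_on_eq_continuous_at[OF open_UNIV] by blast
      then have "(\<lambda>k. translate (X k) d y) \<longlonglongrightarrow> translate g d y"
        unfolding translate_def by (rule isCont_tendsto_compose[OF _ X])
      then have "(\<lambda>k. (cmod (translate (X k) d y - translate g d y))\<^sup>2) \<longlonglongrightarrow> (cmod (translate g d y - translate g d y))\<^sup>2"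
        by (intro tendsto_intros)
      then show "(\<lambda>k. (cmod (translate (X k) d y - translate g d y))\<^sup>2) \<longlonglongrightarrow> 0" by simp
    qed
    show "AE y in F. norm ((cmod (translate (X k) d y - translate g d y))\<^sup>2) \<le> 4 * B\<^sup>2" for k
    proof (rule AE_I2)
      fix y assume y: "y \<in> space F"
      have "y \<otimes>\<^bsub>G\<^esub> X k \<in> ?K" by (rule image_eqI[of _ _ "(y, X k)"]) (use y in auto)
      moreover have "y \<otimes>\<^bsub>G\<^esub> g \<in> ?K" by (rule image_eqI[of _ _ "(y, g)"]) (use y in auto)
      ultimately have b: "cmod (translate (X k) d y) \<le> B" "cmod (translate g d y) \<le> B" by (simp_all add: B translate_def)
      have "(cmod (translate (X k) d y - translate g d y))\<^sup>2 \<le> 2 * (cmod (translate (X k) d y))\<^sup>2 + 2 * (cmod (translate g d y))\<^sup>2"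
        by (rule cmod_diff_sq_le)
      also have "\<dots> \<le> 2 * B\<^sup>2 + 2 * B\<^sup>2" by (intro add_mono mult_left_mono power_mono b) auto
      finally show "norm ((cmod (translate (X k) d y - translate g d y))\<^sup>2) \<le> 4 * B\<^sup>2" by simp
    qed
  qed measurable
  then show "((\<lambda>h. LINT y|F. (cmod (translate h d y - translate g d y))\<^sup>2) \<circ> X) \<longlonglongrightarrow> 0" by (simp add: o_def)
qed

section \<open>Fourier coefficients\<close>

lemma cis_char_shift:
  assumes "\<xi> \<in> \<Sigma>" "k \<in> integer_vectors"
  shows "cis (- pi * (\<xi> \<bullet> (x + k))) = \<sigma> (k, 0) * cis (- pi * (\<xi> \<bullet> x))"
proof -
  have "cis (- pi * (\<xi> \<bullet> (x + k))) = cnj (cis (pi * (\<xi> \<bullet> k))) * cis (- pi * (\<xi> \<bullet> x))"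
    by (simp add: cis_cnj cis_mult inner_add_right algebra_simps)
  also have "cnj (cis (pi * (\<xi> \<bullet> k))) = \<sigma> (k, 0)"
    using assms by (simp add: Sigma_iff \<sigma>_cnj lattice_iff)
  finally show ?thesis .
qed

text \<open>The signs of \<phi> and of the character cancel, so the product has all integral vectors
  as periods, although each factor may change sign under them.\<close>

lemma fourier_integrand_periodic:
  assumes "equivariant A \<epsilon> \<phi>" "\<xi> \<in> \<Sigma>" "k \<in> unit_lattice"
  shows "\<phi> (x + k, t) * cis (- pi * (\<xi> \<bullet> (x + k))) = \<phi> (x, t) * cis (- pi * (\<xi> \<bullet> x))"
proof -
  have k: "k \<in> integer_vectors" using assms(3) by (simp add: integer_vectors_eq)
  have "\<phi> (x + k, t) * cis (- pi * (\<xi> \<bullet> (x + k))) = (\<sigma> (k, 0) * \<sigma> (k, 0)) * (\<phi> (x, t) * cis (- pi * (\<xi> \<bullet> x)))"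
    unfolding cis_char_shift[OF assms(2) k] equivariant_space[OF assms(1) k] by (simp only: ac_simps)
  then show ?thesis using k by (simp add: \<sigma>_square lattice_iff)
qed

lemma cis_inner_measurable [measurable]: "(\<lambda>x::real^'n. cis (c * (\<xi> \<bullet> x))) \<in> borel_measurable borel"
  by (intro borel_measurable_continuous_onI continuous_intros)

lemma fourier_coeff_cube: "fourier_coeff \<phi> \<xi> t = (LINT x|Q. \<phi> (2 *\<^sub>R x, t) * cis (- 2 * pi * (\<xi> \<bullet> x)))"
  by (simp add: fourier_coeff_def cube_measure_def integral_restrict_space set_lebesgue_integral_def One_vec)

text \<open>Doubling is a surjective endomorphism of the torus, and for
  \<open>\<xi> \<in> \<Sigma>\<close> the integrand is periodic under integral vectors, so the
  factor 2 in \<open>fourier_coeff\<close> can be removed.\<close>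

lemma fourier_coeff_eq:
  assumes m: "\<phi> \<in> borel_measurable borel" and e: "equivariant A \<epsilon> \<phi>" and \<xi>: "\<xi> \<in> \<Sigma>"
  shows "fourier_coeff \<phi> \<xi> t = (LINT x|Q. \<phi> (x, t) * cis (- pi * (\<xi> \<bullet> x)))"
proof -
  have [measurable]: "(\<lambda>x. \<phi> (x, t)) \<in> borel_measurable borel" by (rule measurable_slice[OF m])
  have "(LINT x|Q. \<phi> (2 *\<^sub>R x + 0, t) * cis (- pi * (\<xi> \<bullet> (2 *\<^sub>R x + 0)))) = (LINT x|Q. \<phi> (x, t) * cis (- pi * (\<xi> \<bullet> x)))"
  proof (rule integral_cube_affine[where f = "\<lambda>x. 2 *\<^sub>R x" and h = "\<lambda>x. \<phi> (x, t) * cis (- pi * (\<xi> \<bullet> x))"])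
    show "linear ((*\<^sub>R) 2 :: real^'n \<Rightarrow> real^'n)" by (rule linear_scaleR)
    show "surj ((*\<^sub>R) 2 :: real^'n \<Rightarrow> real^'n)" by (rule surjI[of _ "\<lambda>x. (1/2) *\<^sub>R x"]) simp
    show "2 *\<^sub>R k \<in> unit_lattice" if "k \<in> unit_lattice" for k :: "real^'n" using unit_lattice_add[OF that that] by (simp only: scaleR_2)
    show "(\<lambda>x. \<phi> (x, t) * cis (- pi * (\<xi> \<bullet> x))) \<in> borel_measurable borel" by measurable
  qed (rule fourier_integrand_periodic[OF e \<xi>])
  then show ?thesis unfolding fourier_coeff_cube by (simp add: mult.assoc mult.left_commute[of 2])
qed

text \<open>A shift by half an axis vector multiplies the integrand by a constant, which differs
  from 1 for a coordinate violating the parity condition, while the integral is unchanged.\<close>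

lemma fourier_coeff_zero:
  assumes m: "\<phi> \<in> borel_measurable borel" and e: "equivariant A \<epsilon> \<phi>" and \<xi>: "\<xi> \<in> integer_vectors - \<Sigma>"
  shows "fourier_coeff \<phi> \<xi> t = 0"
proof -
  obtain \<nu> where \<nu>: "cis (pi * (\<xi> $ \<nu>)) \<noteq> \<sigma> (axis \<nu> 1, 0)" using \<xi> by (auto simp: Sigma_axis)
  let ?h = "\<lambda>x. \<phi> (2 *\<^sub>R x, t) * cis (- 2 * pi * (\<xi> \<bullet> x))"
  let ?e = "axis \<nu> 1 :: real^'n"
  have [measurable]: "(\<lambda>x. \<phi> (2 *\<^sub>R x, t)) \<in> borel_measurable borel"
    by (rule measurable_compose[OF _ measurable_slice[OF m]]) simp
  have "(LINT x|Q. ?h (x + (1/2) *\<^sub>R ?e)) = (LINT x|Q. ?h x)"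
  proof (rule integral_cube_affine[where f = "\<lambda>x. x" and h = ?h])
    fix k x :: "real^'n" assume k: "k \<in> unit_lattice"
    have k2: "k + k \<in> integer_vectors" "k \<in> integer_vectors"
      using k unit_lattice_add[OF k k] by (simp_all only: integer_vectors_eq)
    have "\<phi> (2 *\<^sub>R (x + k), t) = \<sigma> (k + k, 0) * \<phi> (2 *\<^sub>R x, t)"
      using equivariant_space[OF e k2(1), of "2 *\<^sub>R x"] by (simp add: scaleR_2 algebra_simps)
    also have "\<sigma> (k + k, 0) = \<sigma> (k, 0) * \<sigma> (k, 0)" by (rule \<sigma>_add[OF k2(2) k2(2)])
    also have "\<dots> = 1" by (rule \<sigma>_square) (simp add: lattice_iff k2(2))
    finally have 1: "\<phi> (2 *\<^sub>R (x + k), t) = \<phi> (2 *\<^sub>R x, t)" by simp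
    have "\<xi> \<bullet> k \<in> \<int>"
      unfolding inner_vec_def using \<xi> k2 by (auto simp: integer_vectors_def intro!: Ints_sum Ints_mult)
    then obtain n where n: "\<xi> \<bullet> k = of_int n" by (elim Ints_cases)
    have "cis (- 2 * pi * (\<xi> \<bullet> (x + k))) = cis (- 2 * pi * (\<xi> \<bullet> x)) * cis (2 * pi * of_int (- n))"
      by (simp add: cis_mult inner_add_right n algebra_simps)
    then have "cis (- 2 * pi * (\<xi> \<bullet> (x + k))) = cis (- 2 * pi * (\<xi> \<bullet> x))" by (simp only: cis_int_2pi mult_1_right)
    then show "?h (x + k) = ?h x" using 1 by (simp only:)
  qed (auto simp: linear_id[unfolded id_def])
  moreover have "?h (x + (1/2) *\<^sub>R ?e) = (\<sigma> (?e, 0) * cis (- pi * (\<xi> $ \<nu>))) * ?h x" for x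
  proof -
    have "\<phi> (2 *\<^sub>R (x + (1/2) *\<^sub>R ?e), t) = \<sigma> (?e, 0) * \<phi> (2 *\<^sub>R x, t)"
      using equivariant_space[OF e axis_integer, of "2 *\<^sub>R x" \<nu>] by (simp add: scaleR_add_right)
    moreover have "cis (- 2 * pi * (\<xi> \<bullet> (x + (1/2) *\<^sub>R ?e))) = cis (- pi * (\<xi> $ \<nu>)) * cis (- 2 * pi * (\<xi> \<bullet> x))"
      by (simp add: cis_mult inner_add_right inner_axis algebra_simps)
    ultimately show ?thesis by simp
  qed
  ultimately have "(\<sigma> (?e, 0) * cis (- pi * (\<xi> $ \<nu>))) * fourier_coeff \<phi> \<xi> t = fourier_coeff \<phi> \<xi> t"
    unfolding fourier_coeff_cube by simp
  moreover have "\<sigma> (?e, 0) * cis (- pi * (\<xi> $ \<nu>)) \<noteq> 1"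
  proof
    assume "\<sigma> (?e, 0) * cis (- pi * (\<xi> $ \<nu>)) = 1"
    then have "\<sigma> (?e, 0) * cis (- pi * (\<xi> $ \<nu>)) * cis (pi * (\<xi> $ \<nu>)) = cis (pi * (\<xi> $ \<nu>))" by simp
    then show False using \<nu> by (simp add: mult.assoc cis_mult)
  qed
  ultimately show ?thesis by simp
qed

text \<open>Time equivariance combined with the invariance of the torus measure under
  \<open>A l\<close>. One coefficient function on the whole line thus carries all coefficients of a
  \<int>-orbit.\<close>

lemma fourier_coeff_shift:
  assumes m: "\<phi> \<in> borel_measurable borel" and e: "equivariant A \<epsilon> \<phi>" and \<xi>: "\<xi> \<in> \<Sigma>" and l: "l \<in> \<int>"
  shows "fourier_coeff \<phi> (dual_act A l \<xi>) t = \<sigma> (0, l) * fourier_coeff \<phi> \<xi> (t + l)"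
proof -
  have [measurable]: "(\<lambda>x. \<phi> (x, t + l)) \<in> borel_measurable borel" by (rule measurable_slice[OF m])
  have ll: "(0, l) \<in> lattice" using l by (simp add: lattice_iff zero_integer)
  have "fourier_coeff \<phi> (dual_act A l \<xi>) t = (LINT x|Q. \<phi> (x, t) * cis (- pi * (\<xi> \<bullet> (A l *v x))))"
    by (subst fourier_coeff_eq[OF m e Sigma_dual_act[OF l \<xi>]]) (simp add: dual_act_inner)
  also have "\<dots> = (LINT x|Q. \<sigma> (0, l) * (\<phi> (A l *v x + 0, t + l) * cis (- pi * (\<xi> \<bullet> (A l *v x + 0)))))"
  proof (rule Bochner_Integration.integral_cong[OF refl])
    fix x
    have "\<sigma> (0, l) * \<phi> (A l *v x, t + l) = (\<sigma> (0, l) * \<sigma> (0, l)) * \<phi> (x, t)" by (simp add: equivariant_time[OF e l])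
    then show "\<phi> (x, t) * cis (- pi * (\<xi> \<bullet> (A l *v x))) = \<sigma> (0, l) * (\<phi> (A l *v x + 0, t + l) * cis (- pi * (\<xi> \<bullet> (A l *v x + 0))))"
      using \<sigma>_square[OF ll] by (simp flip: mult.assoc)
  qed
  also have "\<dots> = \<sigma> (0, l) * (LINT x|Q. \<phi> (A l *v x + 0, t + l) * cis (- pi * (\<xi> \<bullet> (A l *v x + 0))))"
    by simp
  also have "(LINT x|Q. \<phi> (A l *v x + 0, t + l) * cis (- pi * (\<xi> \<bullet> (A l *v x + 0)))) = (LINT x|Q. \<phi> (x, t + l) * cis (- pi * (\<xi> \<bullet> x)))"
  proof (rule integral_cube_affine[where f = "\<lambda>x. A l *v x" and h = "\<lambda>x. \<phi> (x, t + l) * cis (- pi * (\<xi> \<bullet> x))"])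
    show "A l *v k \<in> unit_lattice" if "k \<in> unit_lattice" for k :: "real^'n"
      using that A_Ints_vec[OF l] by (simp add: integer_vectors_eq)
    show "(\<lambda>x. \<phi> (x, t + l) * cis (- pi * (\<xi> \<bullet> x))) \<in> borel_measurable borel" by measurable
  qed (rule matrix_vector_mul_linear A_surj fourier_integrand_periodic[OF e \<xi>], assumption?)+
  also have "\<dots> = fourier_coeff \<phi> \<xi> (t + l)" by (rule fourier_coeff_eq[OF m e \<xi>, symmetric])
  finally show ?thesis .
qed

end

section \<open>Poincare series\<close>

lemma test_functions_cmult:
  assumes "\<psi> \<in> test_functions" "continuous_on UNIV f"
  shows "(\<lambda>t. f t * \<psi> (t + s)) \<in> test_functions"
proof -
  obtain B where B: "\<And>t. \<psi> t \<noteq> 0 \<Longrightarrow> \<bar>t\<bar> \<le> B" and c: "continuous_on UNIV \<psi>" using assms(1) by (auto simp: test_functions_def)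
  have "continuous_on UNIV (\<lambda>t. \<psi> (t + s))" by (rule continuous_on_compose2[OF c]) (auto intro!: continuous_intros)
  then have "continuous_on UNIV (\<lambda>t. f t * \<psi> (t + s))" by (intro continuous_on_mult assms(2))
  moreover have "\<bar>t\<bar> \<le> B + \<bar>s\<bar>" if "f t * \<psi> (t + s) \<noteq> 0" for t
    using B[of "t + s"] that by simp
  ultimately show ?thesis unfolding test_functions_def by blast
qed

lemma test_functions_cnj: "\<psi> \<in> test_functions \<Longrightarrow> (\<lambda>t. cnj (\<psi> t)) \<in> test_functions"
  by (auto simp: test_functions_def intro!: continuous_intros)

text \<open>\<open>g\<close> vanishes outside finitely many unit intervals, so its integral is a
  finite sum over them, each moved to the unit interval.\<close>

lemma integral_line_tiles:
  fixes g :: "real \<Rightarrow> complex"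
  assumes g[measurable]: "g \<in> borel_measurable borel" and L: "finite L"
    and supp: "\<And>t. g t \<noteq> 0 \<Longrightarrow> \<lfloor>t\<rfloor> \<in> L"
    and i: "\<And>l. l \<in> L \<Longrightarrow> integrable cube_measure (\<lambda>t. g (t + of_int l))"
  shows "integrable lborel g \<and> (LINT t|lborel. g t) = (\<Sum>l\<in>L. LINT t|cube_measure. g (t + of_int l))"
proof -
  let ?J = "\<lambda>l::int. {of_int l..of_int l + 1 :: real}"
  have shift: "indicator (?J l) (of_int l + 1 * t) = (indicator {0..1} t :: complex)" for l t
    by (auto simp: indicator_def)
  have il: "integrable lborel (\<lambda>t. indicator (?J l) t * g t)"
    and el: "(LINT t|lborel. indicator (?J l) t * g t) = (LINT t|cube_measure. g (t + of_int l))" if "l \<in> L" for l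
  proof -
    have "integrable lborel (\<lambda>t. indicator {0..1} t * g (t + of_int l))"
      using i[OF that] by (simp add: integrable_cube_iff)
    then have "integrable lborel (\<lambda>t. indicator (?J l) (of_int l + 1 * t) * g (of_int l + 1 * t))"
      unfolding shift by (simp add: add.commute)
    then show "integrable lborel (\<lambda>t. indicator (?J l) t * g t)"
      using lborel_integrable_real_affine_iff[of 1 "\<lambda>t. indicator (?J l) t * g t" "of_int l"] by simp
    have "(LINT t|lborel. indicator (?J l) t * g t) = (LINT t|lborel. indicator (?J l) (of_int l + 1 * t) * g (of_int l + 1 * t))"
      using lborel_integral_real_affine[of 1 "\<lambda>t. indicator (?J l) t * g t" "of_int l"] by simp
    also have "\<dots> = (LINT t|cube_measure. g (t + of_int l))"
      unfolding shift by (simp add: integral_cube_eq add.commute)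
    finally show "(LINT t|lborel. indicator (?J l) t * g t) = (LINT t|cube_measure. g (t + of_int l))" .
  qed
  \<comment> \<open>Integers belong to two of the closed tiles and are discarded as a null
    set.\<close>
  have "AE t in lborel. t \<notin> (\<int> :: real set)"
    using AE_not_in[OF countable_imp_null_set_lborel[of "\<int> :: real set"]] by (simp add: Ints_def)
  then have ae: "AE t in lborel. (\<Sum>l\<in>L. indicator (?J l) t * g t) = g t"
  proof eventually_elim
    case (elim t)
    show ?case
    proof (cases "g t = 0")
      case False
      have one: "t \<in> ?J l \<longleftrightarrow> l = \<lfloor>t\<rfloor>" for l
      proof
        assume t: "t \<in> ?J l"
        have "t \<noteq> of_int l + 1" using elim by (metis Ints_1 Ints_add Ints_of_int)
        then have "t < of_int l + 1" using t by auto
        then show "l = \<lfloor>t\<rfloor>" using t floor_unique[of l t] by auto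
      next
        assume l: "l = \<lfloor>t\<rfloor>"
        show "t \<in> ?J l" unfolding l using of_int_floor_le[of t] real_of_int_floor_add_one_ge[of t] by simp
      qed
      have "(\<Sum>l\<in>L. indicator (?J l) t * g t) = (\<Sum>l\<in>L. if l = \<lfloor>t\<rfloor> then g t else 0)"
        unfolding indicator_def one by (intro sum.cong refl) simp
      then show ?thesis using L supp[OF False] by simp
    qed simp
  qed
  have sint: "integrable lborel (\<lambda>t. \<Sum>l\<in>L. indicator (?J l) t * g t)" by (intro Bochner_Integration.integrable_sum il)
  have "integrable lborel g \<longleftrightarrow> integrable lborel (\<lambda>t. \<Sum>l\<in>L. indicator (?J l) t * g t)"
    by (rule integrable_cong_AE) (use ae in \<open>auto elim!: eventually_mono\<close>)
  moreover have "(LINT t|lborel. g t) = (LINT t|lborel. (\<Sum>l\<in>L. indicator (?J l) t * g t))"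
    by (rule integral_cong_AE) (use ae in \<open>auto elim!: eventually_mono\<close>)
  moreover have "\<dots> = (\<Sum>l\<in>L. (LINT t|cube_measure. g (t + of_int l)))"
    by (subst Bochner_Integration.integral_sum) (auto simp: il el)
  ultimately show ?thesis using sint by simp
qed

context solvmanifold
begin

text \<open>An unrestricted infinite sum makes shifts of the index plain reindexing; for test
  functions it reduces to the finite sum of \<open>poincare_sum\<close>.\<close>

definition poincare :: "real^'n \<Rightarrow> (real \<Rightarrow> complex) \<Rightarrow> (real^'n) \<times> real \<Rightarrow> complex" where
  "poincare \<xi> \<psi> y = (\<Sum>\<^sub>\<infinity>l::int. \<sigma> (0, of_int l) * \<psi> (snd y + of_int l) * cis (pi * (dual_act A (of_int l) \<xi> \<bullet> fst y)))"

lemma poincare_sum: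
  assumes "finite L" "\<And>l::int. \<psi> (t + of_int l) \<noteq> 0 \<Longrightarrow> l \<in> L"
  shows "poincare \<xi> \<psi> (x, t) = (\<Sum>l\<in>L. \<sigma> (0, of_int l) * \<psi> (t + of_int l) * cis (pi * (dual_act A (of_int l) \<xi> \<bullet> x)))"
proof -
  have "poincare \<xi> \<psi> (x, t) = infsum (\<lambda>l. \<sigma> (0, of_int l) * \<psi> (t + of_int l) * cis (pi * (dual_act A (of_int l) \<xi> \<bullet> x))) L"
    unfolding poincare_def fst_conv snd_conv by (rule infsum_cong_neutral) (use assms(2) in auto)
  then show ?thesis using assms(1) by simp
qed

lemma test_window:
  assumes "\<psi> \<in> test_functions"
  obtains N where "\<And>t l. \<bar>t\<bar> \<le> T \<Longrightarrow> \<psi> (t + of_int l) \<noteq> 0 \<Longrightarrow> l \<in> {-N..N::int}"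
proof -
  obtain B where B: "\<And>t. \<psi> t \<noteq> 0 \<Longrightarrow> \<bar>t\<bar> \<le> B" using assms by (auto simp: test_functions_def)
  have "l \<in> {- \<lceil>B + T\<rceil>..\<lceil>B + T\<rceil>}" if "\<bar>t\<bar> \<le> T" "\<psi> (t + of_int l) \<noteq> 0" for t l
  proof -
    have "\<bar>of_int l :: real\<bar> \<le> B + T" using B[OF that(2)] that(1) by linarith
    then show ?thesis by (simp add: abs_le_iff) linarith
  qed
  then show ?thesis by (rule that)
qed

text \<open>Near \<open>y\<close> the time coordinate is bounded, so one finite window of indices
  serves a whole neighbourhood.\<close>

lemma poincare_continuous:
  assumes \<psi>: "\<psi> \<in> test_functions"
  shows "continuous_on UNIV (poincare \<xi> \<psi>)"
proof -
  have "isCont (poincare \<xi> \<psi>) y" for y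
  proof -
    define U where "U = (UNIV :: (real^'n) set) \<times> ball (snd y) 1"
    obtain N where N: "\<And>t l. \<bar>t\<bar> \<le> \<bar>snd y\<bar> + 1 \<Longrightarrow> \<psi> (t + of_int l) \<noteq> 0 \<Longrightarrow> l \<in> {-N..N::int}"
      using test_window[OF \<psi>] by blast
    have eq: "poincare \<xi> \<psi> z = (\<Sum>l\<in>{-N..N}. \<sigma> (0, of_int l) * \<psi> (snd z + of_int l) * cis (pi * (dual_act A (of_int l) \<xi> \<bullet> fst z)))"
      if "z \<in> U" for z
    proof -
      have "\<bar>snd z\<bar> \<le> \<bar>snd y\<bar> + 1" using that by (auto simp: U_def dist_real_def mem_Times_iff)
      then show ?thesis using poincare_sum[of "{-N..N}" \<psi> "snd z" \<xi> "fst z"] N by simp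
    qed
    have c: "continuous_on UNIV \<psi>" using \<psi> by (simp add: test_functions_def)
    have "continuous_on U (\<lambda>z. \<Sum>l\<in>{-N..N}. \<sigma> (0, of_int l) * \<psi> (snd z + of_int l) * cis (pi * (dual_act A (of_int l) \<xi> \<bullet> fst z)))"
    proof (intro continuous_on_sum continuous_on_mult continuous_on_const)
      show "continuous_on U (\<lambda>z. \<psi> (snd z + of_int l))" for l
        by (rule continuous_on_compose2[OF c]) (auto intro!: continuous_intros)
      show "continuous_on U (\<lambda>z. cis (pi * (dual_act A (of_int l) \<xi> \<bullet> fst z)))" for l
        by (intro continuous_intros)
    qed
    then have "continuous_on U (poincare \<xi> \<psi>)" using eq by (simp cong: continuous_on_cong)
    moreover have "open U" "y \<in> U" unfolding U_def by (auto intro: open_Times simp: mem_Times_iff)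
    ultimately show ?thesis using continuous_on_eq_continuous_at by blast
  qed
  then show ?thesis by (simp add: continuous_at_imp_continuous_on)
qed

lemma dual_act_A_inner: "dual_act A l \<xi> \<bullet> (A s *v x) = dual_act A (l + s) \<xi> \<bullet> x"
  by (simp add: dual_act_inner A_vec_add)

lemma zero_lattice: "l \<in> \<int> \<Longrightarrow> (0, l) \<in> lattice"
  by (simp add: lattice_iff zero_integer)

text \<open>Reindexing by \<open>l \<mapsto> l + m\<close>, with \<open>\<sigma> (0, m)\<close> of
  square 1. Serves both equivariance in time and the change of base point along a
  \<int>-orbit.\<close>

lemma poincare_time_shift:
  "(\<Sum>\<^sub>\<infinity>l::int. \<sigma> (0, of_int l) * \<psi> (t + of_int m + of_int l) * cis (pi * (dual_act A (of_int l + of_int m) \<xi> \<bullet> x)))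
    = \<sigma> (0, of_int m) * poincare \<xi> \<psi> (x, t)"
proof -
  let ?T = "\<lambda>l::int. \<sigma> (0, of_int l) * \<psi> (t + of_int l) * cis (pi * (dual_act A (of_int l) \<xi> \<bullet> x))"
  have "\<sigma> (0, of_int l) * \<psi> (t + of_int m + of_int l) * cis (pi * (dual_act A (of_int l + of_int m) \<xi> \<bullet> x))
    = \<sigma> (0, of_int m) * ?T (l + m)" for l :: int
  proof -
    have "\<sigma> (0, of_int (l + m)) = \<sigma> (0, of_int l) * \<sigma> (0, of_int m)" using \<sigma>_time_add[of "of_int l" "of_int m"] by simp
    then have "\<sigma> (0, of_int m) * \<sigma> (0, of_int (l + m)) = \<sigma> (0, of_int l) * (\<sigma> (0, of_int m) * \<sigma> (0, of_int m))" by simp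
    also have "\<dots> = \<sigma> (0, of_int l)" using \<sigma>_square[OF zero_lattice[of "of_int m"]] by simp
    finally have s: "\<sigma> (0, of_int m) * \<sigma> (0, of_int (l + m)) = \<sigma> (0, of_int l)" .
    have "t + of_int (l + m) = t + of_int m + of_int l" by simp
    then show ?thesis unfolding s[symmetric] by (simp only: of_int_add mult.assoc)
  qed
  then have "(\<Sum>\<^sub>\<infinity>l::int. \<sigma> (0, of_int l) * \<psi> (t + of_int m + of_int l) * cis (pi * (dual_act A (of_int l + of_int m) \<xi> \<bullet> x)))
    = (\<Sum>\<^sub>\<infinity>l::int. \<sigma> (0, of_int m) * ?T (l + m))" by (simp only:)
  also have "\<dots> = \<sigma> (0, of_int m) * (\<Sum>\<^sub>\<infinity>l::int. ?T (l + m))" by (rule infsum_cmult_right')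
  also have "(\<Sum>\<^sub>\<infinity>l::int. ?T (l + m)) = infsum ?T UNIV"
    by (rule infsum_reindex_bij_betw) (rule bij_betw_byWitness[where f' = "\<lambda>l. l - m"], auto)
  finally show ?thesis by (simp add: poincare_def)
qed

text \<open>For integral \<open>k\<close> every term is multiplied by the same sign, as the whole
  \<int>-orbit of \<xi> lies in \<Sigma>; the time part is
  \<open>poincare_time_shift\<close>.\<close>

lemma poincare_equivariant:
  assumes \<xi>: "\<xi> \<in> \<Sigma>"
  shows "equivariant A \<epsilon> (poincare \<xi> \<psi>)"
  unfolding equivariant_iff
proof (intro conjI ballI allI)
  fix k :: "real^'n" and x t assume k: "k \<in> integer_vectors"
  have "cis (pi * (dual_act A (of_int l) \<xi> \<bullet> (x + k))) = \<sigma> (k, 0) * cis (pi * (dual_act A (of_int l) \<xi> \<bullet> x))" for l :: int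
  proof -
    have "dual_act A (of_int l) \<xi> \<in> \<Sigma>" by (rule Sigma_dual_act[OF _ \<xi>]) simp
    then have "cis (pi * (dual_act A (of_int l) \<xi> \<bullet> k)) = \<sigma> (k, 0)" using k by (simp add: Sigma_iff)
    moreover have "cis (pi * (dual_act A (of_int l) \<xi> \<bullet> (x + k)))
      = cis (pi * (dual_act A (of_int l) \<xi> \<bullet> k)) * cis (pi * (dual_act A (of_int l) \<xi> \<bullet> x))"
      unfolding cis_mult by (simp add: inner_add_right algebra_simps)
    ultimately show ?thesis by simp
  qed
  then have "poincare \<xi> \<psi> (x + k, t) = (\<Sum>\<^sub>\<infinity>l::int. \<sigma> (k, 0) * (\<sigma> (0, of_int l) * \<psi> (t + of_int l) * cis (pi * (dual_act A (of_int l) \<xi> \<bullet> x))))"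
    unfolding poincare_def fst_conv snd_conv by (simp only: ac_simps)
  also have "\<dots> = \<sigma> (k, 0) * poincare \<xi> \<psi> (x, t)"
    unfolding poincare_def fst_conv snd_conv by (rule infsum_cmult_right')
  finally show "poincare \<xi> \<psi> (x + k, t) = \<sigma> (k, 0) * poincare \<xi> \<psi> (x, t)" .
next
  fix j x t assume "j \<in> (\<int> :: real set)"
  then obtain m where j: "j = of_int m" by (elim Ints_cases)
  show "poincare \<xi> \<psi> (A j *v x, t + j) = \<sigma> (0, j) * poincare \<xi> \<psi> (x, t)"
    unfolding j poincare_time_shift[symmetric] by (simp add: poincare_def dual_act_A_inner)
qed

lemma poincare_S: "\<xi> \<in> \<Sigma> \<Longrightarrow> \<psi> \<in> test_functions \<Longrightarrow> poincare \<xi> \<psi> \<in> S"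
  by (intro continuous_in_S poincare_continuous poincare_equivariant)

text \<open>The operator of \<open>rho_eta\<close> at the level of functions.\<close>

definition rotate :: "real^'n \<Rightarrow> (real^'n) \<times> real \<Rightarrow> (real \<Rightarrow> complex) \<Rightarrow> real \<Rightarrow> complex" where
  "rotate \<eta> g \<psi> t = cis (pi * (dual_act A t \<eta> \<bullet> fst g)) * \<psi> (t + snd g)"

lemma rotate_test: "\<psi> \<in> test_functions \<Longrightarrow> rotate \<eta> g \<psi> \<in> test_functions"
  unfolding rotate_def[abs_def] by (intro test_functions_cmult continuous_intros dual_act_cont)

text \<open>Moving \<open>A t\<close> across the pairing turns the extra character factor into one
  evaluated at \<open>t + l\<close>, where it is absorbed into \<psi>.\<close>

lemma translate_poincare: "translate g (poincare \<xi> \<psi>) = poincare \<xi> (rotate \<xi> g \<psi>)"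
proof
  fix y :: "(real^'n) \<times> real"
  have "cis (pi * (dual_act A (of_int l) \<xi> \<bullet> (fst y + A (snd y) *v fst g)))
    = cis (pi * (dual_act A (snd y + of_int l) \<xi> \<bullet> fst g)) * cis (pi * (dual_act A (of_int l) \<xi> \<bullet> fst y))" for l :: int
    unfolding cis_mult by (simp add: inner_add_right dual_act_A_inner algebra_simps)
  moreover have "snd y + snd g + of_int l = snd y + of_int l + snd g" for l :: int by simp
  ultimately show "translate g (poincare \<xi> \<psi>) y = poincare \<xi> (rotate \<xi> g \<psi>) y"
    unfolding translate_def poincare_def rotate_def G_mult' fst_conv snd_conv by (simp only: ac_simps)
qed

text \<open>Series based at different points of one \<int>-orbit are the same family with shifted
  \<psi>, so a single base point represents the orbit.\<close>

lemma poincare_dual_act: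
  "poincare (dual_act A (of_int j) \<xi>) \<psi> = poincare \<xi> (\<lambda>t. \<sigma> (0, of_int j) * \<psi> (t - of_int j))"
proof
  fix y :: "(real^'n) \<times> real"
  let ?\<psi> = "\<lambda>t. \<psi> (t - of_int j)"
  obtain x t where y: "y = (x, t)" by (cases y)
  have "poincare (dual_act A (of_int j) \<xi>) \<psi> y
    = (\<Sum>\<^sub>\<infinity>l::int. \<sigma> (0, of_int l) * ?\<psi> (t + of_int j + of_int l) * cis (pi * (dual_act A (of_int l + of_int j) \<xi> \<bullet> x)))"
    by (simp add: poincare_def y dual_act_add algebra_simps)
  also have "\<dots> = \<sigma> (0, of_int j) * poincare \<xi> ?\<psi> (x, t)" by (rule poincare_time_shift)
  also have "\<dots> = poincare \<xi> (\<lambda>t. \<sigma> (0, of_int j) * ?\<psi> t) y"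
    unfolding y poincare_def fst_conv snd_conv infsum_cmult_right'[symmetric] by (simp only: ac_simps)
  finally show "poincare (dual_act A (of_int j) \<xi>) \<psi> y = poincare \<xi> (\<lambda>t. \<sigma> (0, of_int j) * ?\<psi> t) y" .
qed

section \<open>Unfolding\<close>

lemma S_integrable: "\<phi> \<in> S \<Longrightarrow> integrable F \<phi>"
proof (rule Bochner_Integration.integrable_bound)
  assume \<phi>: "\<phi> \<in> S"
  show "integrable F (\<lambda>y. 1 + (cmod (\<phi> y))\<^sup>2)"
    using S_square[OF \<phi>] finite_measure.integrable_const[OF finite_F] by (intro Bochner_Integration.integrable_add)
  have "cmod z \<le> 1 + (cmod z)\<^sup>2" for z using sum_squares_bound[of "cmod z" 1] norm_ge_zero[of z] by (simp only: one_power2 mult_1_right)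
  then show "AE y in F. norm (\<phi> y) \<le> norm (1 + (cmod (\<phi> y))\<^sup>2)" by (intro AE_I2) (simp add: abs_of_nonneg)
  show "\<phi> \<in> borel_measurable F" by (rule measurable_F[OF S_measurable[OF \<phi>]])
qed

lemma fourier_coeff_measurable:
  assumes \<phi>: "\<phi> \<in> S" and \<xi>: "\<xi> \<in> \<Sigma>"
  shows "(\<lambda>t. fourier_coeff \<phi> \<xi> t) \<in> borel_measurable borel"
proof -
  interpret Q: finite_measure Q by (rule finite_cube_measure)
  have m: "(\<lambda>p. (snd p, fst p)) \<in> borel \<Otimes>\<^sub>M Q \<rightarrow>\<^sub>M (borel \<Otimes>\<^sub>M borel)"
    by (intro measurable_Pair measurable_compose[OF measurable_snd] measurable_cube_measure) auto
  have 1: "(\<lambda>p. \<phi> (snd p, fst p)) \<in> borel_measurable (borel \<Otimes>\<^sub>M Q)"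
    using measurable_compose[OF m, of \<phi> borel] S_measurable[OF \<phi>] by (simp add: borel_prod)
  have 2: "(\<lambda>p. cis (- pi * (\<xi> \<bullet> snd p))) \<in> borel_measurable (borel \<Otimes>\<^sub>M Q)"
    by (rule measurable_compose[OF measurable_snd]) (intro measurable_cube_measure cis_inner_measurable)
  have "(\<lambda>p. \<phi> (snd p, fst p) * cis (- pi * (\<xi> \<bullet> snd p))) \<in> borel_measurable (borel \<Otimes>\<^sub>M Q)"
    by (rule borel_measurable_times[OF 1 2])
  then have "(\<lambda>t. LINT x|Q. \<phi> (x, t) * cis (- pi * (\<xi> \<bullet> x))) \<in> borel_measurable borel"
    using Q.borel_measurable_lebesgue_integral[of "\<lambda>t x. \<phi> (x, t) * cis (- pi * (\<xi> \<bullet> x))" borel]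
    by (simp add: case_prod_unfold)
  then show ?thesis by (simp only: fourier_coeff_eq[OF S_measurable[OF \<phi>] S_equivariant[OF \<phi>] \<xi>])
qed

lemma
  fixes f :: "(real^'n) \<times> real \<Rightarrow> complex"
  assumes f: "integrable F f"
  shows integral_F: "(LINT y|F. f y) = (LINT t|I. LINT x|Q. f (x, t))"
    and integrable_F_slice: "integrable I (\<lambda>t. LINT x|Q. f (x, t))"
    and AE_F_slice: "AE t in I. integrable Q (\<lambda>x. f (x, t))"
proof -
  interpret QI: pair_sigma_finite Q I by (rule pair_QI)
  have f': "integrable (Q \<Otimes>\<^sub>M I) (\<lambda>(x, t). f (x, t))" using f by (simp add: F_eq)
  show "(LINT y|F. f y) = (LINT t|I. LINT x|Q. f (x, t))"
    using QI.integral_snd[OF f'] by (simp add: F_eq)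
  show "integrable I (\<lambda>t. LINT x|Q. f (x, t))" by (rule QI.integrable_snd[OF f'])
  show "AE t in I. integrable Q (\<lambda>x. f (x, t))" by (rule QI.AE_integrable_snd[OF f'])
qed

text \<open>Fubini gives integrability over the unit interval; on the interval starting at
  \<open>l\<close> it follows from the coefficient at the orbit point \<eta> through
  \<open>fourier_coeff_shift\<close>.\<close>

lemma fourier_coeff_integrable:
  assumes \<phi>: "\<phi> \<in> S" and \<xi>: "\<xi> \<in> \<Sigma>"
  shows "integrable I (\<lambda>t. fourier_coeff \<phi> \<xi> (t + of_int l))"
proof -
  define \<eta> where "\<eta> = dual_act A (of_int l) \<xi>"
  have \<eta>: "\<eta> \<in> \<Sigma>" unfolding \<eta>_def by (rule Sigma_dual_act[OF _ \<xi>]) simp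
  have "integrable F (\<lambda>y. cis (- pi * (\<eta> \<bullet> fst y)) * \<phi> y)"
    by (rule integrable_bounded_mult[OF S_integrable[OF \<phi>], where B = 1])
      (auto intro!: measurable_F borel_measurable_continuous_onI continuous_intros)
  from integrable_F_slice[OF this] have "integrable I (\<lambda>t. fourier_coeff \<phi> \<eta> t)"
    by (simp add: fourier_coeff_eq[OF S_measurable[OF \<phi>] S_equivariant[OF \<phi>] \<eta>] mult.commute)
  then have "integrable I (\<lambda>t. \<sigma> (0, of_int l) * fourier_coeff \<phi> \<eta> t)" by simp
  moreover have "\<sigma> (0, of_int l) * fourier_coeff \<phi> \<eta> t = fourier_coeff \<phi> \<xi> (t + of_int l)" for t
  proof -
    have "\<sigma> (0, of_int l) * fourier_coeff \<phi> \<eta> t = (\<sigma> (0, of_int l) * \<sigma> (0, of_int l)) * fourier_coeff \<phi> \<xi> (t + of_int l)"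
      unfolding \<eta>_def by (subst fourier_coeff_shift[OF S_measurable[OF \<phi>] S_equivariant[OF \<phi>] \<xi>]) simp_all
    then show ?thesis using \<sigma>_square[OF zero_lattice[of "of_int l"]] by simp
  qed
  ultimately show ?thesis by simp
qed

lemma fourier_coeff_locally_integrable:
  assumes \<phi>: "\<phi> \<in> S" and \<xi>: "\<xi> \<in> \<Sigma>" and m: "w \<in> borel_measurable borel" and B: "\<And>t. cmod (w t) \<le> B"
    and supp: "\<And>t. w t \<noteq> 0 \<Longrightarrow> \<bar>t\<bar> \<le> R"
  shows "integrable lborel (\<lambda>t. w t * fourier_coeff \<phi> \<xi> t)"
proof -
  have "integrable lborel (\<lambda>t. w t * fourier_coeff \<phi> \<xi> t) \<and>
    (LINT t|lborel. w t * fourier_coeff \<phi> \<xi> t) = (\<Sum>l\<in>{- \<lceil>R\<rceil> - 1..\<lceil>R\<rceil>}. LINT t|I. w (t + of_int l) * fourier_coeff \<phi> \<xi> (t + of_int l))"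
  proof (rule integral_line_tiles)
    show "(\<lambda>t. w t * fourier_coeff \<phi> \<xi> t) \<in> borel_measurable borel"
      using m fourier_coeff_measurable[OF \<phi> \<xi>] by (rule borel_measurable_times)
    show "\<lfloor>t\<rfloor> \<in> {- \<lceil>R\<rceil> - 1..\<lceil>R\<rceil>}" if "w t * fourier_coeff \<phi> \<xi> t \<noteq> 0" for t
    proof -
      have "\<bar>t\<bar> \<le> R" using supp[of t] that by auto
      then show ?thesis by (simp add: abs_le_iff) linarith
    qed
    show "integrable I (\<lambda>t. w (t + of_int l) * fourier_coeff \<phi> \<xi> (t + of_int l))" for l
      by (rule integrable_bounded_mult[OF fourier_coeff_integrable[OF \<phi> \<xi>], where B = B])
        (use m B in \<open>auto intro!: measurable_cube_measure\<close>)
  qed simp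
  then show ?thesis by blast
qed

text \<open>On the fundamental domain only finitely many terms of the series survive. The
  \<open>x\<close>-integral of the \<open>l\<close>-th term is a coefficient at
  \<open>A(l)^T \<xi>\<close>, hence by \<open>fourier_coeff_shift\<close> the one at \<xi> at time
  \<open>t + l\<close>; the shifted unit intervals tile the line.\<close>

theorem unfolding_formula:
  assumes \<phi>: "\<phi> \<in> S" and \<xi>: "\<xi> \<in> \<Sigma>" and \<psi>: "\<psi> \<in> test_functions"
  shows "(LINT y|F. \<phi> y * cnj (poincare \<xi> \<psi> y)) = (LINT t|lborel. fourier_coeff \<phi> \<xi> t * cnj (\<psi> t))"
proof -
  have "\<exists>B. \<forall>t. cmod (\<psi> t) \<le> B" by (rule test_function_bounded[OF \<psi>]) blast
  then obtain B where B: "\<And>t. cmod (\<psi> t) \<le> B" by blast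
  obtain N where N: "\<And>t l. \<bar>t\<bar> \<le> 1 \<Longrightarrow> \<psi> (t + of_int l) \<noteq> 0 \<Longrightarrow> l \<in> {-N..N::int}"
    using test_window[OF \<psi>] by blast
  have \<psi>m[measurable]: "\<psi> \<in> borel_measurable borel" by (rule test_function_measurable[OF \<psi>])
  \<comment> \<open>The \<open>l\<close>-th term of the conjugated series times \<phi>; its factor
    \<open>\<sigma> (0, l)\<close> will cancel against the one from the shift formula.\<close>
  define p where "p l y = cnj (\<sigma> (0, of_int l) * \<psi> (snd y + of_int l) * cis (pi * (dual_act A (of_int l) \<xi> \<bullet> fst y))) * \<phi> y" for l :: int and y
  let ?g = "\<lambda>t. fourier_coeff \<phi> \<xi> t * cnj (\<psi> t)"
  have c: "continuous_on UNIV \<psi>" using \<psi> by (simp add: test_functions_def)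
  have pi: "integrable F (p l)" for l
    unfolding p_def
  proof (rule integrable_bounded_mult[OF S_integrable[OF \<phi>], where B = B])
    show "(\<lambda>y. cnj (\<sigma> (0, of_int l) * \<psi> (snd y + of_int l) * cis (pi * (dual_act A (of_int l) \<xi> \<bullet> fst y)))) \<in> borel_measurable F"
      by (intro measurable_F borel_measurable_continuous_onI continuous_intros continuous_on_compose2[OF c]) auto
  qed (simp add: norm_mult \<sigma>_norm B)
  have pe: "(LINT y|F. p l y) = (LINT t|I. ?g (t + of_int l))" for l
  proof -
    let ?\<eta> = "dual_act A (of_int l) \<xi>"
    have \<eta>: "?\<eta> \<in> \<Sigma>" by (rule Sigma_dual_act[OF _ \<xi>]) simp
    have "(LINT x|Q. p l (x, t)) = ?g (t + of_int l)" for t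
    proof -
      have "(LINT x|Q. p l (x, t)) = (LINT x|Q. (\<sigma> (0, of_int l) * cnj (\<psi> (t + of_int l))) * (\<phi> (x, t) * cis (- pi * (?\<eta> \<bullet> x))))"
        by (simp add: p_def cis_cnj \<sigma>_cnj zero_lattice algebra_simps)
      also have "\<dots> = (\<sigma> (0, of_int l) * cnj (\<psi> (t + of_int l))) * fourier_coeff \<phi> ?\<eta> t"
        by (simp add: fourier_coeff_eq[OF S_measurable[OF \<phi>] S_equivariant[OF \<phi>] \<eta>])
      also have "\<dots> = (\<sigma> (0, of_int l) * \<sigma> (0, of_int l)) * ?g (t + of_int l)"
        by (subst fourier_coeff_shift[OF S_measurable[OF \<phi>] S_equivariant[OF \<phi>] \<xi>]) simp_all
      also have "\<dots> = ?g (t + of_int l)" using \<sigma>_square[OF zero_lattice[of "of_int l"]] by simp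
      finally show ?thesis .
    qed
    then show ?thesis using integral_F[OF pi[of l]] by simp
  qed
  have "(LINT y|F. \<phi> y * cnj (poincare \<xi> \<psi> y)) = (LINT y|F. (\<Sum>l\<in>{-N..N}. p l y))"
  proof (rule Bochner_Integration.integral_cong[OF refl])
    fix y assume "y \<in> space F"
    then obtain x t where y: "y = (x, t)" and t: "\<bar>t\<bar> \<le> 1" by (cases y) (auto simp: space_F)
    have "poincare \<xi> \<psi> y = (\<Sum>l\<in>{-N..N}. \<sigma> (0, of_int l) * \<psi> (t + of_int l) * cis (pi * (dual_act A (of_int l) \<xi> \<bullet> x)))"
      unfolding y by (rule poincare_sum) (use N[OF t] in auto)
    then show "\<phi> y * cnj (poincare \<xi> \<psi> y) = (\<Sum>l\<in>{-N..N}. p l y)"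
      by (simp only: y p_def fst_conv snd_conv cnj_sum sum_distrib_left mult.commute[of "\<phi> (x, t)"])
  qed
  also have "\<dots> = (\<Sum>l\<in>{-N..N}. LINT t|I. ?g (t + of_int l))"
    using pi by (subst Bochner_Integration.integral_sum) (auto simp: pe)
  also have "\<dots> = (LINT t|lborel. ?g t)"
  proof (rule integral_line_tiles[THEN conjunct2, symmetric])
    show "?g \<in> borel_measurable borel" using fourier_coeff_measurable[OF \<phi> \<xi>] by measurable
    show "\<lfloor>t\<rfloor> \<in> {-N..N}" if "?g t \<noteq> 0" for t
      using N[of "t - of_int \<lfloor>t\<rfloor>" "\<lfloor>t\<rfloor>"] that by (simp add: abs_le_iff) linarith
    show "integrable I (\<lambda>t. ?g (t + of_int l))" for l
    proof -
      have "integrable I (\<lambda>t. cnj (\<psi> (t + of_int l)) * fourier_coeff \<phi> \<xi> (t + of_int l))"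
        by (rule integrable_bounded_mult[OF fourier_coeff_integrable[OF \<phi> \<xi>], where B = B])
          (use B in \<open>auto intro!: measurable_cube_measure\<close>)
      then show ?thesis by (simp add: mult.commute)
    qed
  qed simp
  finally show ?thesis .
qed

text \<open>Converts almost everywhere vanishing into orthogonality to Poincare series, a condition
  on classes.\<close>

lemma fourier_coeff_zero_iff:
  assumes \<phi>: "\<phi> \<in> S" and \<xi>: "\<xi> \<in> \<Sigma>"
  shows "(\<forall>\<psi>\<in>test_functions. (LINT y|F. \<phi> y * cnj (poincare \<xi> \<psi> y)) = 0) \<longleftrightarrow> (AE t in lborel. fourier_coeff \<phi> \<xi> t = 0)"
proof
  assume z: "\<forall>\<psi>\<in>test_functions. (LINT y|F. \<phi> y * cnj (poincare \<xi> \<psi> y)) = 0"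
  show "AE t in lborel. fourier_coeff \<phi> \<xi> t = 0"
  proof (rule test_functions_total)
    show "integrable lborel (\<lambda>t. indicator {- real N..real N} t * fourier_coeff \<phi> \<xi> t)" for N :: nat
      by (rule fourier_coeff_locally_integrable[OF \<phi> \<xi>, where B = 1 and R = "real N"]) (auto simp: indicator_def)
    fix \<psi> assume \<psi>: "\<psi> \<in> test_functions"
    have "(LINT t|lborel. fourier_coeff \<phi> \<xi> t * cnj (cnj (\<psi> t))) = 0"
      using z unfolding_formula[OF \<phi> \<xi> test_functions_cnj[OF \<psi>]] test_functions_cnj[OF \<psi>] by simp
    then show "(LINT t|lborel. \<psi> t * fourier_coeff \<phi> \<xi> t) = 0" by (simp add: mult.commute)
  qed
next
  assume ae: "AE t in lborel. fourier_coeff \<phi> \<xi> t = 0"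
  have "(LINT t|lborel. fourier_coeff \<phi> \<xi> t * cnj (\<psi> t)) = 0" for \<psi>
    by (rule integral_eq_zero_AE) (use ae in \<open>auto elim!: eventually_mono\<close>)
  then show "\<forall>\<psi>\<in>test_functions. (LINT y|F. \<phi> y * cnj (poincare \<xi> \<psi> y)) = 0"
    using unfolding_formula[OF \<phi> \<xi>] by simp
qed

lemma Sigma_add_lattice:
  assumes "\<xi> \<in> \<Sigma>" "k \<in> integer_vectors"
  shows "\<xi> - 2 *\<^sub>R k \<in> \<Sigma>"
proof -
  have "cis (pi * ((\<xi> - 2 *\<^sub>R k) $ \<nu>)) = cis (pi * (\<xi> $ \<nu>))" for \<nu>
  proof -
    obtain m where m: "k $ \<nu> = of_int m" using assms(2) by (auto simp: integer_vectors_def elim!: Ints_cases)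
    have "cis (pi * ((\<xi> - 2 *\<^sub>R k) $ \<nu>)) = cis (pi * (\<xi> $ \<nu>)) * cis (2 * pi * of_int (- m))"
      unfolding cis_mult by (simp add: m algebra_simps)
    then show ?thesis by (simp only: cis_int_2pi mult_1_right)
  qed
  then show ?thesis using assms(1) by (simp add: Sigma_axis)
qed

text \<open>Multiplication by the conjugate character of a base point \<open>\<xi>0\<close> turns
  slices of \<phi> into functions on the unit torus, whose integral against the character of
  \<open>l\<close> is the coefficient of \<phi> at \<open>\<xi>0 - 2 l\<close>. Countability of
  \<Sigma> exchanges the quantifier over frequencies with almost every \<open>t\<close>.\<close>

lemma fourier_coeffs_total:
  assumes \<phi>: "\<phi> \<in> S" and z: "\<And>\<xi>. \<xi> \<in> \<Sigma> \<Longrightarrow> AE t in lborel. fourier_coeff \<phi> \<xi> t = 0"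
  shows "AE y in F. \<phi> y = 0"
proof -
  define \<xi>0 where "\<xi>0 = (\<chi> \<nu>. real_of_int (\<epsilon> (axis \<nu> 1, 0)))"
  have \<xi>0: "\<xi>0 \<in> \<Sigma>" by (auto simp: Sigma_eps_def \<xi>0_def intro: exI[of _ 0])
  have cS: "countable \<Sigma>"
    using countable_subset[OF Sigma_integer] countable_unit_lattice by (simp add: integer_vectors_eq)
  have "AE t in lborel. \<forall>\<xi>\<in>\<Sigma>. fourier_coeff \<phi> \<xi> t = 0"
    using z by (simp add: AE_ball_countable[OF cS])
  then have "AE t in I. \<forall>\<xi>\<in>\<Sigma>. fourier_coeff \<phi> \<xi> t = 0"
    unfolding AE_cube_iff by eventually_elim simp
  then have "AE t in I. AE x in Q. \<phi> (x, t) = 0"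
    using AE_F_slice[OF S_integrable[OF \<phi>]]
  proof eventually_elim
    case (elim t)
    have "AE x in Q. cis (- pi * (\<xi>0 \<bullet> x)) * \<phi> (x, t) = 0"
    proof (rule fourier_unique_cube)
      show "integrable Q (\<lambda>x. cis (- pi * (\<xi>0 \<bullet> x)) * \<phi> (x, t))"
        by (rule integrable_bounded_mult[OF elim(2), where B = 1]) (auto intro!: measurable_cube_measure)
      fix l :: "real^'n" assume l: "l \<in> unit_lattice"
      then have \<xi>: "\<xi>0 - 2 *\<^sub>R l \<in> \<Sigma>" by (intro Sigma_add_lattice \<xi>0) (simp add: integer_vectors_eq)
      have "cis (2 * pi * (l \<bullet> x)) * (cis (- pi * (\<xi>0 \<bullet> x)) * \<phi> (x, t)) = \<phi> (x, t) * cis (- pi * ((\<xi>0 - 2 *\<^sub>R l) \<bullet> x))" for x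
        unfolding mult.assoc[symmetric] cis_mult by (simp add: inner_diff_left algebra_simps)
      then have "(LINT x|Q. cis (2 * pi * (l \<bullet> x)) * (cis (- pi * (\<xi>0 \<bullet> x)) * \<phi> (x, t)))
        = (LINT x|Q. \<phi> (x, t) * cis (- pi * ((\<xi>0 - 2 *\<^sub>R l) \<bullet> x)))" by (simp only:)
      also have "\<dots> = fourier_coeff \<phi> (\<xi>0 - 2 *\<^sub>R l) t"
        by (rule fourier_coeff_eq[OF S_measurable[OF \<phi>] S_equivariant[OF \<phi>] \<xi>, symmetric])
      also have "\<dots> = 0" using elim(1) \<xi> by blast
      finally show "(LINT x|Q. cis (2 * pi * (l \<bullet> x)) * (cis (- pi * (\<xi>0 \<bullet> x)) * \<phi> (x, t))) = 0" .
    qed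
    then show ?case by simp
  qed
  then have "AE t in I. (\<integral>\<^sup>+x. ennreal (cmod (\<phi> (x, t))) \<partial>Q) = 0"
  proof eventually_elim
    case (elim t)
    have "(\<integral>\<^sup>+x. ennreal (cmod (\<phi> (x, t))) \<partial>Q) = (\<integral>\<^sup>+x. 0 \<partial>Q)"
      by (rule nn_integral_cong_AE) (use elim in \<open>auto elim!: eventually_mono\<close>)
    then show ?case by simp
  qed
  then have "(\<integral>\<^sup>+t. \<integral>\<^sup>+x. ennreal (cmod (\<phi> (x, t))) \<partial>Q \<partial>I) = (\<integral>\<^sup>+t. 0 \<partial>I)"
    by (rule nn_integral_cong_AE)
  then have "(\<integral>\<^sup>+y. ennreal (cmod (\<phi> y)) \<partial>F) = 0"
    using S_measurable[OF \<phi>] by (subst nn_integral_F) auto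
  then have "AE y in F. ennreal (cmod (\<phi> y)) = 0"
    using measurable_F[OF S_measurable[OF \<phi>]] by (subst (asm) nn_integral_0_iff_AE) auto
  then show ?thesis by eventually_elim simp
qed

text \<open>The shift by \<open>b\<close> adds exactly \<pi> to the phase and so changes the sign,
  while leaving the integral fixed; the product is periodic because the signs of the two characters
  cancel.\<close>

lemma character_orthogonality:
  assumes "\<xi> \<in> \<Sigma>" "\<eta> \<in> \<Sigma>"
  shows "(LINT x|Q. cis (pi * (\<xi> \<bullet> x)) * cis (- pi * (\<eta> \<bullet> x))) = (if \<xi> = \<eta> then 1 else 0)"
proof (cases "\<xi> = \<eta>")
  case True
  have "measure Q (space Q) = 1" using prob_space_cube[where 'a = "real^'n"] by (simp add: measure_def)
  then show ?thesis using True by (simp add: cis_mult)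
next
  case False
  define \<zeta> where "\<zeta> = \<xi> - \<eta>"
  let ?h = "\<lambda>x. cis (pi * (\<zeta> \<bullet> x))"
  have h: "cis (pi * (\<xi> \<bullet> x)) * cis (- pi * (\<eta> \<bullet> x)) = ?h x" for x
    unfolding cis_mult \<zeta>_def by (simp add: inner_diff_left algebra_simps)
  define b where "b = (1 / (\<zeta> \<bullet> \<zeta>)) *\<^sub>R \<zeta>"
  have b: "\<zeta> \<bullet> b = 1" using False by (simp add: b_def \<zeta>_def)
  have hb: "?h (x + b) = - ?h x" for x
  proof -
    have "?h (x + b) = ?h x * cis pi" unfolding cis_mult by (simp add: inner_add_right b distrib_left)
    then show ?thesis by (simp add: cis_pi)
  qed
  have "(LINT x|Q. ?h (x + b)) = (LINT x|Q. ?h x)"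
  proof (rule integral_cube_affine[where f = "\<lambda>x. x" and h = ?h])
    fix k x :: "real^'n" assume "k \<in> unit_lattice"
    then have k: "k \<in> integer_vectors" by (simp add: integer_vectors_eq)
    have "?h (x + k) = ?h x * (cis (pi * (\<xi> \<bullet> k)) * cnj (cis (pi * (\<eta> \<bullet> k))))"
      unfolding cis_cnj cis_mult \<zeta>_def by (simp add: inner_add_right inner_diff_left algebra_simps)
    also have "cis (pi * (\<xi> \<bullet> k)) * cnj (cis (pi * (\<eta> \<bullet> k))) = 1"
      using assms k by (simp add: Sigma_iff \<sigma>_cnj \<sigma>_square lattice_iff)
    finally show "?h (x + k) = ?h x" by simp
  qed (auto simp: linear_id[unfolded id_def])
  then have "- (LINT x|Q. ?h x) = (LINT x|Q. ?h x)" by (simp add: hb)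
  then have "(LINT x|Q. ?h x) = 0" by simp
  then show ?thesis unfolding h using False by simp
qed

section \<open>Fourier coefficients of Poincare series\<close>

lemma fourier_coeff_poincare:
  assumes \<xi>: "\<xi> \<in> \<Sigma>" and \<eta>: "\<eta> \<in> \<Sigma>" and \<psi>: "\<psi> \<in> test_functions"
  obtains L where "finite L" "\<And>l. \<psi> (t + of_int l) \<noteq> 0 \<Longrightarrow> l \<in> L" "fourier_coeff (poincare \<xi> \<psi>) \<eta> t =
    (\<Sum>l\<in>L. \<sigma> (0, of_int l) * \<psi> (t + of_int l) * (if dual_act A (of_int l) \<xi> = \<eta> then 1 else 0))"
proof -
  obtain N where N: "\<And>u l. \<bar>u\<bar> \<le> \<bar>t\<bar> \<Longrightarrow> \<psi> (u + of_int l) \<noteq> 0 \<Longrightarrow> l \<in> {-N..N::int}"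
    using test_window[OF \<psi>] by blast
  note pS = poincare_S[OF \<xi> \<psi>]
  have ps: "poincare \<xi> \<psi> (x, t) = (\<Sum>l\<in>{-N..N}. \<sigma> (0, of_int l) * \<psi> (t + of_int l) * cis (pi * (dual_act A (of_int l) \<xi> \<bullet> x)))" for x
    by (rule poincare_sum) (use N[of t] in auto)
  have int: "integrable Q (\<lambda>x. cis (pi * (\<zeta> \<bullet> x)) * cis (- pi * (\<eta> \<bullet> x)))" for \<zeta>
    by (rule finite_measure.integrable_const_bound[OF finite_cube_measure, of _ 1])
      (auto simp: norm_mult intro!: measurable_cube_measure)
  have "fourier_coeff (poincare \<xi> \<psi>) \<eta> t
    = (LINT x|Q. (\<Sum>l\<in>{-N..N}. \<sigma> (0, of_int l) * \<psi> (t + of_int l) * (cis (pi * (dual_act A (of_int l) \<xi> \<bullet> x)) * cis (- pi * (\<eta> \<bullet> x)))))"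
    by (subst fourier_coeff_eq[OF S_measurable[OF pS] S_equivariant[OF pS] \<eta>]) (simp only: ps sum_distrib_right mult.assoc)
  also have "\<dots> = (\<Sum>l\<in>{-N..N}. \<sigma> (0, of_int l) * \<psi> (t + of_int l) * (LINT x|Q. cis (pi * (dual_act A (of_int l) \<xi> \<bullet> x)) * cis (- pi * (\<eta> \<bullet> x))))"
    using int by (subst Bochner_Integration.integral_sum) auto
  also have "\<dots> = (\<Sum>l\<in>{-N..N}. \<sigma> (0, of_int l) * \<psi> (t + of_int l) * (if dual_act A (of_int l) \<xi> = \<eta> then 1 else 0))"
  proof (intro sum.cong refl arg_cong2[where f = "(*)"])
    show "(LINT x|Q. cis (pi * (dual_act A (of_int l) \<xi> \<bullet> x)) * cis (- pi * (\<eta> \<bullet> x))) = (if dual_act A (of_int l) \<xi> = \<eta> then 1 else 0)" for l :: int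
      by (rule character_orthogonality[OF Sigma_dual_act[OF _ \<xi>] \<eta>]) simp
  qed
  finally show ?thesis using that[of "{-N..N}"] N[of t] by simp
qed

lemma fourier_coeff_poincare_other:
  assumes \<xi>: "\<xi> \<in> \<Sigma>" and \<eta>: "\<eta> \<in> \<Sigma>" and \<psi>: "\<psi> \<in> test_functions" and o: "\<eta> \<notin> int_orbit A \<xi>"
  shows "fourier_coeff (poincare \<xi> \<psi>) \<eta> t = 0"
proof -
  obtain L where "fourier_coeff (poincare \<xi> \<psi>) \<eta> t =
    (\<Sum>l\<in>L. \<sigma> (0, of_int l) * \<psi> (t + of_int l) * (if dual_act A (of_int l) \<xi> = \<eta> then 1 else 0))"
    using fourier_coeff_poincare[OF \<xi> \<eta> \<psi>, of t] by blast
  moreover have "dual_act A (of_int l) \<xi> \<noteq> \<eta>" for l :: int using o by (auto simp: int_orbit_eq)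
  ultimately show ?thesis by simp
qed

text \<open>For a free orbit only \<open>l = 0\<close> leads back to \<xi>. At a fixed point every
  \<open>l\<close> does, and the coefficient is a periodization of \<psi> instead; there the
  functions \<open>wave\<close> replace the series.\<close>

lemma fourier_coeff_poincare_free:
  assumes \<xi>: "\<xi> \<in> \<Sigma>" and \<psi>: "\<psi> \<in> test_functions" and free: "inj (\<lambda>t. dual_act A t \<xi>)"
  shows "fourier_coeff (poincare \<xi> \<psi>) \<xi> t = \<psi> t"
proof -
  obtain L where L: "finite L" "\<And>l. \<psi> (t + of_int l) \<noteq> 0 \<Longrightarrow> l \<in> L" "fourier_coeff (poincare \<xi> \<psi>) \<xi> t =
    (\<Sum>l\<in>L. \<sigma> (0, of_int l) * \<psi> (t + of_int l) * (if dual_act A (of_int l) \<xi> = \<xi> then 1 else 0))"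
    using fourier_coeff_poincare[OF \<xi> \<xi> \<psi>, of t] by blast
  have "dual_act A (of_int l) \<xi> = \<xi> \<longleftrightarrow> l = 0" for l :: int
    using injD[OF free, of "of_int l" 0] by (auto simp: dual_act_zero)
  then have "fourier_coeff (poincare \<xi> \<psi>) \<xi> t = (\<Sum>l\<in>L. if l = 0 then \<psi> t else 0)"
    unfolding L(3) by (intro sum.cong) (auto simp: \<sigma>_zero)
  also have "\<dots> = \<psi> t" using L(1) L(2)[of 0] by auto
  finally show ?thesis .
qed

section \<open>The right regular representation and its subrepresentations\<close>

text \<open>Poincare series play the role of \<open>D\<close>: their continuity gives strong
  continuity, and orthogonality to all of them annihilates every Fourier coefficient.\<close>

sublocale right: L2_rep F S G translate "{poincare \<xi> \<psi> |\<xi> \<psi>. \<xi> \<in> \<Sigma> \<and> \<psi> \<in> test_functions}"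
proof
  show "translate g f \<in> S" if "f \<in> S" for g f by (rule translate_S[OF that])
  show "(LINT x|F. translate g f x * cnj (translate g f' x)) = (LINT x|F. f x * cnj (f' x))" if "f \<in> S" "f' \<in> S" for g f f'
    by (rule translate_inner[OF that])
  show "translate (g \<otimes>\<^bsub>G\<^esub> h) f = translate g (translate h f)" for g h f
    by (simp add: translate_def fun_eq_iff G_assoc del: split_paired_All)
  show "\<exists>h\<in>carrier G. \<forall>f\<in>S. translate g (translate h f) = f" for g
  proof -
    obtain h where "\<forall>y. (y \<otimes>\<^bsub>G\<^esub> g) \<otimes>\<^bsub>G\<^esub> h = y" using G_inverse by blast
    then have "translate g (translate h f) = f" for f by (simp add: translate_def fun_eq_iff del: split_paired_All)
    then show ?thesis by (intro bexI[of _ h]) (auto simp: G_carrier)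
  qed
  show "{poincare \<xi> \<psi> |\<xi> \<psi>. \<xi> \<in> \<Sigma> \<and> \<psi> \<in> test_functions} \<subseteq> S" using poincare_S by blast
  show "AE x in F. f x = 0" if f: "f \<in> S"
    and z: "\<And>d. d \<in> {poincare \<xi> \<psi> |\<xi> \<psi>. \<xi> \<in> \<Sigma> \<and> \<psi> \<in> test_functions} \<Longrightarrow> (LINT x|F. d x * cnj (f x)) = 0" for f
  proof (rule fourier_coeffs_total[OF f])
    fix \<xi> assume \<xi>: "\<xi> \<in> \<Sigma>"
    have "(LINT y|F. f y * cnj (poincare \<xi> \<psi> y)) = 0" if \<psi>: "\<psi> \<in> test_functions" for \<psi>
    proof -
      have "(LINT y|F. f y * cnj (poincare \<xi> \<psi> y)) = (LINT y|F. cnj (poincare \<xi> \<psi> y * cnj (f y)))"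
        by (intro Bochner_Integration.integral_cong refl) (simp add: mult.commute)
      also have "\<dots> = cnj (LINT y|F. poincare \<xi> \<psi> y * cnj (f y))" by (rule Bochner_Integration.integral_cnj)
      also have "(LINT y|F. poincare \<xi> \<psi> y * cnj (f y)) = 0" using \<xi> \<psi> by (intro z) blast
      finally show ?thesis by simp
    qed
    then show "AE t in lborel. fourier_coeff f \<xi> t = 0" using fourier_coeff_zero_iff[OF f \<xi>] by blast
  qed
  show "((\<lambda>h. LINT x|F. (cmod (translate h d x - translate g d x))\<^sup>2) \<longlongrightarrow> 0) (at g within carrier G)"
    if "d \<in> {poincare \<xi> \<psi> |\<xi> \<psi>. \<xi> \<in> \<Sigma> \<and> \<psi> \<in> test_functions}" for d g
    using that poincare_continuous by (intro translate_strongly_continuous) blast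
qed

lemma right_regular_eq: "right_regular A \<epsilon> = right.R"
  unfolding right_regular_def right.R_def L2G_def by (simp add: translate_def[abs_def])

end

lemma total_in_superset: "total_in H X \<Longrightarrow> X \<subseteq> Y \<Longrightarrow> Y \<subseteq> hcarrier H \<Longrightarrow> total_in H Y"
  unfolding total_in_def by blast

context solvmanifold
begin

lemma int_orbit_self: "\<xi> \<in> int_orbit A \<xi>"
  unfolding int_orbit_eq by (rule image_eqI[of _ _ 0]) (auto simp: dual_act_zero)

lemma int_orbit_mem_eq:
  assumes "\<eta> \<in> int_orbit A \<xi>"
  shows "int_orbit A \<eta> = int_orbit A \<xi>"
proof -
  obtain j :: int where j: "\<eta> = dual_act A (of_int j) \<xi>" using assms by (auto simp: int_orbit_eq)
  have "dual_act A (of_int l) \<eta> = dual_act A (of_int (l + j)) \<xi>" for l :: int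
    by (simp add: j dual_act_add)
  then have "int_orbit A \<eta> = (\<lambda>l::int. dual_act A (of_int (l + j)) \<xi>) ` UNIV" by (simp add: int_orbit_eq)
  also have "\<dots> = (\<lambda>l::int. dual_act A (of_int l) \<xi>) ` ((\<lambda>l. l + j) ` UNIV)" by (simp only: image_image)
  also have "(\<lambda>l. l + j) ` UNIV = (UNIV :: int set)" by (rule surjI[of _ "\<lambda>l. l - j"]) simp
  finally show ?thesis by (simp add: int_orbit_eq)
qed

lemma cls_carrier: "f \<in> S \<Longrightarrow> cls f \<in> hcarrier right.R"
  by (simp add: right.R_simps(1) carrier_eq)

lemma cls_inner: "f \<in> S \<Longrightarrow> g \<in> S \<Longrightarrow> hinner right.R (cls f) (cls g) = (LINT y|F. f y * cnj (g y))"
  by (simp add: right.R_simps(5) inner_eq)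

lemma right_act_poincare:
  "\<xi> \<in> \<Sigma> \<Longrightarrow> \<psi> \<in> test_functions \<Longrightarrow> act right.R g (cls (poincare \<xi> \<psi>)) = cls (poincare \<xi> (rotate \<xi> g \<psi>))"
  by (simp add: right.act_cls G_carrier poincare_S translate_poincare)

text \<open>Its orthogonal complement is \<open>U_theta\<close>; a condition on coefficients of
  representatives thereby becomes one on classes.\<close>

definition outer_series :: "(real^'n) set \<Rightarrow> ((real^'n) \<times> real \<Rightarrow> complex) set set" where
  "outer_series \<theta> = {cls (poincare \<xi> \<psi>) |\<xi> \<psi>. \<xi> \<in> \<Sigma> - \<theta> \<and> \<psi> \<in> test_functions}"

lemma outer_series_carrier: "outer_series \<theta> \<subseteq> hcarrier right.R"
  by (auto simp: outer_series_def intro: cls_carrier poincare_S)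

text \<open>\<open>fourier_coeff_zero_iff\<close> treats the frequencies in \<Sigma>,
  \<open>fourier_coeff_zero\<close> the other integral ones.\<close>

lemma U_theta_eq: "U_theta A \<epsilon> \<theta> = {v \<in> hcarrier right.R. \<forall>x\<in>outer_series \<theta>. hinner right.R v x = 0}"
proof -
  have "(\<forall>\<phi>'\<in>cls \<phi>. \<forall>\<xi>\<in>integer_vectors - \<theta>. AE t in lborel. fourier_coeff \<phi>' \<xi> t = 0) \<longleftrightarrow>
    (\<forall>x\<in>outer_series \<theta>. hinner right.R (cls \<phi>) x = 0)" (is "?L \<longleftrightarrow> ?R") if \<phi>: "\<phi> \<in> S" for \<phi>
  proof
    assume L: ?L
    show ?R
      unfolding outer_series_def
    proof clarify
      fix \<xi> \<psi> assume \<xi>: "\<xi> \<in> \<Sigma>" "\<xi> \<notin> \<theta>" and \<psi>: "\<psi> \<in> test_functions"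
      have "AE t in lborel. fourier_coeff \<phi> \<xi> t = 0" using L cls_self[OF \<phi>] \<xi> Sigma_integer by blast
      then have "(LINT y|F. \<phi> y * cnj (poincare \<xi> \<psi> y)) = 0" using fourier_coeff_zero_iff[OF \<phi> \<xi>(1)] \<psi> by blast
      then show "hinner right.R (cls \<phi>) (cls (poincare \<xi> \<psi>)) = 0" by (simp add: cls_inner \<phi> poincare_S \<xi> \<psi>)
    qed
  next
    assume R: ?R
    show ?L
    proof (intro ballI)
      fix \<phi>' \<xi> assume \<phi>': "\<phi>' \<in> cls \<phi>" and \<xi>: "\<xi> \<in> integer_vectors - \<theta>"
      have S': "\<phi>' \<in> S" "cls \<phi>' = cls \<phi>" using cls_memD[OF \<phi>'] by auto
      show "AE t in lborel. fourier_coeff \<phi>' \<xi> t = 0"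
      proof (cases "\<xi> \<in> \<Sigma>")
        case True
        have "(LINT y|F. \<phi>' y * cnj (poincare \<xi> \<psi> y)) = 0" if \<psi>: "\<psi> \<in> test_functions" for \<psi>
        proof -
          have "cls (poincare \<xi> \<psi>) \<in> outer_series \<theta>" using True \<xi> \<psi> unfolding outer_series_def by blast
          then have "hinner right.R (cls \<phi>') (cls (poincare \<xi> \<psi>)) = 0" using R S' by simp
          then show ?thesis unfolding cls_inner[OF S'(1) poincare_S[OF True \<psi>]] .
        qed
        then show ?thesis using fourier_coeff_zero_iff[OF S'(1) True] by blast
      next
        case False
        then show ?thesis
          using fourier_coeff_zero[OF S_measurable[OF S'(1)] S_equivariant[OF S'(1)], of \<xi>] \<xi> by simp
      qed
    qed
  qed
  then show ?thesis unfolding U_theta_def L2G_def right.R_simps(1) carrier_eq by blast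
qed

lemma rho_theta_eq: "rho_theta A \<epsilon> \<theta> = right.R\<lparr>hcarrier := U_theta A \<epsilon> \<theta>\<rparr>"
  by (simp add: rho_theta_def right_regular_eq)

lemma rho_theta_simps: "hcarrier (rho_theta A \<epsilon> \<theta>) = U_theta A \<epsilon> \<theta>" "hinner (rho_theta A \<epsilon> \<theta>) = hinner right.R"
  "hzero (rho_theta A \<epsilon> \<theta>) = hzero right.R" "act (rho_theta A \<epsilon> \<theta>) = act right.R"
  by (simp_all add: rho_theta_eq)

theorem unitary_rho_theta: "unitary_rep G (rho_theta A \<epsilon> \<theta>)"
  unfolding rho_theta_eq
proof (rule unitary_rep_subrep[OF right.unitary])
  show "closed_subspace right.R (U_theta A \<epsilon> \<theta>)"
    unfolding U_theta_eq by (rule hilbert_space.closed_subspace_orthogonal[OF right.hilbert_R outer_series_carrier])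
  show "\<exists>h\<in>carrier G. \<forall>v\<in>hcarrier right.R. act right.R g (act right.R h v) = v" if "g \<in> carrier G" for g
    by (rule right.act_inverse[OF that])
  show "invariant_subset G right.R (U_theta A \<epsilon> \<theta>)"
    unfolding invariant_subset_def
  proof (intro ballI)
    fix g v assume g: "g \<in> carrier G" and v: "v \<in> U_theta A \<epsilon> \<theta>"
    interpret g: hilbert_isometry right.R right.R "act right.R g" by (rule isometric_rep_act[OF right.isometric g])
    have vc: "v \<in> hcarrier right.R" using v by (simp add: U_theta_eq)
    \<comment> \<open>The operator is moved to the other side: \<open>x = g (h x)\<close>, and
      \<open>h x\<close> is again an outer series.\<close>
    obtain h where h: "\<forall>v\<in>hcarrier right.R. act right.R g (act right.R h v) = v" using right.act_inverse[OF g] by blast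
    have "hinner right.R (act right.R g v) x = 0" if x: "x \<in> outer_series \<theta>" for x
    proof -
      have xc: "x \<in> hcarrier right.R" using x outer_series_carrier by blast
      have hx: "act right.R h x \<in> outer_series \<theta>"
        using x unfolding outer_series_def by (auto simp: right_act_poincare) (use rotate_test in blast)
      then have hxc: "act right.R h x \<in> hcarrier right.R" using outer_series_carrier by blast
      have "hinner right.R (act right.R g v) x = hinner right.R (act right.R g v) (act right.R g (act right.R h x))"
        using h xc by simp
      also have "\<dots> = hinner right.R v (act right.R h x)" by (rule g.inner[OF vc hxc])
      also have "\<dots> = 0" using v hx by (simp add: U_theta_eq)
      finally show ?thesis .
    qed
    then show "act right.R g v \<in> U_theta A \<epsilon> \<theta>" using g.into[OF vc] by (simp add: U_theta_eq)
  qed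
qed

section \<open>Inner products of Poincare series and the decomposition into orbits\<close>

lemma poincare_inner_other:
  assumes \<xi>: "\<xi> \<in> \<Sigma>" and \<eta>: "\<eta> \<in> \<Sigma>" and \<psi>: "\<psi> \<in> test_functions" "\<psi>' \<in> test_functions" and o: "\<eta> \<notin> int_orbit A \<xi>"
  shows "hinner right.R (cls (poincare \<xi> \<psi>)) (cls (poincare \<eta> \<psi>')) = 0"
  using fourier_coeff_poincare_other[OF \<xi> \<eta> \<psi>(1) o]
  by (simp add: cls_inner poincare_S \<xi> \<eta> \<psi> unfolding_formula[OF poincare_S[OF \<xi> \<psi>(1)] \<eta> \<psi>(2)])

lemma poincare_inner_free:
  assumes \<xi>: "\<xi> \<in> \<Sigma>" and \<psi>: "\<psi> \<in> test_functions" "\<psi>' \<in> test_functions" and free: "inj (\<lambda>t. dual_act A t \<xi>)"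
  shows "hinner right.R (cls (poincare \<xi> \<psi>)) (cls (poincare \<xi> \<psi>')) = (LINT t|lborel. \<psi> t * cnj (\<psi>' t))"
  by (simp add: cls_inner poincare_S \<xi> \<psi> unfolding_formula[OF poincare_S[OF \<xi> \<psi>(1)] \<xi> \<psi>(2)]
      fourier_coeff_poincare_free[OF \<xi> \<psi>(1) free])

lemma poincare_U_theta:
  assumes \<xi>: "\<xi> \<in> \<Sigma>" and \<psi>: "\<psi> \<in> test_functions"
  shows "cls (poincare \<xi> \<psi>) \<in> U_theta A \<epsilon> (int_orbit A \<xi>)"
  unfolding U_theta_eq outer_series_def
  using cls_carrier[OF poincare_S[OF \<xi> \<psi>]] poincare_inner_other[OF \<xi> _ \<psi>] by blast

text \<open>A vector of \<open>U_theta\<close> is orthogonal to the series based outside the orbit,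
  and a series based inside is rewritten to base point \<xi> by \<open>poincare_dual_act\<close>;
  together these series are total.\<close>

lemma total_rho_theta:
  assumes \<xi>: "\<xi> \<in> \<Sigma>"
  shows "total_in (rho_theta A \<epsilon> (int_orbit A \<xi>)) ((\<lambda>\<psi>. cls (poincare \<xi> \<psi>)) ` test_functions)"
  unfolding total_in_def rho_theta_simps
proof (intro conjI ballI impI)
  show "(\<lambda>\<psi>. cls (poincare \<xi> \<psi>)) ` test_functions \<subseteq> U_theta A \<epsilon> (int_orbit A \<xi>)"
    using poincare_U_theta[OF \<xi>] by blast
  fix v assume v: "v \<in> U_theta A \<epsilon> (int_orbit A \<xi>)"
    and o: "\<forall>x\<in>(\<lambda>\<psi>. cls (poincare \<xi> \<psi>)) ` test_functions. hinner right.R x v = 0"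
  have vc: "v \<in> hcarrier right.R" using v by (simp add: U_theta_eq)
  have "hinner right.R x v = 0" if "x \<in> cls ` {poincare \<xi> \<psi> |\<xi> \<psi>. \<xi> \<in> \<Sigma> \<and> \<psi> \<in> test_functions}" for x
  proof -
    obtain \<eta> \<psi> where \<eta>: "\<eta> \<in> \<Sigma>" and \<psi>: "\<psi> \<in> test_functions" and x: "x = cls (poincare \<eta> \<psi>)" using \<open>x \<in> _\<close> by blast
    have xc: "x \<in> hcarrier right.R" unfolding x by (rule cls_carrier[OF poincare_S[OF \<eta> \<psi>]])
    show ?thesis
    proof (cases "\<eta> \<in> int_orbit A \<xi>")
      case True
      then obtain j :: int where j: "\<eta> = dual_act A (of_int j) \<xi>" by (auto simp: int_orbit_eq)
      have "(\<lambda>t. \<sigma> (0, of_int j) * \<psi> (t + - of_int j)) \<in> test_functions" by (intro test_functions_cmult \<psi> continuous_on_const)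
      then show ?thesis using o unfolding x j poincare_dual_act by simp
    next
      case False
      then have "x \<in> outer_series (int_orbit A \<xi>)" using \<eta> \<psi> unfolding outer_series_def x by blast
      then have "hinner right.R v x = 0" using v by (simp add: U_theta_eq)
      then show ?thesis using hilbert_space.inner_commute[OF right.hilbert_R vc xc] by simp
    qed
  qed
  then show "v = hzero right.R"
    by (intro right.total_D[unfolded total_in_def, THEN conjunct2, THEN bspec, OF vc, THEN mp] ballI)
qed

text \<open>Both families are indexed by all pairs of a frequency and a test function. Within one
  orbit the inner products agree because the summand inherits that of the whole space; across orbits
  both vanish.\<close>

theorem right_regular_decomposition:
  "unitarily_equivalent G (right_regular A \<epsilon>) (rep_sum (int_orbits A \<Sigma>) (rho_theta A \<epsilon>))"
proof -
  let ?O = "int_orbits A \<Sigma>"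
  let ?e = "\<lambda>(\<xi>, \<psi>). cls (poincare \<xi> \<psi>)"
  let ?I = "\<Sigma> \<times> test_functions"
  note iso = unitary_rep_isometric[OF unitary_rho_theta]
  interpret fam: hilbert_family ?O "rho_theta A \<epsilon>"
    by (rule hilbert_family.intro) (rule isometric_rep_hilbert[OF iso])
  let ?f = "\<lambda>(\<xi>, \<psi>). fam.embed (int_orbit A \<xi>) (cls (poincare \<xi> \<psi>))"
  have O: "int_orbit A \<xi> \<in> ?O" if "\<xi> \<in> \<Sigma>" for \<xi> using that by (simp add: int_orbits_def)
  \<comment> \<open>All base points of an orbit occur in the index set, so the total set in a
    summand contains the series of each of them.\<close>
  let ?X = "\<lambda>\<theta>. {cls (poincare \<xi> \<psi>) |\<xi> \<psi>. \<xi> \<in> \<Sigma> \<and> int_orbit A \<xi> = \<theta> \<and> \<psi> \<in> test_functions}"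
  show ?thesis
    unfolding right_regular_eq
  proof (rule equivalentI_gram[OF right.isometric rep_sum_isometric[OF iso], where e = ?e and f = ?f and I = ?I])
    show "total_in right.R (?e ` ?I)"
    proof -
      have "?e ` ?I = cls ` {poincare \<xi> \<psi> |\<xi> \<psi>. \<xi> \<in> \<Sigma> \<and> \<psi> \<in> test_functions}" by force
      then show ?thesis using right.total_D by simp
    qed
    have "total_in (rep_sum ?O (rho_theta A \<epsilon>)) {fam.embed \<theta> x |\<theta> x. \<theta> \<in> ?O \<and> x \<in> ?X \<theta>}"
    proof (rule fam.total_embed)
      fix \<theta> assume "\<theta> \<in> ?O"
      then obtain \<xi> where \<xi>: "\<xi> \<in> \<Sigma>" "\<theta> = int_orbit A \<xi>" by (auto simp: int_orbits_def)
      show "total_in (rho_theta A \<epsilon> \<theta>) (?X \<theta>)"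
      proof (rule total_in_superset)
        show "total_in (rho_theta A \<epsilon> \<theta>) ((\<lambda>\<psi>. cls (poincare \<xi> \<psi>)) ` test_functions)" using total_rho_theta \<xi> by simp
        show "(\<lambda>\<psi>. cls (poincare \<xi> \<psi>)) ` test_functions \<subseteq> ?X \<theta>" using \<xi> by blast
        show "?X \<theta> \<subseteq> hcarrier (rho_theta A \<epsilon> \<theta>)" using poincare_U_theta by (auto simp: rho_theta_simps)
      qed
    qed
    moreover have "{fam.embed \<theta> x |\<theta> x. \<theta> \<in> ?O \<and> x \<in> ?X \<theta>} = ?f ` ?I"
    proof
      show "{fam.embed \<theta> x |\<theta> x. \<theta> \<in> ?O \<and> x \<in> ?X \<theta>} \<subseteq> ?f ` ?I" by force
      show "?f ` ?I \<subseteq> {fam.embed \<theta> x |\<theta> x. \<theta> \<in> ?O \<and> x \<in> ?X \<theta>}" using O by fastforce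
    qed
    ultimately show "total_in (rep_sum ?O (rho_theta A \<epsilon>)) (?f ` ?I)" by simp
    fix i assume "i \<in> ?I"
    then obtain \<xi> \<psi> where i: "i = (\<xi>, \<psi>)" and \<xi>: "\<xi> \<in> \<Sigma>" and \<psi>: "\<psi> \<in> test_functions" by blast
    have xc: "cls (poincare \<xi> \<psi>) \<in> hcarrier (rho_theta A \<epsilon> (int_orbit A \<xi>))"
      using poincare_U_theta[OF \<xi> \<psi>] by (simp add: rho_theta_simps)
    show "\<exists>j\<in>?I. act right.R g (?e i) = ?e j \<and> act (rep_sum ?O (rho_theta A \<epsilon>)) g (?f i) = ?f j" if "g \<in> carrier G" for g
    proof (rule bexI)
      show "(\<xi>, rotate \<xi> g \<psi>) \<in> ?I" using \<xi> rotate_test[OF \<psi>] by simp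
      show "act right.R g (?e i) = ?e (\<xi>, rotate \<xi> g \<psi>) \<and> act (rep_sum ?O (rho_theta A \<epsilon>)) g (?f i) = ?f (\<xi>, rotate \<xi> g \<psi>)"
        using rep_sum_act_embed[OF iso that, where I = ?O] by (simp add: i right_act_poincare \<xi> \<psi> rho_theta_simps)
    qed
    fix j assume "j \<in> ?I"
    then obtain \<eta> \<psi>' where j: "j = (\<eta>, \<psi>')" and \<eta>: "\<eta> \<in> \<Sigma>" and \<psi>': "\<psi>' \<in> test_functions" by blast
    have yc: "cls (poincare \<eta> \<psi>') \<in> hcarrier (rho_theta A \<epsilon> (int_orbit A \<eta>))"
      using poincare_U_theta[OF \<eta> \<psi>'] by (simp add: rho_theta_simps)
    have in_f: "hinner fam.S (?f i) (?f j) = hinner right.R (cls (poincare \<xi> \<psi>)) (fam.embed (int_orbit A \<eta>) (cls (poincare \<eta> \<psi>')) (int_orbit A \<xi>))"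
      using fam.inner_embed[OF O[OF \<xi>] xc fam.embed_in[OF O[OF \<eta>] yc]] by (simp add: i j rho_theta_simps)
    show "hinner right.R (?e i) (?e j) = hinner fam.S (?f i) (?f j)"
    proof (cases "\<eta> \<in> int_orbit A \<xi>")
      case True
      then have "int_orbit A \<eta> = int_orbit A \<xi>" by (rule int_orbit_mem_eq)
      then show ?thesis unfolding in_f using O[OF \<xi>] by (simp add: i j fam.embed_def)
    next
      case False
      then have ne: "int_orbit A \<xi> \<noteq> int_orbit A \<eta>" using int_orbit_self by blast
      have "hinner right.R (cls (poincare \<xi> \<psi>)) (hzero right.R) = 0"
        by (rule hilbert_space.inner_zero_right[OF right.hilbert_R cls_carrier[OF poincare_S[OF \<xi> \<psi>]]])
      then show ?thesis
        unfolding in_f using ne O[OF \<xi>] by (simp add: i j fam.embed_def rho_theta_simps poincare_inner_other[OF \<xi> \<eta> \<psi> \<psi>' False])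
    qed
  qed
qed

section \<open>The representations on \<open>L\<^sup>2(\<real>)\<close>\<close>

definition L2R :: "(real \<Rightarrow> complex) set" where
  "L2R = {\<psi> \<in> borel_measurable borel. integrable lborel (\<lambda>t. (cmod (\<psi> t))\<^sup>2)}"

lemma L2R_L2_space: "L2_space lborel L2R"
proof
  show "f \<in> borel_measurable lborel" "integrable lborel (\<lambda>x. (cmod (f x))\<^sup>2)" if "f \<in> L2R" for f
    using that by (auto simp: L2R_def)
  show "(\<lambda>x. 0) \<in> L2R" by (simp add: L2R_def)
  show "(\<lambda>x. f x + g x) \<in> L2R" if "f \<in> L2R" "g \<in> L2R" for f g
    using that integrable_sq_diff[of f lborel "\<lambda>x. - g x"] by (auto simp: L2R_def)
  show "(\<lambda>x. c * f x) \<in> L2R" if "f \<in> L2R" for f c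
    using that by (auto simp: L2R_def norm_mult power_mult_distrib)
  fix s :: "nat \<Rightarrow> real \<Rightarrow> complex" assume s: "\<And>k. s k \<in> L2R" and c: "\<And>e. e > 0 \<Longrightarrow> \<exists>N. \<forall>j\<ge>N. \<forall>k\<ge>N. (LINT x|lborel. (cmod (s j x - s k x))\<^sup>2) < e"
  have m: "s k \<in> borel_measurable borel" "s k \<in> borel_measurable lborel" "integrable lborel (\<lambda>x. (cmod (s k x))\<^sup>2)" for k
    using s by (auto simp: L2R_def)
  obtain r where r: "integrable lborel (\<lambda>x. (cmod (sequence_limit (\<lambda>k. s (r k)) x))\<^sup>2)"
    "(\<lambda>k. LINT x|lborel. (cmod (s k x - sequence_limit (\<lambda>k. s (r k)) x))\<^sup>2) \<longlonglongrightarrow> 0"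
    using riesz_fischer[OF m(2,3) c] by blast
  have "sequence_limit (\<lambda>k. s (r k)) \<in> L2R" using r(1) m(1) by (simp add: L2R_def sequence_limit_measurable)
  then show "\<exists>f\<in>L2R. (\<lambda>k. LINT x|lborel. (cmod (s k x - f x))\<^sup>2) \<longlonglongrightarrow> 0" using r(2) by blast
qed

lemma integrable_indicator_Icc: "integrable lborel (indicator {a..b::real} :: real \<Rightarrow> real)"
  by (rule integrable_real_indicator) (auto simp: emeasure_lborel_Icc_eq)

lemma L2R_locally_integrable:
  assumes f: "f \<in> L2R"
  shows "integrable lborel (\<lambda>t. indicator {- real N..real N} t * f t)"
proof (rule Bochner_Integration.integrable_bound)
  show "integrable lborel (\<lambda>t. indicator {- real N..real N} t + (cmod (f t))\<^sup>2)"
    using f by (intro Bochner_Integration.integrable_add) (auto simp: L2R_def)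
  have c: "cmod z \<le> 1 + (cmod z)\<^sup>2" for z
    using sum_squares_bound[of "cmod z" 1] norm_ge_zero[of z] by (simp only: one_power2 mult_1_right)
  show "AE t in lborel. norm (indicator {- real N..real N} t * f t) \<le> norm (indicator {- real N..real N} t + (cmod (f t))\<^sup>2)"
    by (intro AE_I2) (use c in \<open>simp add: indicator_def\<close>)
  have [measurable]: "f \<in> borel_measurable borel" using f by (simp add: L2R_def)
  show "(\<lambda>t. indicator {- real N..real N} t * f t) \<in> borel_measurable lborel" by measurable
qed

lemma test_functions_L2R: "test_functions \<subseteq> L2R"
proof
  fix \<psi> assume \<psi>: "\<psi> \<in> test_functions"
  have "\<exists>B. (\<forall>t. cmod (\<psi> t) \<le> B) \<and> (\<forall>t. \<psi> t \<noteq> 0 \<longrightarrow> \<bar>t\<bar> \<le> B)" by (rule test_function_bounded[OF \<psi>]) blast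
  then obtain B where B: "\<And>t. cmod (\<psi> t) \<le> B" "\<And>t. \<psi> t \<noteq> 0 \<Longrightarrow> \<bar>t\<bar> \<le> B" by blast
  have m: "\<psi> \<in> borel_measurable borel" by (rule test_function_measurable[OF \<psi>])
  have "integrable lborel (\<lambda>t. (cmod (\<psi> t))\<^sup>2)"
  proof (rule Bochner_Integration.integrable_bound)
    show "integrable lborel (\<lambda>t. B\<^sup>2 * indicator {-B..B} t :: real)" by (intro integrable_mult_right integrable_indicator_Icc)
    show "AE t in lborel. norm ((cmod (\<psi> t))\<^sup>2) \<le> norm (B\<^sup>2 * indicator {-B..B} t :: real)"
    proof (rule AE_I2)
      fix t
      show "norm ((cmod (\<psi> t))\<^sup>2) \<le> norm (B\<^sup>2 * indicator {-B..B} t :: real)"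
      proof (cases "\<psi> t = 0")
        case False
        then have "t \<in> {-B..B}" using B(2)[of t] by auto
        then show ?thesis using B(1)[of t] by (simp add: power_mono)
      qed simp
    qed
  qed (use m in measurable)
  then show "\<psi> \<in> L2R" using m by (simp add: L2R_def)
qed

lemma integral_translate:
  fixes f :: "real \<Rightarrow> 'b::{banach, second_countable_topology}"
  shows "(LINT t|lborel. f (t + s)) = (LINT t|lborel. f t)"
  using lborel_integral_real_affine[of 1 f s] by (simp add: add.commute)

lemma integrable_translate:
  fixes f :: "real \<Rightarrow> 'b::{banach, second_countable_topology}"
  shows "integrable lborel (\<lambda>t. f (t + s)) \<longleftrightarrow> integrable lborel f"
  using lborel_integrable_real_affine_iff[of 1 f s] by (simp add: add.commute)

lemma rotate_norm: "cmod (rotate \<eta> g \<psi> t) = cmod (\<psi> (t + snd g))"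
  by (simp add: rotate_def norm_mult)

lemma rotate_measurable:
  assumes [measurable]: "\<psi> \<in> borel_measurable borel"
  shows "rotate \<eta> g \<psi> \<in> borel_measurable borel"
proof -
  have [measurable]: "(\<lambda>t. cis (pi * (dual_act A t \<eta> \<bullet> fst g))) \<in> borel_measurable borel"
    by (intro borel_measurable_continuous_onI continuous_intros dual_act_cont)
  show ?thesis unfolding rotate_def[abs_def] by measurable
qed

text \<open>The cocycle identity of the phase factor, obtained by moving \<open>A s\<close> across
  the pairing.\<close>

lemma rotate_mult: "rotate \<eta> (g \<otimes>\<^bsub>G\<^esub> h) \<psi> = rotate \<eta> g (rotate \<eta> h \<psi>)"
proof
  fix t
  have "cis (pi * (dual_act A t \<eta> \<bullet> (fst g + A (snd g) *v fst h)))
    = cis (pi * (dual_act A t \<eta> \<bullet> fst g)) * cis (pi * (dual_act A (t + snd g) \<eta> \<bullet> fst h))"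
    unfolding cis_mult by (simp add: inner_add_right dual_act_A_inner distrib_left)
  then show "rotate \<eta> (g \<otimes>\<^bsub>G\<^esub> h) \<psi> t = rotate \<eta> g (rotate \<eta> h \<psi>) t"
    unfolding rotate_def G_mult' fst_conv snd_conv by (simp add: add.assoc mult.assoc)
qed

lemma rotate_strongly_continuous:
  assumes \<psi>: "\<psi> \<in> test_functions"
  shows "((\<lambda>h. LINT t|lborel. (cmod (rotate \<eta> h \<psi> t - rotate \<eta> g \<psi> t))\<^sup>2) \<longlongrightarrow> 0) (at g within carrier G)"
  unfolding tendsto_at_iff_sequentially
proof (intro allI impI)
  fix X :: "nat \<Rightarrow> (real^'n) \<times> real" assume X: "X \<longlonglongrightarrow> g"
  have c: "continuous_on UNIV \<psi>" using \<psi> by (simp add: test_functions_def)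
  have "\<exists>B. (\<forall>t. cmod (\<psi> t) \<le> B) \<and> (\<forall>t. \<psi> t \<noteq> 0 \<longrightarrow> \<bar>t\<bar> \<le> B)" by (rule test_function_bounded[OF \<psi>]) blast
  then obtain B where B: "\<And>t. cmod (\<psi> t) \<le> B" "\<And>t. \<psi> t \<noteq> 0 \<Longrightarrow> \<bar>t\<bar> \<le> B" by blast
  have "bounded (range (\<lambda>k. snd (X k)))" using tendsto_snd[OF X] by (rule convergent_imp_bounded)
  then obtain M where M: "\<And>k. \<bar>snd (X k)\<bar> \<le> M" by (auto simp: bounded_iff)
  \<comment> \<open>Support radius of \<psi> plus the largest possible displacement; outside
    \<open>{-R..R}\<close> both terms vanish.\<close>
  define R where "R = B + \<bar>M\<bar> + \<bar>snd g\<bar>"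
  have m: "rotate \<eta> h \<psi> \<in> borel_measurable lborel" for h
    using rotate_measurable[OF test_function_measurable[OF \<psi>]] by simp
  note [measurable] = m
  have "(\<lambda>k. LINT t|lborel. (cmod (rotate \<eta> (X k) \<psi> t - rotate \<eta> g \<psi> t))\<^sup>2) \<longlonglongrightarrow> (LINT t|(lborel :: real measure). 0)"
  proof (rule integral_dominated_convergence[where w = "\<lambda>t. 4 * B\<^sup>2 * indicator {-R..R} t"])
    show "integrable lborel (\<lambda>t. 4 * B\<^sup>2 * indicator {-R..R} t :: real)" by (intro integrable_mult_right integrable_indicator_Icc)
    show "AE t in lborel. (\<lambda>k. (cmod (rotate \<eta> (X k) \<psi> t - rotate \<eta> g \<psi> t))\<^sup>2) \<longlonglongrightarrow> 0"
    proof (rule AE_I2)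
      fix t
      have "continuous_on UNIV (\<lambda>h. cis (pi * (dual_act A t \<eta> \<bullet> fst h)) * \<psi> (t + snd h))"
        by (intro continuous_on_mult continuous_on_compose2[OF c] continuous_intros) auto
      then have "isCont (\<lambda>h. rotate \<eta> h \<psi> t) g"
        unfolding rotate_def using continuous_on_eq_continuous_at[OF open_UNIV] by blast
      then have "(\<lambda>k. rotate \<eta> (X k) \<psi> t) \<longlonglongrightarrow> rotate \<eta> g \<psi> t" by (rule isCont_tendsto_compose[OF _ X])
      then have "(\<lambda>k. (cmod (rotate \<eta> (X k) \<psi> t - rotate \<eta> g \<psi> t))\<^sup>2) \<longlonglongrightarrow> (cmod (rotate \<eta> g \<psi> t - rotate \<eta> g \<psi> t))\<^sup>2"
        by (intro tendsto_intros)
      then show "(\<lambda>k. (cmod (rotate \<eta> (X k) \<psi> t - rotate \<eta> g \<psi> t))\<^sup>2) \<longlonglongrightarrow> 0" by simp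
    qed
    show "AE t in lborel. norm ((cmod (rotate \<eta> (X k) \<psi> t - rotate \<eta> g \<psi> t))\<^sup>2) \<le> 4 * B\<^sup>2 * indicator {-R..R} t" for k
    proof (rule AE_I2)
      fix t
      have le: "(cmod (rotate \<eta> (X k) \<psi> t - rotate \<eta> g \<psi> t))\<^sup>2 \<le> 2 * (cmod (\<psi> (t + snd (X k))))\<^sup>2 + 2 * (cmod (\<psi> (t + snd g)))\<^sup>2"
        using cmod_diff_sq_le[of "rotate \<eta> (X k) \<psi> t" "rotate \<eta> g \<psi> t"] by (simp add: rotate_norm)
      show "norm ((cmod (rotate \<eta> (X k) \<psi> t - rotate \<eta> g \<psi> t))\<^sup>2) \<le> 4 * B\<^sup>2 * indicator {-R..R} t"
      proof (cases "t \<in> {-R..R}")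
        case True
        have "2 * (cmod (\<psi> (t + snd (X k))))\<^sup>2 + 2 * (cmod (\<psi> (t + snd g)))\<^sup>2 \<le> 2 * B\<^sup>2 + 2 * B\<^sup>2"
          by (intro add_mono mult_left_mono power_mono B) auto
        then show ?thesis using le True by simp
      next
        case False
        then have t: "\<bar>t\<bar> > R" by auto
        have "\<psi> (t + snd (X k)) = 0"
        proof (rule ccontr)
          assume "\<psi> (t + snd (X k)) \<noteq> 0"
          then have "\<bar>t + snd (X k)\<bar> \<le> B" by (rule B)
          then show False using M[of k] t unfolding R_def by linarith
        qed
        moreover have "\<psi> (t + snd g) = 0"
        proof (rule ccontr)
          assume "\<psi> (t + snd g) \<noteq> 0"
          then have "\<bar>t + snd g\<bar> \<le> B" by (rule B)
          then show False using t unfolding R_def by linarith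
        qed
        ultimately show ?thesis using le False by simp
      qed
    qed
  qed measurable
  then show "((\<lambda>h. LINT t|lborel. (cmod (rotate \<eta> h \<psi> t - rotate \<eta> g \<psi> t))\<^sup>2) \<circ> X) \<longlonglongrightarrow> 0" by (simp add: o_def)
qed

lemma rotate_L2_rep: "L2_rep lborel L2R G (rotate \<eta>) test_functions"
proof -
  interpret L: L2_space lborel L2R by (rule L2R_L2_space)
  show ?thesis
  proof
    show "rotate \<eta> g f \<in> L2R" if "f \<in> L2R" for g f
      using that integrable_translate[of "\<lambda>t. (cmod (f t))\<^sup>2" "snd g"]
      by (simp add: L2R_def rotate_measurable rotate_norm)
    show "(LINT t|lborel. rotate \<eta> g f t * cnj (rotate \<eta> g f' t)) = (LINT t|lborel. f t * cnj (f' t))" for g f f'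
    proof -
      have "rotate \<eta> g f t * cnj (rotate \<eta> g f' t) = f (t + snd g) * cnj (f' (t + snd g))" for t
      proof -
        let ?c = "cis (pi * (dual_act A t \<eta> \<bullet> fst g))"
        have "rotate \<eta> g f t * cnj (rotate \<eta> g f' t) = (?c * cnj ?c) * (f (t + snd g) * cnj (f' (t + snd g)))"
          by (simp add: rotate_def algebra_simps)
        also have "?c * cnj ?c = 1" by (simp flip: complex_norm_square)
        finally show ?thesis by simp
      qed
      then show ?thesis using integral_translate[of "\<lambda>t. f t * cnj (f' t)" "snd g"] by simp
    qed
    show "rotate \<eta> (g \<otimes>\<^bsub>G\<^esub> h) f = rotate \<eta> g (rotate \<eta> h f)" for g h f by (rule rotate_mult)
    show "\<exists>h\<in>carrier G. \<forall>f\<in>L2R. rotate \<eta> g (rotate \<eta> h f) = f" for g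
    proof -
      obtain h where h: "\<forall>y. (y \<otimes>\<^bsub>G\<^esub> g) \<otimes>\<^bsub>G\<^esub> h = y" using G_inverse by blast
      have "(0, 0) \<otimes>\<^bsub>G\<^esub> (g \<otimes>\<^bsub>G\<^esub> h) = (0, 0)" using h unfolding G_assoc by blast
      then have gh: "g \<otimes>\<^bsub>G\<^esub> h = (0, 0)" by (cases "g \<otimes>\<^bsub>G\<^esub> h") (simp add: G_mult A_vec_zero)
      have "rotate \<eta> g (rotate \<eta> h f) = f" for f
        unfolding rotate_mult[symmetric] gh by (simp add: rotate_def fun_eq_iff)
      then show ?thesis by (intro bexI[of _ h]) (auto simp: G_carrier)
    qed
    show "test_functions \<subseteq> L2R" by (rule test_functions_L2R)
    show "AE t in lborel. f t = 0" if f: "f \<in> L2R" and z: "\<And>d. d \<in> test_functions \<Longrightarrow> (LINT t|lborel. d t * cnj (f t)) = 0" for f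
    proof -
      have [measurable]: "f \<in> borel_measurable borel" using f by (simp add: L2R_def)
      have "(\<lambda>t. cnj (f t)) \<in> borel_measurable borel" by measurable
      then have cf: "(\<lambda>t. cnj (f t)) \<in> L2R" using f by (simp add: L2R_def)
      have "AE t in lborel. cnj (f t) = 0"
        by (rule test_functions_total[OF L2R_locally_integrable[OF cf] z])
      then show ?thesis by simp
    qed
    show "((\<lambda>h. LINT x|lborel. (cmod (rotate \<eta> h d x - rotate \<eta> g d x))\<^sup>2) \<longlongrightarrow> 0) (at g within carrier G)"
      if "d \<in> test_functions" for d g by (rule rotate_strongly_continuous[OF that])
  qed
qed

lemma rho_eta_eq: "rho_eta A \<eta> = L2_rep.R lborel L2R (rotate \<eta>)"
proof -
  interpret L: L2_rep lborel L2R G "rotate \<eta>" test_functions by (rule rotate_L2_rep)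
  have "(\<lambda>(x, s) C. (\<lambda>\<psi> t. cis (pi * ((transpose (A t) *v \<eta>) \<bullet> x)) * \<psi> (t + s)) ` C) = (\<lambda>g C. rotate \<eta> g ` C)"
    by (auto simp: fun_eq_iff rotate_def[abs_def] dual_act_def split_beta)
  then show ?thesis unfolding rho_eta_def L.R_def real_L2_def L2R_def[symmetric] by (simp only:)
qed

theorem unitary_rho_eta: "unitary_rep G (rho_eta A \<eta>)"
proof -
  interpret L: L2_rep lborel L2R G "rotate \<eta>" test_functions by (rule rotate_L2_rep)
  show ?thesis unfolding rho_eta_eq by (rule L.unitary)
qed

text \<open>Shifting \<psi> by the real time \<open>t0\<close> absorbs the move from \<eta> to \<xi>
  along the \<real>-orbit; freeness then makes the series preserve inner products.\<close>

theorem rho_eta_rho_theta: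
  assumes \<xi>: "\<xi> \<in> \<Sigma>" and t0: "\<xi> = dual_act A t0 \<eta>" and free: "inj (\<lambda>t. dual_act A t \<eta>)"
  shows "unitarily_equivalent G (rho_eta A \<eta>) (rho_theta A \<epsilon> (int_orbit A \<xi>))"
proof -
  interpret L: L2_rep lborel L2R G "rotate \<eta>" test_functions by (rule rotate_L2_rep)
  let ?s = "\<lambda>\<psi> t. \<psi> (t + t0) :: complex"
  have st: "?s \<psi> \<in> test_functions" if "\<psi> \<in> test_functions" for \<psi>
    using test_functions_cmult[OF that, of "\<lambda>_. 1" t0] by (simp add: continuous_on_const)
  have ss: "?s ` test_functions = test_functions"
  proof
    show "test_functions \<subseteq> ?s ` test_functions"
    proof
      fix \<psi> assume "\<psi> \<in> test_functions"
      then have "(\<lambda>t. \<psi> (t - t0)) \<in> test_functions" using test_functions_cmult[of \<psi> "\<lambda>_. 1" "-t0"] by (simp add: continuous_on_const)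
      then show "\<psi> \<in> ?s ` test_functions" by (intro image_eqI[of _ _ "\<lambda>t. \<psi> (t - t0)"]) simp_all
    qed
  qed (use st in blast)
  have freeX: "inj (\<lambda>t. dual_act A t \<xi>)"
  proof (rule injI)
    fix s t assume "dual_act A s \<xi> = dual_act A t \<xi>"
    then have "dual_act A (s + t0) \<eta> = dual_act A (t + t0) \<eta>" by (simp add: t0 dual_act_add)
    then show "s = t" using injD[OF free, of "s + t0" "t + t0"] by simp
  qed
  show ?thesis
    unfolding rho_eta_eq
  proof (rule equivalentI_gram[OF L.isometric unitary_rep_isometric[OF unitary_rho_theta],
        where e = L.cls and f = "\<lambda>\<psi>. cls (poincare \<xi> (?s \<psi>))" and I = test_functions])
    show "total_in L.R (L.cls ` test_functions)" by (rule L.total_D)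
    have "(\<lambda>\<psi>. cls (poincare \<xi> (?s \<psi>))) ` test_functions = (\<lambda>\<psi>. cls (poincare \<xi> \<psi>)) ` (?s ` test_functions)"
      by (simp only: image_image)
    then show "total_in (rho_theta A \<epsilon> (int_orbit A \<xi>)) ((\<lambda>\<psi>. cls (poincare \<xi> (?s \<psi>))) ` test_functions)"
      using total_rho_theta[OF \<xi>] by (simp only: ss)
    fix \<psi> assume \<psi>: "\<psi> \<in> test_functions"
    show "hinner L.R (L.cls \<psi>) (L.cls \<psi>') = hinner (rho_theta A \<epsilon> (int_orbit A \<xi>)) (cls (poincare \<xi> (?s \<psi>))) (cls (poincare \<xi> (?s \<psi>')))"
      if \<psi>': "\<psi>' \<in> test_functions" for \<psi>'
      using subsetD[OF test_functions_L2R] \<psi> \<psi>' integral_translate[of "\<lambda>t. \<psi> t * cnj (\<psi>' t)" t0]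
      by (simp add: L.R_simps(5) L.inner_eq rho_theta_simps poincare_inner_free[OF \<xi> st st freeX])
    show "\<exists>\<psi>'\<in>test_functions. act L.R g (L.cls \<psi>) = L.cls \<psi>' \<and>
        act (rho_theta A \<epsilon> (int_orbit A \<xi>)) g (cls (poincare \<xi> (?s \<psi>))) = cls (poincare \<xi> (?s \<psi>'))" for g
    proof (rule bexI[OF _ rotate_test[OF \<psi>]], rule conjI)
      show "act L.R g (L.cls \<psi>) = L.cls (rotate \<eta> g \<psi>)"
        using subsetD[OF test_functions_L2R \<psi>] by (intro L.act_cls) (auto simp: G_carrier)
      have "rotate \<xi> g (?s \<psi>) = ?s (rotate \<eta> g \<psi>)"
        by (simp add: rotate_def fun_eq_iff t0 dual_act_add algebra_simps)
      then show "act (rho_theta A \<epsilon> (int_orbit A \<xi>)) g (cls (poincare \<xi> (?s \<psi>))) = cls (poincare \<xi> (?s (rotate \<eta> g \<psi>)))"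
        by (simp add: rho_theta_simps right_act_poincare \<xi> st[OF \<psi>])
    qed
  qed
qed

end

section \<open>Regrouping direct sums\<close>

lemma (in hilbert_family) inner_embed_embed:
  assumes "i \<in> I" "j \<in> I" "u \<in> hcarrier (R i)" "v \<in> hcarrier (R j)"
  shows "hinner S (embed i u) (embed j v) = (if i = j then hinner (R i) u v else 0)"
proof -
  have "hinner S (embed i u) (embed j v) = hinner (R i) u (embed j v i)"
    by (rule inner_embed[OF assms(1,3) embed_in[OF assms(2,4)]])
  also have "\<dots> = (if i = j then hinner (R i) u v else 0)"
    using assms hilbert_space.inner_zero_right[OF hilbert[OF assms(1)] assms(3)] by (simp add: embed_def)
  finally show ?thesis .
qed

lemma rep_sum2_simps: "hcarrier (rep_sum2 R S) = hcarrier R \<times> hcarrier S"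
  "hinner (rep_sum2 R S) (u, v) (u', v') = hinner R u u' + hinner S v v'"
  "act (rep_sum2 R S) g (u, v) = (act R g u, act S g v)"
  by (simp_all add: rep_sum2_def)

text \<open>On \<open>Z\<close> each summand is replaced by an equivalent one; on \<open>Y\<close>
  the summand \<open>i\<close> becomes copy number \<open>k i\<close> of \<open>R (q i)\<close>. All
  vectors of the summands serve as total families, so \<open>equivalentI_gram\<close> handles the
  regrouping and the replacements together.\<close>

lemma rep_sum_regroup:
  fixes P :: "'i \<Rightarrow> ('g, 'u) rep" and C :: "'i \<Rightarrow> ('g, 'v) rep" and R :: "'x \<Rightarrow> ('g, 'w) rep"
    and q :: "'i \<Rightarrow> 'x" and k :: "'i \<Rightarrow> nat"
  assumes P: "\<And>i. i \<in> Z \<union> Y \<Longrightarrow> isometric_rep G (P i)" and disj: "Z \<inter> Y = {}"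
    and C: "\<And>i. i \<in> Z \<Longrightarrow> isometric_rep G (C i)" "\<And>i. i \<in> Z \<Longrightarrow> unitarily_equivalent G (P i) (C i)"
    and R: "\<And>x. x \<in> X \<Longrightarrow> isometric_rep G (R x)" "\<And>i. i \<in> Y \<Longrightarrow> unitarily_equivalent G (P i) (R (q i))"
    and bij: "bij_betw (\<lambda>i. (q i, k i)) Y (SIGMA x:X. {..<m x})"
  shows "unitarily_equivalent G (rep_sum (Z \<union> Y) P)
    (rep_sum2 (rep_sum Z C) (rep_sum X (\<lambda>x. rep_multiple (m x) (R x))))"
proof -
  let ?M = "\<lambda>x. rep_multiple (m x) (R x)"
  let ?A = "rep_sum Z C" and ?B = "rep_sum X ?M"
  have q: "q i \<in> X" "k i < m (q i)" if "i \<in> Y" for i using bij_betwE[OF bij] that by auto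
  have M: "isometric_rep G (?M x)" if "x \<in> X" for x
    unfolding rep_multiple_def by (rule rep_sum_isometric) (rule R(1)[OF that])
  have "\<exists>T. hilbert_isometry (P i) (C i) T \<and> T ` hcarrier (P i) = hcarrier (C i) \<and>
      (\<forall>g\<in>carrier G. \<forall>v\<in>hcarrier (P i). T (act (P i) g v) = act (C i) g (T v))" if i: "i \<in> Z" for i
    using unitarily_equivalentE[OF C(2)[OF i] P C(1)[OF i]] i by (metis UnI1)
  then have "\<forall>i\<in>Z. \<exists>T. hilbert_isometry (P i) (C i) T \<and> T ` hcarrier (P i) = hcarrier (C i) \<and>
      (\<forall>g\<in>carrier G. \<forall>v\<in>hcarrier (P i). T (act (P i) g v) = act (C i) g (T v))" by blast
  then obtain T where T: "\<And>i. i \<in> Z \<Longrightarrow> hilbert_isometry (P i) (C i) (T i)"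
    "\<And>i. i \<in> Z \<Longrightarrow> T i ` hcarrier (P i) = hcarrier (C i)"
    "\<And>i g v. i \<in> Z \<Longrightarrow> g \<in> carrier G \<Longrightarrow> v \<in> hcarrier (P i) \<Longrightarrow> T i (act (P i) g v) = act (C i) g (T i v)"
    using bchoice[of Z] by metis
  have "\<exists>T. hilbert_isometry (P i) (R (q i)) T \<and> T ` hcarrier (P i) = hcarrier (R (q i)) \<and>
      (\<forall>g\<in>carrier G. \<forall>v\<in>hcarrier (P i). T (act (P i) g v) = act (R (q i)) g (T v))" if i: "i \<in> Y" for i
    using unitarily_equivalentE[OF R(2)[OF i] P R(1)[OF q(1)[OF i]]] i by (metis UnI2)
  then have "\<forall>i\<in>Y. \<exists>T. hilbert_isometry (P i) (R (q i)) T \<and> T ` hcarrier (P i) = hcarrier (R (q i)) \<and>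
      (\<forall>g\<in>carrier G. \<forall>v\<in>hcarrier (P i). T (act (P i) g v) = act (R (q i)) g (T v))" by blast
  then obtain T' where T': "\<And>i. i \<in> Y \<Longrightarrow> hilbert_isometry (P i) (R (q i)) (T' i)"
    "\<And>i. i \<in> Y \<Longrightarrow> T' i ` hcarrier (P i) = hcarrier (R (q i))"
    "\<And>i g v. i \<in> Y \<Longrightarrow> g \<in> carrier G \<Longrightarrow> v \<in> hcarrier (P i) \<Longrightarrow> T' i (act (P i) g v) = act (R (q i)) g (T' i v)"
    using bchoice[of Y] by metis
  interpret P: hilbert_family "Z \<union> Y" P by (rule hilbert_family.intro) (rule isometric_rep_hilbert[OF P])
  interpret C: hilbert_family Z C by (rule hilbert_family.intro) (rule isometric_rep_hilbert[OF C(1)])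
  interpret M: hilbert_family X ?M by (rule hilbert_family.intro) (rule isometric_rep_hilbert[OF M])
  have mult: "hilbert_family {..<m x} (\<lambda>_. R x)" if "x \<in> X" for x
    by (rule hilbert_family.intro) (rule isometric_rep_hilbert[OF R(1)[OF that]])
  interpret A: hilbert_space ?A by (rule C.hilbert_rep_sum)
  interpret B: hilbert_space ?B by (rule M.hilbert_rep_sum)
  define E where "E x = hilbert_family.embed {..<m x} (\<lambda>_. R x)" for x
  have E_in: "E x j u \<in> hcarrier (?M x)" if "x \<in> X" "j < m x" "u \<in> hcarrier (R x)" for x j u
    using hilbert_family.embed_in[OF mult[OF that(1)], of j u] that by (simp add: E_def rep_multiple_def)
  have E_inner: "hinner (?M x) (E x j u) (E x j' v) = (if j = j' then hinner (R x) u v else 0)"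
    if "x \<in> X" "j < m x" "u \<in> hcarrier (R x)" "j' < m x" "v \<in> hcarrier (R x)" for x j u j' v
    using hilbert_family.inner_embed_embed[OF mult[OF that(1)], of j j' u v] that by (simp add: E_def rep_multiple_def)
  have E_act: "act (?M x) g (E x j u) = E x j (act (R x) g u)" if "x \<in> X" "g \<in> carrier G" for x j u g
    unfolding E_def rep_multiple_def by (rule rep_sum_act_embed[OF R(1)[OF that(1)] that(2)])
  let ?I = "SIGMA i:Z \<union> Y. hcarrier (P i)"
  let ?e = "\<lambda>(i, u). P.embed i u"
  define f where "f i u = (if i \<in> Z then (C.embed i (T i u), hzero ?B)
    else (hzero ?A, M.embed (q i) (E (q i) (k i) (T' i u))))" for i u
  have Tin: "T i u \<in> hcarrier (C i)" if "i \<in> Z" "u \<in> hcarrier (P i)" for i u using T(2) that by blast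
  have Tin': "T' i u \<in> hcarrier (R (q i))" if "i \<in> Y" "u \<in> hcarrier (P i)" for i u using T'(2) that by blast
  have EY: "E (q i) (k i) (T' i u) \<in> hcarrier (?M (q i))" if "i \<in> Y" "u \<in> hcarrier (P i)" for i u
    by (rule E_in[OF q[OF that(1)] Tin'[OF that]])
  have fZ: "f i u = (C.embed i (T i u), hzero ?B)" if "i \<in> Z" for i u using that by (simp add: f_def)
  have fY: "f i u = (hzero ?A, M.embed (q i) (E (q i) (k i) (T' i u)))" if "i \<in> Y" for i u
    using that disj by (auto simp: f_def)
  have f_in: "f i u \<in> hcarrier (rep_sum2 ?A ?B)" if "i \<in> Z \<union> Y" "u \<in> hcarrier (P i)" for i u
  proof (cases "i \<in> Z")
    case True
    then show ?thesis using C.embed_in[OF True Tin[OF True that(2)]] B.zero_closed by (simp add: fZ rep_sum2_simps)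
  next
    case False
    then have i: "i \<in> Y" using that by simp
    then show ?thesis using M.embed_in[OF q(1)[OF i] EY[OF i that(2)]] A.zero_closed by (simp add: fY rep_sum2_simps)
  qed
  have tA: "total_in ?A {C.embed i x |i x. i \<in> Z \<and> x \<in> hcarrier (C i)}" (is "total_in _ ?XA")
    by (rule C.total_embed) (rule hilbert_space.total_carrier[OF C.hilbert])
  have tB: "total_in ?B {M.embed x y |x y. x \<in> X \<and> y \<in> {E x j u |j u. j \<in> {..<m x} \<and> u \<in> hcarrier (R x)}}" (is "total_in _ ?XB")
  proof (rule M.total_embed)
    fix x assume x: "x \<in> X"
    interpret x: hilbert_family "{..<m x}" "\<lambda>_. R x" by (rule mult[OF x])
    show "total_in (?M x) {E x j u |j u. j \<in> {..<m x} \<and> u \<in> hcarrier (R x)}"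
      unfolding E_def rep_multiple_def
      by (rule x.total_embed) (rule hilbert_space.total_carrier[OF x.hilbert])
  qed
  show ?thesis
  proof (rule equivalentI_gram[OF rep_sum_isometric[OF P] rep_sum2_isometric[OF rep_sum_isometric[OF C(1)] rep_sum_isometric[OF M]],
        where e = ?e and f = "\<lambda>(i, u). f i u" and I = ?I])
    have "total_in P.S {P.embed i x |i x. i \<in> Z \<union> Y \<and> x \<in> hcarrier (P i)}"
      by (rule P.total_embed) (rule hilbert_space.total_carrier[OF P.hilbert])
    moreover have "{P.embed i x |i x. i \<in> Z \<union> Y \<and> x \<in> hcarrier (P i)} = ?e ` ?I" by force
    ultimately show "total_in P.S (?e ` ?I)" by simp
    show "total_in (rep_sum2 ?A ?B) ((\<lambda>(i, u). f i u) ` ?I)"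
    proof (rule total_in_superset)
      show "total_in (rep_sum2 ?A ?B) ((\<lambda>x. (x, hzero ?B)) ` ?XA \<union> (\<lambda>y. (hzero ?A, y)) ` ?XB)"
        by (rule rep_sum2_total[OF rep_sum_isometric[OF C(1)] rep_sum_isometric[OF M] tA tB])
      show "(\<lambda>x. (x, hzero ?B)) ` ?XA \<union> (\<lambda>y. (hzero ?A, y)) ` ?XB \<subseteq> (\<lambda>(i, u). f i u) ` ?I"
      proof (rule Un_least)
        show "(\<lambda>x. (x, hzero ?B)) ` ?XA \<subseteq> (\<lambda>(i, u). f i u) ` ?I"
        proof clarify
          fix i x assume i: "i \<in> Z" and "x \<in> hcarrier (C i)"
          then obtain u where "u \<in> hcarrier (P i)" "x = T i u" using T(2)[OF i] by blast
          then show "(C.embed i x, hzero ?B) \<in> (\<lambda>(i, u). f i u) ` ?I"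
            using i by (intro image_eqI[of _ _ "(i, u)"]) (simp_all add: fZ)
        qed
        show "(\<lambda>y. (hzero ?A, y)) ` ?XB \<subseteq> (\<lambda>(i, u). f i u) ` ?I"
        proof clarify
          fix x j y assume x: "x \<in> X" and j: "j < m x" and y: "y \<in> hcarrier (R x)"
          have "(x, j) \<in> (\<lambda>i. (q i, k i)) ` Y" using bij_betw_imp_surj_on[OF bij] x j by auto
          then obtain i where i: "i \<in> Y" "x = q i" "j = k i" by blast
          obtain u where "u \<in> hcarrier (P i)" "y = T' i u" using T'(2)[OF i(1)] y i by blast
          then show "(hzero ?A, M.embed x (E x j y)) \<in> (\<lambda>(i, u). f i u) ` ?I"
            using i by (intro image_eqI[of _ _ "(i, u)"]) (simp_all add: fY)
        qed
      qed
      show "(\<lambda>(i, u). f i u) ` ?I \<subseteq> hcarrier (rep_sum2 ?A ?B)"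
      proof (rule image_subsetI)
        fix p assume "p \<in> ?I"
        then show "(\<lambda>(i, u). f i u) p \<in> hcarrier (rep_sum2 ?A ?B)" by (cases p) (simp add: f_in)
      qed
    qed
    fix a assume "a \<in> ?I"
    then obtain i u where a: "a = (i, u)" and i: "i \<in> Z \<union> Y" and u: "u \<in> hcarrier (P i)" by blast
    show "\<exists>b\<in>?I. act P.S g (?e a) = ?e b \<and> act (rep_sum2 ?A ?B) g ((\<lambda>(i, u). f i u) a) = (\<lambda>(i, u). f i u) b"
      if g: "g \<in> carrier G" for g
    proof (rule bexI)
      have zA: "act ?A g (hzero ?A) = hzero ?A"
        by (rule hilbert_isometry.zero[OF isometric_rep_act[OF rep_sum_isometric[OF C(1)] g]])
      have zB: "act ?B g (hzero ?B) = hzero ?B"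
        by (rule hilbert_isometry.zero[OF isometric_rep_act[OF rep_sum_isometric[OF M] g]])
      have "act (rep_sum2 ?A ?B) g (f i u) = f i (act (P i) g u)"
      proof (cases "i \<in> Z")
        case True
        then show ?thesis
          using rep_sum_act_embed[where R = C, OF C(1) g, of Z i "T i u"] by (simp add: fZ rep_sum2_simps zA zB T(3)[OF True g u])
      next
        case False
        then have y: "i \<in> Y" using i by simp
        then show ?thesis
          using rep_sum_act_embed[where R = ?M, OF M g, of X "q i" "E (q i) (k i) (T' i u)"]
          by (simp add: fY rep_sum2_simps zA zB T'(3)[OF y g u] E_act[OF q(1)[OF y] g])
      qed
      then show "act P.S g (?e a) = ?e (i, act (P i) g u) \<and>
          act (rep_sum2 ?A ?B) g ((\<lambda>(i, u). f i u) a) = (\<lambda>(i, u). f i u) (i, act (P i) g u)"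
        using rep_sum_act_embed[where R = P, OF P g, of "Z \<union> Y" i u] by (simp add: a)
      show "(i, act (P i) g u) \<in> ?I" using i hilbert_isometry.into[OF isometric_rep_act[OF P[OF i] g] u] by blast
    qed
    fix b assume "b \<in> ?I"
    then obtain j v where b: "b = (j, v)" and j: "j \<in> Z \<union> Y" and v: "v \<in> hcarrier (P j)" by blast
    have e: "hinner P.S (?e a) (?e b) = (if i = j then hinner (P i) u v else 0)"
      using P.inner_embed_embed[OF i j u v] by (simp add: a b)
    have "hinner (rep_sum2 ?A ?B) (f i u) (f j v) = (if i = j then hinner (P i) u v else 0)"
    proof (cases "i \<in> Z"; cases "j \<in> Z")
      assume ij: "i \<in> Z" "j \<in> Z"
      show ?thesis
        using ij v hilbert_isometry.inner[OF T(1)[OF ij(1)] u]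
        by (auto simp: fZ rep_sum2_simps B.inner_zero_left B.zero_closed C.inner_embed_embed[OF ij Tin[OF ij(1) u] Tin[OF ij(2) v]])
    next
      assume ij: "i \<in> Z" "j \<notin> Z"
      then have y: "j \<in> Y" using j by simp
      show ?thesis
        using ij y by (auto simp: fZ fY rep_sum2_simps A.inner_zero_right[OF C.embed_in[OF ij(1) Tin[OF ij(1) u]]]
            B.inner_zero_left[OF M.embed_in[OF q(1)[OF y] EY[OF y v]]])
    next
      assume ij: "i \<notin> Z" "j \<in> Z"
      then have y: "i \<in> Y" using i by simp
      show ?thesis
        using ij y by (auto simp: fZ fY rep_sum2_simps A.inner_zero_left[OF C.embed_in[OF ij(2) Tin[OF ij(2) v]]]
            B.inner_zero_right[OF M.embed_in[OF q(1)[OF y] EY[OF y u]]])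
    next
      assume "i \<notin> Z" "j \<notin> Z"
      then have y: "i \<in> Y" "j \<in> Y" using i j by auto
      have "hinner (rep_sum2 ?A ?B) (f i u) (f j v)
          = hinner ?B (M.embed (q i) (E (q i) (k i) (T' i u))) (M.embed (q j) (E (q j) (k j) (T' j v)))"
        by (simp add: fY y rep_sum2_simps A.inner_zero_left A.zero_closed)
      also have "\<dots> = (if q i = q j then hinner (?M (q i)) (E (q i) (k i) (T' i u)) (E (q j) (k j) (T' j v)) else 0)"
        by (rule M.inner_embed_embed[OF q(1)[OF y(1)] q(1)[OF y(2)] EY[OF y(1) u] EY[OF y(2) v]])
      also have "\<dots> = (if i = j then hinner (P i) u v else 0)"
      proof (cases "q i = q j")
        case True
        have "hinner (?M (q i)) (E (q i) (k i) (T' i u)) (E (q i) (k j) (T' j v)) = (if k i = k j then hinner (R (q i)) (T' i u) (T' j v) else 0)"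
          using E_inner[OF q[OF y(1)] Tin'[OF y(1) u], of "k j" "T' j v"] q(2)[OF y(2)] Tin'[OF y(2) v] True by simp
        moreover have "k i = k j \<longleftrightarrow> i = j" using bij_betw_imp_inj_on[OF bij] y True by (auto simp: inj_on_def)
        ultimately show ?thesis using True hilbert_isometry.inner[OF T'(1)[OF y(1)] u] v by auto
      next
        case False
        then show ?thesis by auto
      qed
      finally show ?thesis .
    qed
    then show "hinner P.S (?e a) (?e b) = hinner (rep_sum2 ?A ?B) ((\<lambda>(i, u). f i u) a) ((\<lambda>(i, u). f i u) b)"
      using e by (simp add: a b)
  qed
qed

section \<open>Irreducibility and inequivalence\<close>

context solvmanifold
begin

text \<open>\<open>fourier_unique_curves\<close> against the zero density, with the compact image of
  \<open>K\<close> on the orbit; injectivity of the orbit map recovers \<open>K\<close>.\<close>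

lemma orbit_integral_zero:
  assumes free: "inj (\<lambda>t. dual_act A t \<eta>)" and f: "integrable lborel f"
    and z: "\<And>x. (LINT t|lborel. cis (pi * (dual_act A t \<eta> \<bullet> x)) * f t) = 0"
  shows "AE t in lborel. f t = (0::complex)"
proof (rule AE_zero_if_compact_integrals_zero[OF f])
  fix K :: "real set" assume K: "compact K"
  let ?c = "\<lambda>t. dual_act A t \<eta>"
  have c: "continuous_on T ?c" for T by (intro dual_act_cont continuous_intros)
  have "(LINT t|lborel. indicator (?c ` K) (?c t) * f t) = (LINT t|lborel. indicator (?c ` K) (?c t) * 0)"
    by (rule fourier_unique_curves[OF c c f _ _ compact_continuous_image[OF c K]]) (simp_all add: z)
  moreover have "indicator (?c ` K) (?c t) = (indicator K t :: complex)" for t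
    using injD[OF free] by (auto simp: indicator_def)
  ultimately show "(LINT t|lborel. indicator K t * f t) = 0" by simp
qed

lemma L2R_measurable: "f \<in> L2R \<Longrightarrow> f \<in> borel_measurable borel"
  by (simp add: L2R_def)

lemma L2R_inner_integrable: "f \<in> L2R \<Longrightarrow> g \<in> L2R \<Longrightarrow> integrable lborel (\<lambda>t. f t * cnj (g t))"
  by (rule integrable_inner_product) (auto simp: L2R_def)

lemma L2R_translate: "f \<in> L2R \<Longrightarrow> (\<lambda>t. f (t + s)) \<in> L2R"
  using integrable_translate[of "\<lambda>t. (cmod (f t))\<^sup>2" s]
  by (auto simp: L2R_def intro!: measurable_compose[of "\<lambda>t. t + s" borel borel f borel])

lemma L2R_indicator: "indicator {a..b} \<in> L2R"
proof -
  have "(cmod (indicator {a..b} t))\<^sup>2 = indicator {a..b} t" for t :: real by (simp add: indicator_def)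
  then show ?thesis by (simp add: L2R_def integrable_indicator_Icc)
qed

lemma nn_integral_translate:
  fixes f :: "real \<Rightarrow> ennreal"
  assumes "f \<in> borel_measurable borel"
  shows "(\<integral>\<^sup>+s. f (t + s) \<partial>lborel) = (\<integral>\<^sup>+s. f s \<partial>lborel)"
  using nn_integral_real_affine[OF assms, of 1 t] by simp

text \<open>Tonelli: the double integral of \<open>|f(t + s)| |g(t)|\<close> is the product of the
  two possibly infinite L1-norms, so its vanishing makes one of them vanish.\<close>

lemma translates_disjoint:
  fixes f g :: "real \<Rightarrow> complex"
  assumes [measurable]: "f \<in> borel_measurable borel" "g \<in> borel_measurable borel"
    and z: "\<And>s. AE t in lborel. f (t + s) * cnj (g t) = 0"
  shows "(AE t in lborel. f t = 0) \<or> (AE t in lborel. g t = 0)"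
proof -
  let ?n = "\<lambda>h t. ennreal (cmod (h t :: complex))"
  have "0 = (\<integral>\<^sup>+s. (\<integral>\<^sup>+t. ?n f (t + s) * ?n g t \<partial>lborel) \<partial>lborel)"
  proof -
    have "(\<integral>\<^sup>+t. ?n f (t + s) * ?n g t \<partial>lborel) = 0" for s
    proof -
      have "AE t in lborel. ?n f (t + s) * ?n g t = 0" using z[of s] by eventually_elim auto
      then show ?thesis by (subst nn_integral_0_iff_AE) auto
    qed
    then show ?thesis by simp
  qed
  also have "\<dots> = (\<integral>\<^sup>+t. (\<integral>\<^sup>+s. ?n f (t + s) * ?n g t \<partial>lborel) \<partial>lborel)"
    by (rule lborel_pair.Fubini') measurable
  also have "\<dots> = (\<integral>\<^sup>+t. (\<integral>\<^sup>+s. ?n f s \<partial>lborel) * ?n g t \<partial>lborel)"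
  proof (rule nn_integral_cong)
    fix t
    have "(\<integral>\<^sup>+s. ?n f (t + s) * ?n g t \<partial>lborel) = (\<integral>\<^sup>+s. ?n f (t + s) \<partial>lborel) * ?n g t"
      by (rule nn_integral_multc) measurable
    also have "(\<integral>\<^sup>+s. ?n f (t + s) \<partial>lborel) = (\<integral>\<^sup>+s. ?n f s \<partial>lborel)"
      by (rule nn_integral_translate) measurable
    finally show "(\<integral>\<^sup>+s. ?n f (t + s) * ?n g t \<partial>lborel) = (\<integral>\<^sup>+s. ?n f s \<partial>lborel) * ?n g t" .
  qed
  also have "\<dots> = (\<integral>\<^sup>+s. ?n f s \<partial>lborel) * (\<integral>\<^sup>+t. ?n g t \<partial>lborel)"
    by (rule nn_integral_cmult) measurable
  finally have "(\<integral>\<^sup>+s. ?n f s \<partial>lborel) = 0 \<or> (\<integral>\<^sup>+t. ?n g t \<partial>lborel) = 0" by simp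
  then show ?thesis by (subst (asm) (1 2) nn_integral_0_iff_AE) auto
qed

text \<open>For fixed \<open>s\<close>, the matrix coefficients at the elements
  \<open>(x, s)\<close> form the Fourier transform of \<open>f(t + s) cnj (g t)\<close> carried by
  the orbit.\<close>

lemma rotate_orthogonal:
  assumes free: "inj (\<lambda>t. dual_act A t \<eta>)" and f: "f \<in> L2R" and g: "g \<in> L2R"
    and z: "\<And>h. (LINT t|lborel. rotate \<eta> h f t * cnj (g t)) = 0"
  shows "(AE t in lborel. f t = 0) \<or> (AE t in lborel. g t = 0)"
proof (rule translates_disjoint[OF L2R_measurable[OF f] L2R_measurable[OF g]])
  fix s
  show "AE t in lborel. f (t + s) * cnj (g t) = 0"
  proof (rule orbit_integral_zero[OF free L2R_inner_integrable[OF L2R_translate[OF f] g]])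
    fix x
    show "(LINT t|lborel. cis (pi * (dual_act A t \<eta> \<bullet> x)) * (f (t + s) * cnj (g t))) = 0"
      using z[of "(x, s)"] by (simp add: rotate_def mult.assoc)
  qed
qed

lemma indicator_Icc_inner: "a \<le> b \<Longrightarrow> (LINT t|lborel. indicator {a..b} t * cnj (indicator {a..b::real} t)) = of_real (b - a)"
proof -
  assume "a \<le> b"
  have "indicator {a..b} t * cnj (indicator {a..b} t) = of_real (indicator {a..b} t)" for t :: real by (simp add: indicator_def)
  then show ?thesis using \<open>a \<le> b\<close> by (simp add: integral_complex_of_real)
qed

text \<open>A proper nonzero invariant closed subspace and its complement would provide nonzero
  \<open>f\<close> and \<open>k\<close> with all matrix coefficients zero.\<close>

theorem irreducible_rho_eta:
  assumes free: "inj (\<lambda>t. dual_act A t \<eta>)"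
  shows "irreducible_rep G (rho_eta A \<eta>)"
proof -
  interpret L: L2_rep lborel L2R G "rotate \<eta>" test_functions by (rule rotate_L2_rep)
  interpret R: hilbert_space L.R by (rule L.hilbert_R)
  have inner: "hinner L.R (L.cls f) (L.cls g) = (LINT t|lborel. f t * cnj (g t))" if "f \<in> L2R" "g \<in> L2R" for f g
    using L.inner_eq[OF that] by (simp add: L.R_simps)
  have zero: "L.cls f = hzero L.R" if "AE t in lborel. f t = 0" for f
    unfolding L.R_simps L.zero_eq by (rule L.cls_eqI[OF that])
  have "hcarrier L.R \<noteq> {hzero L.R}"
  proof
    assume c: "hcarrier L.R = {hzero L.R}"
    have "L.cls (indicator {0..1}) \<in> hcarrier L.R" using L2R_indicator[of 0 1] by (simp add: L.R_simps L.carrier_eq)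
    then have "L.cls (indicator {0..1}) = hzero L.R" using c by simp
    then have "hinner L.R (L.cls (indicator {0..1})) (L.cls (indicator {0..1})) = 0"
      using R.inner_zero_left[OF R.zero_closed] by simp
    then show False using indicator_Icc_inner[of 0 1] by (simp add: inner L2R_indicator)
  qed
  moreover have "W = {hzero L.R} \<or> W = hcarrier L.R" if W: "closed_subspace L.R W" and inv: "invariant_subset G L.R W" for W
  proof (rule ccontr)
    assume n: "\<not> (W = {hzero L.R} \<or> W = hcarrier L.R)"
    obtain g where g: "g \<in> hcarrier L.R" "g \<noteq> hzero L.R" "\<And>w. w \<in> W \<Longrightarrow> hinner L.R w g = 0"
      using R.orthogonal_vector_exists[OF W] n by blast
    obtain w where w: "w \<in> W" "w \<noteq> hzero L.R" using n R.closed_subspace_closed(2)[OF W] by blast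
    have "w \<in> hcarrier L.R" using R.closed_subspace_closed(1)[OF W w(1)] .
    then obtain f where f: "f \<in> L2R" "w = L.cls f" by (auto simp: L.R_simps L.carrier_eq)
    obtain k where k: "k \<in> L2R" "g = L.cls k" using g(1) by (auto simp: L.R_simps L.carrier_eq)
    have "(LINT t|lborel. rotate \<eta> h f t * cnj (k t)) = 0" for h
    proof -
      have h: "h \<in> carrier G" by (simp add: G_carrier)
      have "act L.R h w \<in> W" using inv w(1) h by (simp add: invariant_subset_def)
      then have "hinner L.R (act L.R h w) g = 0" by (rule g(3))
      then have "hinner L.R (L.cls (rotate \<eta> h f)) (L.cls k) = 0" unfolding f(2) k(2) L.act_cls[OF h f(1)] .
      then show ?thesis unfolding inner[OF L.r_closed[OF h f(1)] k(1)] .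
    qed
    then have "(AE t in lborel. f t = 0) \<or> (AE t in lborel. k t = 0)" by (rule rotate_orthogonal[OF free f(1) k(1)])
    then show False using zero w(2) g(2) f(2) k(2) by blast
  qed
  ultimately show ?thesis
    unfolding irreducible_rep_def using unitary_rho_eta[of \<eta>] by (simp add: rho_eta_eq)
qed

text \<open>Restricted to R^n, the diagonal matrix coefficient of an indicator is the Fourier
  transform of a measure on one orbit; the intertwiner equates it with one of density
  \<open>|h|^2\<close> on the other. Testing on a compact arc of the first orbit gives 1 =
  0.\<close>

theorem rho_eta_inequivalent:
  assumes disj: "real_orbit A \<eta> \<inter> real_orbit A \<eta>' = {}"
  shows "\<not> unitarily_equivalent G (rho_eta A \<eta>) (rho_eta A \<eta>')"
proof
  interpret L: L2_rep lborel L2R G "rotate \<eta>" test_functions by (rule rotate_L2_rep)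
  interpret L': L2_rep lborel L2R G "rotate \<eta>'" test_functions by (rule rotate_L2_rep)
  assume "unitarily_equivalent G (rho_eta A \<eta>) (rho_eta A \<eta>')"
  then obtain T where T: "hilbert_isometry L.R L'.R T"
    "\<And>g v. g \<in> carrier G \<Longrightarrow> v \<in> hcarrier L.R \<Longrightarrow> T (act L.R g v) = act L'.R g (T v)"
    unfolding rho_eta_eq using unitarily_equivalentE[OF _ L.isometric L'.isometric] by metis
  interpret T: hilbert_isometry L.R L'.R T by (rule T(1))
  let ?f = "indicator {0..1} :: real \<Rightarrow> complex"
  have f: "?f \<in> L2R" by (rule L2R_indicator)
  have fc: "L.cls ?f \<in> hcarrier L.R" using f by (simp add: L.R_simps L.carrier_eq)
  obtain h where h: "h \<in> L2R" "T (L.cls ?f) = L.cls h" using T.into[OF fc] by (auto simp: L'.R_simps L.carrier_eq)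
  let ?c = "\<lambda>t. dual_act A t \<eta>" and ?d = "\<lambda>t. dual_act A t \<eta>'"
  have cont: "continuous_on X ?c" "continuous_on X ?d" for X by (intro dual_act_cont continuous_intros)+
  have eq: "(LINT t|lborel. cis (pi * (?c t \<bullet> x)) * (?f t * cnj (?f t))) = (LINT t|lborel. cis (pi * (?d t \<bullet> x)) * (h t * cnj (h t)))" for x
  proof -
    let ?g = "(x, 0)"
    have g: "?g \<in> carrier G" by (simp add: G_carrier)
    have r: "rotate \<eta> ?g ?f \<in> L2R" "rotate \<eta>' ?g h \<in> L2R" using L.r_closed[OF g f] L'.r_closed[OF g h(1)] by auto
    have rc: "L.cls (rotate \<eta> ?g ?f) \<in> hcarrier L.R" using r by (simp add: L.R_simps L.carrier_eq)
    have "(LINT t|lborel. rotate \<eta> ?g ?f t * cnj (?f t)) = hinner L.R (L.cls (rotate \<eta> ?g ?f)) (L.cls ?f)"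
      using L.inner_eq[OF r(1) f] by (simp add: L.R_simps)
    also have "\<dots> = hinner L'.R (T (L.cls (rotate \<eta> ?g ?f))) (T (L.cls ?f))" using T.inner[OF rc fc] by simp
    also have "T (L.cls (rotate \<eta> ?g ?f)) = act L'.R ?g (T (L.cls ?f))"
      unfolding L.act_cls[OF g f, symmetric] by (rule T(2)[OF g fc])
    also have "\<dots> = L.cls (rotate \<eta>' ?g h)" unfolding h(2) by (rule L'.act_cls[OF g h(1)])
    also have "hinner L'.R (L.cls (rotate \<eta>' ?g h)) (T (L.cls ?f)) = (LINT t|lborel. rotate \<eta>' ?g h t * cnj (h t))"
      using L.inner_eq[OF r(2) h(1)] by (simp add: L'.R_simps h(2))
    finally show ?thesis unfolding rotate_def fst_conv snd_conv by (simp only: mult.assoc add_0_right)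
  qed
  let ?K = "?c ` {0..1}"
  have "(LINT t|lborel. indicator ?K (?c t) * (?f t * cnj (?f t))) = (LINT t|lborel. indicator ?K (?d t) * (h t * cnj (h t)))"
    by (rule fourier_unique_curves[OF cont(1) cont(2) L2R_inner_integrable[OF f f] L2R_inner_integrable[OF h(1) h(1)] eq
          compact_continuous_image[OF cont(1) compact_Icc]])
  moreover have "indicator ?K (?c t) * (?f t * cnj (?f t)) = ?f t * cnj (?f t)" for t by (simp add: indicator_def)
  moreover have "indicator ?K (?d t) = (0::complex)" for t
    using disj unfolding real_orbit_eq by (auto simp: indicator_def)
  ultimately show False using indicator_Icc_inner[of 0 1] by simp
qed

text \<open>A dimension count: two orthonormal indicators would have preimages in a one-dimensional
  space.\<close>

theorem character_rho_eta_inequivalent: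
  assumes chi: "\<And>g. cmod (f g) = 1"
  shows "\<not> unitarily_equivalent G (character_rep f) (rho_eta A \<eta>)"
proof
  interpret L: L2_rep lborel L2R G "rotate \<eta>" test_functions by (rule rotate_L2_rep)
  interpret R: hilbert_space L.R by (rule L.hilbert_R)
  assume "unitarily_equivalent G (character_rep f) (rho_eta A \<eta>)"
  then obtain T where T: "hilbert_isometry (character_rep f) L.R T" "T ` hcarrier (character_rep f) = hcarrier L.R"
    unfolding rho_eta_eq using unitarily_equivalentE[OF _ character_rep_isometric[of G f, OF chi] L.isometric] by metis
  interpret T: hilbert_isometry "character_rep f" L.R T by (rule T(1))
  let ?i = "\<lambda>a. L.cls (indicator {a..a + 1})"
  have c: "?i a \<in> hcarrier L.R" for a using L2R_indicator[of a "a + 1"] by (simp add: L.R_simps L.carrier_eq)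
  have one: "hinner L.R (?i a) (?i a) = 1" for a
    using indicator_Icc_inner[of a "a + 1"] L.inner_eq[OF L2R_indicator L2R_indicator, of a "a + 1" a "a + 1"] by (simp add: L.R_simps)
  have orth: "hinner L.R (?i 0) (?i 2) = 0"
  proof -
    have "indicator {0..0+1} t * cnj (indicator {2..2+1} t) = (0::complex)" for t :: real by (auto simp: indicator_def)
    then show ?thesis using L.inner_eq[OF L2R_indicator L2R_indicator, of 0 "0 + 1" 2 "2 + 1"] by (simp only: L.R_simps integral_zero)
  qed
  have "?i a \<in> T ` hcarrier (character_rep f)" for a using c[of a] T(2) by simp
  then obtain z w where zw: "z \<in> hcarrier (character_rep f)" "w \<in> hcarrier (character_rep f)" "T z = ?i 0" "T w = ?i 2"
    unfolding image_iff by (metis (no_types))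
  have "z * cnj w = 0" "z * cnj z = 1" "w * cnj w = 1"
    using T.inner[OF zw(1,2)] T.inner[OF zw(1,1)] T.inner[OF zw(2,2)] one[of 0] one[of 2] orth zw(3,4) by (simp_all add: character_rep_def)
  then show False by auto
qed

end

section \<open>Fixed points\<close>

lemma AE_lborel_shift:
  assumes "AE t in lborel. P t" and [measurable]: "Measurable.pred borel P"
  shows "AE t in lborel. P (c + t :: real)"
proof -
  have "AE t in distr lborel borel ((+) c). P t" unfolding lborel_distr_plus by (rule assms(1))
  then show ?thesis by (subst (asm) AE_distr_iff) auto
qed

text \<open>For \<open>k \<noteq> 0\<close> a shift by half a period, \<open>1 / (2 k)\<close>,
  changes the sign of the integrand.\<close>

lemma integral_cube_harmonic: "(LINT t|cube_measure. cis (2 * pi * of_int k * t)) = (if k = 0 then 1 else 0)"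
proof (cases "k = 0")
  case True
  then show ?thesis using prob_space_cube[where 'a = real] by (simp add: measure_def)
next
  case False
  let ?h = "\<lambda>t::real. cis (2 * pi * of_int k * t)"
  have [measurable]: "?h \<in> borel_measurable borel" by measurable
  have per: "?h (t + l) = ?h t" if l: "l \<in> unit_lattice" for t l
  proof -
    obtain n :: int where n: "l = of_int n" using l by (auto simp: unit_lattice_real elim: Ints_cases)
    have "?h (t + l) = ?h t * cis (2 * pi * of_int (k * n))" unfolding cis_mult by (simp add: n algebra_simps)
    then show ?thesis by (simp only: cis_int_2pi mult_1_right)
  qed
  have "(LINT t|cube_measure. ?h (id t + 1 / (2 * of_int k))) = (LINT t|cube_measure. ?h t)"
    by (rule integral_cube_affine) (auto simp: per linear_iff)
  moreover have "?h (t + 1 / (2 * of_int k)) = - ?h t" for t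
  proof -
    have "2 * pi * of_int k * (t + 1 / (2 * of_int k)) = 2 * pi * of_int k * t + pi" using False by (simp add: field_simps)
    then have "?h (t + 1 / (2 * of_int k)) = ?h t * cis pi" unfolding cis_mult by (simp only:)
    then show ?thesis by (simp add: cis_pi)
  qed
  ultimately show ?thesis using False by simp
qed

context solvmanifold
begin

definition fixed :: "real^'n \<Rightarrow> bool" where "fixed \<xi> \<longleftrightarrow> (\<forall>t. dual_act A t \<xi> = \<xi>)"

lemma X_zero_eq: "X_zero A \<epsilon> = {{\<xi>} |\<xi>. \<xi> \<in> \<Sigma> \<and> fixed \<xi>}"
  by (simp add: X_zero_def fixed_def dual_act_def)

abbreviation wave :: "real^'n \<Rightarrow> int \<Rightarrow> (real^'n) \<times> real \<Rightarrow> complex" where "wave \<xi> m \<equiv> chi \<epsilon> {\<xi>} m"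

lemma wave_eq: "wave \<xi> m (x, s) = cis (pi * (\<xi> \<bullet> x)) * cis (pi * of_int (2 * m + \<epsilon> (0, 1)) * s)"
  by (simp add: chi_def)

lemma wave_norm: "cmod (wave \<xi> m g) = 1"
  by (cases g) (simp add: wave_eq norm_mult)

text \<open>A fixed frequency pairs with \<open>A s y\<close> as with \<open>y\<close>, so the twist
  in the group law disappears.\<close>

lemma wave_mult:
  assumes "fixed \<xi>"
  shows "wave \<xi> m (g \<otimes>\<^bsub>G\<^esub> h) = wave \<xi> m g * wave \<xi> m h"
proof -
  obtain x s where g: "g = (x, s)" by (cases g)
  obtain y t where h: "h = (y, t)" by (cases h)
  have "\<xi> \<bullet> (A s *v y) = \<xi> \<bullet> y" using assms dual_act_inner[of A s \<xi> y] by (simp add: fixed_def)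
  then have "wave \<xi> m (g \<otimes>\<^bsub>G\<^esub> h) = cis (pi * (\<xi> \<bullet> x) + pi * (\<xi> \<bullet> y))
      * cis (pi * of_int (2 * m + \<epsilon> (0, 1)) * s + pi * of_int (2 * m + \<epsilon> (0, 1)) * t)"
    unfolding g h G_mult wave_eq by (simp only: inner_add_right distrib_left)
  then show ?thesis unfolding g h wave_eq cis_mult[symmetric] by (simp only: mult_ac)
qed

lemma wave_continuous: "continuous_on X (wave \<xi> m)"
proof -
  have "wave \<xi> m = (\<lambda>y. cis (pi * (\<xi> \<bullet> fst y)) * cis (pi * of_int (2 * m + \<epsilon> (0, 1)) * snd y))"
    by (auto simp: fun_eq_iff wave_eq)
  then show ?thesis by (simp only:) (intro continuous_intros)
qed

lemma wave_character: "fixed \<xi> \<Longrightarrow> unitary_character G (wave \<xi> m)"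
  by (simp add: unitary_character_def wave_norm wave_mult wave_continuous)

text \<open>The time frequency \<open>2 m + \<epsilon> (0, 1)\<close> differs from the parity by an
  even integer, so integral times produce exactly the sign \<sigma>.\<close>

lemma wave_equivariant:
  assumes \<xi>: "\<xi> \<in> \<Sigma>" and f: "fixed \<xi>"
  shows "equivariant A \<epsilon> (wave \<xi> m)"
  unfolding equivariant_iff
proof (intro conjI ballI allI)
  fix k :: "real^'n" and x t assume k: "k \<in> integer_vectors"
  have "cis (pi * (\<xi> \<bullet> (x + k))) = cis (pi * (\<xi> \<bullet> x)) * \<sigma> (k, 0)"
    using \<xi> k unfolding Sigma_iff by (simp add: inner_add_right distrib_left flip: cis_mult)
  then show "wave \<xi> m (x + k, t) = \<sigma> (k, 0) * wave \<xi> m (x, t)" by (simp add: wave_eq)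
next
  fix l :: real and x :: "real^'n" and t assume "l \<in> \<int>"
  then obtain n :: int where n: "l = of_int n" by (auto elim: Ints_cases)
  have "\<xi> \<bullet> (A l *v x) = \<xi> \<bullet> x" using f dual_act_inner[of A l \<xi> x] by (simp add: fixed_def)
  moreover have "cis (pi * of_int (2 * m + \<epsilon> (0, 1)) * (t + l)) = cis (pi * of_int (2 * m + \<epsilon> (0, 1)) * t) * \<sigma> (0, l)"
  proof -
    have "pi * of_int (2 * m + \<epsilon> (0, 1)) * (t + l) = pi * of_int (2 * m + \<epsilon> (0, 1)) * t + 2 * pi * of_int (m * n) + pi * of_int (\<epsilon> (0, 1)) * of_int n"
      by (simp add: n algebra_simps)
    then have "cis (pi * of_int (2 * m + \<epsilon> (0, 1)) * (t + l)) = cis (pi * of_int (2 * m + \<epsilon> (0, 1)) * t)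
        * cis (2 * pi * of_int (m * n)) * cis (pi * of_int (\<epsilon> (0, 1)) * of_int n)"
      by (simp only: cis_mult)
    then show ?thesis unfolding n \<sigma>_time_int cis_int_2pi by simp
  qed
  ultimately show "wave \<xi> m (A l *v x, t + l) = \<sigma> (0, l) * wave \<xi> m (x, t)" by (simp add: wave_eq)
qed

lemma wave_S: "\<xi> \<in> \<Sigma> \<Longrightarrow> fixed \<xi> \<Longrightarrow> (\<lambda>y. z * wave \<xi> m y) \<in> S"
  by (rule continuous_in_S) (auto intro!: continuous_intros wave_continuous equivariant_scale wave_equivariant)

lemma fixed_orbit: "fixed \<xi> \<Longrightarrow> int_orbit A \<xi> = {\<xi>}"
  by (auto simp: int_orbit_eq fixed_def)

lemma wave_fourier_coeff:
  assumes \<xi>: "\<xi> \<in> \<Sigma>" and f: "fixed \<xi>" and \<eta>: "\<eta> \<in> \<Sigma>" "\<eta> \<noteq> \<xi>"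
  shows "fourier_coeff (\<lambda>y. z * wave \<xi> m y) \<eta> t = 0"
proof -
  note S = wave_S[OF \<xi> f, of z m]
  have "fourier_coeff (\<lambda>y. z * wave \<xi> m y) \<eta> t = (LINT x|Q. z * wave \<xi> m (x, t) * cis (- pi * (\<eta> \<bullet> x)))"
    by (rule fourier_coeff_eq[OF S_measurable[OF S] S_equivariant[OF S] \<eta>(1)])
  also have "\<dots> = (LINT x|Q. (z * cis (pi * of_int (2 * m + \<epsilon> (0, 1)) * t)) * (cis (pi * (\<xi> \<bullet> x)) * cis (- pi * (\<eta> \<bullet> x))))"
    by (simp only: wave_eq mult_ac)
  also have "\<dots> = 0" using character_orthogonality[OF \<xi> \<eta>(1)] \<eta>(2) by simp
  finally show ?thesis .
qed

lemma wave_U_theta: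
  assumes \<xi>: "\<xi> \<in> \<Sigma>" and f: "fixed \<xi>"
  shows "cls (\<lambda>y. z * wave \<xi> m y) \<in> U_theta A \<epsilon> {\<xi>}"
proof -
  note S = wave_S[OF \<xi> f, of z m]
  have "hinner right.R (cls (\<lambda>y. z * wave \<xi> m y)) x = 0" if x: "x \<in> outer_series {\<xi>}" for x
  proof -
    obtain \<eta> \<psi> where \<eta>: "\<eta> \<in> \<Sigma>" "\<eta> \<noteq> \<xi>" and \<psi>: "\<psi> \<in> test_functions" and x: "x = cls (poincare \<eta> \<psi>)"
      using x unfolding outer_series_def by blast
    show ?thesis
      unfolding x cls_inner[OF S poincare_S[OF \<eta>(1) \<psi>]] unfolding_formula[OF S \<eta>(1) \<psi>]
      by (simp add: wave_fourier_coeff[OF \<xi> f \<eta>])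
  qed
  then show ?thesis using cls_carrier[OF S] by (simp add: U_theta_eq)
qed

lemma wave_inner:
  assumes \<xi>: "\<xi> \<in> \<Sigma>" and f: "fixed \<xi>"
  shows "(LINT y|F. (z * wave \<xi> m y) * cnj (z' * wave \<xi> m' y)) = (if m = m' then z * cnj z' else 0)"
proof -
  have eq: "(z * wave \<xi> m (x, t)) * cnj (z' * wave \<xi> m' (x, t)) = (z * cnj z') * cis (2 * pi * of_int (m - m') * t)" for x t
  proof -
    let ?c = "cis (pi * (\<xi> \<bullet> x))"
    let ?a = "\<lambda>m. cis (pi * of_int (2 * m + \<epsilon> (0, 1)) * t)"
    have "(z * wave \<xi> m (x, t)) * cnj (z' * wave \<xi> m' (x, t)) = (z * cnj z') * (?c * cnj ?c) * (?a m * cnj (?a m'))"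
      by (simp add: wave_eq algebra_simps)
    also have "?c * cnj ?c = 1" by (simp flip: complex_norm_square)
    also have "?a m * cnj (?a m') = cis (2 * pi * of_int (m - m') * t)"
      unfolding cis_cnj cis_mult by (simp add: algebra_simps)
    finally show ?thesis by simp
  qed
  have "integrable F (\<lambda>y. (z * wave \<xi> m y) * cnj (z' * wave \<xi> m' y))"
    by (intro integrable_F_continuous continuous_intros wave_continuous)
  then have "(LINT y|F. (z * wave \<xi> m y) * cnj (z' * wave \<xi> m' y)) = (LINT t|I. LINT x|Q. (z * cnj z') * cis (2 * pi * of_int (m - m') * t))"
    by (subst integral_F) (simp_all only: eq)
  also have "\<dots> = (LINT t|I. (z * cnj z') * cis (2 * pi * of_int (m - m') * t))"
    using prob_space_cube[where 'a = "real^'n"] by (simp add: measure_def)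
  also have "\<dots> = (z * cnj z') * (LINT t|I. cis (2 * pi * of_int (m - m') * t))" by simp
  also have "\<dots> = (if m = m' then z * cnj z' else 0)" unfolding integral_cube_harmonic by simp
  finally show ?thesis .
qed

lemma translate_wave: "fixed \<xi> \<Longrightarrow> translate g (\<lambda>y. z * wave \<xi> m y) = (\<lambda>y. (wave \<xi> m g * z) * wave \<xi> m y)"
  by (simp add: translate_def fun_eq_iff wave_mult)

text \<open>Only the coefficient at \<xi> can be nonzero. Orthogonality to the waves annihilates it
  on the unit interval, and \<open>fourier_coeff_shift\<close>, which at a fixed point relates
  different times of the same coefficient, spreads this over the line.\<close>

lemma waves_total:
  assumes \<xi>: "\<xi> \<in> \<Sigma>" and f: "fixed \<xi>" and \<phi>: "\<phi> \<in> S" "cls \<phi> \<in> U_theta A \<epsilon> {\<xi>}"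
    and z: "\<And>m. (LINT y|F. wave \<xi> m y * cnj (\<phi> y)) = 0"
  shows "AE y in F. \<phi> y = 0"
proof (rule fourier_coeffs_total[OF \<phi>(1)])
  fix \<eta> assume \<eta>: "\<eta> \<in> \<Sigma>"
  let ?c = "fourier_coeff \<phi> \<xi>"
  show "AE t in lborel. fourier_coeff \<phi> \<eta> t = 0"
  proof (cases "\<eta> = \<xi>")
    case False
    then have "\<eta> \<in> integer_vectors - {\<xi>}" using \<eta> Sigma_integer by blast
    then show ?thesis using \<phi> cls_self[OF \<phi>(1)] unfolding U_theta_def by blast
  next
    case True
    have cm[measurable]: "?c \<in> borel_measurable borel" by (rule fourier_coeff_measurable[OF \<phi>(1) \<xi>])
    \<comment> \<open>Removes the offset \<open>\<epsilon> (0, 1)\<close> from the time frequencies,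
      leaving the harmonics \<open>cis (2 * pi * n * t)\<close>.\<close>
    let ?e = "\<lambda>t. cis (- pi * of_int (\<epsilon> (0, 1)) * t)"
    have em[measurable]: "?e \<in> borel_measurable borel" by measurable
    have "AE t in cube_measure. ?e t * ?c t = 0"
    proof (rule fourier_unique_cube)
      have ci: "integrable I ?c" using fourier_coeff_integrable[OF \<phi>(1) \<xi>, of 0] by simp
      show "integrable I (\<lambda>t. ?e t * ?c t)"
        by (rule integrable_bounded_mult[OF ci measurable_cube_measure[OF em], of 1]) simp
      fix l :: real assume "l \<in> unit_lattice"
      then obtain n :: int where n: "l = of_int n" by (auto simp: unit_lattice_real elim: Ints_cases)
      \<comment> \<open>Conjugation reverses the frequency, hence \<open>- n\<close>.\<close>
      have "(LINT y|F. cnj (wave \<xi> (- n) y * cnj (\<phi> y))) = 0"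
        unfolding Bochner_Integration.integral_cnj z by simp
      moreover have "integrable F (\<lambda>y. cnj (wave \<xi> (- n) y * cnj (\<phi> y)))"
      proof -
        have "integrable F (\<lambda>y. cnj (wave \<xi> (- n) y) * \<phi> y)"
          by (rule integrable_bounded_mult[OF S_integrable[OF \<phi>(1)], of _ 1])
            (auto simp: wave_norm intro!: measurable_F borel_measurable_continuous_onI continuous_intros wave_continuous)
        then show ?thesis by simp
      qed
      ultimately have "0 = (LINT t|I. LINT x|Q. cnj (wave \<xi> (- n) (x, t) * cnj (\<phi> (x, t))))"
        by (subst integral_F[symmetric]) simp_all
      also have "\<dots> = (LINT t|I. cis (2 * pi * (l \<bullet> t)) * (?e t * ?c t))"
      proof (rule Bochner_Integration.integral_cong[OF refl])
        fix t
        have "cnj (wave \<xi> (- n) (x, t) * cnj (\<phi> (x, t))) = (cis (2 * pi * (l \<bullet> t)) * ?e t) * (\<phi> (x, t) * cis (- pi * (\<xi> \<bullet> x)))" for x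
        proof -
          have "pi * of_int (2 * (- n) + \<epsilon> (0, 1)) * t = - (2 * pi * (l \<bullet> t) + - pi * of_int (\<epsilon> (0, 1)) * t)" by (simp add: n algebra_simps)
          then have "cnj (cis (pi * of_int (2 * (- n) + \<epsilon> (0, 1)) * t)) = cis (2 * pi * (l \<bullet> t)) * ?e t"
            by (simp only: cis_cnj minus_minus cis_mult)
          moreover have "cnj (cis (pi * (\<xi> \<bullet> x))) = cis (- pi * (\<xi> \<bullet> x))" by (simp add: cis_cnj)
          ultimately show ?thesis unfolding wave_eq complex_cnj_mult complex_cnj_cnj by (simp only: mult_ac)
        qed
        then show "(LINT x|Q. cnj (wave \<xi> (- n) (x, t) * cnj (\<phi> (x, t)))) = cis (2 * pi * (l \<bullet> t)) * (?e t * ?c t)"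
          using fourier_coeff_eq[OF S_measurable[OF \<phi>(1)] S_equivariant[OF \<phi>(1)] \<xi>, of t] by (simp only: integral_mult_right_zero mult.assoc)
      qed
      finally show "(LINT t|I. cis (2 * pi * (l \<bullet> t)) * (?e t * ?c t)) = 0" ..
    qed
    then have "AE t in lborel. t \<in> {0..1} \<longrightarrow> ?c t = 0" unfolding AE_cube_iff by eventually_elim auto
    then have "AE t in lborel. of_int l + t \<in> {0..1} \<longrightarrow> ?c (of_int l + t) = 0" for l :: int
      by (rule AE_lborel_shift) measurable
    then have "AE t in lborel. \<forall>l::int. of_int l + t \<in> {0..1} \<longrightarrow> ?c (of_int l + t) = 0" by (simp add: AE_all_countable)
    then show ?thesis
    proof eventually_elim
      fix t assume all: "\<forall>l::int. of_int l + t \<in> {0..1} \<longrightarrow> ?c (of_int l + t) = 0"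
      let ?l = "- \<lfloor>t\<rfloor>"
      have "0 \<le> t - of_int \<lfloor>t\<rfloor>" "t - of_int \<lfloor>t\<rfloor> \<le> 1" by linarith+
      then have "of_int ?l + t \<in> {0..1}" by simp
      then have "?c (of_int ?l + t) = 0" using all by blast
      then have "?c (t + of_int ?l) = 0" by (simp only: add.commute)
      moreover have "?c t = \<sigma> (0, of_int ?l) * ?c (t + of_int ?l)"
        using fourier_coeff_shift[OF S_measurable[OF \<phi>(1)] S_equivariant[OF \<phi>(1)] \<xi>, of "of_int ?l" t] f unfolding fixed_def by (simp only: Ints_of_int)
      ultimately show "fourier_coeff \<phi> \<eta> t = 0" using True by simp
    qed
  qed
qed

text \<open>The family contains all complex multiples of the waves, so that a group element, acting
  by a scalar, moves it into itself and the indices \<open>(m, z)\<close> change alike on both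
  sides.\<close>

theorem rho_theta_fixed:
  assumes \<xi>: "\<xi> \<in> \<Sigma>" and f: "fixed \<xi>"
  shows "unitarily_equivalent G (rho_theta A \<epsilon> {\<xi>}) (rep_sum UNIV (\<lambda>m. character_rep (wave \<xi> m)))"
proof -
  let ?C = "\<lambda>m. character_rep (wave \<xi> m)"
  let ?w = "\<lambda>(m, z) y. z * wave \<xi> m y"
  have C: "isometric_rep G (?C m)" for m by (rule character_rep_isometric) (rule wave_norm)
  interpret C: hilbert_family UNIV ?C by (rule hilbert_family.intro) (rule isometric_rep_hilbert[OF C])
  have c: "hcarrier (?C m) = UNIV" "hinner (?C m) z z' = z * cnj z'" "act (?C m) g z = wave \<xi> m g * z" for m z z' g
    by (simp_all add: character_rep_def)
  show ?thesis
  proof (rule equivalentI_gram[OF unitary_rep_isometric[OF unitary_rho_theta] rep_sum_isometric[OF C],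
        where e = "\<lambda>i. cls (?w i)" and f = "\<lambda>(m, z). C.embed m z" and I = UNIV])
    show "total_in (rho_theta A \<epsilon> {\<xi>}) (range (\<lambda>i. cls (?w i)))"
      unfolding total_in_def rho_theta_simps
    proof (intro conjI ballI impI)
      show "range (\<lambda>i. cls (?w i)) \<subseteq> U_theta A \<epsilon> {\<xi>}" using wave_U_theta[OF \<xi> f] by auto
      fix v assume v: "v \<in> U_theta A \<epsilon> {\<xi>}" and o: "\<forall>x\<in>range (\<lambda>i. cls (?w i)). hinner right.R x v = 0"
      have "v \<in> hcarrier right.R" using v by (simp add: U_theta_eq)
      then obtain \<phi> where \<phi>: "\<phi> \<in> S" "v = cls \<phi>" by (auto simp: right.R_simps(1) carrier_eq)
      have "(LINT y|F. wave \<xi> m y * cnj (\<phi> y)) = 0" for m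
      proof -
        have "hinner right.R (cls (?w (m, 1))) v = 0" using o by blast
        then have "hinner right.R (cls (\<lambda>y. 1 * wave \<xi> m y)) (cls \<phi>) = 0" unfolding \<phi>(2) by (simp only: prod.case)
        then show ?thesis unfolding cls_inner[OF wave_S[OF \<xi> f] \<phi>(1)] by simp
      qed
      then have "AE y in F. \<phi> y = 0" using waves_total[OF \<xi> f \<phi>(1)] v \<phi>(2) by simp
      then show "v = hzero right.R" unfolding \<phi>(2) right.R_simps(3) zero_eq by (rule cls_eqI)
    qed
    have "total_in C.S {C.embed m z |m z. m \<in> UNIV \<and> z \<in> UNIV}"
      by (rule C.total_embed) (metis c(1) hilbert_space.total_carrier[OF isometric_rep_hilbert[OF C]])
    moreover have "{C.embed m z |m z. m \<in> UNIV \<and> z \<in> UNIV} = range (\<lambda>(m, z). C.embed m z)" by auto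
    ultimately show "total_in C.S (range (\<lambda>(m, z). C.embed m z))" by simp
    fix i :: "int \<times> complex"
    obtain m z where i: "i = (m, z)" by (cases i)
    show "hinner (rho_theta A \<epsilon> {\<xi>}) (cls (?w i)) (cls (?w j)) = hinner C.S ((\<lambda>(m, z). C.embed m z) i) ((\<lambda>(m, z). C.embed m z) j)" for j
    proof -
      obtain m' z' where j: "j = (m', z')" by (cases j)
      have "hinner (rho_theta A \<epsilon> {\<xi>}) (cls (?w i)) (cls (?w j)) = (if m = m' then z * cnj z' else 0)"
        unfolding i j prod.case rho_theta_simps cls_inner[OF wave_S[OF \<xi> f] wave_S[OF \<xi> f]] by (rule wave_inner[OF \<xi> f])
      moreover have "hinner C.S (C.embed m z) (C.embed m' z') = (if m = m' then z * cnj z' else 0)"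
        using C.inner_embed_embed[of m m' z z'] by (simp add: c)
      ultimately show ?thesis by (simp add: i j)
    qed
    show "\<exists>j\<in>UNIV. act (rho_theta A \<epsilon> {\<xi>}) g (cls (?w i)) = cls (?w j) \<and>
        act C.S g ((\<lambda>(m, z). C.embed m z) i) = (\<lambda>(m, z). C.embed m z) j" if g: "g \<in> carrier G" for g
    proof (intro bexI conjI)
      show "act (rho_theta A \<epsilon> {\<xi>}) g (cls (?w i)) = cls (?w (m, wave \<xi> m g * z))"
        unfolding i prod.case rho_theta_simps right.act_cls[OF g wave_S[OF \<xi> f]] translate_wave[OF f] ..
      show "act C.S g ((\<lambda>(m, z). C.embed m z) i) = (\<lambda>(m, z). C.embed m z) (m, wave \<xi> m g * z)"
        using rep_sum_act_embed[where R = ?C, OF C g, of UNIV m z] by (simp add: i c)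
    qed simp
  qed
qed

text \<open>A linear operator on the one-dimensional space is multiplication by its value at 1,
  which is nonzero for a unitary one.\<close>

lemma equivalent_characters_eq:
  assumes "unitarily_equivalent G (character_rep f) (character_rep f')"
  shows "f g = f' g"
proof -
  obtain T where T: "unitary_map (character_rep f) (character_rep f') T"
    "\<And>g v. T (act (character_rep f) g v) = act (character_rep f') g (T v)"
    using assms by (auto simp: unitarily_equivalent_def G_carrier character_rep_def)
  have "\<forall>c u. T (c * u) = c * T u" using T(1) unfolding unitary_map_def by (simp add: character_rep_def)
  then have s: "T (f g * 1) = f g * T 1" by blast
  have "T (f g * 1) = f' g * T 1" using T(2)[of g 1] by (simp add: character_rep_def)
  moreover have "T 1 * cnj (T 1) = 1" using T(1) unfolding unitary_map_def by (simp add: character_rep_def)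
  ultimately show ?thesis using s by auto
qed

lemma wave_injective:
  assumes "\<And>g. wave \<xi> m g = wave \<xi>' m' g"
  shows "\<xi> = \<xi>' \<and> m = m'"
proof -
  have lin: "a = b" if e: "\<And>s::real. cis (a * s) = cis (b * s)" for a b :: real
  proof (rule ccontr)
    assume ab: "a \<noteq> b"
    have "cis ((a - b) * s) = cis (a * s) * cnj (cis (b * s))" for s by (simp add: cis_cnj cis_mult algebra_simps)
    also have "cis (a * s) * cnj (cis (b * s)) = 1" for s unfolding e by (simp flip: complex_norm_square)
    \<comment> \<open>At this argument the value is \<open>cis pi = -1\<close>, a
      contradiction.\<close>
    finally have "cis ((a - b) * (pi / (a - b))) = 1" .
    then show False using ab by simp
  qed
  have "pi * of_int (2 * m + \<epsilon> (0, 1)) = pi * of_int (2 * m' + \<epsilon> (0, 1))"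
    by (rule lin) (use assms[of "(0, _)"] in \<open>simp add: wave_eq\<close>)
  then have "m = m'" by simp
  have "\<xi> = \<xi>'"
  proof (rule vector_eq_ldot[THEN iffD1, rule_format])
    fix x
    have "pi * (x \<bullet> \<xi>) = pi * (x \<bullet> \<xi>')"
    proof (rule lin)
      fix s
      show "cis (pi * (x \<bullet> \<xi>) * s) = cis (pi * (x \<bullet> \<xi>') * s)"
        using assms[of "(s *\<^sub>R x, 0)"] by (simp add: wave_eq inner_commute mult_ac)
    qed
    then show "x \<bullet> \<xi> = x \<bullet> \<xi>'" by simp
  qed
  then show ?thesis using \<open>m = m'\<close> by simp
qed

end

section \<open>Orbits and the decomposition\<close>

context solvmanifold
begin

lemma real_orbit_self: "\<xi> \<in> real_orbit A \<xi>"
  unfolding real_orbit_eq by (rule image_eqI[of _ _ 0]) (auto simp: dual_act_zero)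

lemma real_orbit_mem_eq:
  assumes "\<eta> \<in> real_orbit A \<xi>"
  shows "real_orbit A \<eta> = real_orbit A \<xi>"
proof -
  obtain s where s: "\<eta> = dual_act A s \<xi>" using assms by (auto simp: real_orbit_eq)
  have "real_orbit A \<eta> = (\<lambda>t. dual_act A (t + s) \<xi>) ` UNIV" by (simp add: real_orbit_eq s dual_act_add)
  also have "\<dots> = (\<lambda>t. dual_act A t \<xi>) ` ((\<lambda>t. t + s) ` UNIV)" by (simp only: image_image)
  also have "(\<lambda>t. t + s) ` UNIV = (UNIV :: real set)" by (rule surjI[of _ "\<lambda>t. t - s"]) simp
  finally show ?thesis by (simp add: real_orbit_eq)
qed

lemma int_orbit_subset_real: "int_orbit A \<xi> \<subseteq> real_orbit A \<xi>"
  by (auto simp: int_orbit_eq real_orbit_eq)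

lemma X_infty_orbit:
  assumes "\<omega> \<in> X_infty A \<epsilon>" "\<eta> \<in> \<omega>"
  shows "\<omega> = real_orbit A \<eta>" "inj (\<lambda>t. dual_act A t \<eta>)"
proof -
  obtain \<xi> where "\<omega> = real_orbit A \<xi>" using assms(1) by (auto simp: X_infty_def)
  then show *: "\<omega> = real_orbit A \<eta>" using assms(2) real_orbit_mem_eq by blast
  have "\<not> compact (closure \<omega>)" using assms(1) by (simp add: X_infty_def)
  then show "inj (\<lambda>t. dual_act A t \<eta>)" unfolding * by (rule noncompact_orbit_inj)
qed

lemma X_infty_not_fixed:
  assumes "\<omega> \<in> X_infty A \<epsilon>" "\<eta> \<in> \<omega>"
  shows "\<not> fixed \<eta>"
proof
  assume "fixed \<eta>"
  then have "dual_act A 0 \<eta> = dual_act A 1 \<eta>" by (simp add: fixed_def)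
  then show False using injD[OF X_infty_orbit(2)[OF assms], of 0 1] by simp
qed

lemma X_infty_meets_Sigma:
  assumes "\<omega> \<in> X_infty A \<epsilon>"
  obtains \<xi> where "\<xi> \<in> \<omega>" "\<xi> \<in> \<Sigma>"
  using assms by (auto simp: X_infty_def)

text \<open>The dichotomy of orbits through \<Sigma>: a relatively compact orbit of an integral
  point is a single point by \<open>compact_orbit_fixed\<close>, where exponentiality
  enters.\<close>

lemma Sigma_fixed_or_infinite:
  assumes \<xi>: "\<xi> \<in> \<Sigma>"
  shows "fixed \<xi> \<or> real_orbit A \<xi> \<in> X_infty A \<epsilon>"
proof (cases "compact (closure (real_orbit A \<xi>))")
  case True
  have "dual_act A (of_int l) \<xi> \<in> integer_vectors" for l :: int
    using Sigma_dual_act[OF Ints_of_int \<xi>] Sigma_integer by blast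
  then show ?thesis using compact_orbit_fixed[OF exponential _ True] by (simp add: fixed_def)
next
  case False
  then show ?thesis using \<xi> real_orbit_self by (auto simp: X_infty_def)
qed

text \<open>Each \<int>-orbit in \<omega> has a representative on the arc over
  \<open>{0..1}\<close>, which is compact and contains finitely many integral vectors.\<close>

lemma finite_int_orbits:
  assumes \<omega>: "\<omega> \<in> X_infty A \<epsilon>"
  shows "finite (int_orbits A (\<omega> \<inter> \<Sigma>))"
proof -
  obtain \<eta> where \<eta>: "\<eta> \<in> \<omega>" "\<eta> \<in> \<Sigma>" by (rule X_infty_meets_Sigma[OF \<omega>])
  let ?K = "(\<lambda>t. dual_act A t \<eta>) ` {0..1}"
  have "compact ?K" by (intro compact_continuous_image dual_act_cont continuous_intros) simp
  then have "bounded (?K \<inter> \<Sigma>)" by (meson bounded_Int compact_imp_bounded)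
  then have "finite (?K \<inter> \<Sigma>)" by (rule finite_integer_vectors_bounded) (use Sigma_integer in blast)
  moreover have "int_orbits A (\<omega> \<inter> \<Sigma>) \<subseteq> int_orbit A ` (?K \<inter> \<Sigma>)"
    unfolding int_orbits_def
  proof (rule image_subsetI)
    fix \<xi> assume \<xi>: "\<xi> \<in> \<omega> \<inter> \<Sigma>"
    then obtain t where t: "\<xi> = dual_act A t \<eta>" unfolding X_infty_orbit(1)[OF \<omega> \<eta>(1)] real_orbit_eq by auto
    \<comment> \<open>Subtracting the integral part of the time moves \<xi> to the arc without
      leaving its \<int>-orbit.\<close>
    let ?\<zeta> = "dual_act A (of_int (- \<lfloor>t\<rfloor>)) \<xi>"
    have \<zeta>: "?\<zeta> = dual_act A (of_int (- \<lfloor>t\<rfloor>) + t) \<eta>" unfolding t dual_act_add ..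
    have "0 \<le> t - of_int \<lfloor>t\<rfloor>" "t - of_int \<lfloor>t\<rfloor> \<le> 1" by linarith+
    then have "of_int (- \<lfloor>t\<rfloor>) + t \<in> {0..1}" by simp
    then have "?\<zeta> \<in> ?K" unfolding \<zeta> by (rule imageI)
    moreover have "?\<zeta> \<in> \<Sigma>" using \<xi> by (intro Sigma_dual_act Ints_of_int) simp
    moreover have "?\<zeta> \<in> int_orbit A \<xi>" unfolding int_orbit_eq by (rule rangeI)
    then have "int_orbit A ?\<zeta> = int_orbit A \<xi>" by (rule int_orbit_mem_eq)
    ultimately show "int_orbit A \<xi> \<in> int_orbit A ` (?K \<inter> \<Sigma>)" by (metis IntI imageI)
  qed
  ultimately show ?thesis by (meson finite_imageI finite_subset)
qed

theorem rho_eta_in_rho_omega: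
  assumes \<omega>: "\<omega> \<in> X_infty A \<epsilon>" and \<eta>: "\<eta> \<in> \<omega>"
  shows "rho_eta A \<eta> \<in> rho_omega A \<epsilon> \<omega>"
proof -
  have "unitarily_equivalent G (rho_eta A \<eta>) (rho_theta A \<epsilon> \<theta>)" if \<theta>: "\<theta> \<in> int_orbits A (\<omega> \<inter> \<Sigma>)" for \<theta>
  proof -
    obtain \<xi> where \<xi>: "\<theta> = int_orbit A \<xi>" "\<xi> \<in> \<omega>" "\<xi> \<in> \<Sigma>" using \<theta> by (auto simp: int_orbits_def)
    obtain t where t: "\<xi> = dual_act A t \<eta>" using \<xi>(2) unfolding X_infty_orbit(1)[OF \<omega> \<eta>] real_orbit_eq by auto
    show ?thesis unfolding \<xi>(1) by (rule rho_eta_rho_theta[OF \<xi>(3) t X_infty_orbit(2)[OF \<omega> \<eta>]])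
  qed
  then show ?thesis unfolding rho_omega_def using unitary_rho_eta by blast
qed

text \<open>A point of \<omega> in \<Sigma> supplies some \<open>rho_theta\<close>, through which
  both representations are compared.\<close>

lemma rho_omega_equivalent:
  assumes \<omega>: "\<omega> \<in> X_infty A \<epsilon>" and R: "R \<in> rho_omega A \<epsilon> \<omega>" and \<eta>: "\<eta> \<in> \<omega>"
  shows "unitarily_equivalent G R (rho_eta A \<eta>)" "unitarily_equivalent G (rho_eta A \<eta>) R"
proof -
  obtain \<xi> where \<xi>: "\<xi> \<in> \<omega>" "\<xi> \<in> \<Sigma>" by (rule X_infty_meets_Sigma[OF \<omega>])
  let ?\<theta> = "int_orbit A \<xi>"
  have \<theta>: "?\<theta> \<in> int_orbits A (\<omega> \<inter> \<Sigma>)" using \<xi> by (simp add: int_orbits_def)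
  have iso: "isometric_rep G R" "isometric_rep G (rho_eta A \<eta>)" "isometric_rep G (rho_theta A \<epsilon> ?\<theta>)"
    using R unitary_rho_eta[of \<eta>] unitary_rho_theta[of ?\<theta>] by (auto simp: rho_omega_def intro: unitary_rep_isometric)
  have R\<theta>: "unitarily_equivalent G R (rho_theta A \<epsilon> ?\<theta>)" using R \<theta> by (simp add: rho_omega_def)
  have E\<theta>: "unitarily_equivalent G (rho_eta A \<eta>) (rho_theta A \<epsilon> ?\<theta>)"
    using rho_eta_in_rho_omega[OF \<omega> \<eta>] \<theta> by (simp add: rho_omega_def)
  show *: "unitarily_equivalent G R (rho_eta A \<eta>)"
    by (rule unitarily_equivalent_trans[OF R\<theta> unitarily_equivalent_sym[OF E\<theta> iso(2,3)] iso(1,3,2)])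
  show "unitarily_equivalent G (rho_eta A \<eta>) R"
    by (rule unitarily_equivalent_sym[OF * iso(1,2)])
qed

text \<open>A \<int>-orbit lies in exactly one \<real>-orbit and is singled out in it by a number
  below the multiplicity, while a fixed point is a \<int>-orbit by itself; this is the data for
  \<open>rep_sum_regroup\<close>.\<close>

lemma int_orbits_regroup:
  fixes R :: "(real^'n) set \<Rightarrow> ((real^'n) \<times> real, 'v) rep"
  assumes R: "\<And>\<omega>. \<omega> \<in> X_infty A \<epsilon> \<Longrightarrow> R \<omega> \<in> rho_omega A \<epsilon> \<omega>"
  shows "unitarily_equivalent G (rep_sum (int_orbits A \<Sigma>) (rho_theta A \<epsilon>))
    (rep_sum2
      (rep_sum (X_zero A \<epsilon>) (\<lambda>\<omega>. rep_sum UNIV (\<lambda>m. character_rep (chi \<epsilon> \<omega> m))))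
      (rep_sum (X_infty A \<epsilon>) (\<lambda>\<omega>. rep_multiple (mult_omega A \<epsilon> \<omega>) (R \<omega>))))"
proof -
  let ?Z = "X_zero A \<epsilon>" and ?X = "X_infty A \<epsilon>" and ?O = "int_orbits A \<Sigma>"
  let ?Y = "?O - ?Z"
  \<comment> \<open>Independent of the chosen point, as a \<int>-orbit stays within one
    \<real>-orbit.\<close>
  define q where "q \<theta> = real_orbit A (SOME \<xi>. \<xi> \<in> \<theta>)" for \<theta>
  have q: "q (int_orbit A \<xi>) = real_orbit A \<xi>" for \<xi>
  proof -
    have "(SOME \<zeta>. \<zeta> \<in> int_orbit A \<xi>) \<in> int_orbit A \<xi>" using int_orbit_self by (rule someI)
    then show ?thesis unfolding q_def using int_orbit_subset_real real_orbit_mem_eq by blast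
  qed
  have ZO: "?Z \<subseteq> ?O"
  proof
    fix \<theta> assume "\<theta> \<in> ?Z"
    then obtain \<xi> where \<xi>: "\<theta> = {\<xi>}" "\<xi> \<in> \<Sigma>" "fixed \<xi>" by (auto simp: X_zero_eq)
    then have "\<theta> = int_orbit A \<xi>" by (simp add: fixed_orbit)
    then show "\<theta> \<in> ?O" using \<xi>(2) by (simp add: int_orbits_def)
  qed
  have Y: "q \<theta> \<in> ?X \<and> \<theta> \<in> int_orbits A (q \<theta> \<inter> \<Sigma>)" if \<theta>: "\<theta> \<in> ?Y" for \<theta>
  proof -
    obtain \<xi> where \<xi>: "\<theta> = int_orbit A \<xi>" "\<xi> \<in> \<Sigma>" using \<theta> by (auto simp: int_orbits_def)
    have "\<not> fixed \<xi>"
    proof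
      assume "fixed \<xi>"
      then have "\<theta> \<in> ?Z" using \<xi> fixed_orbit by (auto simp: X_zero_eq)
      then show False using \<theta> by simp
    qed
    then have "real_orbit A \<xi> \<in> ?X" using Sigma_fixed_or_infinite[OF \<xi>(2)] by simp
    then show ?thesis unfolding \<xi>(1) q using \<xi>(2) real_orbit_self by (auto simp: int_orbits_def)
  qed
  have Y': "\<theta> \<in> ?Y \<and> q \<theta> = \<omega>" if \<omega>: "\<omega> \<in> ?X" and \<theta>: "\<theta> \<in> int_orbits A (\<omega> \<inter> \<Sigma>)" for \<omega> \<theta>
  proof -
    obtain \<xi> where \<xi>: "\<theta> = int_orbit A \<xi>" "\<xi> \<in> \<omega>" "\<xi> \<in> \<Sigma>" using \<theta> by (auto simp: int_orbits_def)
    have "\<theta> \<notin> ?Z"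
    proof
      assume "\<theta> \<in> ?Z"
      then obtain \<zeta> where "\<theta> = {\<zeta>}" "fixed \<zeta>" by (auto simp: X_zero_eq)
      then have "fixed \<xi>" using int_orbit_self[of \<xi>] \<xi>(1) by simp
      then show False using X_infty_not_fixed[OF \<omega> \<xi>(2)] by simp
    qed
    moreover have "q \<theta> = \<omega>" unfolding \<xi>(1) q using X_infty_orbit(1)[OF \<omega> \<xi>(2)] by simp
    ultimately show ?thesis using \<xi> by (auto simp: int_orbits_def)
  qed
  have "\<exists>f. bij_betw f (int_orbits A (\<omega> \<inter> \<Sigma>)) {..<mult_omega A \<epsilon> \<omega>}" if \<omega>: "\<omega> \<in> ?X" for \<omega>
    using ex_bij_betw_finite_nat[OF finite_int_orbits[OF \<omega>]] by (simp add: mult_omega_def atLeast0LessThan)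
  then obtain k where k: "\<And>\<omega>. \<omega> \<in> ?X \<Longrightarrow> bij_betw (k \<omega>) (int_orbits A (\<omega> \<inter> \<Sigma>)) {..<mult_omega A \<epsilon> \<omega>}" by metis
  have bij: "bij_betw (\<lambda>\<theta>. (q \<theta>, k (q \<theta>) \<theta>)) ?Y (SIGMA \<omega>:?X. {..<mult_omega A \<epsilon> \<omega>})"
    unfolding bij_betw_def
  proof
    show "inj_on (\<lambda>\<theta>. (q \<theta>, k (q \<theta>) \<theta>)) ?Y"
    proof (rule inj_onI)
      fix \<theta> \<theta>' assume \<theta>: "\<theta> \<in> ?Y" "\<theta>' \<in> ?Y" and "(q \<theta>, k (q \<theta>) \<theta>) = (q \<theta>', k (q \<theta>') \<theta>')"
      then have eq: "q \<theta>' = q \<theta>" "k (q \<theta>) \<theta> = k (q \<theta>) \<theta>'" by auto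
      have "\<theta> \<in> int_orbits A (q \<theta> \<inter> \<Sigma>)" "\<theta>' \<in> int_orbits A (q \<theta> \<inter> \<Sigma>)" using Y[OF \<theta>(1)] Y[OF \<theta>(2)] eq(1) by auto
      then show "\<theta> = \<theta>'" using inj_onD[OF bij_betw_imp_inj_on[OF k] eq(2)] Y[OF \<theta>(1)] by blast
    qed
    show "(\<lambda>\<theta>. (q \<theta>, k (q \<theta>) \<theta>)) ` ?Y = (SIGMA \<omega>:?X. {..<mult_omega A \<epsilon> \<omega>})"
    proof (intro equalityI subsetI)
      fix p assume "p \<in> (\<lambda>\<theta>. (q \<theta>, k (q \<theta>) \<theta>)) ` ?Y"
      then obtain \<theta> where \<theta>: "\<theta> \<in> ?Y" "p = (q \<theta>, k (q \<theta>) \<theta>)" by blast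
      then show "p \<in> (SIGMA \<omega>:?X. {..<mult_omega A \<epsilon> \<omega>})" using Y[OF \<theta>(1)] bij_betwE[OF k] by blast
    next
      fix p assume "p \<in> (SIGMA \<omega>:?X. {..<mult_omega A \<epsilon> \<omega>})"
      then obtain \<omega> j where p: "p = (\<omega>, j)" "\<omega> \<in> ?X" "j \<in> {..<mult_omega A \<epsilon> \<omega>}" by blast
      then obtain \<theta> where \<theta>: "\<theta> \<in> int_orbits A (\<omega> \<inter> \<Sigma>)" "j = k \<omega> \<theta>"
        using bij_betw_imp_surj_on[OF k[OF p(2)]] by blast
      have "\<theta> \<in> ?Y" "q \<theta> = \<omega>" using Y'[OF p(2) \<theta>(1)] by auto
      then show "p \<in> (\<lambda>\<theta>. (q \<theta>, k (q \<theta>) \<theta>)) ` ?Y" unfolding p(1) \<theta>(2) by (intro image_eqI[of _ _ \<theta>]) simp_all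
    qed
  qed
  have C: "isometric_rep G (rep_sum UNIV (\<lambda>m. character_rep (chi \<epsilon> \<omega> m)))" if \<omega>: "\<omega> \<in> ?Z" for \<omega>
  proof -
    obtain \<xi> where "\<omega> = {\<xi>}" using \<omega> by (auto simp: X_zero_eq)
    then show ?thesis by (intro rep_sum_isometric character_rep_isometric) (simp add: wave_norm)
  qed
  have Ceq: "unitarily_equivalent G (rho_theta A \<epsilon> \<omega>) (rep_sum UNIV (\<lambda>m. character_rep (chi \<epsilon> \<omega> m)))" if \<omega>: "\<omega> \<in> ?Z" for \<omega>
  proof -
    obtain \<xi> where "\<omega> = {\<xi>}" "\<xi> \<in> \<Sigma>" "fixed \<xi>" using \<omega> by (auto simp: X_zero_eq)
    then show ?thesis using rho_theta_fixed by simp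
  qed
  have Riso: "isometric_rep G (R \<omega>)" if "\<omega> \<in> ?X" for \<omega>
    using R[OF that] by (auto simp: rho_omega_def intro: unitary_rep_isometric)
  have Req: "unitarily_equivalent G (rho_theta A \<epsilon> \<theta>) (R (q \<theta>))" if \<theta>: "\<theta> \<in> ?Y" for \<theta>
  proof (rule unitarily_equivalent_sym)
    show "unitarily_equivalent G (R (q \<theta>)) (rho_theta A \<epsilon> \<theta>)" using R[of "q \<theta>"] Y[OF \<theta>] by (auto simp: rho_omega_def)
  qed (use Riso Y[OF \<theta>] in \<open>auto intro: unitary_rep_isometric unitary_rho_theta\<close>)
  have "unitarily_equivalent G (rep_sum (?Z \<union> ?Y) (rho_theta A \<epsilon>))
    (rep_sum2 (rep_sum ?Z (\<lambda>\<omega>. rep_sum UNIV (\<lambda>m. character_rep (chi \<epsilon> \<omega> m))))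
      (rep_sum ?X (\<lambda>\<omega>. rep_multiple (mult_omega A \<epsilon> \<omega>) (R \<omega>))))"
  proof (rule rep_sum_regroup[where q = q and k = "\<lambda>\<theta>. k (q \<theta>) \<theta>"])
    show "isometric_rep G (rho_theta A \<epsilon> i)" for i by (rule unitary_rep_isometric[OF unitary_rho_theta])
    show "?Z \<inter> ?Y = {}" by blast
  qed (erule C Ceq Riso Req | rule bij)+
  then show ?thesis using ZO by (simp only: Un_Diff_cancel Un_absorb1)
qed

lemma rho_omega_irreducible:
  assumes \<omega>: "\<omega> \<in> X_infty A \<epsilon>" and R: "R \<in> rho_omega A \<epsilon> \<omega>"
  shows "irreducible_rep G R"
proof -
  obtain \<eta> where \<eta>: "\<eta> \<in> \<omega>" "\<eta> \<in> \<Sigma>" by (rule X_infty_meets_Sigma[OF \<omega>])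
  show ?thesis
    by (rule irreducible_equivalent[OF irreducible_rho_eta[OF X_infty_orbit(2)[OF \<omega> \<eta>(1)]] _ rho_omega_equivalent(2)[OF \<omega> R \<eta>(1)]])
      (use R in \<open>simp add: rho_omega_def\<close>)
qed

text \<open>Distinct \<real>-orbits are disjoint, so \<open>rho_eta_inequivalent\<close> applies to
  a point of each.\<close>

lemma rho_omega_inequivalent:
  assumes \<omega>: "\<omega> \<in> X_infty A \<epsilon>" "\<omega>' \<in> X_infty A \<epsilon>" "\<omega> \<noteq> \<omega>'"
    and R: "R \<in> rho_omega A \<epsilon> \<omega>" "R' \<in> rho_omega A \<epsilon> \<omega>'"
  shows "\<not> unitarily_equivalent G R R'"
proof
  assume eq: "unitarily_equivalent G R R'"
  obtain \<eta> where \<eta>: "\<eta> \<in> \<omega>" by (rule X_infty_meets_Sigma[OF \<omega>(1)])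
  obtain \<eta>' where \<eta>': "\<eta>' \<in> \<omega>'" by (rule X_infty_meets_Sigma[OF \<omega>(2)])
  have iso: "isometric_rep G R" "isometric_rep G R'" "isometric_rep G (rho_eta A \<eta>)" "isometric_rep G (rho_eta A \<eta>')"
    using R unitary_rho_eta[of \<eta>] unitary_rho_eta[of \<eta>'] by (auto simp: rho_omega_def intro: unitary_rep_isometric)
  have "unitarily_equivalent G (rho_eta A \<eta>) (rho_eta A \<eta>')"
    by (rule unitarily_equivalent_trans[OF rho_omega_equivalent(2)[OF \<omega>(1) R(1) \<eta>]
          unitarily_equivalent_trans[OF eq rho_omega_equivalent(1)[OF \<omega>(2) R(2) \<eta>'] iso(1,2,4)] iso(3,1,4)])
  moreover have "real_orbit A \<eta> \<inter> real_orbit A \<eta>' = {}"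
  proof (rule ccontr)
    assume "real_orbit A \<eta> \<inter> real_orbit A \<eta>' \<noteq> {}"
    then obtain \<zeta> where "\<zeta> \<in> \<omega>" "\<zeta> \<in> \<omega>'"
      using X_infty_orbit(1)[OF \<omega>(1) \<eta>] X_infty_orbit(1)[OF \<omega>(2) \<eta>'] by auto
    then show False using X_infty_orbit(1)[OF \<omega>(1)] X_infty_orbit(1)[OF \<omega>(2)] \<omega>(3) by metis
  qed
  ultimately show False using rho_eta_inequivalent by blast
qed

lemma character_rho_omega_inequivalent:
  assumes \<omega>: "\<omega> \<in> X_zero A \<epsilon>" "\<omega>' \<in> X_infty A \<epsilon>" and R: "R \<in> rho_omega A \<epsilon> \<omega>'"
  shows "\<not> unitarily_equivalent G (character_rep (chi \<epsilon> \<omega> m)) R"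
proof
  assume eq: "unitarily_equivalent G (character_rep (chi \<epsilon> \<omega> m)) R"
  obtain \<xi> where \<xi>: "\<omega> = {\<xi>}" using \<omega>(1) by (auto simp: X_zero_eq)
  obtain \<eta> where \<eta>: "\<eta> \<in> \<omega>'" by (rule X_infty_meets_Sigma[OF \<omega>(2)])
  have iso: "isometric_rep G R" "isometric_rep G (rho_eta A \<eta>)"
    using R unitary_rho_eta[of \<eta>] by (auto simp: rho_omega_def intro: unitary_rep_isometric)
  have "unitarily_equivalent G (character_rep (wave \<xi> m)) (rho_eta A \<eta>)"
    by (rule unitarily_equivalent_trans[OF eq[unfolded \<xi>] rho_omega_equivalent(1)[OF \<omega>(2) R \<eta>]
          character_rep_isometric[OF wave_norm] iso])
  then show False using character_rho_eta_inequivalent[of "wave \<xi> m", OF wave_norm] by blast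
qed

lemma characters_inequivalent:
  assumes \<omega>: "\<omega> \<in> X_zero A \<epsilon>" "\<omega>' \<in> X_zero A \<epsilon>" and ne: "(\<omega>, m) \<noteq> (\<omega>', m')"
  shows "\<not> unitarily_equivalent G (character_rep (chi \<epsilon> \<omega> m)) (character_rep (chi \<epsilon> \<omega>' m'))"
proof
  assume eq: "unitarily_equivalent G (character_rep (chi \<epsilon> \<omega> m)) (character_rep (chi \<epsilon> \<omega>' m'))"
  obtain \<xi> \<xi>' where \<xi>: "\<omega> = {\<xi>}" "\<omega>' = {\<xi>'}" using \<omega> by (auto simp: X_zero_eq)
  have "\<xi> = \<xi>' \<and> m = m'" by (rule wave_injective) (rule equivalent_characters_eq[OF eq[unfolded \<xi>]])
  then show False using ne \<xi> by simp
qed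

end

text \<open>\<open>rho_omega\<close> is a class, so the second decomposition is asserted for every
  choice \<open>R\<close> of members; the clause on \<open>rho_eta\<close> shows that each class has
  a member on L2 of the line. Separate type variables let the inequivalence compare members on
  different underlying types.\<close>

theorem theorem3p9:
  fixes A :: "real \<Rightarrow> real^'n^'n"
    and \<epsilon> :: "(real^'n) \<times> real \<Rightarrow> int"
  assumes "one_parameter_subgroup A"
    and "A 1 \<in> SL_int"
    and "exponential_lie_group (semidirect A)"
    and "parity_hom A \<epsilon>"
  shows "(unitary_rep (semidirect A) (right_regular A \<epsilon>))
     \<and> (\<forall>\<theta>\<in>int_orbits A (Sigma_eps \<epsilon>). unitary_rep (semidirect A) (rho_theta A \<epsilon> \<theta>))
     \<and> (unitarily_equivalent (semidirect A) (right_regular A \<epsilon>)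
           (rep_sum (int_orbits A (Sigma_eps \<epsilon>)) (rho_theta A \<epsilon>)))
     \<and> (\<forall>R :: (real^'n) set \<Rightarrow> ((real^'n) \<times> real, 'v) rep.
           (\<forall>\<omega>\<in>X_infty A \<epsilon>. R \<omega> \<in> rho_omega A \<epsilon> \<omega>) \<longrightarrow>
           unitarily_equivalent (semidirect A)
             (rep_sum (int_orbits A (Sigma_eps \<epsilon>)) (rho_theta A \<epsilon>))
             (rep_sum2
               (rep_sum (X_zero A \<epsilon>) (\<lambda>\<omega>. rep_sum UNIV (\<lambda>m. character_rep (chi \<epsilon> \<omega> m))))
               (rep_sum (X_infty A \<epsilon>) (\<lambda>\<omega>. rep_multiple (mult_omega A \<epsilon> \<omega>) (R \<omega>)))))
     \<and> (\<forall>\<omega>\<in>X_infty A \<epsilon>. finite (int_orbits A (\<omega> \<inter> Sigma_eps \<epsilon>)))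
     \<and> (\<forall>\<omega>\<in>X_zero A \<epsilon>. \<forall>m. unitary_character (semidirect A) (chi \<epsilon> \<omega> m))
     \<and> (\<forall>\<omega>\<in>X_infty A \<epsilon>. \<forall>R :: ((real^'n) \<times> real, 'v) rep.
           R \<in> rho_omega A \<epsilon> \<omega> \<longrightarrow> irreducible_rep (semidirect A) R)
     \<and> (\<forall>\<omega>\<in>X_infty A \<epsilon>. \<forall>\<eta>\<in>\<omega>. rho_eta A \<eta> \<in> rho_omega A \<epsilon> \<omega>)
     \<and> (\<forall>\<omega>\<in>X_zero A \<epsilon>. \<forall>\<omega>'\<in>X_zero A \<epsilon>. \<forall>m m'. (\<omega>, m) \<noteq> (\<omega>', m') \<longrightarrow>
           \<not> unitarily_equivalent (semidirect A) (character_rep (chi \<epsilon> \<omega> m)) (character_rep (chi \<epsilon> \<omega>' m')))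
     \<and> (\<forall>\<omega>\<in>X_infty A \<epsilon>. \<forall>\<omega>'\<in>X_infty A \<epsilon>. \<omega> \<noteq> \<omega>' \<longrightarrow>
           (\<forall>(R :: ((real^'n) \<times> real, 'v) rep) (R' :: ((real^'n) \<times> real, 'w) rep).
              R \<in> rho_omega A \<epsilon> \<omega> \<and> R' \<in> rho_omega A \<epsilon> \<omega>' \<longrightarrow> \<not> unitarily_equivalent (semidirect A) R R'))
     \<and> (\<forall>\<omega>\<in>X_zero A \<epsilon>. \<forall>m. \<forall>\<omega>'\<in>X_infty A \<epsilon>. \<forall>R :: ((real^'n) \<times> real, 'v) rep.
           R \<in> rho_omega A \<epsilon> \<omega>' \<longrightarrow>
           \<not> unitarily_equivalent (semidirect A) (character_rep (chi \<epsilon> \<omega> m)) R)"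
proof -
  interpret solvmanifold A \<epsilon>
    by (intro solvmanifold.intro one_parameter.intro solvmanifold_axioms.intro assms)
  have chi: "unitary_character G (chi \<epsilon> \<omega> m)" if "\<omega> \<in> X_zero A \<epsilon>" for \<omega> m
    using that wave_character by (auto simp: X_zero_eq)
  have right: "unitary_rep G (right_regular A \<epsilon>)" unfolding right_regular_eq by (rule right.unitary)
  show ?thesis
  proof (intro conjI ballI allI impI)
    fix R :: "(real^'n) set \<Rightarrow> ((real^'n) \<times> real, 'v) rep"
    assume "\<forall>\<omega>\<in>X_infty A \<epsilon>. R \<omega> \<in> rho_omega A \<epsilon> \<omega>"
    then show "unitarily_equivalent G (rep_sum (int_orbits A \<Sigma>) (rho_theta A \<epsilon>))
      (rep_sum2
        (rep_sum (X_zero A \<epsilon>) (\<lambda>\<omega>. rep_sum UNIV (\<lambda>m. character_rep (chi \<epsilon> \<omega> m))))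
        (rep_sum (X_infty A \<epsilon>) (\<lambda>\<omega>. rep_multiple (mult_omega A \<epsilon> \<omega>) (R \<omega>))))"
      by (intro int_orbits_regroup) blast
  next
    fix \<omega> \<omega>' and R :: "((real^'n) \<times> real, 'v) rep" and R' :: "((real^'n) \<times> real, 'w) rep"
    assume "\<omega> \<in> X_infty A \<epsilon>" "\<omega>' \<in> X_infty A \<epsilon>" "\<omega> \<noteq> \<omega>'" "R \<in> rho_omega A \<epsilon> \<omega> \<and> R' \<in> rho_omega A \<epsilon> \<omega>'"
    then show "\<not> unitarily_equivalent G R R'" using rho_omega_inequivalent by blast
  qed (auto intro: right unitary_rho_theta right_regular_decomposition finite_int_orbits chi
      rho_omega_irreducible rho_eta_in_rho_omega dest: characters_inequivalent character_rho_omega_inequivalent)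
qed

end
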